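(* Let $f\in A^1_{\beta}$, $1<p\le q<\infty$, $\alpha>-1$, $\beta>-1$, and $$\gamma=\frac{n+1+\beta}{q}-\frac{n+1+\alpha}{p}.$$ If $n=1$ and $\gamma>-1$, or if $n>1$ and $\gamma>-1/2$, then $H^\beta_{\bar{f}}:A^p_{\alpha}\rightarrow L^q_{\beta}$ is compact if and only if $f\in \mathcal{B}^{1+\gamma}_{0}$. In all other cases, $H^\beta_{\bar f}:A^p_\alpha\to L^q_\beta$ is compact if and only if $f$ is constant.
   Context: $\mathbb{B}_n$ is the open unit ball of $\mathbb{C}^n$ ($n\ge 1$), $\langle z,w\rangle=\sum_k z_k\overline{w_k}$, and $dv$ is Lebesgue volume measure on $\mathbb{B}_n$ normalized so that $v(\mathbb{B}_n)=1$. For $\alpha>-1$, $dv_\alpha(z)=c_\alpha(1-|z|^2)^\alpha dv(z)$ with $c_\alpha>0$ such that $v_\alpha(\mathbb{B}_n)=1$; $L^p_\alpha=L^p(\mathbb{B}_n,dv_\alpha)$, and $A^p_\alpha$ is the subspace of holomorphic functions in $L^p_\alpha$. Hankel operators: $P_{\beta} g(z)=\int_{\mathbb{B}_n} \frac{g(w)\,dv_{\beta}(w)}{(1-\langle z,w\rangle )^{n+1+\beta}}$, and $H^\beta_{\bar f} g=(I-P_\beta)(\bar f g)$, defined for $g$ in the space $H^\infty$ of bounded holomorphic functions, which is dense in $A^p_\alpha$. Compactness from $A^p_\alpha$ to $L^q_\beta$ means that this densely defined operator extends to a compact linear operator $A^p_\alpha\to L^q_\beta$. Bloch type spaces: for $s\ge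 0$, $\mathcal{B}^{s}$ is the space of holomorphic $f$ on $\mathbb{B}_n$ with $\|f\|_{\mathcal{B}^s}=|f(0)|+\sup_{z\in\mathbb{B}_n}(1-|z|^2)^{s}|\nabla f(z)|<\infty$, where $\nabla f=(\partial f/\partial z_1,\dots,\partial f/\partial z_n)$. For $s>0$, $\mathcal{B}^s_0$ is the closure of the polynomials in $\mathcal{B}^s$; equivalently, it consists of the holomorphic $f$ with $\lim_{|z|\to1^-}(1-|z|^2)^s|\nabla f(z)|=0$. *)

theory Defs
  imports "HOL-Analysis.Analysis"
begin

text \<open>
  Functions on the unit ball are rendered as total functions on \<open>complex ^ 'n\<close> of which only
  the values on \<open>ball 0 1\<close> matter. The measures below have \<open>ball 0 1\<close> as their space, so
  measurability and ``almost everywhere'' also refer to the ball only.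
\<close>

definition cdot :: "complex ^ 'n \<Rightarrow> complex ^ 'n \<Rightarrow> complex" where
  "cdot z w = (\<Sum>k\<in>UNIV. z $ k * cnj (w $ k))"

definition ball_volume :: "(complex ^ 'n) measure" where
  "ball_volume = uniform_measure (restrict_space lborel (ball 0 1)) (ball 0 1)"

definition weight_const :: "'n::finite itself \<Rightarrow> real \<Rightarrow> real" where
  "weight_const _ \<alpha> =
     1 / (LINT z|(ball_volume :: (complex ^ 'n) measure). (1 - (norm z)\<^sup>2) powr \<alpha>)"

definition ball_weighted :: "real \<Rightarrow> (complex ^ 'n) measure" where
  "ball_weighted \<alpha> = density ball_volume
     (\<lambda>z. ennreal (weight_const TYPE('n) \<alpha> * (1 - (norm z)\<^sup>2) powr \<alpha>))"

text \<open>
  \<open>Lp\<close> consists of functions, not of classes modulo equality almost everywhere; \<open>Lp_norm\<close>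
  is thus only a seminorm on it.
\<close>

definition Lp :: "'a measure \<Rightarrow> real \<Rightarrow> ('a \<Rightarrow> complex) set" where
  "Lp M p = {f \<in> borel_measurable M. integrable M (\<lambda>x. norm (f x) powr p)}"

definition Lp_norm :: "'a measure \<Rightarrow> real \<Rightarrow> ('a \<Rightarrow> complex) \<Rightarrow> real" where
  "Lp_norm M p f = (LINT x|M. norm (f x) powr p) powr (1 / p)"

text \<open>
  A compact linear operator from a subspace \<open>V\<close> of \<open>L\<^sup>p(M)\<close> to \<open>L\<^sup>q(N)\<close>, acting on
  representatives: linearity is required up to null sets. Compatibility with equality almost
  everywhere need not be demanded. If \<open>g\<close> in \<open>V\<close> has seminorm 0, the multiples \<open>k g\<close> form a
  bounded sequence, and convergence of a subsequence of \<open>T (k g) = k T g\<close> forces \<open>T g = 0\<close>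
  almost everywhere.
\<close>

definition compact_operator ::
  "('a \<Rightarrow> complex) set \<Rightarrow> 'a measure \<Rightarrow> real \<Rightarrow> 'b measure \<Rightarrow> real
    \<Rightarrow> (('a \<Rightarrow> complex) \<Rightarrow> 'b \<Rightarrow> complex) \<Rightarrow> bool" where
  "compact_operator V M p N q T \<longleftrightarrow>
     (\<forall>g\<in>V. T g \<in> Lp N q) \<and>
     (\<forall>g\<in>V. \<forall>h\<in>V. AE x in N. T (\<lambda>y. g y + h y) x = T g x + T h x) \<and>
     (\<forall>c. \<forall>g\<in>V. AE x in N. T (\<lambda>y. c * g y) x = c * T g x) \<and>
     (\<forall>g :: nat \<Rightarrow> 'a \<Rightarrow> complex.
        range g \<subseteq> V \<and> bounded (range (\<lambda>k. Lp_norm M p (g k))) \<longrightarrow>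
        (\<exists>h\<in>Lp N q. \<exists>r. strict_mono r \<and>
           (\<lambda>k. Lp_norm N q (\<lambda>x. T (g (r k)) x - h x)) \<longlonglongrightarrow> 0))"

definition holomorphic_ball :: "(complex ^ 'n \<Rightarrow> complex) set" where
  "holomorphic_ball = {f. \<forall>z\<in>ball 0 1. \<exists>L. (f has_derivative L) (at z) \<and>
     (\<forall>c v. L (c *s v) = c * L v)}"

definition bergman_space :: "real \<Rightarrow> real \<Rightarrow> (complex ^ 'n \<Rightarrow> complex) set" where
  "bergman_space p \<alpha> = holomorphic_ball \<inter> Lp (ball_weighted \<alpha>) p"

definition H_infinity :: "(complex ^ 'n \<Rightarrow> complex) set" where
  "H_infinity = {f \<in> holomorphic_ball. bounded (f ` ball 0 1)}"

text \<open>
  The base \<open>1 - cdot z w\<close> has positive real part for \<open>z\<close>, \<open>w\<close> in the ball, so the principal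
  branch taken by \<open>powr\<close> is the usual one.
\<close>

definition bergman_proj :: "real \<Rightarrow> (complex ^ 'n \<Rightarrow> complex) \<Rightarrow> complex ^ 'n \<Rightarrow> complex" where
  "bergman_proj \<beta> g z = (LINT w|ball_weighted \<beta>.
     g w / (1 - cdot z w) powr complex_of_real (real CARD('n) + 1 + \<beta>))"

definition hankel_conj :: "real \<Rightarrow> (complex ^ 'n \<Rightarrow> complex) \<Rightarrow>
    (complex ^ 'n \<Rightarrow> complex) \<Rightarrow> complex ^ 'n \<Rightarrow> complex" where
  "hankel_conj \<beta> f g z = cnj (f z) * g z - bergman_proj \<beta> (\<lambda>w. cnj (f w) * g w) z"

definition hankel_conj_compact ::
  "real \<Rightarrow> (complex ^ 'n \<Rightarrow> complex) \<Rightarrow> real \<Rightarrow> real \<Rightarrow> real \<Rightarrow> bool" where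
  "hankel_conj_compact \<beta> f p \<alpha> q \<longleftrightarrow>
     (\<exists>T. compact_operator (bergman_space p \<alpha>) (ball_weighted \<alpha>) p (ball_weighted \<beta>) q T \<and>
        (\<forall>g\<in>H_infinity. AE z in ball_weighted \<beta>. T g z = hankel_conj \<beta> f g z))"

definition cgrad :: "(complex ^ 'n \<Rightarrow> complex) \<Rightarrow> complex ^ 'n \<Rightarrow> complex ^ 'n" where
  "cgrad f z = (\<chi> k. deriv (\<lambda>t. f (z + axis k t)) 0)"

definition bloch_space :: "real \<Rightarrow> (complex ^ 'n \<Rightarrow> complex) set" where
  "bloch_space s = {f \<in> holomorphic_ball.
     bdd_above ((\<lambda>z. (1 - (norm z)\<^sup>2) powr s * norm (cgrad f z)) ` ball 0 1)}"

definition bloch_norm :: "real \<Rightarrow> (complex ^ 'n \<Rightarrow> complex) \<Rightarrow> real" where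
  "bloch_norm s f =
     norm (f 0) + (SUP z\<in>ball 0 1. (1 - (norm z)\<^sup>2) powr s * norm (cgrad f z))"

definition polynomials :: "(complex ^ 'n \<Rightarrow> complex) set" where
  "polynomials = {Q. \<exists>A c. finite (A :: ('n \<Rightarrow> nat) set) \<and>
     Q = (\<lambda>z. \<Sum>m\<in>A. c m * (\<Prod>k\<in>UNIV. (z $ k) ^ m k))}"

definition little_bloch_space :: "real \<Rightarrow> (complex ^ 'n \<Rightarrow> complex) set" where
  "little_bloch_space s = {f \<in> bloch_space s.
     \<forall>\<epsilon>>0. \<exists>Q\<in>polynomials. bloch_norm s (\<lambda>z. f z - Q z) < \<epsilon>}"

end

(* Put d(z,w) = |1 - <z,w>|, e = 1 if n = 1 and e = 1/2 otherwise.

   Sufficiency. A function whose gradient is O((1 - |z|^2)^(-1-gamma)) satisfies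
     |f(z) - f(w)| <= C d(z,w)^t ((1 - |z|^2)^(-gamma-t) + (1 - |w|^2)^(-gamma-t))  for max(0, -gamma) < t < e,
   so for large b the Schur test, with the Forelli-Rudin estimates, bounds g |-> (I - P_b)(conj f g).
   As (I - P_beta)(I - P_b) = I - P_beta on bounded g, this extends the Hankel operator to A^p_alpha
   with norm controlled by the Bloch norm of f. For polynomials f the gain of a smaller gamma and normal
   families give compactness, and polynomials approximate f in the little Bloch space.

   Necessity. On normalized kernels g_z the operator tends to 0 as |z| -> 1. Pairing its values with
   <w-z,a> (1 - <w,z>)^(-1) (1 - <z,w>)^(-n-1-b) in L^2((1 - |w|^2)^b) kills the holomorphic part
   P_beta(conj f g_z), since <w-z,a> vanishes at w = z, and evaluates the derivative of f at z in the
   direction a - <a,z>z. As |<w-z,a>| is O(d(z,w)^e) in general and O(d(z,w)) for a = z, Hoelder's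
   inequality turns this into decay of the derivatives of f. For gamma <= -e that decay forces the
   derivatives (for n > 1 the tangential ones) to vanish at the boundary, so f is constant. *)
theory Submission
  imports Defs "HOL-Complex_Analysis.Complex_Analysis"
begin


text \<open>Why p <= q costs no extra work: the growth bound for A^p_\<alpha> embeds it in A^q with
  weight \<beta> - q \<gamma>, so that only an estimate between two weighted L^q spaces remains, and
  \<gamma> is exactly the mismatch of homogeneities. The number e is the power in |z - w| =
  O(d(z,w)^e): for n > 1 a tangential displacement of length h near the sphere costs only h^2 in d.
  It caps the Lipschitz exponent t and so produces the threshold \<gamma> > -e. In the necessity
  part the L^q limit furnished by compactness must be identified as 0. This uses pointwise decay of
  the operator on the kernels, which presupposes a Bloch bound for f slightly weaker than the final
  one; boundedness of the operator on the same kernels supplies it. All integrals over the ball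
  descend from a single integration by parts: masses of the weights, mean value property,
  reproducing formula, and from the latter the Forelli-Rudin bounds, by comparing each dyadic shell
  with a kernel integral that is known exactly.\<close>

type_synonym 'n cfun = "complex^'n => complex"

section \<open>Holomorphic functions of several variables\<close>

lemma norm_vsmult: "norm (c *s (v::complex^'n)) = norm c * norm v"
 unfolding norm_vec_def by (simp add: norm_mult L2_set_right_distrib)

lemma scaleR_eq_vsmult: "r *\<^sub>R (v::complex^'n) = complex_of_real r *s v"
 unfolding vec_eq_iff vector_scaleR_component by (simp add: scaleR_conv_of_real)

lemma bounded_linear_vsmult: "bounded_linear (\<lambda>t. t *s (v::complex^'n))"
 by (rule bounded_linear_intro[where K="norm v"])
  (auto simp: scaleR_eq_vsmult vec_eq_iff algebra_simps norm_vsmult scaleR_complex.sel scaleR_conv_of_real[where 'a=complex])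

lemma bounded_linear_vsmult_right: "bounded_linear (\<lambda>w::complex^'n. c *s w)"
 by (rule bounded_linear_intro[where K="norm c"])
  (auto simp: scaleR_eq_vsmult vec_eq_iff algebra_simps norm_vsmult)

lemma cdot_simps [simp]:
 "cdot (x + y) z = cdot x z + cdot y z" "cdot (x - y) z = cdot x z - cdot y z"
 "cdot z (x + y) = cdot z x + cdot z y" "cdot z (x - y) = cdot z x - cdot z y"
 "cdot (c *s x) z = c * cdot x z" "cdot z (c *s x) = cnj c * cdot z x"
 "cdot 0 z = 0" "cdot z 0 = 0" "cdot (- x) z = - cdot x z" "cdot z (- x) = - cdot z x"
 by (simp_all add: cdot_def sum.distrib sum_subtractf sum_negf algebra_simps sum_distrib_left)

lemma cnj_cdot [simp]: "cnj (cdot x y) = cdot y x"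
 by (simp add: cdot_def mult.commute)

lemma norm_cdot_le: "norm (cdot x y) <= norm x * norm y"
proof -
 have "norm (cdot x y) <= (\<Sum>k\<in>UNIV. \<bar>norm (x $ k)\<bar> * \<bar>norm (y $ k)\<bar>)"
  unfolding cdot_def by (rule order_trans[OF norm_sum]) (simp add: norm_mult)
 also have "... <= norm x * norm y"
  unfolding norm_vec_def by (rule L2_set_mult_ineq)
 finally show ?thesis .
qed

lemma cdot_self: "cdot x x = of_real ((norm x)^2)"
proof -
 have "(norm x)^2 = (\<Sum>k\<in>UNIV. (norm (x $ k))^2)"
  unfolding norm_vec_def L2_set_def by (simp add: sum_nonneg)
 thus ?thesis
  by (simp add: cdot_def complex_norm_square[symmetric])
qed

lemma norm_diff_sq: "(norm (x - y))^2 = (norm x)^2 + (norm y)^2 - 2 * Re (cdot x y)"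
proof -
 have *: "cdot x y + cdot y x = of_real (2 * Re (cdot x y))"
  by (metis cnj_cdot complex_add_cnj)
 have "complex_of_real ((norm (x - y))^2) = cdot (x - y) (x - y)"
  by (simp only: cdot_self)
 also have "... = cdot x x + cdot y y - (cdot x y + cdot y x)"
  by (simp add: algebra_simps)
 also have "... = of_real ((norm x)^2 + (norm y)^2 - 2 * Re (cdot x y))"
  unfolding * by (simp add: cdot_self)
 finally show ?thesis using of_real_eq_iff by blast
qed

lemma norm_add_sq: "(norm (x + y))^2 = (norm x)^2 + (norm y)^2 + 2 * Re (cdot x y)"
 for x y :: "complex^'n"
proof -
 show ?thesis using norm_diff_sq[of x "- y"] by simp
qed

lemma cdot_axis: "cdot v (axis k 1) = v $ k"
 by (simp add: cdot_def axis_def if_distrib[of cnj] if_distrib[of "\<lambda>x. _ * x"] cong: if_cong)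

lemma vec_sum_axis: "v = (\<Sum>k\<in>UNIV. (v $ k) *s axis k 1)" for v :: "complex^'n"
 by (simp add: vec_eq_iff axis_def if_distrib[of "\<lambda>x. _ * x"] cong: if_cong)

lemma bounded_linear_cdot: "bounded_linear (\<lambda>z. cdot z w)"
 by (rule bounded_linear_intro[where K="norm w"])
  (auto simp: norm_cdot_le scaleR_eq_vsmult scaleR_conv_of_real)

lemma continuous_on_cdot [continuous_intros]:
 "continuous_on S f ==> continuous_on S g ==> continuous_on S (\<lambda>x. cdot (f x) (g x))"
 unfolding cdot_def by (intro continuous_intros)

section \<open>Complex differentiability and directional derivatives\<close>

definition holo_on :: "(complex ^ 'n) set => (complex ^ 'n => complex) => bool" where
 "holo_on S f \<longleftrightarrow> (\<forall>z\<in>S. \<exists>L. (f has_derivative L) (at z) \<and> (\<forall>c v. L (c *s v) = c * L v))"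

text \<open>Reduces several variables to one: where \<open>holo_on\<close> holds, this slice
  derivative is the value at \<open>v\<close> of the complex linear total derivative
  (\<open>holo_dirI\<close>), so one-variable Cauchy theory applies line by line.\<close>

definition dir :: "complex ^ 'n => (complex ^ 'n => complex) => complex ^ 'n => complex" where
 "dir v f z = deriv (\<lambda>t. f (z + t *s v)) 0"

lemma holomorphic_ball_eq: "holomorphic_ball = Collect (holo_on (ball 0 1))"
 by (auto simp: holomorphic_ball_def holo_on_def)

lemma slice_DERIV:
 fixes f :: "'n::finite cfun"
 assumes "(f has_derivative L) (at (z + t *s v))" "!!c v. L (c *s v) = c * L v"
 shows "((\<lambda>t. f (z + t *s v)) has_field_derivative L v) (at t)"
proof -
 have "((\<lambda>t. z + t *s v) has_derivative (\<lambda>t. t *s v)) (at t)"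
  using has_derivative_add[OF has_derivative_const[of z]
   bounded_linear_imp_has_derivative[OF bounded_linear_vsmult]] by simp
 from has_derivative_compose[OF this assms(1)]
 have "((\<lambda>t. f (z + t *s v)) has_derivative (\<lambda>t. L (t *s v))) (at t)" .
 moreover have "(\<lambda>t. L (t *s v)) = (*) (L v)" by (auto simp: assms(2) mult.commute)
 ultimately show ?thesis
  unfolding has_field_derivative_def by simp
qed

lemma holo_dirI:
 fixes f :: "'n::finite cfun"
 assumes "(f has_derivative L) (at z)" "!!c v. L (c *s v) = c * L v"
 shows "dir v f z = L v"
proof -
 have "((\<lambda>t. f (z + t *s v)) has_field_derivative L v) (at 0)"
  by (rule slice_DERIV) (use assms in auto)
 thus ?thesis unfolding dir_def by (rule DERIV_imp_deriv)
qed

lemma holo_has_derivative: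
 assumes "holo_on S f" "z \<in> S"
 shows "(f has_derivative (\<lambda>v. dir v f z)) (at z)"
proof -
 obtain L where L: "(f has_derivative L) (at z)" "!!c v. L (c *s v) = c * L v"
  using assms unfolding holo_on_def by blast
 have "(\<lambda>v. dir v f z) = L" using holo_dirI[OF L] by auto
 with L show ?thesis by simp
qed

lemma dir_cmul: "holo_on S f ==> z \<in> S ==> dir (c *s v) f z = c * dir v f z"
 unfolding holo_on_def using holo_dirI by metis

lemma dir_linear: "holo_on S f ==> z \<in> S ==> linear (\<lambda>v. dir v f z)"
 using holo_has_derivative has_derivative_linear by blast

lemma dir_diff: "holo_on S f ==> z \<in> S ==> dir (u - v) f z = dir u f z - dir v f z"
 using dir_linear linear_diff by blast

lemma dir_sum: "holo_on S f ==> z \<in> S ==> dir (\<Sum>k\<in>A. g k) f z = (\<Sum>k\<in>A. dir (g k) f z)"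
 using dir_linear linear_sum by blast

lemma dir_0: "holo_on S f ==> z \<in> S ==> dir 0 f z = 0"
 using dir_linear linear_0 by blast

lemma slice_holo_DERIV:
 assumes "holo_on S f" "z + t *s v \<in> S"
 shows "((\<lambda>t. f (z + t *s v)) has_field_derivative dir v f (z + t *s v)) (at t)"
 by (rule slice_DERIV[OF holo_has_derivative[OF assms]]) (rule dir_cmul[OF assms])

lemma slice_holomorphic:
 assumes "holo_on S f" "!!t. t \<in> T ==> z + t *s v \<in> S"
 shows "(\<lambda>t. f (z + t *s v)) holomorphic_on T"
 unfolding holomorphic_on_def field_differentiable_def
 using slice_holo_DERIV[OF assms] by (meson has_field_derivative_at_within)

lemma holo_onI:
 assumes "!!z. z \<in> S ==> (f has_derivative L z) (at z)" "!!z c v. z \<in> S ==> L z (c *s v) = c * L z v"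
 shows "holo_on S f"
 unfolding holo_on_def using assms by blast

lemma holo_on_subset: "holo_on S f ==> T \<subseteq> S ==> holo_on T f"
 unfolding holo_on_def by blast

lemma holo_continuous_on: "holo_on S f ==> continuous_on S f"
 by (intro continuous_at_imp_continuous_on ballI has_derivative_continuous[OF holo_has_derivative])

lemma holo_const [simp]: "holo_on S (\<lambda>_. c)"
 by (rule holo_onI[where L="\<lambda>_ _. 0"]) auto

lemma dir_const [simp]: "dir v (\<lambda>_. c) z = 0"
 by (simp add: dir_def)

lemma holo_lin:
 assumes "holo_on S f" "holo_on S g"
 shows "holo_on S (\<lambda>z. a * f z + b * g z)"
  and "z \<in> S ==> dir v (\<lambda>z. a * f z + b * g z) z = a * dir v f z + b * dir v g z"
proof -
 have D: "((\<lambda>z. a * f z + b * g z) has_derivative (\<lambda>v. a * dir v f z + b * dir v g z)) (at z)"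
  if "z \<in> S" for z
  by (intro has_derivative_add has_derivative_mult_right holo_has_derivative[OF assms(1)]
   holo_has_derivative[OF assms(2)] that)
 note l = dir_cmul[OF assms(1)] dir_cmul[OF assms(2)]
 show "holo_on S (\<lambda>z. a * f z + b * g z)"
  by (rule holo_onI[OF D]) (auto simp: l algebra_simps)
 show "dir v (\<lambda>z. a * f z + b * g z) z = a * dir v f z + b * dir v g z" if "z \<in> S"
  by (rule holo_dirI[OF D[OF that]]) (auto simp: l that algebra_simps)
qed

lemma holo_add: "holo_on S f ==> holo_on S g ==> holo_on S (\<lambda>z. f z + g z)"
 using holo_lin(1)[of S f g 1 1] by simp
lemma holo_diff: "holo_on S f ==> holo_on S g ==> holo_on S (\<lambda>z. f z - g z)"
 using holo_lin(1)[of S f g 1 "-1"] by simp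
lemma holo_cmul: "holo_on S f ==> holo_on S (\<lambda>z. c * f z)"
 using holo_lin(1)[of S f f c 0] by simp
lemma dir_fun_diff: "holo_on S f ==> holo_on S g ==> z \<in> S ==>
  dir v (\<lambda>z. f z - g z) z = dir v f z - dir v g z"
 using holo_lin(2)[of S f g z v 1 "-1"] by simp
lemma dir_fun_cmul: "holo_on S f ==> z \<in> S ==> dir v (\<lambda>z. c * f z) z = c * dir v f z"
 using holo_lin(2)[of S f f z v c 0] by simp

lemma holo_mult:
 assumes "holo_on S f" "holo_on S g"
 shows "holo_on S (\<lambda>z. f z * g z)"
  and "z \<in> S ==> dir v (\<lambda>z. f z * g z) z = f z * dir v g z + dir v f z * g z"
proof -
 have D: "((\<lambda>z. f z * g z) has_derivative (\<lambda>v. f z * dir v g z + dir v f z * g z)) (at z)"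
  if "z \<in> S" for z
  by (intro has_derivative_mult holo_has_derivative[OF assms(1)]
   holo_has_derivative[OF assms(2)] that)
 note l = dir_cmul[OF assms(1)] dir_cmul[OF assms(2)]
 show "holo_on S (\<lambda>z. f z * g z)"
  by (rule holo_onI[OF D]) (auto simp: l algebra_simps)
 show "dir v (\<lambda>z. f z * g z) z = f z * dir v g z + dir v f z * g z" if "z \<in> S"
  by (rule holo_dirI[OF D[OF that]]) (auto simp: l that algebra_simps)
qed

lemma holo_sum: "(!!k. k \<in> A ==> holo_on S (f k)) ==> holo_on S (\<lambda>z. \<Sum>k\<in>A. f k z)"
 by (induction A rule: infinite_finite_induct) (auto intro!: holo_add)

lemma holo_compose:
 assumes "holo_on S f" "!!z. z \<in> S ==> (\<phi> has_field_derivative \<phi>' (f z)) (at (f z))"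
 shows "holo_on S (\<lambda>z. \<phi> (f z))"
  and "z \<in> S ==> dir v (\<lambda>z. \<phi> (f z)) z = \<phi>' (f z) * dir v f z"
proof -
 have D: "((\<lambda>z. \<phi> (f z)) has_derivative (\<lambda>v. \<phi>' (f z) * dir v f z)) (at z)" if "z \<in> S" for z
  using has_derivative_compose[OF holo_has_derivative[OF assms(1) that]
   assms(2)[OF that, unfolded has_field_derivative_def]] by (simp add: mult.commute)
 show "holo_on S (\<lambda>z. \<phi> (f z))"
  by (rule holo_onI[OF D]) (auto simp: dir_cmul[OF assms(1)] algebra_simps)
 show "dir v (\<lambda>z. \<phi> (f z)) z = \<phi>' (f z) * dir v f z" if "z \<in> S"
  by (rule holo_dirI[OF D[OF that]]) (auto simp: dir_cmul[OF assms(1)] that algebra_simps)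
qed

lemma holo_affine:
 assumes "holo_on S f" "!!w. w \<in> T ==> a + c *s w \<in> S"
 shows "holo_on T (\<lambda>w. f (a + c *s w))"
  and "w \<in> T ==> dir v (\<lambda>w. f (a + c *s w)) w = c * dir v f (a + c *s w)"
proof -
 have D: "((\<lambda>w. f (a + c *s w)) has_derivative (\<lambda>v. c * dir v f (a + c *s w))) (at w)"
  if "w \<in> T" for w
 proof -
  have "((\<lambda>w. a + c *s w) has_derivative (\<lambda>v. c *s v)) (at w)"
   by (rule has_derivative_eq_rhs, rule has_derivative_add[OF has_derivative_const
    bounded_linear_imp_has_derivative[OF bounded_linear_vsmult_right]]) simp
  from has_derivative_compose[OF this holo_has_derivative[OF assms(1) assms(2)[OF that]]]
  show ?thesis by (simp add: dir_cmul[OF assms(1) assms(2)[OF that]])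
 qed
 have l: "c * dir (d *s v) f (a + c *s w) = d * (c * dir v f (a + c *s w))" if "w \<in> T" for w d v
  by (simp add: dir_cmul[OF assms(1) assms(2)[OF that]])
 show "holo_on T (\<lambda>w. f (a + c *s w))" by (rule holo_onI[OF D]) (auto simp: l)
 show "dir v (\<lambda>w. f (a + c *s w)) w = c * dir v f (a + c *s w)" if "w \<in> T"
  by (rule holo_dirI[OF D[OF that]]) (auto simp: l that)
qed

lemma holo_cdot [simp]: "holo_on S (\<lambda>z. cdot z w)"
 and dir_cdot [simp]: "dir v (\<lambda>z. cdot z w) z = cdot v w"
proof -
 have D: "((\<lambda>z. cdot z w) has_derivative (\<lambda>v. cdot v w)) (at z)" for z
  using bounded_linear_cdot by (rule bounded_linear_imp_has_derivative)
 show "holo_on S (\<lambda>z. cdot z w)" by (rule holo_onI[OF D]) simp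
 show "dir v (\<lambda>z. cdot z w) z = cdot v w" by (rule holo_dirI[OF D]) simp
qed

lemma holo_nth: "holo_on S (\<lambda>z. z $ k)"
 using holo_cdot[of S "axis k 1"] by (simp add: cdot_axis)

lemma holo_on_cong:
 assumes "holo_on S f" "open S" "!!z. z \<in> S ==> f z = g z"
 shows "holo_on S g" and "z \<in> S ==> dir v g z = dir v f z"
proof -
 have D: "(g has_derivative (\<lambda>v. dir v f z)) (at z)" if "z \<in> S" for z
  by (rule has_derivative_transform_within_open[OF holo_has_derivative[OF assms(1) that] assms(2)])
   (use assms that in auto)
 show "holo_on S g" by (rule holo_onI[OF D]) (auto simp: dir_cmul[OF assms(1)])
 show "dir v g z = dir v f z" if "z \<in> S"
  by (rule holo_dirI[OF D[OF that]]) (auto simp: dir_cmul[OF assms(1)] that)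
qed

subsection \<open>Cauchy estimates\<close>

text \<open>The circle of radius \<open>R / 2\<close> is used, since the Cauchy inequality asks for
  continuity on a closed disc; this is the source of the factor 2.\<close>

lemma Cauchy_deriv_le:
 assumes "\<phi> holomorphic_on ball a R" "R > 0" "!!x. x \<in> ball a R ==> norm (\<phi> x) <= M"
 shows "norm (deriv \<phi> a) <= 2 * M / R"
proof -
 have "norm ((deriv ^^ 1) \<phi> a) <= fact 1 * M / (R/2)^1"
 proof (rule Cauchy_inequality)
  have sub: "cball a (R/2) \<subseteq> ball a R" using assms(2) by auto
  show "\<phi> holomorphic_on ball a (R/2)" by (rule holomorphic_on_subset[OF assms(1)]) (use assms(2) in auto)
  show "continuous_on (cball a (R/2)) \<phi>"
   by (rule continuous_on_subset[OF holomorphic_on_imp_continuous_on[OF assms(1)] sub])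
  show "norm (\<phi> x) <= M" if "norm (a - x) = R/2" for x
   by (rule assms(3)) (use that assms(2) in \<open>auto simp: dist_norm\<close>)
 qed (use assms in auto)
 thus ?thesis by (simp add: mult.commute)
qed

text \<open>For \<open>x\<close> within \<open>R / 2\<close> of the centre the closed disc of radius
  \<open>R / 3\<close> stays inside, so the second derivative is at most 2 M / (R/3)^2 = 18 M / R^2
  there, and Taylor's formula of order one does the rest.\<close>

lemma Cauchy_quadratic:
 assumes "\<phi> holomorphic_on ball a R" "R > 0" "!!x. x \<in> ball a R ==> norm (\<phi> x) <= M"
  and "norm h < R / 2"
 shows "norm (\<phi> (a + h) - \<phi> a - h * deriv \<phi> a) <= 18 * M * (norm h)^2 / R^2"
proof -
 have d2: "norm ((deriv ^^ 2) \<phi> x) <= 18 * M / R^2" if "x \<in> ball a (R/2)" for x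
 proof -
  have sub: "cball x (R/3) \<subseteq> ball a R"
  proof
   fix y assume "y \<in> cball x (R/3)"
   hence "dist a y <= dist a x + R/3" using dist_triangle[of a y x] by auto
   with that assms(2) show "y \<in> ball a R" by auto
  qed
  have "norm ((deriv ^^ 2) \<phi> x) <= fact 2 * M / (R/3)^2"
  proof (rule Cauchy_inequality)
   show "\<phi> holomorphic_on ball x (R/3)"
    by (rule holomorphic_on_subset[OF assms(1)]) (use sub ball_subset_cball in blast)
   show "continuous_on (cball x (R/3)) \<phi>"
    by (rule continuous_on_subset[OF holomorphic_on_imp_continuous_on[OF assms(1)] sub])
   show "norm (\<phi> y) <= M" if "norm (x - y) = R/3" for y
    by (rule assms(3)) (use that sub in \<open>auto simp: dist_norm\<close>)
  qed (use assms in auto)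
  thus ?thesis by (simp add: power_divide)
 qed
 have D: "((deriv ^^ i) \<phi> has_field_derivative (deriv ^^ Suc i) \<phi> x) (at x within ball a (R/2))"
  if "x \<in> ball a (R/2)" for i x
 proof -
  have "(deriv ^^ i) \<phi> holomorphic_on ball a R" by (rule holomorphic_higher_deriv[OF assms(1)]) auto
  from holomorphic_derivI[OF this, of x] show ?thesis
   using that assms(2) by (auto intro: has_field_derivative_at_within)
 qed
 have "norm ((deriv ^^ 0) \<phi> (a + h) - (\<Sum>i\<le>1. (deriv ^^ i) \<phi> a * ((a + h) - a)^i / fact i))
  <= (18 * M / R^2) * norm ((a + h) - a)^(Suc 1) / fact 1"
  by (rule complex_Taylor[where S="ball a (R/2)" and f = "\<lambda>i. (deriv ^^ i) \<phi>"])
   (use D d2 assms in \<open>auto simp: dist_norm numeral_2_eq_2\<close>)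
 thus ?thesis by (simp add: power2_eq_square algebra_simps)
qed

lemma holo_slice_ball:
 assumes "holo_on (ball z R) f" "R > 0" "norm v ~= 0"
 shows "(\<lambda>t. f (z + t *s v)) holomorphic_on ball 0 (R / norm v)"
  and "t \<in> ball 0 (R / norm v) ==> z + t *s v \<in> ball z R"
proof -
 show *: "z + t *s v \<in> ball z R" if "t \<in> ball 0 (R / norm v)" for t
  using that assms by (simp add: dist_norm norm_vsmult pos_less_divide_eq)
 show "(\<lambda>t. f (z + t *s v)) holomorphic_on ball 0 (R / norm v)"
  by (rule slice_holomorphic[OF assms(1) *])
qed

lemma holo_dir_le:
 assumes "holo_on (ball z R) f" "R > 0" "!!x. x \<in> ball z R ==> norm (f x) <= M"
 shows "norm (dir v f z) <= 2 * M * norm v / R"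
proof (cases "norm v = 0")
 case True
 thus ?thesis using dir_0[OF assms(1), of z] assms(2) by simp
next
 case False
 have "norm (deriv (\<lambda>t. f (z + t *s v)) 0) <= 2 * M / (R / norm v)"
  by (rule Cauchy_deriv_le) (use holo_slice_ball[OF assms(1,2) False] assms False in auto)
 thus ?thesis by (simp add: dir_def)
qed

lemma holo_quadratic:
 assumes "holo_on (ball z R) f" "R > 0" "!!x. x \<in> ball z R ==> norm (f x) <= M"
  and "norm h < R / 2"
 shows "norm (f (z + h) - f z - dir h f z) <= 18 * M * (norm h)^2 / R^2"
proof (cases "norm h = 0")
 case True
 thus ?thesis using dir_0[OF assms(1), of z] assms(2) by simp
next
 case False
 have "norm (f (z + (0 + 1) *s h) - f (z + 0 *s h) - 1 * deriv (\<lambda>t. f (z + t *s h)) 0)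
  <= 18 * M * (norm (1::complex))^2 / (R / norm h)^2"
  by (rule Cauchy_quadratic) (use holo_slice_ball[OF assms(1,2) False] assms False in \<open>auto simp: field_simps\<close>)
 thus ?thesis by (simp add: dir_def power_divide)
qed

text \<open>An explicit quadratic remainder, unlike a bare little-o, survives pointwise limits and
  integration over a parameter. Differentiability of limits and of parameter integrals is obtained
  in this form.\<close>

lemma has_derivative_quadratic:
 fixes F :: "'a::real_normed_vector => 'b::real_normed_vector"
 assumes "bounded_linear L" "r > 0"
  "!!h. norm h < r ==> norm (F (z + h) - F z - L h) <= C * (norm h)^2"
 shows "(F has_derivative L) (at z)"
 unfolding has_derivative_at
proof (intro conjI assms(1))
 have "((\<lambda>h. norm (F (z + h) - F z - L h) / norm h) \<longlongrightarrow> 0) (at 0)"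
 proof (rule tendsto_sandwich[where f="\<lambda>_. 0" and h="\<lambda>h. \<bar>C\<bar> * norm h"])
  show "((\<lambda>h::'a. \<bar>C\<bar> * norm h) \<longlongrightarrow> 0) (at 0)"
   by (auto intro!: tendsto_eq_intros)
  have "norm (F (z + h) - F z - L h) / norm h <= \<bar>C\<bar> * norm h" if "h ~= 0" "norm h < r" for h
  proof -
   have "norm (F (z + h) - F z - L h) <= \<bar>C\<bar> * (norm h)^2"
    by (rule order_trans[OF assms(3)[OF that(2)]]) (simp add: mult_right_mono)
   thus ?thesis using that(1) by (simp add: divide_le_eq power2_eq_square mult.assoc)
  qed
  thus "\<forall>\<^sub>F h in at 0. norm (F (z + h) - F z - L h) / norm h <= \<bar>C\<bar> * norm h"
   unfolding eventually_at using assms(2) by (intro exI[of _ r]) auto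
 qed (auto intro!: always_eventually)
 thus "(\<lambda>h. norm (F (z + h) - F z - L h) / norm h) \<midarrow>0\<rightarrow> 0" .
qed

lemma holo_local_lipschitz:
 fixes g :: "'n::finite cfun"
 assumes g: "holo_on (ball z (2 * R)) g" and R: "R > 0" and M: "!!x. x \<in> ball z (2 * R) ==> norm (g x) <= M" and x: "x \<in> ball z R"
 shows "norm (g x - g z) <= 2 * M / R * norm (x - z)"
proof (rule differentiable_bound[where S="ball z R" and f'="\<lambda>w v. dir v g w"])
 have sub: "ball w R \<subseteq> ball z (2 * R)" if "w \<in> ball z R" for w
 proof
  fix y assume "y \<in> ball w R"
  thus "y \<in> ball z (2 * R)" using that dist_triangle[of z y w] by simp
 qed
 show "(g has_derivative (\<lambda>v. dir v g w)) (at w within ball z R)" if "w \<in> ball z R" for w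
  by (rule has_derivative_at_withinI[OF holo_has_derivative[OF g]]) (use that R in auto)
 show "onorm (\<lambda>v. dir v g w) <= 2 * M / R" if w: "w \<in> ball z R" for w
 proof (rule onorm_le)
  fix v
  have "norm (dir v g w) <= 2 * M * norm v / R"
   by (rule holo_dir_le[OF holo_on_subset[OF g sub[OF w]] R]) (use M sub[OF w] in blast)
  thus "norm (dir v g w) <= 2 * M / R * norm v" by simp
 qed
qed (use R x in auto)

lemma dir_eq_sum_axis:
 assumes "holo_on S f" "z \<in> S"
 shows "dir v f z = (\<Sum>k\<in>UNIV. v $ k * dir (axis k 1) f z)"
proof -
 have "dir v f z = dir (\<Sum>k\<in>UNIV. (v $ k) *s axis k 1) f z" using vec_sum_axis[of v] by simp
 thus ?thesis by (simp add: dir_sum[OF assms] dir_cmul[OF assms])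
qed

text \<open>The Cauchy estimates bound the gradients at \<open>w\<close>, a subsequence of them
  converges and defines a candidate \<open>L\<close>, and the quadratic remainder estimate, uniform
  in \<open>j\<close>, passes to the limit.\<close>

lemma holo_pointwise_limit:
 fixes f :: "nat => 'n::finite cfun"
 assumes f: "!!j. holo_on (ball z R) (f j)"
  and M: "!!j x. x \<in> ball z R ==> norm (f j x) <= M"
  and lim: "!!x. x \<in> ball z R ==> (\<lambda>j. f j x) \<longlonglongrightarrow> g x"
 shows "holo_on (ball z R) g"
 unfolding holo_on_def
proof
 fix w assume w: "w \<in> ball z R"
 define r where "r = R - dist z w"
 have r: "r > 0" using w by (simp add: r_def)
 have sub: "ball w r \<subseteq> ball z R"
 proof
  fix y assume "y \<in> ball w r"
  thus "y \<in> ball z R" using dist_triangle[of z y w] by (auto simp: r_def)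
 qed
 have fw: "holo_on (ball w r) (f j)" for j by (rule holo_on_subset[OF f sub])
 have Mw: "norm (f j x) <= M" if "x \<in> ball w r" for j x using M sub that by blast
 define l where "l j = (\<chi> k. dir (axis k 1) (f j) w)" for j
 have "norm (dir (axis k 1) (f j) w) <= 2 * M * norm (axis k 1 :: complex^'n) / r" for j k
  by (rule holo_dir_le[OF fw r Mw])
 hence "norm (l j $ k) <= 2 * M / r" for j k by (simp add: l_def)
 hence "norm (l j) <= (\<Sum>k\<in>(UNIV :: 'n set). 2 * M / r)" for j
  unfolding norm_vec_def[of "l j"] by (intro order_trans[OF L2_set_le_sum sum_mono]) auto
 hence "bounded (range l)" unfolding bounded_iff by blast
 then obtain L0 \<rho> where \<rho>: "strict_mono \<rho>" and L0: "(l \<circ> \<rho>) \<longlonglongrightarrow> L0" using bounded_imp_convergent_subsequence by blast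
 define L where "L h = (\<Sum>k\<in>UNIV. h $ k * L0 $ k)" for h
 have "norm (g (w + h) - g w - L h) <= 18 * M / r^2 * (norm h)^2" if h: "norm h < r / 2" for h
 proof -
  have "w + h \<in> ball w r" using h r by (simp add: dist_norm)
  hence wh: "w + h \<in> ball z R" using sub by blast
  have l: "(\<lambda>j. f (\<rho> j) x) \<longlonglongrightarrow> g x" if "x \<in> ball z R" for x
   using LIMSEQ_subseq_LIMSEQ[OF lim[OF that] \<rho>] by (simp add: o_def)
  have "(\<lambda>j. l (\<rho> j) $ k) \<longlonglongrightarrow> L0 $ k" for k using tendsto_vec_nth[OF L0] by (simp add: o_def)
  hence "(\<lambda>j. dir h (f (\<rho> j)) w) \<longlonglongrightarrow> L h"
   unfolding dir_eq_sum_axis[where v=h, OF f w] L_def by (intro tendsto_intros) (simp add: l_def)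
  hence "(\<lambda>j. norm (f (\<rho> j) (w + h) - f (\<rho> j) w - dir h (f (\<rho> j)) w)) \<longlonglongrightarrow> norm (g (w + h) - g w - L h)"
   by (intro tendsto_intros l wh w)
  thus ?thesis by (rule LIMSEQ_le_const2) (use holo_quadratic[OF fw r Mw h] in simp)
 qed
 moreover have "bounded_linear L" unfolding L_def[abs_def]
  by (intro bounded_linear_sum bounded_linear_mult_const bounded_linear_vec_nth)
 ultimately have "(g has_derivative L) (at w)" using r by (intro has_derivative_quadratic[where r="r / 2" and C="18 * M / r^2"]) auto
 moreover have "L (c *s v) = c * L v" for c v by (simp add: L_def sum_distrib_left mult.assoc)
 ultimately show "\<exists>L. (g has_derivative L) (at w) \<and> (\<forall>c v. L (c *s v) = c * L v)" by blast
qed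


subsection \<open>Integrals depending holomorphically on a parameter\<close>

lemma norm_integral_le:
 fixes f :: "'x => 'b::{banach, second_countable_topology}"
 assumes "integrable M f" "integrable M g" "!!x. x \<in> space M ==> norm (f x) <= g x"
 shows "norm (LINT x|M. f x) <= (LINT x|M. g x)"
 by (rule order_trans[OF integral_norm_bound integral_mono]) (use assms in auto)

text \<open>The function \<open>g\<close> acts three times: as majorant of the pointwise derivative,
  as operator bound of the integrated derivative, and as coefficient of the quadratic
  remainder.\<close>

lemma has_derivative_integral_quadratic:
 fixes F :: "'a::real_normed_vector => 'x => complex"
 assumes r: "r > 0" and g: "integrable M g"
  and F: "!!h. norm h < r ==> integrable M (F (z + h))"
  and Lm: "!!h. (\<lambda>x. L x h) \<in> borel_measurable M"
  and lin: "!!x. x \<in> space M ==> linear (L x)"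
  and Lb: "!!x h. x \<in> space M ==> norm (L x h) <= norm h * g x"
  and quad: "!!x h. x \<in> space M ==> norm h < r ==>
   norm (F (z + h) x - F z x - L x h) <= g x * (norm h)^2"
 shows "((\<lambda>w. (LINT x|M. F w x)) has_derivative (\<lambda>h. (LINT x|M. L x h))) (at z)"
  and "integrable M (\<lambda>x. L x h)"
proof -
 have iL: "integrable M (\<lambda>x. L x h)" for h
  by (rule Bochner_Integration.integrable_bound[OF integrable_mult_right[OF g, of "norm h"] Lm])
   (auto intro!: AE_I2 order_trans[OF Lb])
 show "integrable M (\<lambda>x. L x h)" by (rule iL)
 have Fz: "integrable M (F z)" using F[of 0] r by simp
 show "((\<lambda>w. (LINT x|M. F w x)) has_derivative (\<lambda>h. (LINT x|M. L x h))) (at z)"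
 proof (rule has_derivative_quadratic[OF _ r])
  show "bounded_linear (\<lambda>h. (LINT x|M. L x h))"
  proof (rule bounded_linear_intro[where K="LINT x|M. g x"])
   show "(LINT x|M. L x (a + b)) = (LINT x|M. L x a) + (LINT x|M. L x b)" for a b
    by (subst Bochner_Integration.integral_add[symmetric, OF iL iL])
     (auto intro!: Bochner_Integration.integral_cong simp: linear_add[OF lin])
   show "(LINT x|M. L x (c *\<^sub>R a)) = c *\<^sub>R (LINT x|M. L x a)" for a c
   proof -
    have "(LINT x|M. L x (c *\<^sub>R a)) = (LINT x|M. c *\<^sub>R L x a)"
     by (intro Bochner_Integration.integral_cong) (auto simp: linear_scale[OF lin])
    thus ?thesis using iL[of a] by simp
   qed
   show "norm (LINT x|M. L x h) <= norm h * (LINT x|M. g x)" for h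
    by (subst integral_mult_right_zero[symmetric], rule norm_integral_le[OF iL])
     (use g Lb in auto)
  qed
  show "norm ((LINT x|M. F (z + h) x) - (LINT x|M. F z x) - (LINT x|M. L x h)) <= (LINT x|M. g x) * (norm h)^2"
   if "norm h < r" for h
  proof -
   have "(LINT x|M. F (z + h) x) - (LINT x|M. F z x) - (LINT x|M. L x h)
    = (LINT x|M. F (z + h) x - F z x - L x h)"
    using F[OF that] Fz iL by simp
   also have "norm ... <= (LINT x|M. g x * (norm h)^2)"
    by (rule norm_integral_le) (use F[OF that] Fz iL g quad[OF _ that] in auto)
   finally show ?thesis by simp
  qed
 qed
qed

lemma slice_LIMSEQ:
 assumes "(\<phi> has_field_derivative D) (at a)" "e ~= (0::real)"
 shows "(\<lambda>i. (\<phi> (a + of_real (e / real (Suc i))) - \<phi> a) / of_real (e / real (Suc i))) \<longlonglongrightarrow> (D::complex)"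
proof -
 have 1: "((\<lambda>h. (\<phi> (a + h) - \<phi> a) / h) \<longlongrightarrow> D) (at 0)"
  using assms(1) by (simp add: DERIV_def)
 have "(\<lambda>i. e / real (Suc i)) \<longlonglongrightarrow> 0" by (rule tendsto_divide_0[OF tendsto_const])
  (rule filterlim_compose[OF filterlim_real_at_infinity_sequentially[THEN filterlim_mono] filterlim_Suc], auto)
 hence "(\<lambda>i. complex_of_real (e / real (Suc i))) \<longlonglongrightarrow> of_real 0" by (rule tendsto_of_real)
 hence "(\<lambda>i. complex_of_real (e / real (Suc i))) \<longlonglongrightarrow> 0" by simp
 moreover have "complex_of_real (e / real (Suc i)) ~= 0" for i using assms(2) by (simp del: of_nat_Suc)
 ultimately have "filterlim (\<lambda>i. complex_of_real (e / real (Suc i))) (at 0) sequentially"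
  by (simp add: filterlim_at)
 from filterlim_compose[OF 1 this] show ?thesis .
qed

text \<open>Derivatives as pointwise limits of a sequence of difference quotients: this settles
  their measurability in a parameter and, later, their holomorphy.\<close>

lemma dir_LIMSEQ:
 assumes "holo_on S f" "z \<in> S" "e ~= (0::real)"
 shows "(\<lambda>i. (f (z + of_real (e / real (Suc i)) *s v) - f z) / of_real (e / real (Suc i))) \<longlonglongrightarrow> dir v f z"
proof -
 have "((\<lambda>t. f (z + t *s v)) has_field_derivative dir v f z) (at 0)"
  using slice_holo_DERIV[OF assms(1), of z 0 v] assms(2) by simp
 from slice_LIMSEQ[OF this assms(3)] show ?thesis by simp
qed

lemma ball_shrink:
 fixes z z0 :: "'a::metric_space"
 assumes "z \<in> ball z0 R"
 obtains r where "r > 0" "ball z r \<subseteq> ball z0 R"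
 using assms open_contains_ball[of "ball z0 R"] open_ball by blast

text \<open>Cauchy estimates turn the majorant \<open>g\<close> of \<open>F\<close> into majorants
  of the derivative and of the quadratic remainder, so that domination of \<open>F\<close> alone
  permits differentiation under the integral.\<close>

lemma holo_integral:
 fixes F :: "complex^'n => 'x => complex"
 assumes F: "!!x. x \<in> space M ==> holo_on (ball z0 R) (\<lambda>z. F z x)"
  and b: "!!z x. z \<in> ball z0 R ==> x \<in> space M ==> norm (F z x) <= g x"
  and m: "!!z. z \<in> ball z0 R ==> F z \<in> borel_measurable M"
  and g: "integrable M g"
 shows "holo_on (ball z0 R) (\<lambda>z. (LINT x|M. F z x))"
  and "z \<in> ball z0 R ==> dir v (\<lambda>z. (LINT x|M. F z x)) z = (LINT x|M. dir v (\<lambda>z. F z x) z)"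
  and "z \<in> ball z0 R ==> integrable M (\<lambda>x. dir v (\<lambda>z. F z x) z)"
proof -
 have main: "((\<lambda>w. (LINT x|M. F w x)) has_derivative (\<lambda>h. (LINT x|M. dir h (\<lambda>z. F z x) z))) (at z)
  \<and> (\<forall>h. integrable M (\<lambda>x. dir h (\<lambda>z. F z x) z))" if z: "z \<in> ball z0 R" for z
 proof -
  obtain r where r: "r > 0" "ball z r \<subseteq> ball z0 R" using ball_shrink[OF z] .
  have Fz: "holo_on (ball z r) (\<lambda>z. F z x)" if "x \<in> space M" for x
   using F[OF that] r(2) holo_on_subset by blast
  have bz: "norm (F w x) <= g x" if "w \<in> ball z r" "x \<in> space M" for w x using b r(2) that by blast
  \<comment> \<open>The two Cauchy constants added: 2/r for the derivative, 18/r^2 for the quadratic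
    remainder.\<close>
  define C where "C = 2 / r + 18 / r^2"
  have C: "2 / r <= C" "18 / r^2 <= C" using r(1) by (auto simp: C_def)
  have g0: "g x >= 0" if "x \<in> space M" for x
   by (rule order_trans[OF norm_ge_zero bz[of z x]]) (use that r in auto)
  have 1: "r / 2 > 0" using r by simp
  have 2: "integrable M (\<lambda>x. C * g x)" using g by simp
  have 3: "integrable M (F (z + h))" if "norm h < r / 2" for h
  proof -
   have "z + h \<in> ball z r" using that r by (simp add: dist_norm)
   hence "z + h \<in> ball z0 R" using r by blast
   with b g m show ?thesis by (intro Bochner_Integration.integrable_bound[OF g]) (auto intro!: AE_I2 order_trans[OF b abs_ge_self])
  qed
  have 4: "(\<lambda>x. dir h (\<lambda>z. F z x) z) \<in> borel_measurable M" for h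
  proof -
   \<comment> \<open>Small enough for all points \<open>z + (e / Suc i) h\<close> to stay in the
     ball, where \<open>F\<close> is measurable in the parameter.\<close>
   define e where "e = r / (2 * (norm h + 1))"
   have nh: "norm h + 1 > 0" by (simp add: add_nonneg_pos)
   have e: "e > 0" unfolding e_def using r(1) nh by simp
   have nr: "norm (complex_of_real (e / real (Suc i)) *s h) < r" for i
   proof -
    have "norm (complex_of_real (e / real (Suc i)) *s h) = e / real (Suc i) * norm h"
     using e unfolding norm_vsmult norm_of_real by simp
    also have "... <= e * norm h" using e by (intro mult_right_mono) (auto simp: divide_le_eq)
    also have "... <= e * (norm h + 1)" using e by simp
    also have "... = r / 2"
    proof -
     have "r / (2 * N) * N = r / 2" if "N > 0" for N using that by simp
     from this[OF nh] show ?thesis by (simp only: e_def)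
    qed
    finally show ?thesis using r(1) by simp
   qed
   hence inb: "z + complex_of_real (e / real (Suc i)) *s h \<in> ball z0 R" for i
   proof -
    from nr[of i] have "z + complex_of_real (e / real (Suc i)) *s h \<in> ball z r"
     by (simp add: dist_norm del: of_real_divide of_nat_Suc)
    thus ?thesis using r(2) by blast
   qed
   show ?thesis
   proof (rule borel_measurable_LIMSEQ_metric)
    show "(\<lambda>x. (F (z + of_real (e / real (Suc i)) *s h) x - F z x) / of_real (e / real (Suc i)))
     \<in> borel_measurable M" for i
     using m[OF inb[of i]] m[OF z] by measurable
    show "(\<lambda>i. (F (z + of_real (e / real (Suc i)) *s h) x - F z x) / of_real (e / real (Suc i)))
     \<longlonglongrightarrow> dir h (\<lambda>z. F z x) z" if "x \<in> space M" for x
     by (rule dir_LIMSEQ[OF Fz[OF that]]) (use r e in auto)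
   qed
  qed
  have 5: "norm (dir h (\<lambda>z. F z x) z) <= norm h * (C * g x)" if x: "x \<in> space M" for x h
  proof -
   have "norm (dir h (\<lambda>z. F z x) z) <= 2 * g x * norm h / r"
    by (rule holo_dir_le[OF Fz[OF x] r(1)]) (use bz x in auto)
   also have "... = (norm h * g x) * (2 / r)" by simp
   also have "... <= (norm h * g x) * C" using C(1) g0[OF x] by (intro mult_left_mono) auto
   finally show ?thesis by (simp add: mult_ac)
  qed
  have 6: "norm (F (z + h) x - F z x - dir h (\<lambda>z. F z x) z) <= C * g x * (norm h)^2"
   if x: "x \<in> space M" and h: "norm h < r / 2" for x h
  proof -
   have "norm (F (z + h) x - F z x - dir h (\<lambda>z. F z x) z) <= 18 * g x * (norm h)^2 / r^2"
    by (rule holo_quadratic[OF Fz[OF x] r(1)]) (use bz x h in auto)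
   also have "... = (g x * (norm h)^2) * (18 / r^2)" by simp
   also have "... <= (g x * (norm h)^2) * C" using C(2) g0[OF x] by (intro mult_left_mono) auto
   finally show ?thesis by (simp add: mult_ac)
  qed
  have 7: "linear (\<lambda>h. dir h (\<lambda>z. F z x) z)" if "x \<in> space M" for x
   using dir_linear[OF Fz[OF that]] r(1) by simp
  from has_derivative_integral_quadratic[where L="\<lambda>x h. dir h (\<lambda>z. F z x) z" and z=z and F=F, OF 1 2 3 4 7 5 6]
  show ?thesis by simp
 qed
 have c: "(LINT x|M. dir (c *s v) (\<lambda>z. F z x) z) = c * (LINT x|M. dir v (\<lambda>z. F z x) z)"
  if "z \<in> ball z0 R" for c v z
 proof -
  have "(LINT x|M. dir (c *s v) (\<lambda>z. F z x) z) = (LINT x|M. c * dir v (\<lambda>z. F z x) z)"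
   by (intro Bochner_Integration.integral_cong refl dir_cmul[OF F that])
  thus ?thesis by simp
 qed
 show "holo_on (ball z0 R) (\<lambda>z. (LINT x|M. F z x))"
  unfolding holo_on_def using main c by blast
 show "dir v (\<lambda>z. (LINT x|M. F z x)) z = (LINT x|M. dir v (\<lambda>z. F z x) z)" if "z \<in> ball z0 R"
  by (rule holo_dirI[where L="\<lambda>v. (LINT x|M. dir v (\<lambda>z. F z x) z)"]) (use main c that in auto)
 show "integrable M (\<lambda>x. dir v (\<lambda>z. F z x) z)" if "z \<in> ball z0 R" using main that by blast
qed

lemma DERIV_integral:
 fixes F :: "complex => 'x => complex"
 assumes F: "!!x z. x \<in> space M ==> z \<in> ball z0 R ==> ((\<lambda>z. F z x) has_field_derivative F' z x) (at z)"
  and b: "!!z x. z \<in> ball z0 R ==> x \<in> space M ==> norm (F z x) <= g x"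
  and m: "!!z. z \<in> ball z0 R ==> F z \<in> borel_measurable M"
  and m': "!!z. z \<in> ball z0 R ==> F' z \<in> borel_measurable M"
  and g: "integrable M g" and z: "z \<in> ball z0 R"
 shows "((\<lambda>z. (LINT x|M. F z x)) has_field_derivative (LINT x|M. F' z x)) (at z)"
proof -
 obtain r where r: "r > 0" "ball z r \<subseteq> ball z0 R" using ball_shrink[OF z] .
 have Fz: "(\<lambda>z. F z x) holomorphic_on ball z r" if "x \<in> space M" for x
  unfolding holomorphic_on_def field_differentiable_def
  using F[OF that] r(2) by (meson has_field_derivative_at_within subsetD)
 have dF: "deriv (\<lambda>z. F z x) z = F' z x" if "x \<in> space M" for x
  using F[OF that z] by (rule DERIV_imp_deriv)
 have bz: "norm (F w x) <= g x" if "w \<in> ball z r" "x \<in> space M" for w x using b r(2) that by blast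
 define C where "C = 2 / r + 18 / r^2"
 have C: "2 / r <= C" "18 / r^2 <= C" using r(1) by (auto simp: C_def)
 have g0: "g x >= 0" if "x \<in> space M" for x
  by (rule order_trans[OF norm_ge_zero bz[of z x]]) (use that r in auto)
 have 1: "r / 2 > 0" using r by simp
 have 2: "integrable M (\<lambda>x. C * g x)" using g by simp
 have 3: "integrable M (F (z + h))" if "norm h < r / 2" for h
 proof -
  have "z + h \<in> ball z r" using that r by (simp add: dist_norm)
  hence "z + h \<in> ball z0 R" using r by blast
  with b g m show ?thesis by (intro Bochner_Integration.integrable_bound[OF g]) (auto intro!: AE_I2 order_trans[OF b abs_ge_self])
 qed
 have 4: "(\<lambda>x. F' z x * h) \<in> borel_measurable M" for h
  using m'[OF z] by measurable
 have 5: "norm (F' z x * h) <= norm h * (C * g x)" if x: "x \<in> space M" for x h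
 proof -
  have "norm (F' z x) <= 2 * g x / r"
   unfolding dF[OF x, symmetric] by (rule Cauchy_deriv_le[OF Fz[OF x] r(1)]) (use bz x in auto)
  hence "norm (F' z x * h) <= 2 * g x / r * norm h" unfolding norm_mult by (intro mult_right_mono) auto
  also have "... = (norm h * g x) * (2 / r)" by simp
  also have "... <= (norm h * g x) * C" using C(1) g0[OF x] by (intro mult_left_mono) auto
  finally show ?thesis by (simp add: mult_ac)
 qed
 have 6: "norm (F (z + h) x - F z x - F' z x * h) <= C * g x * (norm h)^2"
  if x: "x \<in> space M" and h: "norm h < r / 2" for x h
 proof -
  have "norm (F (z + h) x - F z x - h * deriv (\<lambda>z. F z x) z) <= 18 * g x * (norm h)^2 / r^2"
   by (rule Cauchy_quadratic[OF Fz[OF x] r(1)]) (use bz x h in auto)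
  also have "... = (g x * (norm h)^2) * (18 / r^2)" by simp
  also have "... <= (g x * (norm h)^2) * C" using C(2) g0[OF x] by (intro mult_left_mono) auto
  finally show ?thesis unfolding dF[OF x] by (simp add: mult_ac)
 qed
 have 7: "linear (\<lambda>h. F' z x * h)" for x
  by (intro bounded_linear.linear bounded_linear_mult_right)
 from has_derivative_integral_quadratic(1)[where L="\<lambda>x h. F' z x * h" and z=z and F=F, OF 1 2 3 4 7 5 6]
 have "((\<lambda>z. (LINT x|M. F z x)) has_derivative (\<lambda>h. (LINT x|M. F' z x) * h)) (at z)" by simp
 thus ?thesis unfolding has_field_derivative_def .
qed

section \<open>Derivatives of holomorphic functions are holomorphic\<close>

lemma holo_on_locally:
 assumes "!!z. z \<in> S ==> \<exists>r>0. holo_on (ball z r) f"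
 shows "holo_on S f"
 using assms unfolding holo_on_def by (meson centre_in_ball)

lemma holo_locally_bounded:
 assumes f: "holo_on S f" "open S" and "z \<in> S"
 obtains r M where "r > 0" "ball z r \<subseteq> S" "!!w. w \<in> ball z r ==> norm (f w) <= M"
proof -
 obtain r where r: "r > 0" "cball z r \<subseteq> S" using assms open_contains_cball by blast
 have "compact (f ` cball z r)"
  by (rule compact_continuous_image[OF continuous_on_subset[OF holo_continuous_on[OF f(1)] r(2)]]) simp
 hence "bounded (f ` cball z r)" by (rule compact_imp_bounded)
 then obtain M where "!!y. y \<in> f ` cball z r ==> norm y <= M"
  unfolding bounded_iff by auto
 note M = this
 show thesis
 proof (rule that[OF r(1)])
  show "ball z r \<subseteq> S" using r(2) ball_subset_cball by blast
  show "norm (f w) <= M" if "w \<in> ball z r" for w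
   by (rule M) (use that ball_subset_cball in blast)
 qed
qed

text \<open>Difference quotients with real steps are holomorphic and, by the Lipschitz estimate,
  uniformly bounded near each point; their pointwise limit is the derivative, so
  \<open>holo_pointwise_limit\<close> applies.\<close>

lemma holo_dir:
 assumes f: "holo_on S f" "open S"
 shows "holo_on S (dir v f)"
proof (rule holo_on_locally)
 fix z assume "z \<in> S"
 then obtain r0 M where r0: "r0 > 0" "ball z r0 \<subseteq> S" "!!w. w \<in> ball z r0 ==> norm (f w) <= M"
  using holo_locally_bounded[OF f] by metis
 \<comment> \<open>A third of the radius, because the Lipschitz estimate at a point within
   \<open>r\<close> of \<open>z\<close> uses a ball of radius \<open>2 * r\<close> around that
   point.\<close>
 define r where "r = r0 / 3"
 have r: "r > 0" using r0 by (simp add: r_def)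
 have nv: "norm v + 1 > 0" by (simp add: add_nonneg_pos)
 define e where "e = r / (norm v + 1)"
 have e: "e > 0" "e * (norm v + 1) = r" using r nv by (simp_all add: e_def)
 define t where "t i = e / real (Suc i)" for i
 have t: "t i > 0" "t i <= e" for i using e by (auto simp: t_def divide_le_eq)
 have tv: "norm (of_real (t i) *s v) < r" for i
 proof -
  have "t i * norm v <= e * norm v" using t by (intro mult_right_mono) auto
  also have "... < r" using e by (simp add: distrib_left)
  finally show ?thesis using t[of i] by (simp add: norm_vsmult)
 qed
 have sub: "ball w (2 * r) \<subseteq> ball z r0" if "w \<in> ball z r" for w
 proof
  fix y assume "y \<in> ball w (2 * r)"
  thus "y \<in> ball z r0" using dist_triangle[of z y w] that by (auto simp: r_def)
 qed
 have zr: "ball z r \<subseteq> S" using r0 by (auto simp: r_def)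
 define q where "q i w = (f (w + of_real (t i) *s v) - f w) / of_real (t i)" for i w
 have in1: "w + of_real (t i) *s v \<in> ball w r" for w i using tv[of i] by (simp add: dist_norm)
 have "holo_on (ball z r) (dir v f)"
 proof (rule holo_pointwise_limit[where f=q and M="2 * M / r * norm v"])
  fix i
  have "holo_on (ball z r) (\<lambda>w. f (of_real (t i) *s v + 1 *s w))"
  proof (rule holo_affine(1)[OF f(1)])
   fix w assume w: "w \<in> ball z r"
   have "w + of_real (t i) *s v \<in> ball w (2 * r)" using in1[of w i] r by simp
   hence "w + of_real (t i) *s v \<in> S" using sub[OF w] r0(2) by blast
   thus "of_real (t i) *s v + 1 *s w \<in> S" by (simp add: add.commute)
  qed
  hence "holo_on (ball z r) (\<lambda>w. (1 / of_real (t i)) * (f (of_real (t i) *s v + 1 *s w) - f w))"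
   by (intro holo_cmul holo_diff holo_on_subset[OF f(1) zr])
  thus "holo_on (ball z r) (q i)" by (simp add: q_def[abs_def] add.commute)
  fix w assume w: "w \<in> ball z r"
  have fw: "holo_on (ball w (2 * r)) f" using holo_on_subset[OF f(1)] sub[OF w] r0(2) by blast
  have "norm (f (w + of_real (t i) *s v) - f w) <= 2 * M / r * norm (w + of_real (t i) *s v - w)"
   by (rule holo_local_lipschitz[OF fw r _ in1]) (use sub[OF w] r0(3) in blast)
  thus "norm (q i w) <= 2 * M / r * norm v"
   using t(1)[of i] by (simp add: q_def norm_divide norm_vsmult pos_divide_le_eq mult_ac)
 next
  fix w assume w: "w \<in> ball z r"
  show "(\<lambda>i. q i w) \<longlonglongrightarrow> dir v f w"
   unfolding q_def t_def by (rule dir_LIMSEQ[OF f(1)]) (use zr w e in auto)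
 qed
 with r show "\<exists>r>0. holo_on (ball z r) (dir v f)" by blast
qed


section \<open>Integration over the ball\<close>

abbreviation lball :: "(complex^'n) measure" where
 "lball \<equiv> restrict_space lborel (ball 0 1)"

definition rho :: "complex^'n => real" where
 "rho z = 1 - (norm z)^2"

abbreviation bmeas :: "(complex^'n => 'b::topological_space) => bool" where
 "bmeas f \<equiv> f \<in> borel_measurable lball"

abbreviation bint :: "(complex^'n => real) => ennreal" where
 "bint f \<equiv> \<integral>\<^sup>+w. ennreal (f w) \<partial>lball"

lemma space_lball [simp]: "space lball = ball 0 1"
 by (simp add: space_restrict_space)

lemma bint_mono: "(!!w. norm w < 1 ==> F w <= G w) ==> bint F <= bint G"
 by (intro nn_integral_mono ennreal_leI) simp

lemma bint_cmult: "c >= 0 ==> bmeas F ==> bint (\<lambda>w. c * F w) = ennreal c * bint F"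
 by (simp add: ennreal_mult' nn_integral_cmult)

lemma bint_lincomb:
 "x >= 0 ==> y >= 0 ==> bmeas F ==> bmeas G ==> (!!w. F w >= 0) ==> (!!w. G w >= 0) ==>
 bint (\<lambda>w. x * F w + y * G w) = ennreal x * bint F + ennreal y * bint G"
 by (simp add: ennreal_plus[OF mult_nonneg_nonneg mult_nonneg_nonneg] ennreal_mult' nn_integral_add nn_integral_cmult)

lemma rho_pos: "norm z < 1 ==> rho z > 0"
 unfolding rho_def using power_strict_mono[of "norm z" 1 2] by simp

lemma rho_le_1: "rho z <= 1"
 by (simp add: rho_def)

lemma rho_le_0: "norm z >= 1 ==> rho z <= 0"
 unfolding rho_def using power_mono[of 1 "norm z" 2] by simp

lemma continuous_on_rho [continuous_intros]:
 "continuous_on S f ==> continuous_on S (\<lambda>x. rho (f x))"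
 unfolding rho_def by (intro continuous_intros)

lemma measurable_rho [measurable]: "rho \<in> borel_measurable borel"
 by (rule borel_measurable_continuous_onI) (intro continuous_intros)

lemma measurable_lball_borel:
 fixes f :: "complex^'n => 'b::topological_space"
 shows "f \<in> borel_measurable borel ==> bmeas f"
 by (rule measurable_restrict_space1) simp

lemma measurable_lball:
 fixes f :: "complex^'n => 'b::topological_space"
 assumes "continuous_on (ball 0 1) f"
 shows "bmeas f"
proof -
 have "f \<in> borel_measurable (restrict_space borel (ball 0 1))"
  by (rule borel_measurable_continuous_on_restrict[OF assms])
 moreover have "sets (restrict_space borel (ball 0 1)) = sets (lball :: (complex^'n) measure)"
  by (rule sets_restrict_space_cong) simp
 ultimately show ?thesis using measurable_cong_sets by blast
qed

lemma finite_measure_lball: "finite_measure (lball :: (complex^'n) measure)"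
proof (rule finite_measureI)
 have "emeasure (lball :: (complex^'n) measure) (ball 0 1) = emeasure lborel (ball (0::complex^'n) 1)"
  by (subst emeasure_restrict_space) auto
 thus "emeasure (lball :: (complex^'n) measure) (space lball) ~= \<infinity>"
  using emeasure_lborel_ball_finite[of "0::complex^'n" 1] by simp
qed

lemma measurable_rho_powr: "bmeas (\<lambda>w. rho w powr t)"
 by (rule measurable_lball_borel) measurable

section \<open>Integration by parts on the ball\<close>

lemma integral_lball:
 fixes f :: "'n::finite cfun"
 shows "(LINT w|lball. f w) = (LINT w|lborel. indicator (ball 0 1) w *\<^sub>R f w)"
 by (subst integral_restrict_space) auto

text \<open>Translation invariance makes the integral of each difference quotient vanish. The mean
  value inequality bounds the quotients by \<open>K\<close>, the support keeps them in a fixed ball,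
  and dominated convergence yields the integral of the derivative.\<close>

lemma integral_directional_derivative:
 fixes u u' :: "'a::euclidean_space => complex"
 assumes D: "!!w. ((\<lambda>t::real. u (w + t *\<^sub>R e)) has_vector_derivative u' w) (at 0)"
  and cont: "continuous_on UNIV u" and K: "!!w. norm (u' w) <= K"
  and supp: "!!w. norm w >= 1 ==> u w = 0"
 shows "(LINT w|lborel. u' w) = 0"
proof -
 have K0: "K >= 0" using K norm_ge_zero order_trans by blast
 define t where "t i = 1 / real (Suc i)" for i
 have t: "t i > 0" "t i <= 1" for i by (auto simp: t_def)
 have t0: "t \<longlonglongrightarrow> 0" unfolding t_def by (rule LIMSEQ_Suc[OF lim_1_over_n])
 define q where "q i w = (1 / t i) *\<^sub>R (u (w + t i *\<^sub>R e) - u w)" for i w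
 have D': "((\<lambda>t::real. u (w + t *\<^sub>R e)) has_vector_derivative u' (w + s *\<^sub>R e)) (at s)" for w s
 proof -
  have 1: "((\<lambda>r. r - s) has_vector_derivative 1) (at s)"
   by (auto intro!: derivative_eq_intros simp: has_real_derivative_iff_has_vector_derivative[symmetric])
  have "((\<lambda>t. u ((w + s *\<^sub>R e) + t *\<^sub>R e)) \<circ> (\<lambda>r. r - s) has_vector_derivative 1 *\<^sub>R u' (w + s *\<^sub>R e)) (at s)"
   by (rule vector_diff_chain_at[OF 1]) (simp add: D)
  thus ?thesis by (simp add: o_def algebra_simps)
 qed
 have mvt: "norm (u (w + s *\<^sub>R e) - u w) <= K * s" if "s >= 0" for w s
 proof -
  have "norm (u (w + s *\<^sub>R e) - u (w + 0 *\<^sub>R e)) <= K * norm (s - 0)"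
  proof (rule differentiable_bound[where S="UNIV" and f="\<lambda>s. u (w + s *\<^sub>R e)" and f'="\<lambda>s r. r *\<^sub>R u' (w + s *\<^sub>R e)"])
   show "((\<lambda>s. u (w + s *\<^sub>R e)) has_derivative (\<lambda>r. r *\<^sub>R u' (w + s *\<^sub>R e))) (at s within UNIV)" for s
    using D'[of w s] by (simp add: has_vector_derivative_def)
   show "onorm (\<lambda>r. r *\<^sub>R u' (w + s *\<^sub>R e)) <= K" for s
    by (rule onorm_le) (simp add: mult.commute[of K] mult_left_mono K)
  qed auto
  thus ?thesis using that by simp
 qed
 have iu: "integrable lborel u"
 proof -
  have "compact (u ` cball 0 1)"
   by (rule compact_continuous_image[OF continuous_on_subset[OF cont]]) auto
  hence "bounded (u ` cball 0 1)" by (rule compact_imp_bounded)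
  then obtain M where M: "!!y. y \<in> u ` cball 0 1 ==> norm y <= M" unfolding bounded_iff by auto
  have um: "u \<in> borel_measurable lborel"
   using borel_measurable_continuous_onI[OF cont] by simp
  have "integrable lborel (\<lambda>w::'a. indicator (cball 0 1) w *\<^sub>R \<bar>M\<bar>)"
   using emeasure_lborel_cball_finite[of "0::'a"] by (intro integrable_indicator) auto
  thus ?thesis
  proof (rule Bochner_Integration.integrable_bound[OF _ um], intro AE_I2)
   fix w
   show "norm (u w) <= norm (indicator (cball 0 1) w *\<^sub>R \<bar>M\<bar>)"
    using supp[of w] M[of "u w"] by (cases "norm w <= 1") (auto simp: indicator_def)
  qed
 qed
 have iut: "integrable lborel (\<lambda>w. u (w + c))" "(LINT w|lborel. u (w + c)) = (LINT w|lborel. u w)" for c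
 proof -
  have um: "u \<in> borel_measurable borel"
   using borel_measurable_continuous_onI[OF cont] by simp
  have "distr lborel borel ((+) c) = lborel" by (rule lborel_distr_plus)
  hence "integrable (distr lborel borel ((+) c)) u" "integral\<^sup>L (distr lborel borel ((+) c)) u = integral\<^sup>L lborel u"
   using iu by simp_all
  thus "integrable lborel (\<lambda>w. u (w + c))" "(LINT w|lborel. u (w + c)) = (LINT w|lborel. u w)"
   using um by (simp_all add: integrable_distr_eq integral_distr add.commute)
 qed
 have q0: "(LINT w|lborel. q i w) = 0" for i
  unfolding q_def using iut iu by simp
 have "(\<lambda>i. (LINT w|lborel. q i w)) \<longlonglongrightarrow> (LINT w|lborel. u' w)"
 \<comment> \<open>Steps are at most 1, so for \<open>norm w > 1 + norm e\<close> neither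
   \<open>w\<close> nor the shifted point meets the open unit ball and the quotient is 0.\<close>
 proof (rule integral_dominated_convergence[where w="\<lambda>w. indicator (cball 0 (1 + norm e)) w *\<^sub>R K"])
  have um: "u \<in> borel_measurable borel"
   using borel_measurable_continuous_onI[OF cont] by simp
  show qm: "q i \<in> borel_measurable lborel" for i
   unfolding q_def using um by measurable
  have qlim: "(\<lambda>i. q i w) \<longlonglongrightarrow> u' w" for w
  proof -
   have "((\<lambda>h. (1 / h) *\<^sub>R (u (w + h *\<^sub>R e) - u w)) \<longlongrightarrow> u' w) (at 0)"
   proof -
    have "((\<lambda>h. (u (w + h *\<^sub>R e) - u w - h *\<^sub>R u' w) /\<^sub>R \<bar>h\<bar>) \<longlongrightarrow> 0) (at 0)"
     using D[of w] unfolding has_vector_derivative_def has_derivative_at2 by (simp add: field_simps)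
    hence "((\<lambda>h. norm ((1 / h) *\<^sub>R (u (w + h *\<^sub>R e) - u w) - u' w)) \<longlongrightarrow> 0) (at 0)"
    proof (rule Lim_transform_eventually[OF tendsto_norm_zero])
     show "\<forall>\<^sub>F h in at 0. norm ((u (w + h *\<^sub>R e) - u w - h *\<^sub>R u' w) /\<^sub>R \<bar>h\<bar>) = norm ((1 / h) *\<^sub>R (u (w + h *\<^sub>R e) - u w) - u' w)"
      unfolding eventually_at
     proof (intro exI[of _ 1] conjI ballI impI, simp)
      fix h :: real assume "h ~= 0 \<and> dist h 0 < 1"
      hence h: "h ~= 0" by simp
      have "(1 / h) *\<^sub>R (u (w + h *\<^sub>R e) - u w) - u' w = (1 / h) *\<^sub>R (u (w + h *\<^sub>R e) - u w - h *\<^sub>R u' w)"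
       using h by (simp add: scaleR_diff_right)
      thus "norm ((u (w + h *\<^sub>R e) - u w - h *\<^sub>R u' w) /\<^sub>R \<bar>h\<bar>) = norm ((1 / h) *\<^sub>R (u (w + h *\<^sub>R e) - u w) - u' w)"
       by (simp add: divide_inverse)
     qed
    qed
    thus ?thesis using Lim_null tendsto_norm_zero_iff by blast
   qed
   moreover have "filterlim t (at 0) sequentially"
    using t0 t by (auto simp: filterlim_at less_imp_neq[symmetric])
   ultimately show ?thesis unfolding q_def using filterlim_compose by blast
  qed
  show "u' \<in> borel_measurable lborel"
   by (rule borel_measurable_LIMSEQ_metric[OF qm qlim])
  show "integrable lborel (\<lambda>w::'a. indicator (cball 0 (1 + norm e)) w *\<^sub>R K :: real)"
   using emeasure_lborel_cball_finite[of "0::'a"] by (intro integrable_indicator) auto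
  show "AE w in lborel. (\<lambda>i. q i w) \<longlonglongrightarrow> u' w" using qlim by simp
  show "AE w in lborel. norm (q i w) <= indicator (cball 0 (1 + norm e)) w *\<^sub>R K" for i
  proof (intro AE_I2)
   fix w :: 'a
   show "norm (q i w) <= indicator (cball 0 (1 + norm e)) w *\<^sub>R K"
   proof (cases "norm w <= 1 + norm e")
    case True
    have "norm (q i w) = norm (u (w + t i *\<^sub>R e) - u w) / t i"
     using t[of i] by (simp add: q_def divide_inverse mult.commute)
    also have "... <= K" using mvt[of "t i" w] t[of i] by (simp add: divide_le_eq)
    finally show ?thesis using True by simp
   next
    case False
    have "norm (t i *\<^sub>R e) <= 1 * norm e" using t[of i] unfolding norm_scaleR by (intro mult_right_mono) auto
    hence "norm (w + t i *\<^sub>R e) >= 1" using False norm_triangle_ineq4[of "w + t i *\<^sub>R e" "t i *\<^sub>R e"] by simp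
    moreover have "norm w >= 1" using False norm_ge_zero[of e] by linarith
    ultimately show ?thesis using supp False by (simp add: q_def)
   qed
  qed
 qed
 thus ?thesis by (simp add: q0 LIMSEQ_const_iff)
qed

text \<open>Squaring makes the positive part differentiable across 0; the cut-off of the weight near
  the sphere is built from it.\<close>

lemma DERIV_pos_sq: "((\<lambda>y::real. (max 0 y)^2) has_field_derivative 2 * max 0 y) (at y)"
proof (cases "y = 0")
 case True
 have "((\<lambda>y::real. (max 0 y)^2) has_derivative (\<lambda>h. 0)) (at 0)"
  by (rule has_derivative_quadratic[where r=1 and C=1]) (auto simp: max_def)
 moreover have "(*) (0::real) = (\<lambda>h. 0)" by auto
 ultimately show ?thesis using True by (simp add: has_field_derivative_def)
next
 case False
 then consider "y > 0" | "y < 0" by linarith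
 thus ?thesis
 proof cases
  case 1
  have "((\<lambda>y::real. y^2) has_field_derivative 2 * max 0 y) (at y)"
   using 1 by (auto intro!: derivative_eq_intros)
  thus ?thesis
   by (rule has_field_derivative_transform_within_open[where S="{0<..}"]) (use 1 in auto)
 next
  case 2
  have "((\<lambda>y::real. 0) has_field_derivative 2 * max 0 y) (at y)"
   using 2 by (auto intro!: derivative_eq_intros)
  thus ?thesis
   by (rule has_field_derivative_transform_within_open[where S="{..<0}"]) (use 2 in auto)
 qed
qed

lemma DERIV_rho: "((\<lambda>s::real. rho (w + s *\<^sub>R e)) has_field_derivative - 2 * Re (cdot e w)) (at 0)"
proof -
 have "rho (w + s *\<^sub>R e) = rho w - s^2 * (norm e)^2 - 2 * s * Re (cdot e w)" for s
 proof -
  have "Re (cdot w e) = Re (cdot e w)" by (metis cnj_cdot cnj.sel(1))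
  hence "Re (cdot w (s *\<^sub>R e)) = s * Re (cdot e w)" by (simp add: scaleR_eq_vsmult)
  thus ?thesis
   unfolding rho_def norm_add_sq by (simp add: power_mult_distrib)
 qed
 hence "(\<lambda>s::real. rho (w + s *\<^sub>R e)) = (\<lambda>s. rho w - s^2 * (norm e)^2 - 2 * s * Re (cdot e w))" by blast
 thus ?thesis by (auto intro!: derivative_eq_intros)
qed

lemma holo_vector_derivative:
 assumes "holo_on S f" "w \<in> S"
 shows "((\<lambda>s::real. f (w + s *\<^sub>R e)) has_vector_derivative dir e f w) (at 0)"
proof -
 have "((\<lambda>t. f (w + t *s e)) has_field_derivative dir e f w) (at (of_real 0))"
  using slice_holo_DERIV[OF assms(1), of w 0 e] assms(2) by simp
 moreover have "((of_real :: real => complex) has_vector_derivative 1) (at 0)"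
  unfolding has_vector_derivative_def of_real_def
  by (rule bounded_linear_imp_has_derivative, rule bounded_linear_scaleR_left)
 ultimately have "((\<lambda>t. f (w + t *s e)) \<circ> of_real has_vector_derivative 1 * dir e f w) (at 0)"
  using field_vector_diff_chain_at by blast
 thus ?thesis by (simp add: o_def scaleR_eq_vsmult)
qed


lemma integrable_lball_bounded:
 fixes f :: "complex^'n => 'b::{banach, second_countable_topology}"
 assumes "bmeas f" "!!w. norm w < 1 ==> norm (f w) <= M"
 shows "integrable lball f"
 by (rule finite_measure.integrable_const_bound[OF finite_measure_lball, where B=M])
  (use assms in \<open>auto intro!: AE_I2\<close>)

lemma cont_cball_bound:
 fixes f :: "complex^'n => 'b::real_normed_vector"
 assumes "continuous_on (cball 0 1) f"
 obtains M where "M > 0" "!!w. norm w <= 1 ==> norm (f w) <= M"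
proof -
 have "compact (f ` cball 0 1)" by (rule compact_continuous_image[OF assms]) simp
 hence "bounded (f ` cball 0 1)" by (rule compact_imp_bounded)
 then obtain M where M: "!!y. y \<in> f ` cball 0 1 ==> norm y <= M" unfolding bounded_iff by auto
 show thesis
 proof (rule that[of "\<bar>M\<bar> + 1"])
  show "norm (f w) <= \<bar>M\<bar> + 1" if "norm w <= 1" for w using M[of "f w"] that by auto
 qed simp
qed

lemma integrable_lball_cont:
 fixes f :: "complex^'n => 'b::{banach, second_countable_topology}"
 assumes "continuous_on (cball 0 1) f"
 shows "integrable lball f"
proof -
 obtain M where "!!w. norm w <= 1 ==> norm (f w) <= M" using cont_cball_bound[OF assms] by metis
 thus ?thesis
  by (intro integrable_lball_bounded[where M=M] measurable_lball continuous_on_subset[OF assms]) auto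
qed

text \<open>Since \<open>\<psi>\<close> vanishes below \<open>\<epsilon>\<close>, the integrand
  extended by 0 is differentiable on the whole space with a bounded derivative, and no boundary term
  arises. Holomorphy of \<open>h\<close> and \<open>k\<close> beyond the closed ball supplies bounds
  up to the sphere.\<close>

lemma ibp_cutoff:
 fixes h k :: "'n::finite cfun"
 assumes h: "holo_on (ball 0 R) h" and k: "holo_on (ball 0 R) k" and R: "R > 1"
  and chi: "!!x. (\<psi> has_real_derivative \<psi>' x) (at x)" "continuous_on UNIV \<psi>'"
  and eps: "\<epsilon> > 0" "!!x. x <= \<epsilon> ==> \<psi> x = 0"
 shows "(LINT w|lball. of_real (\<psi>' (rho w)) * (cdot v w * h w * cnj (k w)))
   = (LINT w|lball. of_real (\<psi> (rho w)) * (dir v h w * cnj (k w)))"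
proof -
 have chi0: "\<psi>' x = 0" if "x < \<epsilon>" for x
 proof -
  have "((\<lambda>x. 0) has_real_derivative \<psi>' x) (at x)"
  proof (rule has_field_derivative_transform_within_open[OF chi(1)])
   show "open {..<\<epsilon>}" "x \<in> {..<\<epsilon>}" using that by auto
   show "\<psi> y = 0" if "y \<in> {..<\<epsilon>}" for y using that by (intro eps(2)) simp
  qed
  thus ?thesis by (rule DERIV_unique[OF _ DERIV_const])
 qed
 have cchi: "continuous_on UNIV \<psi>"
  by (intro continuous_at_imp_continuous_on ballI DERIV_isCont[OF chi(1)])
 have Dh: "holo_on (ball 0 R) (dir e h)" and Dk: "holo_on (ball 0 R) (dir e k)" for e
  using h k by (simp_all add: holo_dir)
 have sub: "cball 0 1 \<subseteq> ball (0::complex^'n) R" using R by auto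
 note c = continuous_on_subset[OF holo_continuous_on[OF h] sub] continuous_on_subset[OF holo_continuous_on[OF k] sub]
  continuous_on_subset[OF holo_continuous_on[OF Dh] sub] continuous_on_subset[OF holo_continuous_on[OF Dk] sub]
  continuous_on_compose2[OF chi(2)] continuous_on_compose2[OF cchi]
 define \<phi> where "\<phi> w = of_real (\<psi> (rho w)) * (h w * cnj (k w))" for w
 define \<phi>' where "\<phi>' e w = of_real (\<psi>' (rho w) * (- 2 * Re (cdot e w))) * (h w * cnj (k w))
  + of_real (\<psi> (rho w)) * (dir e h w * cnj (k w) + h w * cnj (dir e k w))" for e w
 define u where "u w = (if norm w < 1 then \<phi> w else 0)" for w
 define u' where "u' e w = (if norm w < 1 then \<phi>' e w else 0)" for e w
 have out: "\<psi> (rho w) = 0" "\<psi>' (rho w) = 0" if "\<not> norm w < 1" for w :: "complex^'n"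
  using rho_le_0[of w] that eps chi0[of "rho w"] by auto
 have u_eq: "u w = \<phi> w" "u' e w = \<phi>' e w" for w e
  by (auto simp: u_def u'_def \<phi>_def \<phi>'_def out)
 have Dphi: "((\<lambda>s::real. \<phi> (w + s *\<^sub>R e)) has_vector_derivative \<phi>' e w) (at 0)" if "w \<in> ball 0 R" for w e
 proof -
  have "((\<lambda>s::real. \<psi> (rho (w + s *\<^sub>R e))) has_field_derivative \<psi>' (rho w) * (- 2 * Re (cdot e w))) (at 0)"
   using DERIV_chain2[OF _ DERIV_rho, where f=\<psi>] chi(1)[of "rho w"] by simp
  hence 1: "((\<lambda>s::real. complex_of_real (\<psi> (rho (w + s *\<^sub>R e)))) has_vector_derivative of_real (\<psi>' (rho w) * (- 2 * Re (cdot e w)))) (at 0)"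
   by (intro has_vector_derivative_of_real) (simp add: has_real_derivative_iff_has_vector_derivative)
  note 2 = holo_vector_derivative[OF h that, of e]
  note 3 = bounded_linear.has_vector_derivative[OF bounded_linear_cnj holo_vector_derivative[OF k that, of e]]
  have "((\<lambda>s::real. \<phi> (w + s *\<^sub>R e)) has_vector_derivative
   of_real (\<psi> (rho (w + 0 *\<^sub>R e))) * (h (w + 0 *\<^sub>R e) * cnj (dir e k w) + dir e h w * cnj (k (w + 0 *\<^sub>R e)))
   + of_real (\<psi>' (rho w) * (- 2 * Re (cdot e w))) * (h (w + 0 *\<^sub>R e) * cnj (k (w + 0 *\<^sub>R e)))) (at 0)"
   unfolding \<phi>_def by (rule has_vector_derivative_mult[OF 1 has_vector_derivative_mult[OF 2 3]])
  thus ?thesis by (simp add: \<phi>'_def algebra_simps)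
 qed
 have D: "((\<lambda>s::real. u (w + s *\<^sub>R e)) has_vector_derivative u' e w) (at 0)" for w e
 proof (cases "norm w < R")
  case True
  thus ?thesis using Dphi[of w e] by (simp add: u_eq)
 next
  case False
  have "((\<lambda>s::real. (0::complex)) has_vector_derivative 0) (at 0)" by simp
  moreover have "open {s::real. 1 < norm (w + s *\<^sub>R e)}"
   by (intro open_Collect_less continuous_intros)
  ultimately have "((\<lambda>s::real. u (w + s *\<^sub>R e)) has_vector_derivative 0) (at 0)"
   by (rule has_vector_derivative_transform_within_open) (use False R in \<open>auto simp: u_def\<close>)
  thus ?thesis using False R by (simp add: u'_def)
 qed
 have cphi: "continuous_on (cball 0 1) (\<phi>' e)" for e
  unfolding \<phi>'_def by (intro continuous_intros c) auto
 have cu: "continuous_on UNIV u"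
 proof -
  have "continuous_on (ball 0 R) \<phi>"
   unfolding \<phi>_def by (intro continuous_intros holo_continuous_on[OF h] holo_continuous_on[OF k] c(6)) auto
  hence "continuous_on (ball 0 R) u" by (simp add: u_eq cong: continuous_on_cong)
  moreover have "continuous_on (- cball 0 1) u"
   by (rule continuous_on_eq[OF continuous_on_const[of _ 0]]) (auto simp: u_def)
  ultimately have "continuous_on (ball 0 R \<union> - cball 0 1) u"
   by (intro continuous_on_open_Un) auto
  moreover have "ball 0 R \<union> - cball 0 1 = (UNIV :: (complex^'n) set)" using R by auto
  ultimately show ?thesis by simp
 qed
 have z: "(LINT w|lball. \<phi>' e w) = 0" for e
 proof -
  obtain K where K: "K > 0" "!!w. norm w <= 1 ==> norm (\<phi>' e w) <= K" using cont_cball_bound[OF cphi] by metis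
  have "norm (u' e w) <= K" for w using K(1) K(2)[of w] by (auto simp: u'_def)
  from integral_directional_derivative[OF D cu this] have "(LINT w|lborel. u' e w) = 0" by (simp add: u_def)
  moreover have "u' e w = indicator (ball 0 1) w *\<^sub>R \<phi>' e w" for w
   by (auto simp: u'_def indicator_def)
  ultimately show ?thesis by (simp add: integral_lball)
 qed
 define F G where "F w = of_real (\<psi>' (rho w)) * (cdot v w * h w * cnj (k w))"
  and "G w = of_real (\<psi> (rho w)) * (dir v h w * cnj (k w))" for w
 have iF: "integrable lball F" and iG: "integrable lball G"
  unfolding F_def G_def by (intro integrable_lball_cont continuous_intros c; auto)+
 \<comment> \<open>This combination of the real derivatives along \<open>v\<close> and
   \<open>\<i> *s v\<close> is twice the Wirtinger derivative: the derivative of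
   \<open>cnj (k w)\<close> cancels, and real and imaginary part of \<open>cdot v w\<close>
   recombine.\<close>
 have "0 = (LINT w|lball. \<phi>' v w) - \<i> * (LINT w|lball. \<phi>' (\<i> *s v) w)" by (simp add: z)
 also have "... = (LINT w|lball. \<phi>' v w - \<i> * \<phi>' (\<i> *s v) w)"
  using integrable_lball_cont[OF cphi] by simp
 also have "... = (LINT w|lball. 2 * (G w - F w))"
 proof (rule Bochner_Integration.integral_cong[OF refl])
  fix w :: "complex^'n" assume "w \<in> space lball"
  hence w: "w \<in> ball 0 R" using R by auto
  have d: "dir (\<i> *s v) h w = \<i> * dir v h w" "dir (\<i> *s v) k w = \<i> * dir v k w"
   using dir_cmul[OF h w] dir_cmul[OF k w] by auto
  have "\<phi>' v w - \<i> * \<phi>' (\<i> *s v) w = - 2 * of_real (\<psi>' (rho w)) * (of_real (Re (cdot v w)) + \<i> * of_real (Im (cdot v w))) * (h w * cnj (k w)) + 2 * G w"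
   unfolding \<phi>'_def d G_def by (simp add: algebra_simps)
  also have "of_real (Re (cdot v w)) + \<i> * of_real (Im (cdot v w)) = cdot v w"
   by (metis complex_eq)
  finally show "\<phi>' v w - \<i> * \<phi>' (\<i> *s v) w = 2 * (G w - F w)"
   by (simp add: F_def algebra_simps)
 qed
 also have "... = 2 * ((LINT w|lball. G w) - (LINT w|lball. F w))"
  using iF iG by simp
 finally show ?thesis by (simp add: F_def G_def)
qed

text \<open>A continuously differentiable stand-in for \<open>x powr (t + 1)\<close> that vanishes
  for \<open>x <= \<epsilon>\<close>. For positive \<open>x\<close> the squared factor keeps its
  derivative below a constant times \<open>x powr t\<close>, uniformly in \<open>\<epsilon>\<close>,
  and nonnegative when \<open>t > -1\<close>.\<close>

definition cutoff :: "real => real => real => real" where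
 "cutoff t \<epsilon> x = x powr (t - 1) * (max 0 (x - \<epsilon>))^2"

definition cutoff' :: "real => real => real => real" where
 "cutoff' t \<epsilon> x = (t - 1) * x powr (t - 2) * (max 0 (x - \<epsilon>))^2 + x powr (t - 1) * (2 * max 0 (x - \<epsilon>))"

lemma cutoff_eq_0: "x <= \<epsilon> ==> cutoff t \<epsilon> x = 0"
 by (simp add: cutoff_def)

lemma cutoff_DERIV:
 assumes "\<epsilon> > 0"
 shows "(cutoff t \<epsilon> has_real_derivative cutoff' t \<epsilon> x) (at x)"
proof (cases "x > 0")
 case True
 have 1: "((\<lambda>x. x powr (t - 1)) has_real_derivative (t - 1) * x powr (t - 2)) (at x)"
  using has_real_derivative_powr[OF True, of "t - 1"] by (simp add: algebra_simps)
 have 2: "((\<lambda>x. (max 0 (x - \<epsilon>))^2) has_real_derivative 2 * max 0 (x - \<epsilon>)) (at x)"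
 proof -
  have "((\<lambda>x. x - \<epsilon>) has_real_derivative 1) (at x)" by (auto intro!: derivative_eq_intros)
  from DERIV_chain2[where f="\<lambda>y. (max 0 y)^2" and g="\<lambda>x. x - \<epsilon>", OF DERIV_pos_sq this]
  show ?thesis by simp
 qed
 show ?thesis
 proof -
  have "cutoff t \<epsilon> = (\<lambda>x. x powr (t - 1) * (max 0 (x - \<epsilon>))^2)" by (simp add: fun_eq_iff cutoff_def)
  thus ?thesis
   unfolding cutoff'_def using DERIV_mult[OF 1 2] by (simp add: algebra_simps)
 qed
next
 case False
 have "((\<lambda>_. 0) has_real_derivative 0) (at x)" by simp
 hence "(cutoff t \<epsilon> has_real_derivative 0) (at x)"
  by (rule has_field_derivative_transform_within_open[where S="{..<\<epsilon>}"]) (use False assms in \<open>auto simp: cutoff_def max_def\<close>)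
 thus ?thesis using False assms by (simp add: cutoff'_def max_def)
qed

lemma cutoff'_cont:
 assumes "\<epsilon> > 0"
 shows "continuous_on UNIV (cutoff' t \<epsilon>)"
proof -
 have 1: "continuous_on {0<..} (cutoff' t \<epsilon>)"
  unfolding cutoff'_def by (intro continuous_intros) auto
 have 2: "continuous_on {..<\<epsilon>} (cutoff' t \<epsilon>)"
  by (rule continuous_on_eq[OF continuous_on_const[of _ 0]]) (auto simp: cutoff'_def max_def)
 have "continuous_on ({0<..} \<union> {..<\<epsilon>}) (cutoff' t \<epsilon>)"
  by (rule continuous_on_open_Un[OF _ _ 1 2]) auto
 moreover have "{0<..} \<union> {..<\<epsilon>} = (UNIV::real set)" using assms by auto
 ultimately show ?thesis by simp
qed

lemma powr_shift:
 fixes x t :: real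
 assumes "x > 0"
 shows "x powr (t - 1) * x^2 = x powr (t + 1)" "x powr (t - 2) * x^2 = x powr t"
  "x powr (t - 1) * x = x powr t" "x powr (t - 2) * x = x powr (t - 1)" "x powr t * x = x powr (t + 1)"
 using assms powr_add[of x "t - 1" 2] powr_add[of x "t - 1" 1] powr_add[of x "t - 2" 1] powr_add[of x "t - 2" 2]
  powr_add[of x t 1]
 by (simp_all add: add.commute)

lemma cutoff_bounds:
 assumes "\<epsilon> > 0" "x > 0"
 shows "0 <= cutoff t \<epsilon> x" "cutoff t \<epsilon> x <= x powr (t + 1)" "t > -1 ==> 0 <= cutoff' t \<epsilon> x"
  "\<bar>cutoff' t \<epsilon> x\<bar> <= (\<bar>t - 1\<bar> + 2) * x powr t"
proof -
 define m where "m = max 0 (x - \<epsilon>)"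
 have m: "0 <= m" "m <= x" using assms by (auto simp: m_def)
 have e1: "x powr (t - 1) * x^2 = x powr (t + 1)"
  using assms by (simp add: powr_shift)
 have e2: "x powr (t - 2) * x^2 = x powr t" "x powr (t - 1) * x = x powr t" "x powr (t - 2) * x = x powr (t - 1)"
  using assms by (simp_all add: powr_shift)
 show "0 <= cutoff t \<epsilon> x" by (simp add: cutoff_def)
 have "x powr (t - 1) * m^2 <= x powr (t - 1) * x^2"
  using m by (intro mult_left_mono power_mono) auto
 thus "cutoff t \<epsilon> x <= x powr (t + 1)" by (simp add: cutoff_def m_def e1)
 have c: "cutoff' t \<epsilon> x = x powr (t - 2) * (m * ((t - 1) * m + 2 * x))"
  unfolding cutoff'_def m_def[symmetric] by (simp add: algebra_simps power2_eq_square e2(3)[symmetric])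
 show "0 <= cutoff' t \<epsilon> x" if "t > -1"
 proof -
  \<comment> \<open>Regrouped so that \<open>t > -1\<close> and \<open>m <= x\<close> show the sign
    although \<open>t - 1\<close> may be negative.\<close>
  have "(t - 1) * m + 2 * x = (t + 1) * m + 2 * (x - m)" by (simp add: algebra_simps)
  also have "... >= 0" using that m by simp
  finally show ?thesis unfolding c using m by simp
 qed
 have "\<bar>m * ((t - 1) * m + 2 * x)\<bar> = m * \<bar>(t - 1) * m + 2 * x\<bar>" using m by (simp add: abs_mult)
 also have "... <= x * ((\<bar>t - 1\<bar> + 2) * x)"
 proof (rule mult_mono)
  have "\<bar>(t - 1) * m + 2 * x\<bar> <= \<bar>t - 1\<bar> * m + 2 * x"
   using abs_triangle_ineq[of "(t - 1) * m" "2 * x"] m by (simp add: abs_mult)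
  also have "... <= \<bar>t - 1\<bar> * x + 2 * x" using m by (intro add_mono mult_left_mono) auto
  finally show "\<bar>(t - 1) * m + 2 * x\<bar> <= (\<bar>t - 1\<bar> + 2) * x" by (simp add: algebra_simps)
 qed (use m in auto)
 finally have "x powr (t - 2) * \<bar>m * ((t - 1) * m + 2 * x)\<bar> <= x powr (t - 2) * (x * ((\<bar>t - 1\<bar> + 2) * x))"
  by (intro mult_left_mono) auto
 also have "... = (\<bar>t - 1\<bar> + 2) * (x powr (t - 2) * x^2)" by (simp add: power2_eq_square)
 finally show "\<bar>cutoff' t \<epsilon> x\<bar> <= (\<bar>t - 1\<bar> + 2) * x powr t" unfolding c e2(1) by (simp add: abs_mult)
qed

lemma cutoff_tendsto:
 assumes "x > 0"
 shows "(\<lambda>i. cutoff t (1 / real (Suc i)) x) \<longlonglongrightarrow> x powr (t + 1)"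
  "(\<lambda>i. cutoff' t (1 / real (Suc i)) x) \<longlonglongrightarrow> (t + 1) * x powr t"
proof -
 have e1: "x powr (t - 1) * x^2 = x powr (t + 1)"
  using assms by (simp add: powr_shift)
 have e2: "x powr (t - 2) * x^2 = x powr t" "x powr (t - 1) * x = x powr t"
  using assms by (simp_all add: powr_shift)
 have "(\<lambda>i. 1 / real (Suc i)) \<longlonglongrightarrow> 0" by (rule LIMSEQ_Suc[OF lim_1_over_n])
 hence m: "(\<lambda>i. max 0 (x - 1 / real (Suc i))) \<longlonglongrightarrow> max 0 (x - 0)"
  by (intro tendsto_intros)
 have "(\<lambda>i. cutoff t (1 / real (Suc i)) x) \<longlonglongrightarrow> x powr (t - 1) * (max 0 (x - 0))^2"
  unfolding cutoff_def by (intro tendsto_intros m)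
 thus "(\<lambda>i. cutoff t (1 / real (Suc i)) x) \<longlonglongrightarrow> x powr (t + 1)" using assms e1 by simp
 have "(\<lambda>i. cutoff' t (1 / real (Suc i)) x) \<longlonglongrightarrow> (t - 1) * x powr (t - 2) * (max 0 (x - 0))^2 + x powr (t - 1) * (2 * max 0 (x - 0))"
  unfolding cutoff'_def by (intro tendsto_intros m)
 also have "(t - 1) * x powr (t - 2) * (max 0 (x - 0))^2 + x powr (t - 1) * (2 * max 0 (x - 0)) = (t + 1) * x powr t"
 proof -
  have "(t - 1) * x powr (t - 2) * (max 0 (x - 0))^2 + x powr (t - 1) * (2 * max 0 (x - 0))
   = (t - 1) * (x powr (t - 2) * x^2) + 2 * (x powr (t - 1) * x)" using assms by simp
  thus ?thesis unfolding e2 by (simp add: algebra_simps)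
 qed
 finally show "(\<lambda>i. cutoff' t (1 / real (Suc i)) x) \<longlonglongrightarrow> (t + 1) * x powr t" .
qed

lemma nn_integral_limit_le:
 fixes f :: "nat => 'x => ennreal"
 assumes "!!i. f i \<in> borel_measurable M" "!!x. x \<in> space M ==> (\<lambda>i. f i x) \<longlonglongrightarrow> g x"
  and "!!i. (\<integral>\<^sup>+x. f i x \<partial>M) <= C"
 shows "(\<integral>\<^sup>+x. g x \<partial>M) <= C"
proof -
 have "(\<integral>\<^sup>+x. g x \<partial>M) = (\<integral>\<^sup>+x. liminf (\<lambda>i. f i x) \<partial>M)"
  by (intro nn_integral_cong) (simp add: lim_imp_Liminf[OF trivial_limit_sequentially assms(2)])
 also have "... <= liminf (\<lambda>i. \<integral>\<^sup>+x. f i x \<partial>M)"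
  by (rule nn_integral_liminf) (rule assms(1))
 also have "... <= liminf (\<lambda>i::nat. C)"
  by (rule Liminf_mono) (simp add: assms(3))
 finally show ?thesis by (simp add: Liminf_const)
qed

text \<open>Integration by parts with \<open>h w = w $ j\<close> bounds the integral of (t+1) rho^t
  |w_j|^2 by the volume, uniformly in the cut-off, which Fatou's lemma then removes. Summation over
  \<open>j\<close> gives rho^t |w|^2; this controls rho^t where |w| >= 1/2, while rho >= 3/4 on the
  smaller ball.\<close>

lemma integrable_rho_powr:
 assumes t: "t > -1"
 shows "integrable (lball :: (complex^'n) measure) (\<lambda>w. rho w powr t)"
proof -
 let ?B = "lball :: (complex^'n) measure"
 define V where "V = measure ?B (space ?B)"
 note mc = measurable_lball_borel[where 'n='n]
 have cm: "continuous_on UNIV (cutoff t \<epsilon>)" if "\<epsilon> > 0" for \<epsilon>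
  by (intro continuous_at_imp_continuous_on ballI DERIV_isCont[OF cutoff_DERIV[OF that]])
 have j: "bint (\<lambda>w. (t + 1) * rho w powr t * (norm (w $ j))^2) <= ennreal V" for j :: 'n
 proof (rule nn_integral_limit_le)
  define \<epsilon> where "\<epsilon> i = 1 / real (Suc i)" for i
  have e: "\<epsilon> i > 0" for i by (simp add: \<epsilon>_def)
  let ?f = "\<lambda>i w. cutoff' t (\<epsilon> i) (rho w) * (norm (w $ j))^2"
  have cf: "continuous_on A (?f i)" for A i
   by (intro continuous_intros continuous_on_compose2[OF cutoff'_cont[OF e]]) auto
  have cg: "continuous_on A (\<lambda>w::complex^'n. cutoff t (\<epsilon> i) (rho w))" for A i
   by (intro continuous_intros continuous_on_compose2[OF cm[OF e]]) auto
  show "bmeas (\<lambda>w. ennreal (?f i w))" for i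
   using measurable_lball[OF cf] by measurable
  show "(\<lambda>i. ennreal (?f i w)) \<longlonglongrightarrow> ennreal ((t + 1) * rho w powr t * (norm (w $ j))^2)"
   if "w \<in> space ?B" for w
   using cutoff_tendsto(2)[OF rho_pos[of w], of t] that unfolding \<epsilon>_def by (intro tendsto_ennrealI tendsto_intros) auto
  show "bint (\<lambda>w. ?f i w) <= ennreal V" for i
  proof -
   have "(LINT w|?B. complex_of_real (cutoff' t (\<epsilon> i) (rho w)) * (cdot (axis j 1) w * cdot w (axis j 1) * cnj 1))
    = (LINT w|?B. of_real (cutoff t (\<epsilon> i) (rho w)) * (dir (axis j 1) (\<lambda>w. cdot w (axis j 1)) w * cnj 1))"
    by (rule ibp_cutoff[where R=2 and \<epsilon>="\<epsilon> i"]) (auto intro: e cutoff_DERIV[OF e] cutoff'_cont[OF e] cutoff_eq_0)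
   moreover have "cdot (axis j 1) w * cdot w (axis j 1) = of_real ((norm (w $ j))^2)" for w :: "complex^'n"
    by (metis cdot_axis cnj_cdot complex_norm_square mult.commute)
   moreover have "cdot (axis j 1) (axis j (1::complex)) = 1" unfolding cdot_axis by (simp add: axis_def)
   ultimately have "complex_of_real (LINT w|?B. ?f i w) = of_real (LINT w|?B. cutoff t (\<epsilon> i) (rho w))"
    by (simp flip: of_real_power of_real_mult integral_complex_of_real)
   hence "(LINT w|?B. ?f i w) = (LINT w|?B. cutoff t (\<epsilon> i) (rho w))" using of_real_eq_iff by blast
   also have "... <= (LINT w|?B. 1)"
   proof (rule integral_mono)
    fix w :: "complex^'n" assume "w \<in> space ?B"
    hence "rho w > 0" using rho_pos by auto
    from cutoff_bounds(2)[OF e[of i] this, of t] have "cutoff t (\<epsilon> i) (rho w) <= rho w powr (t + 1)" .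
    also have "... <= 1" using \<open>rho w > 0\<close> rho_le_1[of w] t by (intro powr_le1) auto
    finally show "cutoff t (\<epsilon> i) (rho w) <= 1" .
   qed (auto intro!: integrable_lball_cont cg continuous_intros)
   finally have le: "(LINT w|?B. ?f i w) <= V" by (simp add: V_def)
   have "bint (\<lambda>w. ?f i w) = ennreal (LINT w|?B. ?f i w)"
   proof (rule nn_integral_eq_integral[OF integrable_lball_cont[OF cf]])
    show "AE w in ?B. 0 <= ?f i w"
     using cutoff_bounds(3)[OF e[of i] rho_pos t] by (intro AE_I2 mult_nonneg_nonneg) auto
   qed
   thus ?thesis using le by (simp add: ennreal_leI)
  qed
 qed
 have int_j: "integrable ?B (\<lambda>w. (t + 1) * rho w powr t * (norm (w $ j))^2)" for j
 proof (rule integrableI_bounded)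
  show "bmeas (\<lambda>w. (t + 1) * rho w powr t * (norm (w $ j))^2)"
  proof -
   have "bmeas (\<lambda>w::complex^'n. (norm (w $ j))^2)"
    by (intro measurable_lball continuous_intros)
   thus ?thesis using measurable_rho_powr[of t] by measurable
  qed
  have "bint (\<lambda>w. norm ((t + 1) * rho w powr t * (norm (w $ j))^2))
   = bint (\<lambda>w. (t + 1) * rho w powr t * (norm (w $ j))^2)"
   using t by (intro nn_integral_cong) (simp add: abs_mult)
  also have "... < \<infinity>" unfolding infinity_ennreal_def by (rule order_le_less_trans[OF j ennreal_less_top])
  finally show "bint (\<lambda>w. norm ((t + 1) * rho w powr t * (norm (w $ j))^2)) < \<infinity>" .
 qed
 have "integrable ?B (\<lambda>w. (\<Sum>j\<in>UNIV. (t + 1) * rho w powr t * (norm (w $ j))^2))"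
  by (intro Bochner_Integration.integrable_sum int_j)
 moreover have "(\<Sum>j\<in>UNIV. (t + 1) * rho w powr t * (norm (w $ j))^2) = (t + 1) * rho w powr t * (norm w)^2" for w :: "complex^'n"
  by (simp add: norm_vec_def L2_set_def sum_nonneg sum_distrib_left)
 ultimately have "integrable ?B (\<lambda>w. (t + 1) * rho w powr t * (norm w)^2)" by simp
 hence "integrable ?B (\<lambda>w. 4 / (t + 1) * ((t + 1) * rho w powr t * (norm w)^2) + (1 + (3/4) powr t))"
  using finite_measure.integrable_const[OF finite_measure_lball] by (intro Bochner_Integration.integrable_add integrable_mult_right) auto
 thus ?thesis
 proof (rule Bochner_Integration.integrable_bound[OF _ measurable_rho_powr], intro AE_I2)
  fix w :: "complex^'n" assume "w \<in> space ?B"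
  hence w: "norm w < 1" by simp
  have "rho w powr t <= 4 * (rho w powr t * (norm w)^2) + (1 + (3/4) powr t)"
  proof (cases "norm w >= 1/2")
   case True
   have "1/4 <= (norm w)^2" using power_mono[OF True, of 2] by (simp add: power_divide)
   hence "rho w powr t * (1/4) <= rho w powr t * (norm w)^2" by (intro mult_left_mono) auto
   hence "rho w powr t <= 4 * (rho w powr t * (norm w)^2)" by simp
   moreover have "(3/4::real) powr t >= 0" by simp
   ultimately show ?thesis by linarith
  next
   case False
   have "(norm w)^2 <= (1/2)^2" using False by (intro power_mono) auto
   hence r: "rho w >= 3/4" by (simp add: rho_def power_divide)
   have "rho w powr t <= 1 + (3/4) powr t"
   proof (cases "t >= 0")
    case True
    have "rho w powr t <= 1" using r rho_le_1[of w] True by (intro powr_le1) auto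
    thus ?thesis using powr_ge_zero[of "3/4" t] by linarith
   next
    case False
    have "rho w powr t <= (3/4) powr t" using r False by (intro powr_mono2') auto
    thus ?thesis by linarith
   qed
   moreover have "rho w powr t * (norm w)^2 >= 0" by simp
   ultimately show ?thesis by linarith
  qed
  moreover have "4 / (t + 1) * ((t + 1) * rho w powr t * (norm w)^2) = 4 * (rho w powr t * (norm w)^2)"
   using t by simp
  ultimately have "rho w powr t <= 4 / (t + 1) * ((t + 1) * rho w powr t * (norm w)^2) + (1 + (3/4) powr t)"
   by argo
  thus "norm (rho w powr t) <= norm (4 / (t + 1) * ((t + 1) * rho w powr t * (norm w)^2) + (1 + (3/4) powr t))"
   unfolding real_norm_def abs_of_nonneg[OF powr_ge_zero] by (rule order_trans[OF _ abs_ge_self])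
 qed
qed


lemma tendsto_real_ball_cutoff:
 fixes g :: "nat => real => real" and F :: "'n::finite cfun"
 assumes F: "continuous_on (cball 0 1) F" and t: "t > -1"
  and g: "!!i. continuous_on UNIV (g i)" "!!i x. 0 < x ==> x <= 1 ==> \<bar>g i x\<bar> <= C * x powr t"
   "!!x. 0 < x ==> (\<lambda>i. g i x) \<longlonglongrightarrow> l x"
  and l: "(\<lambda>w. l (rho w)) \<in> borel_measurable (lball :: (complex^'n) measure)"
 shows "(\<lambda>i. (LINT w|lball. of_real (g i (rho w)) * F w)) \<longlonglongrightarrow> (LINT w|lball. of_real (l (rho w)) * F w)"
proof -
 obtain M where M: "M > 0" "!!w. norm w <= 1 ==> norm (F w) <= M" using cont_cball_bound[OF F] by metis
 have Fm: "bmeas F" by (intro measurable_lball continuous_on_subset[OF F]) auto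
 show ?thesis
 proof (rule integral_dominated_convergence[where w="\<lambda>w. C * rho w powr t * M"])
  have "(\<lambda>w. complex_of_real (l (rho w))) \<in> borel_measurable (lball :: (complex^'n) measure)"
   using l by measurable
  thus "bmeas (\<lambda>w. of_real (l (rho w)) * F w)" using Fm by measurable
  have "(\<lambda>w. complex_of_real (g i (rho w))) \<in> borel_measurable (lball :: (complex^'n) measure)" for i
   by (intro measurable_lball continuous_intros continuous_on_compose2[OF g(1)]) auto
  thus "bmeas (\<lambda>w. of_real (g i (rho w)) * F w)" for i
   using Fm by measurable
  show "integrable (lball :: (complex^'n) measure) (\<lambda>w. C * rho w powr t * M)"
   by (intro integrable_mult_left integrable_mult_right integrable_rho_powr t)
  show "AE w in lball. (\<lambda>i. of_real (g i (rho w)) * F w) \<longlonglongrightarrow> of_real (l (rho w)) * F w"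
   by (intro AE_I2 tendsto_intros g(3) rho_pos) simp
  show "AE w in lball. norm (of_real (g i (rho w)) * F w) <= C * rho w powr t * M" for i
  proof (intro AE_I2)
   fix w :: "complex^'n" assume "w \<in> space lball"
   hence w: "norm w < 1" by simp
   have "norm (of_real (g i (rho w)) * F w) = \<bar>g i (rho w)\<bar> * norm (F w)" by (simp add: norm_mult)
   also have "... <= (C * rho w powr t) * M"
   proof (rule mult_mono)
    show "\<bar>g i (rho w)\<bar> <= C * rho w powr t" by (rule g(2)[OF rho_pos[OF w] rho_le_1])
    thus "0 <= C * rho w powr t" by linarith
   qed (use M w in auto)
   finally show "norm (of_real (g i (rho w)) * F w) <= C * rho w powr t * M" .
  qed
 qed
qed

text \<open>Integration by parts in the Wirtinger derivative \<open>\<partial>\<^sub>v\<close>, which annihilates the antiholomorphic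
 factor and maps \<open>rho\<^sup>t\<^sup>+\<^sup>1\<close> to \<open>- (t + 1) \<langle>v, w\<rangle> rho\<^sup>t\<close>.\<close>

lemma ball_ibp:
 fixes h k :: "'n::finite cfun"
 assumes h: "holo_on (ball 0 R) h" and k: "holo_on (ball 0 R) k" and R: "R > 1" and t: "t > -1"
 shows "of_real (t + 1) * (LINT w|lball. of_real (rho w powr t) * (cdot v w * h w * cnj (k w)))
   = (LINT w|lball. of_real (rho w powr (t + 1)) * (dir v h w * cnj (k w)))"
proof -
 define \<epsilon> where "\<epsilon> i = 1 / real (Suc i)" for i
 have e: "\<epsilon> i > 0" for i by (simp add: \<epsilon>_def)
 have sub: "cball 0 1 \<subseteq> ball (0::complex^'n) R" using R by auto
 have Dh: "holo_on (ball 0 R) (dir v h)" using h by (simp add: holo_dir)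
 note c = continuous_on_subset[OF holo_continuous_on[OF h] sub] continuous_on_subset[OF holo_continuous_on[OF k] sub]
  continuous_on_subset[OF holo_continuous_on[OF Dh] sub]
 define F G where "F w = cdot v w * h w * cnj (k w)" and "G w = dir v h w * cnj (k w)" for w
 have cF: "continuous_on (cball 0 1) F" and cG: "continuous_on (cball 0 1) G"
  unfolding F_def G_def by (intro continuous_intros c)+
 have "(\<lambda>i. (LINT w|lball. of_real (cutoff' t (\<epsilon> i) (rho w)) * F w)) \<longlonglongrightarrow> (LINT w|lball. of_real ((t + 1) * rho w powr t) * F w)"
 proof (rule tendsto_real_ball_cutoff[OF cF t, where C="\<bar>t - 1\<bar> + 2"])
  show "continuous_on UNIV (cutoff' t (\<epsilon> i))" for i by (rule cutoff'_cont[OF e])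
  show "\<bar>cutoff' t (\<epsilon> i) x\<bar> <= (\<bar>t - 1\<bar> + 2) * x powr t" if "0 < x" for i x
   by (rule cutoff_bounds(4)[OF e that])
  show "(\<lambda>i. cutoff' t (\<epsilon> i) x) \<longlonglongrightarrow> (t + 1) * x powr t" if "0 < x" for x
   unfolding \<epsilon>_def by (rule cutoff_tendsto(2)[OF that])
  show "(\<lambda>w. (t + 1) * rho w powr t) \<in> borel_measurable (lball :: (complex^'n) measure)"
   using measurable_rho_powr by measurable
 qed
 moreover have "(\<lambda>i. (LINT w|lball. of_real (cutoff t (\<epsilon> i) (rho w)) * G w)) \<longlonglongrightarrow> (LINT w|lball. of_real (rho w powr (t + 1)) * G w)"
 proof (rule tendsto_real_ball_cutoff[OF cG t, where C=1])
  show "continuous_on UNIV (cutoff t (\<epsilon> i))" for i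
   by (intro continuous_at_imp_continuous_on ballI DERIV_isCont[OF cutoff_DERIV[OF e]])
  show "\<bar>cutoff t (\<epsilon> i) x\<bar> <= 1 * x powr t" if "0 < x" "x <= 1" for i x
  proof -
   have "\<bar>cutoff t (\<epsilon> i) x\<bar> <= x powr (t + 1)" using cutoff_bounds(1,2)[OF e[of i] that(1)] by simp
   also have "... <= x powr t" using that by (intro powr_mono') auto
   finally show ?thesis by simp
  qed
  show "(\<lambda>i. cutoff t (\<epsilon> i) x) \<longlonglongrightarrow> x powr (t + 1)" if "0 < x" for x
   unfolding \<epsilon>_def by (rule cutoff_tendsto(1)[OF that])
  show "(\<lambda>w. rho w powr (t + 1)) \<in> borel_measurable (lball :: (complex^'n) measure)"
   by (rule measurable_rho_powr)
 qed
 moreover have "(LINT w|lball. of_real (cutoff' t (\<epsilon> i) (rho w)) * F w) = (LINT w|lball. of_real (cutoff t (\<epsilon> i) (rho w)) * G w)" for i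
  unfolding F_def G_def
  by (rule ibp_cutoff[OF h k R, where \<epsilon>="\<epsilon> i"]) (auto intro: e cutoff_DERIV[OF e] cutoff'_cont[OF e] cutoff_eq_0)
 ultimately have "(LINT w|lball. of_real ((t + 1) * rho w powr t) * F w) = (LINT w|lball. of_real (rho w powr (t + 1)) * G w)"
  using LIMSEQ_unique by simp
 moreover have "(LINT w|lball. of_real ((t + 1) * rho w powr t) * F w) = of_real (t + 1) * (LINT w|lball. of_real (rho w powr t) * F w)"
  by (subst integral_mult_right_zero[symmetric]) (simp only: of_real_mult mult.assoc)
 ultimately show ?thesis by (simp add: F_def G_def)
qed

section \<open>Masses of the weights and the mean value property\<close>

definition bmass :: "'n::finite itself => real => real" where
 "bmass _ t = (LINT w|(lball :: (complex^'n) measure). rho w powr t)"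

lemma emeasure_lball_pos: "emeasure (lball :: (complex^'n) measure) (space lball) ~= 0"
proof
 assume "emeasure (lball :: (complex^'n) measure) (space lball) = 0"
 hence "emeasure lborel (ball (0::complex^'n) 1) = 0"
  by (subst (asm) emeasure_restrict_space) auto
 hence "ball (0::complex^'n) 1 \<in> null_sets lborel" by auto
 hence "ball (0::complex^'n) 1 \<in> null_sets (completion lborel)" by (rule null_sets_completionI)
 hence "negligible (ball (0::complex^'n) 1)" by (simp add: negligible_iff_null_sets)
 moreover have "\<not> negligible (ball (0::complex^'n) 1)" by (rule open_not_negligible) auto
 ultimately show False by contradiction
qed

lemma integral_lball_pos:
 fixes f :: "complex^'n => real"
 assumes "integrable lball f" "!!w. norm w < 1 ==> f w > 0"
 shows "(LINT w|lball. f w) > 0"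
proof -
 have "(LINT w|lball. f w) ~= 0"
 proof
  assume "(LINT w|lball. f w) = 0"
  hence "AE w in lball. f w = 0"
   by (subst (asm) integral_nonneg_eq_0_iff_AE[OF assms(1)]) (use assms(2) in \<open>auto intro!: AE_I2 less_imp_le\<close>)
  moreover have "AE w in lball. f w ~= 0" by (rule AE_I2) (use assms(2) in force)
  ultimately have "AE w in (lball :: (complex^'n) measure). False" by eventually_elim simp
  then obtain N where N: "{w \<in> space lball. \<not> False} \<subseteq> N" "emeasure (lball :: (complex^'n) measure) N = 0" "N \<in> sets lball"
   by (rule AE_E)
  hence "N = space lball" using sets.sets_into_space by blast
  with N(2) emeasure_lball_pos[where 'n='n] show False by simp
 qed
 moreover have "(LINT w|lball. f w) >= 0"
  by (rule integral_nonneg_AE) (use assms(2) in \<open>auto intro!: AE_I2 less_imp_le\<close>)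
 ultimately show ?thesis by linarith
qed

lemma bmass_pos: "t > -1 ==> bmass TYPE('n::finite) t > 0"
 unfolding bmass_def by (rule integral_lball_pos[OF integrable_rho_powr]) (auto dest: rho_pos)

text \<open>Integration by parts with \<open>h w = w $ j\<close>, summed over \<open>j\<close>, and
  |w|^2 = 1 - rho. This functional equation of the Beta integral stands in for an explicit value of
  the mass in the proof of the reproducing formula.\<close>

lemma bmass_rec:
 assumes t: "t > -1"
 shows "(real CARD('n::finite) + 1 + t) * bmass TYPE('n) (t + 1) = (t + 1) * bmass TYPE('n) t"
proof -
 let ?B = "lball :: (complex^'n) measure"
 have cr: "complex_of_real ((t + 1) * (LINT w|?B. rho w powr t * (norm (w $ j))^2)) = of_real (LINT w|?B. rho w powr (t + 1))" for j
 proof -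
  have "of_real (t + 1) * (LINT w|?B. of_real (rho w powr t) * (cdot (axis j 1) w * cdot w (axis j 1) * cnj 1))
   = (LINT w|?B. of_real (rho w powr (t + 1)) * (dir (axis j 1) (\<lambda>w. cdot w (axis j 1)) w * cnj 1))"
   by (rule ball_ibp[where R=2]) (use t in auto)
  moreover have "cdot (axis j 1) w * cdot w (axis j 1) = of_real ((norm (w $ j))^2)" for w :: "complex^'n"
   by (metis cdot_axis cnj_cdot complex_norm_square mult.commute)
  moreover have "cdot (axis j 1) (axis j (1::complex)) = 1" unfolding cdot_axis by (simp add: axis_def)
  ultimately have "of_real (t + 1) * (LINT w|?B. complex_of_real (rho w powr t * (norm (w $ j))^2)) = (LINT w|?B. complex_of_real (rho w powr (t + 1)))"
   by simp
  thus ?thesis by (simp only: integral_complex_of_real of_real_mult[symmetric])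
 qed
 have j: "(t + 1) * (LINT w|?B. rho w powr t * (norm (w $ j))^2) = bmass TYPE('n) (t + 1)" for j
  using cr[of j] of_real_eq_iff unfolding bmass_def by blast
 have ij: "integrable ?B (\<lambda>w. rho w powr t * (norm (w $ j))^2)" for j
 proof (rule Bochner_Integration.integrable_bound[OF integrable_rho_powr[OF t]])
  have "bmeas (\<lambda>w::complex^'n. (norm (w $ j))^2)"
   by (intro measurable_lball continuous_intros)
  thus "bmeas (\<lambda>w. rho w powr t * (norm (w $ j))^2)"
   using measurable_rho_powr[of t] by measurable
  show "AE w in ?B. norm (rho w powr t * (norm (w $ j))^2) <= norm (rho w powr t)"
  proof (intro AE_I2)
   fix w :: "complex^'n" assume "w \<in> space ?B"
   hence "norm (w $ j) <= 1" using Finite_Cartesian_Product.norm_nth_le[of w j] by simp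
   hence "(norm (w $ j))^2 <= 1" by (simp add: power_le_one)
   thus "norm (rho w powr t * (norm (w $ j))^2) <= norm (rho w powr t)"
    by (simp add: mult_left_le)
  qed
 qed
 have "real CARD('n) * bmass TYPE('n) (t + 1) = (\<Sum>j\<in>UNIV. (t + 1) * (LINT w|?B. rho w powr t * (norm (w $ (j::'n)))^2))"
  by (simp only: j) simp
 also have "... = (t + 1) * (LINT w|?B. (\<Sum>j\<in>UNIV. rho w powr t * (norm (w $ (j::'n)))^2))"
  unfolding Bochner_Integration.integral_sum[OF ij] sum_distrib_left by simp
 also have "(LINT w|?B. (\<Sum>j\<in>UNIV. rho w powr t * (norm (w $ (j::'n)))^2)) = (LINT w|?B. rho w powr t - rho w powr (t + 1))"
 proof (rule Bochner_Integration.integral_cong[OF refl])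
  fix w :: "complex^'n" assume "w \<in> space ?B"
  hence r: "rho w > 0" by (auto intro: rho_pos)
  have "(\<Sum>j\<in>UNIV. rho w powr t * (norm (w $ j))^2) = rho w powr t * (norm w)^2"
   by (simp add: norm_vec_def L2_set_def sum_nonneg sum_distrib_left)
  also have "(norm w)^2 = 1 - rho w" by (simp add: rho_def)
  also have "rho w powr t * (1 - rho w) = rho w powr t - rho w powr (t + 1)"
   using powr_shift(5)[OF r, of t] by (simp add: right_diff_distrib)
  finally show "(\<Sum>j\<in>UNIV. rho w powr t * (norm (w $ j))^2) = rho w powr t - rho w powr (t + 1)" .
 qed
 also have "... = bmass TYPE('n) t - bmass TYPE('n) (t + 1)"
  unfolding bmass_def using t by (intro Bochner_Integration.integral_diff integrable_rho_powr) auto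
 finally show ?thesis by (simp add: algebra_simps)
qed

text \<open>The weighted integral of \<open>h (x *s w)\<close> has, as a function of
  \<open>x\<close>, a derivative composed of terms \<open>w $ j\<close> times a derivative of
  \<open>h\<close>. Each of them is, up to conjugation, an integration by parts against the constant
  1 and vanishes, so the values at \<open>x = 1\<close> and \<open>x = 0\<close> agree.\<close>

lemma holo_ball_mean_value:
 fixes h :: "'n::finite cfun"
 assumes h: "holo_on (ball 0 R) h" and R: "R > 1" and t: "t > -1"
 shows "(LINT w|lball. of_real (rho w powr t) * h w) = of_real (bmass TYPE('n) t) * h 0"
proof -
 \<comment> \<open>Strictly between 1 and \<open>R\<close>: the parameter disc then contains
   \<open>x = 1\<close>, while for \<open>w\<close> in the ball all points \<open>x *s w\<close>
   stay in a compact part of the domain of \<open>h\<close>.\<close>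
 define R' where "R' = (1 + R) / 2"
 have R': "1 < R'" "R' < R" using R by (auto simp: R'_def)
 have "of_real R' *s w \<in> ball 0 R" if "w \<in> cball 0 1" for w :: "complex^'n"
 proof -
  have "R' * norm w <= R' * 1" using that R' by (intro mult_left_mono) auto
  hence "R' * norm w < R" using R' by linarith
  thus ?thesis using R' by (simp add: norm_vsmult)
 qed
 hence "continuous_on (cball 0 1) (\<lambda>w. h (of_real R' *s w))"
  by (intro continuous_on_compose2[OF holo_continuous_on[OF h]] linear_continuous_on bounded_linear_vsmult_right) auto
 then obtain M where M: "M > 0" "!!w. norm w <= 1 ==> norm (h (of_real R' *s w)) <= M"
  using cont_cball_bound by metis
 have in_R: "x *s w \<in> ball 0 R" if "norm x < R'" "norm w < R / R'" for x :: complex and w :: "complex^'n"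
 proof -
  have "norm x * norm w <= R' * norm w" using that by (intro mult_right_mono) auto
  also have "... < R' * (R / R')" using that R' by (intro mult_strict_left_mono) auto
  finally show ?thesis using R' by (simp add: norm_vsmult)
 qed
 have RR: "R / R' > 1" using R' by simp
 let ?F = "\<lambda>x w. of_real (rho w powr t) * h (x *s w)"
 let ?F' = "\<lambda>x w. of_real (rho w powr t) * (\<Sum>j\<in>UNIV. w $ j * dir (axis j 1) h (x *s w))"
 have hx: "holo_on (ball 0 (R/R')) (\<lambda>w. h (x *s w))" "holo_on (ball 0 (R/R')) (\<lambda>w. dir v h (x *s w))" if "norm x < R'" for x v
  using holo_affine(1)[OF h, of "ball 0 (R/R')" 0 x] holo_affine(1)[OF holo_dir[OF h], of "ball 0 (R/R')" 0 x v] in_R[OF that]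
  by auto
 have sub: "cball 0 1 \<subseteq> ball (0::complex^'n) (R/R')" using RR by auto
 have cx: "continuous_on (cball 0 1) (\<lambda>w. h (x *s w))" "continuous_on (cball 0 1) (\<lambda>w. dir v h (x *s w))" if "norm x < R'" for x v
  using holo_continuous_on[OF hx(1)[OF that]] holo_continuous_on[OF hx(2)[OF that]] continuous_on_subset[OF _ sub] by blast+
 have mr: "(\<lambda>w. complex_of_real (rho w powr t)) \<in> borel_measurable (lball :: (complex^'n) measure)"
  using measurable_rho_powr by measurable
 have z: "(LINT w|lball. ?F' x w) = 0" if x: "norm x < R'" for x
 proof -
  have ci: "continuous_on (cball 0 1) (\<lambda>w. w $ j * dir (axis j 1) h (x *s w))" for j
   by (intro continuous_intros cx x)
  have i: "integrable lball (\<lambda>w. of_real (rho w powr t) * (w $ j * dir (axis j 1) h (x *s w)))" for j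
  proof -
   obtain K where K: "K > 0" "!!w. norm w <= 1 ==> norm (w $ j * dir (axis j 1) h (x *s w)) <= K"
    using cont_cball_bound[OF ci[of j]] by metis
   have "integrable (lball :: (complex^'n) measure) (\<lambda>w. K * rho w powr t)" by (intro integrable_mult_left integrable_mult_right integrable_rho_powr t)
   thus ?thesis
   proof (rule Bochner_Integration.integrable_bound)
    have "bmeas (\<lambda>w. w $ j * dir (axis j 1) h (x *s w))"
     by (rule measurable_lball[OF continuous_on_subset[OF ci]]) auto
    thus "bmeas (\<lambda>w. of_real (rho w powr t) * (w $ j * dir (axis j 1) h (x *s w)))"
     using mr by measurable
    show "AE w in lball. norm (of_real (rho w powr t) * (w $ j * dir (axis j 1) h (x *s w))) <= norm (K * rho w powr t)"
    proof (intro AE_I2)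
     fix w :: "complex^'n" assume "w \<in> space lball"
     hence "norm (w $ j * dir (axis j 1) h (x *s w)) <= K" using K(2)[of w] by simp
     hence "rho w powr t * norm (w $ j * dir (axis j 1) h (x *s w)) <= rho w powr t * K"
      by (intro mult_left_mono) auto
     thus "norm (of_real (rho w powr t) * (w $ j * dir (axis j 1) h (x *s w))) <= norm (K * rho w powr t)"
      using K(1) by (simp only: norm_mult) (simp add: mult.commute)
    qed
   qed
  qed
  have "(LINT w|lball. of_real (rho w powr t) * (w $ j * dir (axis j 1) h (x *s w))) = 0" for j
  proof -
   have "of_real (t + 1) * (LINT w|lball. of_real (rho w powr t) * (cdot (axis j 1) w * 1 * cnj (dir (axis j 1) h (x *s w))))
    = (LINT w|lball. of_real (rho w powr (t + 1)) * (dir (axis j 1) (\<lambda>_. 1) w * cnj (dir (axis j 1) h (x *s w))))"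
    by (rule ball_ibp[OF holo_const hx(2)[OF x] RR t])
   hence "(LINT w|lball. of_real (rho w powr t) * (cdot (axis j 1) w * 1 * cnj (dir (axis j 1) h (x *s w)))) = 0"
    using t by (simp del: of_real_add)
   moreover have "(LINT w|lball. of_real (rho w powr t) * (w $ j * dir (axis j 1) h (x *s w)))
    = (LINT w|lball. cnj (of_real (rho w powr t) * (cdot (axis j 1) w * 1 * cnj (dir (axis j 1) h (x *s w)))))"
    by (intro Bochner_Integration.integral_cong) (simp_all add: cdot_axis)
   ultimately show ?thesis by (simp only: Bochner_Integration.integral_cnj complex_cnj_zero)
  qed
  thus ?thesis
   by (simp add: sum_distrib_left Bochner_Integration.integral_sum[OF i])
 qed
 have D: "((\<lambda>x. (LINT w|lball. ?F x w)) has_field_derivative 0) (at x)" if x: "x \<in> ball 0 R'" for x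
 proof -
  have "((\<lambda>x. (LINT w|lball. ?F x w)) has_field_derivative (LINT w|lball. ?F' x w)) (at x)"
  proof (rule DERIV_integral[where g="\<lambda>w. M * rho w powr t", OF _ _ _ _ _ x])
   show "((\<lambda>x. ?F x w) has_field_derivative ?F' x w) (at x)" if "w \<in> space lball" "x \<in> ball 0 R'" for w x
   proof -
    have xw: "x *s w \<in> ball 0 R" using in_R[of x w] that RR by simp
    have "((\<lambda>x. h (0 + x *s w)) has_field_derivative dir w h (0 + x *s w)) (at x)"
     by (rule slice_holo_DERIV[OF h]) (use xw in simp)
    moreover have "dir w h (x *s w) = (\<Sum>j\<in>UNIV. w $ j * dir (axis j 1) h (x *s w))"
     by (subst vec_sum_axis[of w]) (simp only: dir_sum[OF h xw] dir_cmul[OF h xw])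
    ultimately show ?thesis by (auto intro!: derivative_eq_intros)
   qed
   show "norm (?F x w) <= M * rho w powr t" if "x \<in> ball 0 R'" "w \<in> space lball" for x w
   proof -
    have "norm (x / of_real R') * norm w <= 1"
     using that R' by (intro mult_le_one) (auto simp: norm_divide divide_le_eq)
    hence "norm (h (of_real R' *s ((x / of_real R') *s w))) <= M" by (intro M(2)) (simp add: norm_vsmult)
    hence "norm (h (x *s w)) <= M" using R' by (simp add: vector_smult_assoc)
    hence "rho w powr t * norm (h (x *s w)) <= rho w powr t * M" by (intro mult_left_mono) auto
    thus ?thesis by (simp add: norm_mult mult.commute)
   qed
   show "bmeas (?F x)" if "x \<in> ball 0 R'" for x
   proof -
    have "bmeas (\<lambda>w. h (x *s w))"
     by (rule measurable_lball[OF continuous_on_subset[OF cx(1)]]) (use that in auto)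
    thus ?thesis using mr by measurable
   qed
   show "bmeas (?F' x)" if "x \<in> ball 0 R'" for x
   proof -
    have "bmeas (\<lambda>w. (\<Sum>j\<in>UNIV. w $ j * dir (axis j 1) h (x *s w)))"
     by (rule measurable_lball) (use that in \<open>auto intro!: continuous_intros continuous_on_subset[OF cx(2)]\<close>)
    thus ?thesis using mr by measurable
   qed
   show "integrable (lball :: (complex^'n) measure) (\<lambda>w. M * rho w powr t)"
    by (intro integrable_mult_left integrable_mult_right integrable_rho_powr t)
  qed
  thus ?thesis using z[of x] x by simp
 qed
 have "\<exists>c. \<forall>x\<in>ball 0 R'. (LINT w|lball. ?F x w) = c"
  by (rule has_field_derivative_zero_constant) (auto intro!: has_field_derivative_at_within D)
 then obtain c where c: "!!x. x \<in> ball 0 R' ==> (LINT w|lball. ?F x w) = c" by blast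
 have "(LINT w|lball. ?F 1 w) = (LINT w|lball. ?F 0 w)" using R' c[of 1] c[of 0] by simp
 also have "... = of_real (bmass TYPE('n) t) * h 0"
  unfolding bmass_def by simp
 finally show ?thesis by simp
qed


section \<open>The Bergman kernels and the reproducing formula\<close>

definition ker :: "real => complex^'n => complex^'n => complex" where
 "ker s z w = (1 - cdot z w) powr (- complex_of_real s)"

text \<open>The quantity d of the overview. It is no distance: on the diagonal it equals
  \<open>rho z\<close>. Near the sphere it measures tangential displacements quadratically.\<close>

definition kdist :: "complex^'n => complex^'n => real" where
 "kdist z w = norm (1 - cdot z w)"

lemma norm_cdot_lt: "norm z < 1 ==> norm w <= 1 ==> norm (cdot z w) < 1"
 using norm_cdot_le[of z w] mult_left_mono[of "norm w" 1 "norm z"] by simp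

lemma norm_cdot_lt': "norm z <= 1 ==> norm w < 1 ==> norm (cdot z w) < 1"
 using norm_cdot_le[of z w] mult_right_mono[of "norm z" 1 "norm w"] by simp

lemma one_minus_notin: fixes c :: complex shows "norm c < 1 ==> 1 - c \<notin> \<real>\<^sub>\<le>\<^sub>0" "norm c < 1 ==> 1 - c ~= 0"
 using complex_Re_le_cmod[of c] by (auto simp: complex_nonpos_Reals_iff)

lemma kdist_commute: "kdist z w = kdist w z"
proof -
 have "norm (cnj (1 - cdot z w)) = norm (1 - cdot w z)" by simp
 thus ?thesis unfolding kdist_def complex_mod_cnj .
qed

lemma kdist_pos: "norm z < 1 ==> norm w <= 1 ==> kdist z w > 0"
 unfolding kdist_def using one_minus_notin(2)[OF norm_cdot_lt] by simp

lemma kdist_ge: "1 - norm z * norm w <= kdist z w"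
 unfolding kdist_def using norm_triangle_ineq2[of 1 "cdot z w"] norm_cdot_le[of z w] by simp

lemma kdist_le_2: "norm z <= 1 ==> norm w <= 1 ==> kdist z w <= 2"
 unfolding kdist_def using norm_triangle_ineq4[of 1 "cdot z w"] norm_cdot_le[of z w] mult_le_one[of "norm z" "norm w"]
 by simp

lemma cnj_ker: "norm (cdot z w) < 1 ==> cnj (ker s z w) = ker s w z"
proof -
 assume "norm (cdot z w) < 1"
 hence "Re (1 - cdot z w) >= 0" using complex_Re_le_cmod[of "cdot z w"] by simp
 from cnj_powr[OF this] show ?thesis unfolding ker_def by simp
qed

lemma norm_ker: "norm (ker s z w) = kdist z w powr (- s)"
 unfolding ker_def kdist_def by (simp add: norm_powr_real_powr')

lemma ker_alt: "ker s z w = 1 / (1 - cdot z w) powr (complex_of_real s)"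
 unfolding ker_def by (simp add: powr_minus divide_inverse)

lemma ker_mult: "norm (cdot z w) < 1 ==> ker s z w * ker t z w = ker (s + t) z w"
 unfolding ker_def using one_minus_notin[of "cdot z w"] by (simp flip: powr_add)

lemma ker_add1: "norm (cdot z w) < 1 ==> ker (s + 1) z w * (1 - cdot z w) = ker s z w"
proof -
 assume *: "norm (cdot z w) < 1"
 have "ker s z w = ker (s + 1) z w * ker (-1) z w" using ker_mult[OF *, of "s + 1" "-1"] by simp
 also have "ker (-1) z w = 1 - cdot z w" unfolding ker_def using one_minus_notin[OF *] by simp
 finally show ?thesis by simp
qed

lemma ker_0_left [simp]: "ker s 0 w = 1" and ker_0_right [simp]: "ker s w 0 = 1"
 by (simp_all add: ker_def)

lemma ker_self: "norm z < 1 ==> ker s z z = of_real (rho z powr (- s))"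
proof -
 assume "norm z < 1"
 hence "rho z > 0" by (rule rho_pos)
 have "1 - cdot z z = of_real (rho z)" by (simp add: cdot_self rho_def)
 hence "ker s z z = of_real (rho z) powr of_real (- s)" unfolding ker_def by (simp only: of_real_minus)
 also have "... = of_real (rho z powr (- s))" by (rule powr_of_real[OF less_imp_le[OF \<open>rho z > 0\<close>]])
 finally show ?thesis .
qed

lemma ker_holo:
 assumes "!!z. z \<in> S ==> norm (cdot z w) < 1"
 shows "holo_on S (\<lambda>z. ker s z w)"
  and "z \<in> S ==> dir v (\<lambda>z. ker s z w) z = of_real s * cdot v w * ker (s + 1) z w"
proof -
 have 1: "((\<lambda>x. (1 - x) powr (- complex_of_real s)) has_field_derivative
   of_real s * (1 - cdot z w) powr (- of_real (s + 1))) (at (cdot z w))" if "z \<in> S" for z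
 proof -
  have "((\<lambda>x. (1 - x) powr (- complex_of_real s)) has_field_derivative
   (- of_real s * (1 - cdot z w) powr (- of_real s - 1)) * (0 - 1)) (at (cdot z w))"
  proof (rule DERIV_chain2[where g="\<lambda>x. 1 - x" and f="\<lambda>x. x powr (- complex_of_real s)"])
   show "((\<lambda>x. x powr (- complex_of_real s)) has_field_derivative
    - of_real s * (1 - cdot z w) powr (- of_real s - 1)) (at (1 - cdot z w))"
    by (rule has_field_derivative_powr[OF one_minus_notin(1)[OF assms[OF that]]])
   show "((\<lambda>x. 1 - x) has_field_derivative (0 - 1)) (at (cdot z w))"
    by (intro derivative_intros)
  qed
  moreover have "- complex_of_real s - 1 = - of_real (s + 1)" by simp
  ultimately show ?thesis by (simp only: mult_minus_left mult_minus_right diff_0 mult_1_right minus_minus)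
 qed
 note c = holo_compose[OF holo_cdot, of S "\<lambda>x. (1 - x) powr (- complex_of_real s)" "\<lambda>c. of_real s * (1 - c) powr (- of_real (s + 1))" w]
 show "holo_on S (\<lambda>z. ker s z w)" unfolding ker_def by (rule c(1)[OF 1])
 show "dir v (\<lambda>z. ker s z w) z = of_real s * cdot v w * ker (s + 1) z w" if "z \<in> S"
 proof -
  have "dir v (\<lambda>z. ker s z w) z = of_real s * (1 - cdot z w) powr (- of_real (s + 1)) * dir v (\<lambda>z. cdot z w) z"
   unfolding ker_def by (rule c(2)[OF 1 that])
  thus ?thesis by (simp only: dir_cdot ker_def mult_ac)
 qed
qed

lemma ker_slice_DERIV:
 assumes "norm (cdot (x *s z) w) < 1"
 shows "((\<lambda>x. ker s (x *s z) w) has_field_derivative of_real s * cdot z w * ker (s + 1) (x *s z) w) (at x)"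
proof -
 have h: "holo_on {y. norm (cdot y w) < 1} (\<lambda>z. ker s z w)" by (rule ker_holo(1)) simp
 have d: "dir z (\<lambda>z. ker s z w) (x *s z) = of_real s * cdot z w * ker (s + 1) (x *s z) w"
  by (rule ker_holo(2)[where S="{y. norm (cdot y w) < 1}"]) (use assms in simp_all)
 have "((\<lambda>t. ker s (0 + t *s z) w) has_field_derivative dir z (\<lambda>z. ker s z w) (0 + x *s z)) (at x)"
  by (rule slice_holo_DERIV[OF h]) (use assms in simp)
 thus ?thesis by (simp only: add_0 d)
qed

lemma ker_cont_right: "norm z < 1 ==> continuous_on (cball 0 1) (\<lambda>w. ker s z w)"
proof -
 assume z: "norm z < 1"
 have "continuous_on (cball 0 1) (\<lambda>w. cnj (ker s w z))"
  by (intro continuous_intros holo_continuous_on ker_holo) (use z in \<open>auto intro: norm_cdot_lt'\<close>)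
 thus ?thesis
  by (rule continuous_on_eq) (use z in \<open>auto intro!: cnj_ker norm_cdot_lt'\<close>)
qed

lemma norm_ker_le:
 assumes "norm z <= r" "r < 1" "norm w <= 1" "s >= 0"
 shows "norm (ker s z w) <= (1 - r) powr (- s)"
proof -
 have "0 <= r" using norm_ge_zero[of z] assms(1) by linarith
 hence "norm z * norm w <= r * 1" by (intro mult_mono) (use assms in auto)
 hence "1 - r <= kdist z w" using kdist_ge[of z w] by linarith
 thus ?thesis unfolding norm_ker using assms by (intro powr_mono2') auto
qed

text \<open>\<open>\<Phi> k\<close> and \<open>\<phi> k\<close> are the k-th derivatives of
  \<open>\<Phi> 0\<close> and \<open>\<phi> 0\<close>, so agreement at 0 for all \<open>k\<close> is
  agreement of the Taylor coefficients.\<close>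

lemma taylor_unique:
 fixes \<Phi> \<phi> :: "nat => complex => complex"
 assumes 1: "!!k x. x \<in> ball 0 R ==> (\<Phi> k has_field_derivative \<Phi> (Suc k) x) (at x)"
  and 2: "!!k x. x \<in> ball 0 R ==> (\<phi> k has_field_derivative \<phi> (Suc k) x) (at x)"
  and 0: "!!k. \<Phi> k 0 = \<phi> k 0" and x: "x \<in> ball 0 R"
 shows "\<Phi> 0 x = \<phi> 0 x"
proof -
 have hd: "(deriv ^^ k) (\<Psi> 0) x = \<Psi> k x"
  if \<Psi>: "!!k x. x \<in> ball 0 R ==> (\<Psi> k has_field_derivative \<Psi> (Suc k) x) (at x)" and "x \<in> ball 0 R"
  for \<Psi> :: "nat => complex => complex" and k x
  using that(2)
 proof (induction k arbitrary: x)
  case (Suc k)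
  have "((deriv ^^ k) (\<Psi> 0) has_field_derivative \<Psi> (Suc k) x) (at x)"
   by (rule has_field_derivative_transform_within_open[OF \<Psi>[OF Suc.prems] open_ball Suc.prems]) (simp add: Suc.IH)
  thus ?case by (simp add: DERIV_imp_deriv)
 qed simp
 have h: "\<Psi> 0 holomorphic_on ball 0 R"
  if \<Psi>: "!!k x. x \<in> ball 0 R ==> (\<Psi> k has_field_derivative \<Psi> (Suc k) x) (at x)" for \<Psi> :: "nat => complex => complex"
  unfolding holomorphic_on_def field_differentiable_def using \<Psi> by (meson has_field_derivative_at_within)
 have R: "0 \<in> ball 0 R" using x order_le_less_trans[OF norm_ge_zero] by auto
 show ?thesis
  by (rule holomorphic_fun_eq_on_ball[OF h[where \<Psi>=\<Phi>, OF 1] h[where \<Psi>=\<phi>, OF 2] x])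
   (use R 0 hd[where \<Psi>=\<Phi>, OF 1] hd[where \<Psi>=\<phi>, OF 2] in auto)
qed

lemma measurable_rho_powr_complex: "bmeas (\<lambda>w. complex_of_real (rho w powr t))"
 using measurable_rho_powr by measurable

text \<open>Both sides are functions of \<open>x\<close> on a disc containing 1 when \<open>z\<close> is replaced by \<open>x z\<close>; by
 integration by parts their derivatives of all orders agree at 0.\<close>

lemma reproducing_smooth:
 fixes h :: "'n::finite cfun"
 assumes h: "holo_on (ball 0 R) h" and R: "R > 1" and t: "t > -1" and z: "norm z < 1"
 shows "(LINT w|lball. of_real (rho w powr t) * (h w * ker (real CARD('n) + 1 + t) z w))
  = of_real (bmass TYPE('n) t) * h z"
proof -
 define s where "s = real CARD('n) + 1 + t"
 have s: "s > 0" using t by (simp add: s_def add_pos_pos)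
 define G where "G k = ((\<lambda>f. dir z f) ^^ k) h" for k
 have G: "holo_on (ball 0 R) (G k)" for k
  unfolding G_def by (induction k) (auto intro!: holo_dir h)
 have GS: "G (Suc k) = dir z (G k)" for k by (simp add: G_def)
 have sub: "cball 0 1 \<subseteq> ball (0::complex^'n) R" using R by auto
 have cG: "continuous_on (cball 0 1) (G k)" for k
  by (rule continuous_on_subset[OF holo_continuous_on[OF G] sub])
 \<comment> \<open>Chosen so that \<open>R1 > 1\<close> while \<open>R1 * norm z < 1\<close>: the
   parameter 1 is interior and the kernel stays bounded.\<close>
 define R1 where "R1 = 2 / (1 + norm z)"
 define q where "q = R1 * norm z"
 have n1: "1 + norm z > 0" by (simp add: add_pos_nonneg)
 have R1: "R1 > 1" unfolding R1_def using z n1 by simp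
 have q: "q < 1" unfolding q_def R1_def using z n1 by simp
 have xz: "norm (x *s z) <= q" if "x \<in> ball 0 R1" for x
  unfolding norm_vsmult q_def using that by (intro mult_right_mono) auto
 have xz1: "norm (x *s z) < 1" if "x \<in> ball 0 R1" for x using xz[OF that] q by linarith
 define A where "A k = bmass TYPE('n) (t + real k)" for k
 have A: "A k > 0" for k unfolding A_def using t by (intro bmass_pos) simp
 have rec: "(s + real k) * A (Suc k) = (t + real k + 1) * A k" for k
  using bmass_rec[where 'n='n, of "t + real k"] t by (simp add: A_def s_def add_ac)
 \<comment> \<open>A derivative in \<open>x\<close> raises the kernel exponent by one and produces a
   factor \<open>cdot z w\<close>; integration by parts converts that factor into
   \<open>dir z\<close> on \<open>G k\<close> and one more power of \<open>rho\<close>. Hence all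
   three shift with \<open>k\<close>.\<close>
 define F where "F k x w = of_real (rho w powr (t + real k)) * (G k w * ker (s + real k) (x *s z) w)" for k x and w :: "complex^'n"
 define \<Phi> where "\<Phi> k x = (LINT w|lball. F k x w) / of_real (A k)" for k x
 define \<phi> where "\<phi> k x = G k (x *s z)" for k x
 have D1: "(\<Phi> k has_field_derivative \<Phi> (Suc k) x) (at x)" if x: "x \<in> ball 0 R1" for k x
 proof -
  define \<sigma> where "\<sigma> = s + real k"
  define \<tau> where "\<tau> = t + real k"
  have st: "\<sigma> > 0" "\<tau> > -1" using s t by (auto simp: \<sigma>_def \<tau>_def)
  obtain M where M: "M > 0" "!!w. norm w <= 1 ==> norm (G k w) <= M" using cont_cball_bound[OF cG] by metis
  let ?F' = "\<lambda>x w. of_real (rho w powr \<tau>) * (G k w * (of_real \<sigma> * cdot z w * ker (\<sigma> + 1) (x *s z) w))"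
  have "((\<lambda>x. (LINT w|lball. F k x w)) has_field_derivative (LINT w|lball. ?F' x w)) (at x)"
  proof (rule DERIV_integral[where g="\<lambda>w. M * (1 - q) powr (- \<sigma>) * rho w powr \<tau>", OF _ _ _ _ _ x])
   show "((\<lambda>x. F k x w) has_field_derivative ?F' x w) (at x)" if "w \<in> space lball" "x \<in> ball 0 R1" for w x
    unfolding F_def \<sigma>_def[symmetric] \<tau>_def[symmetric]
    by (intro DERIV_cmult ker_slice_DERIV norm_cdot_lt xz1) (use that in auto)
   show "norm (F k x w) <= M * (1 - q) powr (- \<sigma>) * rho w powr \<tau>" if "x \<in> ball 0 R1" "w \<in> space lball" for x w
   proof -
    have "norm (G k w) * norm (ker \<sigma> (x *s z) w) <= M * (1 - q) powr (- \<sigma>)"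
     by (rule mult_mono) (use that M xz[OF that(1)] q st in \<open>auto intro!: norm_ker_le\<close>)
    hence "rho w powr \<tau> * (norm (G k w) * norm (ker \<sigma> (x *s z) w)) <= rho w powr \<tau> * (M * (1 - q) powr (- \<sigma>))"
     by (intro mult_left_mono) auto
    thus ?thesis unfolding F_def \<sigma>_def[symmetric] \<tau>_def[symmetric] by (simp add: norm_mult mult.commute)
   qed
   have cx: "continuous_on (cball 0 1) (ker r (x *s z))" if "x \<in> ball 0 R1" for x r
    using ker_cont_right[OF xz1[OF that], of r] .
   show "bmeas (F k x)" if "x \<in> ball 0 R1" for x
   proof -
    have "bmeas (\<lambda>w. G k w * ker (s + real k) (x *s z) w)"
     by (rule measurable_lball, rule continuous_on_subset[of "cball 0 1"]) (use cx[OF that] cG in \<open>auto intro!: continuous_intros\<close>)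
    thus ?thesis unfolding F_def using measurable_rho_powr_complex by measurable
   qed
   show "bmeas (?F' x)" if "x \<in> ball 0 R1" for x
   proof -
    have "bmeas (\<lambda>w. G k w * (of_real \<sigma> * cdot z w * ker (\<sigma> + 1) (x *s z) w))"
     by (rule measurable_lball, rule continuous_on_subset[of "cball 0 1"]) (use cx[OF that] cG in \<open>auto intro!: continuous_intros\<close>)
    thus ?thesis using measurable_rho_powr_complex by measurable
   qed
   show "integrable (lball :: (complex^'n) measure) (\<lambda>w. M * (1 - q) powr (- \<sigma>) * rho w powr \<tau>)"
    by (intro integrable_mult_right integrable_rho_powr st)
  qed
  hence D: "(\<Phi> k has_field_derivative (LINT w|lball. ?F' x w) / of_real (A k)) (at x)"
   unfolding \<Phi>_def by (rule DERIV_cdivide)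
  have c1: "norm (cdot (x *s z) w) < 1" if "norm w < 1 / q" for w
  proof (cases "q = 0")
   case True
   hence "norm (x *s z) <= 0" using xz[OF x] by simp
   hence "x *s z = 0" by (simp only: norm_le_zero_iff)
   thus ?thesis by (simp only: cdot_simps) simp
  next
   case False
   hence "q > 0" unfolding q_def using R1 by (simp add: less_le)
   have "norm (cdot (x *s z) w) <= q * norm w"
    by (rule order_trans[OF norm_cdot_le]) (use xz[OF x] in \<open>auto intro!: mult_right_mono\<close>)
   also have "... < q * (1 / q)" using that \<open>q > 0\<close> by (intro mult_strict_left_mono) auto
   finally show ?thesis using \<open>q > 0\<close> by simp
  qed
  \<comment> \<open>A common radius above 1 on which \<open>G k\<close> and the kernel in
    \<open>w\<close> are both holomorphic, as \<open>ball_ibp\<close> requires; for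
    \<open>q = 0\<close> the kernel is constant.\<close>
  define Q where "Q = min R (if q = 0 then 2 else 1 / q)"
  have q0: "q >= 0" using R1 by (simp add: q_def)
  have Q: "Q > 1" using R q q0 by (auto simp: Q_def less_divide_eq)
  have cQ: "norm (cdot w (x *s z)) < 1" if "w \<in> ball 0 Q" for w
  proof (cases "q = 0")
   case True
   hence "norm (x *s z) <= 0" using xz[OF x] by simp
   hence "x *s z = 0" by (simp only: norm_le_zero_iff)
   thus ?thesis by (simp only: cdot_simps) simp
  next
   case False
   hence "norm w < 1 / q" using that by (simp add: Q_def)
   have "norm (cnj (cdot (x *s z) w)) < 1" unfolding complex_mod_cnj by (rule c1[OF \<open>norm w < 1 / q\<close>])
   thus ?thesis unfolding cnj_cdot .
  qed
  have hG: "holo_on (ball 0 Q) (G k)" by (rule holo_on_subset[OF G subset_ball]) (simp add: Q_def)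
  have hk: "holo_on (ball 0 Q) (\<lambda>w. ker (\<sigma> + 1) w (x *s z))" by (rule ker_holo(1)[OF cQ])
  have cn: "cnj (ker (\<sigma> + 1) w (x *s z)) = ker (\<sigma> + 1) (x *s z) w" if "w \<in> space lball" for w
   by (rule cnj_ker[OF cQ]) (use that Q in auto)
  have "(LINT w|lball. ?F' x w) = (LINT w|lball. of_real \<sigma> * (of_real (rho w powr \<tau>) * (cdot z w * G k w * cnj (ker (\<sigma> + 1) w (x *s z)))))"
   by (intro Bochner_Integration.integral_cong refl) (simp only: cn mult_ac)
  also have "... = of_real \<sigma> * (LINT w|lball. of_real (rho w powr \<tau>) * (cdot z w * G k w * cnj (ker (\<sigma> + 1) w (x *s z))))"
   by (rule integral_mult_right_zero)
  also have "... = of_real (\<sigma> / (\<tau> + 1)) * (of_real (\<tau> + 1) * (LINT w|lball. of_real (rho w powr \<tau>) * (cdot z w * G k w * cnj (ker (\<sigma> + 1) w (x *s z)))))"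
  proof -
   have e: "complex_of_real \<sigma> = of_real (\<sigma> / (\<tau> + 1)) * of_real (\<tau> + 1)"
    unfolding of_real_mult[symmetric] using st by simp
   show ?thesis by (subst (1) e) (rule mult.assoc)
  qed
  also have "of_real (\<tau> + 1) * (LINT w|lball. of_real (rho w powr \<tau>) * (cdot z w * G k w * cnj (ker (\<sigma> + 1) w (x *s z))))
   = (LINT w|lball. of_real (rho w powr (\<tau> + 1)) * (dir z (G k) w * cnj (ker (\<sigma> + 1) w (x *s z))))"
   by (rule ball_ibp[OF hG hk Q st(2)])
  also have "... = (LINT w|lball. F (Suc k) x w)"
  proof -
   have e: "s + real (Suc k) = \<sigma> + 1" "t + real (Suc k) = \<tau> + 1" by (simp_all add: \<sigma>_def \<tau>_def)
   show ?thesis by (intro Bochner_Integration.integral_cong refl) (simp only: cn F_def GS e)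
  qed
  finally have "(LINT w|lball. ?F' x w) / of_real (A k) = of_real (\<sigma> / (\<tau> + 1) / A k) * (LINT w|lball. F (Suc k) x w)"
   by simp
  \<comment> \<open>The recursion for \<open>bmass\<close> matches the constant left by
    differentiation and integration by parts with the change of normalisation from
    \<open>A k\<close> to \<open>A (Suc k)\<close>.\<close>
  also have "\<sigma> / (\<tau> + 1) / A k = 1 / A (Suc k)"
  proof -
   have "(\<tau> + 1) * A k ~= 0" "A (Suc k) ~= 0" using A[of k] A[of "Suc k"] st by auto
   hence "\<sigma> / ((\<tau> + 1) * A k) = 1 / A (Suc k)"
    using rec[of k, folded \<sigma>_def \<tau>_def] by (subst frac_eq_eq) auto
   thus ?thesis by simp
  qed
  finally have "(LINT w|lball. ?F' x w) / of_real (A k) = \<Phi> (Suc k) x" by (simp add: \<Phi>_def)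
  with D show ?thesis by simp
 qed
 have D2: "(\<phi> k has_field_derivative \<phi> (Suc k) x) (at x)" if "x \<in> ball 0 R1" for k x
 proof -
  have "0 + x *s z \<in> ball 0 R" using xz1[OF that] R by simp
  from slice_holo_DERIV[OF G this] show ?thesis by (simp add: \<phi>_def[abs_def] GS)
 qed
 \<comment> \<open>At \<open>x = 0\<close> the kernel is 1, and what remains is the mean value
   property of \<open>G k\<close> for the exponent \<open>t + real k\<close>.\<close>
 have "\<Phi> k 0 = \<phi> k 0" for k
  unfolding \<Phi>_def \<phi>_def F_def A_def using holo_ball_mean_value[OF G R, of "t + real k" k] t bmass_pos[where 'n='n, of "t + real k"]
  by simp
 from taylor_unique[of R1 \<Phi> \<phi>, OF D1 D2 this, of 1] have "\<Phi> 0 1 = \<phi> 0 1" using R1 by simp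
 thus ?thesis using A[of 0] by (simp add: \<Phi>_def \<phi>_def F_def A_def G_def s_def field_simps)
qed


section \<open>Dilations and functions unbounded near the sphere\<close>

lemma holo_dilate:
 assumes f: "holo_on (ball 0 1) f" and r: "0 < r" "r < 1"
 shows "holo_on (ball 0 (1 / r)) (\<lambda>w. f (of_real r *s w))"
 using holo_affine(1)[OF f, of "ball 0 (1/r)" 0 "of_real r"] r
 by (simp add: norm_vsmult pos_less_divide_eq mult.commute)

lemma rho_dilate: "0 <= r ==> r <= 1 ==> rho w <= rho (of_real r *s w)"
 unfolding rho_def norm_vsmult using mult_right_mono[of "r^2" 1 "(norm w)^2"]
 by (simp add: power_mult_distrib power_le_one)

lemma dilate_LIMSEQ:
 fixes f :: "'n::finite cfun"
 assumes f: "holo_on (ball 0 1) f" and w: "norm w < 1"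
 shows "(\<lambda>i. f (of_real (1 - 1 / real (i + 2)) *s w)) \<longlonglongrightarrow> f w"
proof -
 have "(\<lambda>i. 1 / real (Suc (Suc i))) \<longlonglongrightarrow> 0" by (intro LIMSEQ_Suc lim_1_over_n)
 hence "(\<lambda>i. complex_of_real (1 - 1 / real (i + 2))) \<longlonglongrightarrow> of_real (1 - 0)"
  by (intro tendsto_intros) simp
 hence "(\<lambda>i. of_real (1 - 1 / real (i + 2)) *s w) \<longlonglongrightarrow> 1 *s w"
  using bounded_linear.tendsto[OF bounded_linear_vsmult] by (simp only: diff_zero of_real_1)
 moreover have "isCont f w"
  using holo_has_derivative[OF f, of w] w has_derivative_continuous by auto
 ultimately show ?thesis using isCont_tendsto_compose[of w f] by simp
qed

text \<open>Dilates are holomorphic across the sphere, so the smooth case applies to them. Dominated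
  convergence works because \<open>rho\<close> does not decrease under contraction: the growth
  majorant of \<open>f\<close> dominates every dilate.\<close>

lemma reproducing_growth:
 fixes f :: "'n::finite cfun"
 assumes f: "holo_on (ball 0 1) f" and b: "!!w. norm w < 1 ==> norm (f w) <= C * rho w powr (- \<kappa>)"
  and t: "t > -1" "t - \<kappa> > -1" "\<kappa> >= 0" and z: "norm z < 1"
 shows "(LINT w|lball. of_real (rho w powr t) * (f w * ker (real CARD('n) + 1 + t) z w))
  = of_real (bmass TYPE('n) t) * f z"
proof -
 define s where "s = real CARD('n) + 1 + t"
 have s: "s > 0" using t by (simp add: s_def add_pos_pos)
 define r where "r i = 1 - 1 / real (i + 2)" for i
 have r: "0 < r i" "r i < 1" for i by (auto simp: r_def)
 have "0 <= C * rho (0::complex^'n) powr (- \<kappa>)" by (rule order_trans[OF norm_ge_zero b]) simp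
 hence C0: "C >= 0" by (simp add: rho_def)
 have fc: "continuous_on (ball 0 1) f" by (rule holo_continuous_on[OF f])
 have kc: "continuous_on (cball 0 1) (ker s z)" by (rule ker_cont_right[OF z])
 have "(\<lambda>i. (LINT w|lball. of_real (rho w powr t) * (f (of_real (r i) *s w) * ker s z w)))
  \<longlonglongrightarrow> (LINT w|lball. of_real (rho w powr t) * (f w * ker s z w))"
 proof (rule integral_dominated_convergence[where w="\<lambda>w. C * (1 - norm z) powr (- s) * rho w powr (t - \<kappa>)"])
  have km: "bmeas (ker s z)" by (rule measurable_lball[OF continuous_on_subset[OF kc]]) auto
  show "bmeas (\<lambda>w. of_real (rho w powr t) * (f w * ker s z w))"
   using measurable_rho_powr_complex[of t] measurable_lball[OF fc] km by measurable
  have "bmeas (\<lambda>w. f (of_real (r i) *s w))" for i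
   by (rule measurable_lball[OF continuous_on_subset[OF holo_continuous_on[OF holo_dilate[OF f r]]]])
    (use r[of i] in \<open>auto intro!: less_trans[OF _ less_divide_eq_1_pos[THEN iffD2]]\<close>)
  thus "bmeas (\<lambda>w. of_real (rho w powr t) * (f (of_real (r i) *s w) * ker s z w))" for i
   using measurable_rho_powr_complex[of t] km by measurable
  show "integrable (lball :: (complex^'n) measure) (\<lambda>w. C * (1 - norm z) powr (- s) * rho w powr (t - \<kappa>))"
   by (intro integrable_mult_right integrable_rho_powr t)
  show "AE w in lball. (\<lambda>i. of_real (rho w powr t) * (f (of_real (r i) *s w) * ker s z w)) \<longlonglongrightarrow> of_real (rho w powr t) * (f w * ker s z w)"
   by (rule AE_I2) (auto intro!: tendsto_intros dilate_LIMSEQ[OF f, folded r_def])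
  show "AE w in lball. norm (of_real (rho w powr t) * (f (of_real (r i) *s w) * ker s z w)) <= C * (1 - norm z) powr (- s) * rho w powr (t - \<kappa>)" for i
  proof (rule AE_I2)
   fix w :: "complex^'n" assume "w \<in> space lball"
   hence w: "norm w < 1" by simp
   have "r i * norm w <= 1 * norm w" using r[of i] by (intro mult_right_mono) auto
   hence rw: "norm (of_real (r i) *s w) < 1" using r[of i] w by (simp add: norm_vsmult)
   have "norm (f (of_real (r i) *s w)) <= C * rho (of_real (r i) *s w) powr (- \<kappa>)" by (rule b[OF rw])
   also have "... <= C * rho w powr (- \<kappa>)"
    using C0 t rho_dilate[of "r i" w] rho_pos[OF w] r[of i] by (intro mult_left_mono powr_mono2') auto
   finally have "norm (f (of_real (r i) *s w)) * norm (ker s z w) <= (C * rho w powr (- \<kappa>)) * (1 - norm z) powr (- s)"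
    using s w z C0 by (intro mult_mono norm_ker_le) auto
   hence "rho w powr t * (norm (f (of_real (r i) *s w)) * norm (ker s z w)) <= rho w powr t * ((C * rho w powr (- \<kappa>)) * (1 - norm z) powr (- s))"
    by (rule mult_left_mono) simp
   also have "... = C * (1 - norm z) powr (- s) * (rho w powr t * rho w powr (- \<kappa>))" by simp
   also have "rho w powr t * rho w powr (- \<kappa>) = rho w powr (t - \<kappa>)" by (simp flip: powr_add)
   finally show "norm (of_real (rho w powr t) * (f (of_real (r i) *s w) * ker s z w)) <= C * (1 - norm z) powr (- s) * rho w powr (t - \<kappa>)"
    by (simp add: norm_mult)
  qed
 qed
 moreover have "(LINT w|lball. of_real (rho w powr t) * (f (of_real (r i) *s w) * ker s z w))
   = of_real (bmass TYPE('n) t) * f (of_real (r i) *s z)" for i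
  unfolding s_def by (rule reproducing_smooth[OF holo_dilate[OF f r] _ t(1) z]) (use r[of i] in simp)
 moreover have "(\<lambda>i. of_real (bmass TYPE('n) t) * f (of_real (r i) *s z)) \<longlonglongrightarrow> of_real (bmass TYPE('n) t) * f z"
  by (intro tendsto_intros dilate_LIMSEQ[OF f z, folded r_def])
 ultimately show ?thesis unfolding s_def using LIMSEQ_unique by simp
qed

section \<open>Forelli--Rudin estimates\<close>

lemma measurable_kdist_pair: "(\<lambda>p. kdist (fst p) (snd p)) \<in> borel_measurable ((lball :: (complex^'n) measure) \<Otimes>\<^sub>M lball)"
proof -
 let ?P = "(lball :: (complex^'n) measure) \<Otimes>\<^sub>M (lball :: (complex^'n) measure)"
 have 1: "(\<lambda>p. fst p $ k) \<in> borel_measurable ?P" for k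
  by (rule measurable_compose[OF measurable_fst measurable_lball]) (intro continuous_intros)
 have 2: "(\<lambda>p. cnj (snd p $ k)) \<in> borel_measurable ?P" for k
  by (rule measurable_compose[OF measurable_snd measurable_lball]) (intro continuous_intros)
 have c: "(\<lambda>p. cdot (fst p) (snd p)) \<in> borel_measurable ?P"
  unfolding cdot_def by (intro borel_measurable_sum borel_measurable_times 1 2)
 show "(\<lambda>p. kdist (fst p) (snd p)) \<in> borel_measurable ?P"
  unfolding kdist_def using c by measurable
qed

lemma measurable_kdist: "z \<in> ball 0 1 ==> bmeas (kdist z)"
 unfolding kdist_def by (intro measurable_lball continuous_intros)

lemma measurable_rho_kdist:
 assumes "norm z < 1"
 shows "bmeas (\<lambda>w. rho w powr t * kdist z w powr e)"
proof -
 have "bmeas (\<lambda>w. kdist z w powr e)"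
  by (rule measurable_compose[OF measurable_kdist]) (use assms in simp_all)
 thus ?thesis by (intro borel_measurable_times measurable_rho_powr)
qed

text \<open>The reproducing formula for the function \<open>ker s w z\<close> of \<open>w\<close>,
  read at the point \<open>z\<close>: the integrand becomes the squared modulus of the kernel. At
  this exponent the kernel integral is known exactly.\<close>

lemma kdist_integral:
 fixes z :: "complex^'n"
 assumes t: "t > -1" and z: "norm z < 1"
 defines "s \<equiv> real CARD('n) + 1 + t"
 shows "bint (\<lambda>w. rho w powr t * kdist z w powr (- 2 * s)) = ennreal (bmass TYPE('n) t * rho z powr (- s))"
proof -
 define R where "R = 2 / (1 + norm z)"
 have n1: "1 + norm z > 0" by (simp add: add_pos_nonneg)
 have R: "R > 1" unfolding R_def using z n1 by simp
 have c: "norm (cdot w z) < 1" if "w \<in> ball 0 R" for w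
 proof -
  have "norm (cdot w z) <= R * norm z"
   by (rule order_trans[OF norm_cdot_le]) (use that in \<open>auto intro!: mult_right_mono\<close>)
  also have "... < 1" unfolding R_def using z n1 by simp
  finally show ?thesis .
 qed
 have e: "ker s w z * ker s z w = of_real (kdist z w powr (- 2 * s))" if "w \<in> space lball" for w
 proof -
  have "ker s w z = cnj (ker s z w)" by (rule cnj_ker[symmetric], rule norm_cdot_lt) (use that z in auto)
  hence "ker s w z * ker s z w = of_real ((norm (ker s z w))^2)"
   by (metis complex_norm_square mult.commute)
  also have "(norm (ker s z w))^2 = kdist z w powr (- 2 * s)"
   unfolding norm_ker power2_eq_square by (simp flip: powr_add)
  finally show ?thesis .
 qed
 have "(LINT w|lball. of_real (rho w powr t) * (ker s w z * ker s z w)) = of_real (bmass TYPE('n) t) * ker s z z"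
  unfolding s_def by (rule reproducing_smooth[OF ker_holo(1)[OF c] R t z])
 also have "(LINT w|lball. of_real (rho w powr t) * (ker s w z * ker s z w)) = (LINT w|lball. complex_of_real (rho w powr t * kdist z w powr (- 2 * s)))"
  by (intro Bochner_Integration.integral_cong refl) (simp only: e of_real_mult)
 finally have i: "(LINT w|lball. rho w powr t * kdist z w powr (- 2 * s)) = bmass TYPE('n) t * rho z powr (- s)"
  unfolding ker_self[OF z] integral_complex_of_real of_real_mult[symmetric] of_real_eq_iff .
 have "bmass TYPE('n) t * rho z powr (- s) > 0" using bmass_pos[OF t, where 'n='n] rho_pos[OF z] by simp
 \<comment> \<open>A non-integrable function has Bochner integral 0, so the positive value just
   found yields integrability.\<close>
 hence "integrable lball (\<lambda>w. rho w powr t * kdist z w powr (- 2 * s))"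
  using i not_integrable_integral_eq by fastforce
 hence "bint (\<lambda>w. rho w powr t * kdist z w powr (- 2 * s)) = ennreal (LINT w|lball. rho w powr t * kdist z w powr (- 2 * s))"
  by (rule nn_integral_eq_integral) simp
 thus ?thesis unfolding i .
qed

lemma kdist_ge_rho:
 assumes "norm z < 1" "norm w <= 1"
 shows "1 - norm z <= kdist z w" "rho z <= 2 * kdist z w"
proof -
 show 1: "1 - norm z <= kdist z w"
  using kdist_ge[of z w] mult_left_mono[OF assms(2), of "norm z"] by simp
 have "(1 - norm z)^2 >= 0" by simp
 hence "rho z <= 2 * (1 - norm z)" unfolding rho_def by (simp add: power2_eq_square algebra_simps)
 with 1 show "rho z <= 2 * kdist z w" by simp
qed

text \<open>Explicit, because \<open>schur_const\<close> combines several of these and has to be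
  fixed before any point or function. The last quotient sums a geometric series over dyadic shells;
  the powers of 4 come from the comparison on a shell and from the initial radius
  \<open>rho z / 4\<close>.\<close>

definition fr_const :: "'n::finite itself => real => real => real" where
 "fr_const _ t e = (let s = real CARD('n) + 1 + t; c = e - s in
  4 powr (s + \<bar>s - c\<bar>) * bmass TYPE('n) t * 4 powr c / (1 - 2 powr (- c)))"

text \<open>On the shell where \<open>kdist z w\<close> is comparable to \<open>r\<close>, the kernel at \<open>z\<close> is comparable to the
 one at \<open>(1 - r) *s z\<close>, whose square is integrated exactly by the reproducing formula.\<close>

lemma forelli_rudin:
 assumes t: "t > -1" and e: "e > real CARD('n::finite) + 1 + t"
 shows "fr_const TYPE('n) t e > 0" and "norm (z::complex^'n) < 1 ==>
  bint (\<lambda>w. rho w powr t * kdist z w powr (- e)) <= ennreal (fr_const TYPE('n) t e * rho z powr (real CARD('n) + 1 + t - e))"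
proof -
 define s where "s = real CARD('n) + 1 + t"
 define c where "c = e - s"
 have s: "s > 0" using t by (simp add: s_def add_pos_pos)
 have c: "c > 0" using e by (simp add: c_def s_def)
 define A where "A = bmass TYPE('n) t"
 have A: "A > 0" unfolding A_def by (rule bmass_pos[OF t])
 define q where "q = 2 powr (- c)"
 have q: "0 < q" "q < 1" using c by (auto simp: q_def powr_minus_divide)
 define B where "B = 4 powr (s + \<bar>s - c\<bar>)"
 define C where "C = B * A * 4 powr c / (1 - q)"
 have C: "fr_const TYPE('n) t e = C" unfolding fr_const_def Let_def C_def B_def A_def q_def c_def s_def by (rule refl)
 show "fr_const TYPE('n) t e > 0" unfolding C using A q by (simp add: C_def B_def)
 {assume z: "norm z < 1"
  \<comment> \<open>A quarter, because \<open>rho z <= 2 * kdist z w\<close>: in this unit every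
    \<open>w\<close> has \<open>kdist z w >= 2 * \<delta>\<close> and lies in a shell of index at
    least 0.\<close>
  define \<delta> where "\<delta> = rho z / 4"
  have d: "\<delta> > 0" using rho_pos[OF z] by (simp add: \<delta>_def)
  define r where "r k = 2 ^ k * \<delta>" for k :: nat
  have r: "r k > 0" for k using d by (simp add: r_def)
  define z' where "z' k = of_real (1 - r k) *s z" for k
  have z': "norm (z' k) < 1" "r k <= rho (z' k)" if "r k <= 1" for k
  proof -
   have "norm (z' k) = (1 - r k) * norm z" unfolding z'_def norm_vsmult norm_of_real using that by simp
   hence nz': "norm (z' k) <= 1 - r k" using z that mult_left_mono[of "norm z" 1 "1 - r k"] by simp
   thus 1: "norm (z' k) < 1" using r[of k] by linarith
   have "(norm (z' k))^2 <= norm (z' k) * 1" unfolding power2_eq_square using 1 by (intro mult_left_mono) auto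
   thus "r k <= rho (z' k)" unfolding rho_def using nz' by linarith
  qed
  \<comment> \<open>On a shell \<open>2 * r k <= kdist z w <= 2\<close>, so shells with
    \<open>r k > 1\<close> are empty; for them \<open>z' k\<close> may lie outside the ball.\<close>
  define a where "a k = (if r k <= 1 then B * r k powr (s - c) else 0)" for k
  have a: "a k >= 0" for k by (simp add: a_def B_def)
  let ?F = "\<lambda>k w. ennreal (a k) * ennreal (rho w powr t * kdist (z' k) w powr (- 2 * s))"
  have pw: "ennreal (rho w powr t * kdist z w powr (- e)) <= (\<Sum>k. ?F k w)" if w: "norm w < 1" for w
  proof -
   let ?D = "kdist z w"
   \<comment> \<open>The index of the shell of \<open>w\<close>; it gives
     \<open>2 * r k <= kdist z w <= 4 * r k\<close>.\<close>
   define k where "k = nat \<lfloor>log 2 (?D / (2 * \<delta>))\<rfloor>"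
   have q1: "?D / (2 * \<delta>) >= 1" using kdist_ge_rho(2)[OF z less_imp_le[OF w]] d by (simp add: \<delta>_def)
   hence "log 2 (?D / (2 * \<delta>)) >= 0" by simp
   hence k1: "real k <= log 2 (?D / (2 * \<delta>))" "log 2 (?D / (2 * \<delta>)) < real k + 1"
    unfolding k_def by (simp_all add: of_nat_nat)
   have "2 powr (real k) <= ?D / (2 * \<delta>)" using k1(1) q1 by (simp add: le_log_iff)
   hence lo: "2 * r k <= ?D" using d by (simp add: powr_realpow pos_le_divide_eq r_def mult_ac)
   have "?D / (2 * \<delta>) < 2 powr (real (Suc k))" using k1(2) q1 by (simp add: log_less_iff add.commute)
   hence "?D / (2 * \<delta>) < 2 ^ Suc k" by (simp only: powr_realpow zero_less_numeral)
   hence hi: "?D <= 4 * r k" using d by (simp add: pos_divide_less_eq r_def mult_ac)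
   have r1: "r k <= 1" using lo kdist_le_2[of z w] z w by simp
   have D0: "?D > 0" using lo r[of k] by linarith
   \<comment> \<open>Moving the centre from \<open>z\<close> to \<open>z' k\<close> changes
     \<open>1 - cdot z w\<close> by at most \<open>r k\<close>, that is, by at most half of
     \<open>kdist z w\<close>.\<close>
   have "1 - cdot (z' k) w = (1 - cdot z w) + of_real (r k) * cdot z w" by (simp add: z'_def algebra_simps)
   hence "kdist (z' k) w <= ?D + norm (of_real (r k) * cdot z w)" unfolding kdist_def using norm_triangle_ineq by metis
   also have "norm (of_real (r k) * cdot z w) <= r k * 1"
    unfolding norm_mult using r[of k] norm_cdot_lt[OF z, of w] w by (intro mult_mono) auto
   finally have "kdist (z' k) w <= 2 * ?D" using lo r[of k] by linarith
   hence "(2 * ?D) powr (- 2 * s) <= kdist (z' k) w powr (- 2 * s)"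
    using kdist_pos[OF z'(1)[OF r1], of w] w s by (intro powr_mono2') auto
   moreover have "(2 * ?D) powr (- 2 * s) = 4 powr (- s) * ?D powr (- 2 * s)"
    using D0 powr_powr[of 2 2 "- s"] by (simp add: powr_mult)
   ultimately have "4 powr s * (4 powr (- s) * ?D powr (- 2 * s)) <= 4 powr s * kdist (z' k) w powr (- 2 * s)"
    by (intro mult_left_mono) auto
   hence 1: "?D powr (- 2 * s) <= 4 powr s * kdist (z' k) w powr (- 2 * s)" by (simp add: powr_minus_divide)
   have 2: "?D powr (s - c) <= 4 powr \<bar>s - c\<bar> * r k powr (s - c)"
   proof (cases "s >= c")
    case True
    hence "?D powr (s - c) <= (4 * r k) powr (s - c)" using hi D0 by (intro powr_mono2) auto
    thus ?thesis using True r[of k] by (simp add: powr_mult)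
   next
    case False
    have "?D powr (s - c) <= r k powr (s - c)" using lo r[of k] False by (intro powr_mono2') auto
    also have "... <= 4 powr \<bar>s - c\<bar> * r k powr (s - c)" using ge_one_powr_ge_zero[of 4 "\<bar>s - c\<bar>"] by (simp add: mult_le_cancel_right1)
    finally show ?thesis .
   qed
   have "?D powr (- e) = ?D powr (- 2 * s) * ?D powr (s - c)" unfolding powr_add[symmetric] by (simp add: c_def)
   also have "... <= (4 powr s * kdist (z' k) w powr (- 2 * s)) * (4 powr \<bar>s - c\<bar> * r k powr (s - c))"
    by (intro mult_mono 1 2) auto
   also have "... = a k * kdist (z' k) w powr (- 2 * s)" using r1 by (simp add: a_def B_def powr_add)
   finally have "rho w powr t * ?D powr (- e) <= rho w powr t * (a k * kdist (z' k) w powr (- 2 * s))" by (rule mult_left_mono) simp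
   hence "ennreal (rho w powr t * ?D powr (- e)) <= ?F k w"
    using a by (simp add: mult.left_commute ennreal_leI flip: ennreal_mult)
   also have "... <= (\<Sum>k. ?F k w)" using sum_le_suminf[of "\<lambda>k. ?F k w" "{k}"] by simp
   finally show ?thesis .
  qed
  have I: "(\<integral>\<^sup>+w. ?F k w \<partial>lball) <= ennreal (B * A * \<delta> powr (- c) * q ^ k)" for k
  proof (cases "r k <= 1")
   case True
   have "(\<integral>\<^sup>+w. ?F k w \<partial>lball) = ennreal (a k) * ennreal (A * rho (z' k) powr (- s))"
    unfolding s_def A_def kdist_integral[OF t z'(1)[OF True], symmetric]
    by (intro nn_integral_cmult measurable_compose[OF _ measurable_ennreal] measurable_rho_kdist z' True)
   also have "... <= ennreal (a k) * ennreal (A * r k powr (- s))"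
    using z'(2)[OF True] r[of k] A s by (intro mult_left_mono ennreal_leI powr_mono2') auto
   also have "... = ennreal (B * A * (r k powr (s - c) * r k powr (- s)))"
    using True A by (simp add: a_def B_def mult_ac flip: ennreal_mult)
   \<comment> \<open>The total power of \<open>r k\<close> is \<open>- c\<close> with
     \<open>c > 0\<close>, so the shells form a geometric series with ratio
     \<open>q\<close>.\<close>
   also have "r k powr (s - c) * r k powr (- s) = \<delta> powr (- c) * q ^ k"
    unfolding powr_add[symmetric] using d by (simp add: r_def q_def powr_mult powr_powr mult.commute flip: powr_realpow)
   finally show ?thesis by (simp add: mult.assoc)
  qed (simp add: a_def)
  have m: "bmeas (?F k)" for k
  proof (cases "r k <= 1")
   case True
   thus ?thesis by (intro borel_measurable_times_ennreal measurable_compose[OF _ measurable_ennreal] measurable_rho_kdist z') auto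
  qed (simp add: a_def)
  have "bint (\<lambda>w. rho w powr t * kdist z w powr (- e)) <= (\<integral>\<^sup>+w. (\<Sum>k. ?F k w) \<partial>lball)"
   by (intro nn_integral_mono pw) simp
  also have "... = (\<Sum>k. (\<integral>\<^sup>+w. ?F k w \<partial>lball))" by (rule nn_integral_suminf[OF m])
  also have "... <= (\<Sum>k. ennreal (B * A * \<delta> powr (- c) * q ^ k))" by (intro suminf_le I summableI)
  also have "... = ennreal (\<Sum>k. B * A * \<delta> powr (- c) * q ^ k)"
   using q A by (intro suminf_ennreal2 summable_mult summable_geometric) (auto simp: B_def)
  also have "(\<Sum>k. B * A * \<delta> powr (- c) * q ^ k) = C * rho z powr (- c)"
   using q rho_pos[OF z] by (subst suminf_mult) (auto simp: suminf_geometric C_def \<delta>_def powr_divide powr_minus_divide)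
  also have "- c = real CARD('n) + 1 + t - e" by (simp add: c_def s_def)
  finally show "bint (\<lambda>w. rho w powr t * kdist z w powr (- e)) <= ennreal (fr_const TYPE('n) t e * rho z powr (real CARD('n) + 1 + t - e))"
   unfolding C .}
qed


section \<open>Hoelder's inequality and the Schur test\<close>

text \<open>Young's inequality, integrated with factors adapted to \<open>a\<close> and
  \<open>b\<close>. Prescribing positive bounds instead of norms keeps zero and infinite norms out
  of the argument.\<close>

lemma nn_integral_Hoelder:
 fixes f g :: "'x => real"
 assumes pq: "p > 1" "q > 1" "1 / p + 1 / q = 1"
  and m: "f \<in> borel_measurable M" "g \<in> borel_measurable M"
  and nn: "!!x. x \<in> space M ==> f x >= 0" "!!x. x \<in> space M ==> g x >= 0"
  and ab: "a > 0" "b > 0" "(\<integral>\<^sup>+x. ennreal (f x powr p) \<partial>M) <= ennreal (a powr p)"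
   "(\<integral>\<^sup>+x. ennreal (g x powr q) \<partial>M) <= ennreal (b powr q)"
 shows "(\<integral>\<^sup>+x. ennreal (f x * g x) \<partial>M) <= ennreal (a * b)"
proof -
 define A B where "A = a * b / (p * a powr p)" and "B = a * b / (q * b powr q)"
 have AB: "A >= 0" "B >= 0" using pq ab by (auto simp: A_def B_def)
 have y: "f x * g x <= A * f x powr p + B * g x powr q" if "x \<in> space M" for x
 proof -
  have "(f x / a) * (g x / b) <= (f x / a) powr p / p + (g x / b) powr q / q"
   by (rule Youngs_inequality) (use pq nn that ab in auto)
  hence "a * b * ((f x / a) * (g x / b)) <= a * b * ((f x / a) powr p / p + (g x / b) powr q / q)"
   using ab by (intro mult_left_mono) auto
  also have "a * b * ((f x / a) * (g x / b)) = f x * g x" using ab by simp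
  also have "a * b * ((f x / a) powr p / p + (g x / b) powr q / q) = A * f x powr p + B * g x powr q"
   using nn that ab by (simp add: A_def B_def powr_divide distrib_left mult.commute[of p] mult.commute[of q])
  finally show ?thesis .
 qed
 have "(\<integral>\<^sup>+x. ennreal (f x * g x) \<partial>M) <= (\<integral>\<^sup>+x. ennreal A * ennreal (f x powr p) + ennreal B * ennreal (g x powr q) \<partial>M)"
 proof (rule nn_integral_mono)
  fix x assume x: "x \<in> space M"
  have "ennreal (f x * g x) <= ennreal (A * f x powr p + B * g x powr q)" by (rule ennreal_leI[OF y[OF x]])
  also have "... = ennreal A * ennreal (f x powr p) + ennreal B * ennreal (g x powr q)"
   using AB by (simp add: ennreal_plus ennreal_mult)
  finally show "ennreal (f x * g x) <= ennreal A * ennreal (f x powr p) + ennreal B * ennreal (g x powr q)" .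
 qed
 also have "... = ennreal A * (\<integral>\<^sup>+x. ennreal (f x powr p) \<partial>M) + ennreal B * (\<integral>\<^sup>+x. ennreal (g x powr q) \<partial>M)"
  using m by (simp add: nn_integral_add nn_integral_cmult)
 also have "... <= ennreal A * ennreal (a powr p) + ennreal B * ennreal (b powr q)"
  using ab by (intro add_mono mult_left_mono) auto
 also have "... = ennreal (A * a powr p + B * b powr q)" using AB by (simp add: ennreal_plus ennreal_mult)
 also have "A * a powr p + B * b powr q = a * b * (1 / p + 1 / q)" using ab pq(1,2) by (simp add: A_def B_def distrib_left)
 finally show ?thesis unfolding pq(3) by simp
qed

text \<open>The integrand is split as (Q^(1/q') H) (Q^(1/q) G / H). Hoelder and the first condition
  bound u^q by K H^q times the integral of Q G^q H^(-q); Fubini's theorem and the second condition,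
  which carries the weight \<open>\<omega>\<close>, finish.\<close>

lemma schur_test:
 fixes Q :: "'x => 'x => real"
 assumes M: "sigma_finite_measure M" and Q: "(\<lambda>p. Q (fst p) (snd p)) \<in> borel_measurable (M \<Otimes>\<^sub>M M)"
  "!!z w. z \<in> space M ==> w \<in> space M ==> Q z w >= 0"
  and G: "G \<in> borel_measurable M" "!!z. z \<in> space M ==> G z >= 0"
  and H: "H \<in> borel_measurable M" "!!z. z \<in> space M ==> H z > 0"
  and \<omega>: "\<omega> \<in> borel_measurable M" "!!z. z \<in> space M ==> \<omega> z >= 0"
  and q: "q' > 1" "q > 1" "1 / q' + 1 / q = 1" and C: "C1 > 0" "C2 >= 0"
  and 1: "!!z. z \<in> space M ==> (\<integral>\<^sup>+w. ennreal (Q z w * H w powr q') \<partial>M) <= ennreal (C1 * H z powr q')"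
  and 2: "!!w. w \<in> space M ==> (\<integral>\<^sup>+z. ennreal (Q z w * H z powr q * \<omega> z) \<partial>M) <= ennreal (C2 * H w powr q * \<omega> w)"
  and u: "!!z. z \<in> space M ==> u z >= 0" "!!z. z \<in> space M ==> ennreal (u z) <= (\<integral>\<^sup>+w. ennreal (Q z w * G w) \<partial>M)"
 shows "(\<integral>\<^sup>+z. ennreal (\<omega> z * u z powr q) \<partial>M) <= ennreal (C1 powr (q / q') * C2) * (\<integral>\<^sup>+w. ennreal (\<omega> w * G w powr q) \<partial>M)"
proof -
 interpret M: sigma_finite_measure M by fact
 interpret P: pair_sigma_finite M M by standard
 define K where "K = C1 powr (q / q')"
 have K: "K > 0" using C by (simp add: K_def)
 define L where "L w = G w powr q * H w powr (- q)" for w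
 have Lm: "L \<in> borel_measurable M" unfolding L_def using G(1) H(1) by measurable
 have L0: "L w >= 0" for w by (simp add: L_def)
 have Qz: "Q z \<in> borel_measurable M" if "z \<in> space M" for z
  using measurable_compose_Pair1[OF that Q(1)] by simp
 define J where "J z = (\<integral>\<^sup>+w. ennreal (Q z w * L w) \<partial>M)" for z
 have pw: "ennreal (u z powr q) <= ennreal (K * H z powr q) * J z" if z: "z \<in> space M" for z
 proof (cases "J z")
  case top
  thus ?thesis using K H(2)[OF z] by (simp add: ennreal_mult_top)
 next
  case (real j)
  define a where "a = C1 powr (1 / q') * H z"
  have a: "a > 0" using C H(2)[OF z] by (simp add: a_def)
  have aq: "a powr q = K * H z powr q" "a powr q' = C1 * H z powr q'"
   using C H(2)[OF z] q by (simp_all add: a_def K_def powr_mult powr_powr)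
  have "u z powr q <= a powr q * j + e" if e: "e > 0" for e
  proof -
   \<comment> \<open>\<open>nn_integral_Hoelder\<close> takes strictly positive bounds and
     \<open>j\<close> may be 0; the excess disappears in \<open>field_le_epsilon\<close>.\<close>
   define j' where "j' = j + e / a powr q"
   have j': "j' > 0" using real(1) e a unfolding j'_def by (intro add_nonneg_pos divide_pos_pos) auto
   have "(\<integral>\<^sup>+w. ennreal ((Q z w powr (1 / q') * H w) * (Q z w powr (1 / q) * (G w / H w))) \<partial>M) <= ennreal (a * j' powr (1 / q))"
   proof (rule nn_integral_Hoelder[OF q])
    show "(\<lambda>w. Q z w powr (1 / q') * H w) \<in> borel_measurable M" "(\<lambda>w. Q z w powr (1 / q) * (G w / H w)) \<in> borel_measurable M"
     using Qz[OF z] G(1) H(1) by measurable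
    have "(\<integral>\<^sup>+w. ennreal ((Q z w powr (1 / q') * H w) powr q') \<partial>M) = (\<integral>\<^sup>+w. ennreal (Q z w * H w powr q') \<partial>M)"
     using q by (intro nn_integral_cong) (simp add: powr_mult powr_powr Q(2) z H(2) less_imp_le)
    also have "... <= ennreal (a powr q')" using 1[OF z] by (simp add: aq)
    finally show "(\<integral>\<^sup>+w. ennreal ((Q z w powr (1 / q') * H w) powr q') \<partial>M) <= ennreal (a powr q')" .
    have "(\<integral>\<^sup>+w. ennreal ((Q z w powr (1 / q) * (G w / H w)) powr q) \<partial>M) = J z"
     unfolding J_def L_def using q
     by (intro nn_integral_cong) (simp add: powr_mult powr_powr Q(2) z H(2) G(2) less_imp_le powr_divide powr_minus_divide)
    also have "... <= ennreal j'" unfolding real(2) j'_def using e a by (intro ennreal_leI) simp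
    also have "j' = (j' powr (1 / q)) powr q" using j' q by (simp add: powr_powr)
    finally show "(\<integral>\<^sup>+w. ennreal ((Q z w powr (1 / q) * (G w / H w)) powr q) \<partial>M) <= ennreal ((j' powr (1 / q)) powr q)" .
   qed (use a j' Q(2) z H(2)[THEN less_imp_le] G(2) in \<open>auto intro!: mult_nonneg_nonneg divide_nonneg_nonneg\<close>)
   also have "(\<integral>\<^sup>+w. ennreal ((Q z w powr (1 / q') * H w) * (Q z w powr (1 / q) * (G w / H w))) \<partial>M) = (\<integral>\<^sup>+w. ennreal (Q z w * G w) \<partial>M)"
   proof (intro nn_integral_cong arg_cong[where f=ennreal])
    fix w assume w: "w \<in> space M"
    have "Q z w powr (1 / q') * Q z w powr (1 / q) = Q z w" using q(3) Q(2)[OF z w] by (simp flip: powr_add)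
    thus "Q z w powr (1 / q') * H w * (Q z w powr (1 / q) * (G w / H w)) = Q z w * G w"
     using H(2)[OF w] by (simp add: mult.assoc[symmetric] mult.commute[of _ "H w"])
   qed
   finally have "ennreal (u z) <= ennreal (a * j' powr (1 / q))" using u(2)[OF z] order_trans by blast
   hence "u z <= a * j' powr (1 / q)" using a j' by (subst (asm) ennreal_le_iff) auto
   hence "u z powr q <= (a * j' powr (1 / q)) powr q" using u(1)[OF z] q by (intro powr_mono2) auto
   also have "... = a powr q * j'" using a j' q by (simp add: powr_mult powr_powr)
   also have "... = a powr q * j + e" using a by (simp add: j'_def distrib_left)
   finally show ?thesis .
  qed
  hence "u z powr q <= a powr q * j" by (rule field_le_epsilon)
  hence "ennreal (u z powr q) <= ennreal (a powr q * j)" by (rule ennreal_leI)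
  thus ?thesis unfolding real(2) aq using K real(1) by (simp add: ennreal_mult)
 qed
 have "(\<integral>\<^sup>+z. ennreal (\<omega> z * u z powr q) \<partial>M) <= (\<integral>\<^sup>+z. (\<integral>\<^sup>+w. ennreal (\<omega> z * (K * H z powr q)) * ennreal (Q z w * L w) \<partial>M) \<partial>M)"
 proof (rule nn_integral_mono)
  fix z assume z: "z \<in> space M"
  have "ennreal (\<omega> z * u z powr q) = ennreal (\<omega> z) * ennreal (u z powr q)" using \<omega>(2)[OF z] by (simp add: ennreal_mult)
  also have "... <= ennreal (\<omega> z) * (ennreal (K * H z powr q) * J z)" by (intro mult_left_mono pw z) simp
  also have "... = ennreal (\<omega> z * (K * H z powr q)) * J z" using \<omega>(2)[OF z] K by (simp add: ennreal_mult mult.assoc)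
  also have "... = (\<integral>\<^sup>+w. ennreal (\<omega> z * (K * H z powr q)) * ennreal (Q z w * L w) \<partial>M)"
   unfolding J_def using Qz[OF z] Lm by (subst nn_integral_cmult) auto
  finally show "ennreal (\<omega> z * u z powr q) <= (\<integral>\<^sup>+w. ennreal (\<omega> z * (K * H z powr q)) * ennreal (Q z w * L w) \<partial>M)" .
 qed
 also have "... = (\<integral>\<^sup>+w. (\<integral>\<^sup>+z. ennreal (\<omega> z * (K * H z powr q)) * ennreal (Q z w * L w) \<partial>M) \<partial>M)"
 proof (rule P.Fubini'[symmetric])
  have f: "f \<in> borel_measurable M ==> (\<lambda>p. f (fst p)) \<in> borel_measurable (M \<Otimes>\<^sub>M M)"
   "f \<in> borel_measurable M ==> (\<lambda>p. f (snd p)) \<in> borel_measurable (M \<Otimes>\<^sub>M M)" for f :: "'x => real"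
   by (rule measurable_compose[OF measurable_fst], assumption) (rule measurable_compose[OF measurable_snd], assumption)
  show "(\<lambda>(w, z). ennreal (\<omega> w * (K * H w powr q)) * ennreal (Q w z * L z)) \<in> borel_measurable (M \<Otimes>\<^sub>M M)"
   unfolding case_prod_beta' using f(1)[OF \<omega>(1)] f(1)[OF H(1)] f(2)[OF Lm] Q(1) by measurable
 qed
 also have "... <= (\<integral>\<^sup>+w. ennreal (K * C2) * ennreal (\<omega> w * G w powr q) \<partial>M)"
 proof (rule nn_integral_mono)
  fix w assume w: "w \<in> space M"
  have Qw: "(\<lambda>z. Q z w) \<in> borel_measurable M"
   using measurable_compose[OF measurable_Pair2'[OF w] Q(1)] by simp
  have "(\<integral>\<^sup>+z. ennreal (\<omega> z * (K * H z powr q)) * ennreal (Q z w * L w) \<partial>M)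
   = (\<integral>\<^sup>+z. ennreal (K * L w) * ennreal (Q z w * H z powr q * \<omega> z) \<partial>M)"
  proof (rule nn_integral_cong)
   fix z assume z: "z \<in> space M"
   show "ennreal (\<omega> z * (K * H z powr q)) * ennreal (Q z w * L w) = ennreal (K * L w) * ennreal (Q z w * H z powr q * \<omega> z)"
    using \<omega>(2)[OF z] K L0 Q(2)[OF z w] by (simp flip: ennreal_mult)
  qed
  also have "... = ennreal (K * L w) * (\<integral>\<^sup>+z. ennreal (Q z w * H z powr q * \<omega> z) \<partial>M)"
   using Qw H(1) \<omega>(1) by (subst nn_integral_cmult) auto
  also have "... <= ennreal (K * L w) * ennreal (C2 * H w powr q * \<omega> w)" by (intro mult_left_mono 2 w) simp
  also have "... = ennreal (K * C2 * (\<omega> w * G w powr q * (H w powr (- q) * H w powr q)))"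
   using K C L0[of w] \<omega>(2)[OF w] by (simp flip: ennreal_mult) (simp add: L_def mult_ac)
  also have "H w powr (- q) * H w powr q = 1" using H(2)[OF w] by (simp flip: powr_add)
  finally show "(\<integral>\<^sup>+z. ennreal (\<omega> z * (K * H z powr q)) * ennreal (Q z w * L w) \<partial>M) <= ennreal (K * C2) * ennreal (\<omega> w * G w powr q)"
   using K C \<omega>(2)[OF w] by (simp add: ennreal_mult)
 qed
 also have "... = ennreal (K * C2) * (\<integral>\<^sup>+w. ennreal (\<omega> w * G w powr q) \<partial>M)"
  using \<omega>(1) G(1) by (subst nn_integral_cmult) auto
 finally show ?thesis by (simp add: K_def)
qed

definition schur_const :: "'n::finite itself => real => real => real => real => real => real => real" where
 "schur_const T \<beta> \<tau> k \<sigma> q q' = (let F = \<lambda>t. fr_const T t (real CARD('n) + 1 + \<tau> - k) in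
  (F (\<tau> - \<sigma> * q') + F (\<tau> - k - \<sigma> * q')) powr (q / q') * (F (\<beta> - k - \<sigma> * q) + F (\<beta> - \<sigma> * q)))"

text \<open>With exponent \<open>e = n + 1 + \<tau> - k\<close> of \<open>kdist\<close> the kernel is homogeneous of the right degree; the
 Schur test function is \<open>rho powr - \<sigma>\<close>.\<close>

lemma bergman_schur:
 fixes G u :: "complex^'n => real"
 assumes q: "q > 1" "q' > 1" "1 / q + 1 / q' = 1" and k: "k >= 0" and \<sigma>: "\<sigma> > 0" "\<sigma> * q' > k" "k + \<sigma> * q < \<beta> + 1"
  and \<tau>: "\<tau> > k + \<sigma> * q' - 1" "\<tau> > \<beta> + k - \<sigma> * q"
 shows "schur_const TYPE('n) \<beta> \<tau> k \<sigma> q q' > 0" and "bmeas G ==> (!!w. norm w < 1 ==> G w >= 0) ==> (!!w. norm w < 1 ==> u w >= 0) ==>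
  (!!z. norm z < 1 ==> ennreal (u z) <= bint (\<lambda>w. kdist z w powr (k - (real CARD('n) + 1 + \<tau>)) * (rho z powr (- k) + rho w powr (- k)) * rho w powr \<tau> * G w)) ==>
  bint (\<lambda>z. rho z powr \<beta> * u z powr q) <= ennreal (schur_const TYPE('n) \<beta> \<tau> k \<sigma> q q') * bint (\<lambda>w. rho w powr \<beta> * G w powr q)"
proof -
 let ?n = "real CARD('n)"
 let ?B = "lball :: (complex^'n) measure"
 define e where "e = ?n + 1 + \<tau> - k"
 define Q where "Q z w = kdist z w powr (- e) * (rho z powr (- k) + rho w powr (- k)) * rho w powr \<tau>" for z w :: "complex^'n"
 define H where "H w = rho w powr (- \<sigma>)" for w :: "complex^'n"
 have sq: "\<sigma> * q > 0" "\<sigma> * q' > 0" using \<sigma> q by auto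
 \<comment> \<open>Two summands of \<open>Q\<close> in each of two Schur conditions make four
   Forelli-Rudin integrals; their hypotheses are what the inequalities on \<open>\<sigma>\<close>
   and \<open>\<tau>\<close> encode.\<close>
 have fr: "\<tau> - \<sigma> * q' > -1" "e > ?n + 1 + (\<tau> - \<sigma> * q')" "\<tau> - k - \<sigma> * q' > -1" "e > ?n + 1 + (\<tau> - k - \<sigma> * q')"
  "\<beta> - k - \<sigma> * q > -1" "e > ?n + 1 + (\<beta> - k - \<sigma> * q)" "\<beta> - \<sigma> * q > -1" "e > ?n + 1 + (\<beta> - \<sigma> * q)"
  using \<sigma> \<tau> k sq by (auto simp: e_def)
 define a1 a2 b1 b2 where ab: "a1 = fr_const TYPE('n) (\<tau> - \<sigma> * q') e" "a2 = fr_const TYPE('n) (\<tau> - k - \<sigma> * q') e"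
  "b1 = fr_const TYPE('n) (\<beta> - k - \<sigma> * q) e" "b2 = fr_const TYPE('n) (\<beta> - \<sigma> * q) e"
 note a1 = forelli_rudin[OF fr(1,2), folded ab] and a2 = forelli_rudin[OF fr(3,4), folded ab]
 note b1 = forelli_rudin[OF fr(5,6), folded ab] and b2 = forelli_rudin[OF fr(7,8), folded ab]
 have comb: "bint (\<lambda>w. x * (rho w powr t1 * kdist z w powr (- e)) + y * (rho w powr t2 * kdist z w powr (- e))) <= ennreal (x * c1 + y * c2)"
  if "norm z < 1" "x >= 0" "y >= 0" "c1 >= 0" "c2 >= 0"
   "bint (\<lambda>w. rho w powr t1 * kdist z w powr (- e)) <= ennreal c1"
   "bint (\<lambda>w. rho w powr t2 * kdist z w powr (- e)) <= ennreal c2" for x y c1 c2 t1 t2 and z :: "complex^'n"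
  unfolding bint_lincomb[OF that(2,3) measurable_rho_kdist[OF that(1)] measurable_rho_kdist[OF that(1)] mult_nonneg_nonneg[OF powr_ge_zero powr_ge_zero] mult_nonneg_nonneg[OF powr_ge_zero powr_ge_zero]]
  using that by (simp add: ennreal_plus ennreal_mult add_mono mult_left_mono)
 have pw: "rho z powr x * rho z powr y = rho z powr (x + y)" for z :: "complex^'n" and x y by (simp add: powr_add)
 have S1: "bint (\<lambda>w. Q z w * H w powr q') <= ennreal ((a1 + a2) * H z powr q')" if z: "norm z < 1" for z
 proof -
  have "Q z w * H w powr q' = rho z powr (- k) * (rho w powr (\<tau> - \<sigma> * q') * kdist z w powr (- e)) + 1 * (rho w powr (\<tau> - k - \<sigma> * q') * kdist z w powr (- e))" for w
  proof -
   have "H w powr q' = rho w powr (- (\<sigma> * q'))" by (simp add: H_def powr_powr)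
   moreover have "rho w powr (\<tau> - \<sigma> * q') = rho w powr \<tau> * rho w powr (- (\<sigma> * q'))" by (simp add: pw)
   moreover have "rho w powr (\<tau> - k - \<sigma> * q') = rho w powr (- k) * rho w powr \<tau> * rho w powr (- (\<sigma> * q'))" by (simp add: pw algebra_simps)
   ultimately show ?thesis unfolding Q_def by (simp only: distrib_left distrib_right mult_1_left mult_ac)
  qed
  hence "bint (\<lambda>w. Q z w * H w powr q') <= ennreal (rho z powr (- k) * (a1 * rho z powr (?n + 1 + (\<tau> - \<sigma> * q') - e)) + 1 * (a2 * rho z powr (?n + 1 + (\<tau> - k - \<sigma> * q') - e)))"
   using a1 a2 z by (simp only:) (intro comb, auto)
  also have "rho z powr (- k) * (a1 * rho z powr (?n + 1 + (\<tau> - \<sigma> * q') - e)) + 1 * (a2 * rho z powr (?n + 1 + (\<tau> - k - \<sigma> * q') - e)) = (a1 + a2) * H z powr q'"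
   unfolding e_def H_def powr_powr mult.left_commute[of _ a1] pw by (simp add: algebra_simps)
  finally show ?thesis .
 qed
 have S2: "bint (\<lambda>z. Q z w * H z powr q * rho z powr \<beta>) <= ennreal ((b1 + b2) * H w powr q * rho w powr \<beta>)" if w: "norm w < 1" for w
 proof -
  have "Q z w * H z powr q * rho z powr \<beta> = rho w powr \<tau> * (rho z powr (\<beta> - k - \<sigma> * q) * kdist w z powr (- e)) + rho w powr (\<tau> - k) * (rho z powr (\<beta> - \<sigma> * q) * kdist w z powr (- e))" for z
  proof -
   have "H z powr q = rho z powr (- (\<sigma> * q))" by (simp add: H_def powr_powr)
   moreover have "rho z powr (\<beta> - \<sigma> * q) = rho z powr \<beta> * rho z powr (- (\<sigma> * q))" by (simp add: pw)
   moreover have "rho z powr (\<beta> - k - \<sigma> * q) = rho z powr (- k) * rho z powr \<beta> * rho z powr (- (\<sigma> * q))" by (simp add: pw algebra_simps)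
   moreover have "rho w powr (\<tau> - k) = rho w powr \<tau> * rho w powr (- k)" by (simp add: pw)
   ultimately show ?thesis unfolding Q_def kdist_commute[of z w] by (simp only: distrib_left distrib_right mult_ac)
  qed
  hence "bint (\<lambda>z. Q z w * H z powr q * rho z powr \<beta>) <= ennreal (rho w powr \<tau> * (b1 * rho w powr (?n + 1 + (\<beta> - k - \<sigma> * q) - e)) + rho w powr (\<tau> - k) * (b2 * rho w powr (?n + 1 + (\<beta> - \<sigma> * q) - e)))"
   using b1 b2 w by (simp only:) (intro comb, auto)
  also have "rho w powr \<tau> * (b1 * rho w powr (?n + 1 + (\<beta> - k - \<sigma> * q) - e)) + rho w powr (\<tau> - k) * (b2 * rho w powr (?n + 1 + (\<beta> - \<sigma> * q) - e)) = (b1 + b2) * H w powr q * rho w powr \<beta>"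
   unfolding e_def H_def powr_powr mult.left_commute[of _ b1] mult.left_commute[of _ b2] mult.assoc pw by (simp add: algebra_simps)
  finally show ?thesis .
 qed
 have C: "schur_const TYPE('n) \<beta> \<tau> k \<sigma> q q' = (a1 + a2) powr (q / q') * (b1 + b2)"
  by (simp add: schur_const_def ab e_def)
 show "schur_const TYPE('n) \<beta> \<tau> k \<sigma> q q' > 0" unfolding C using a1(1) a2(1) b1(1) b2(1) by simp
 {assume G: "bmeas G" "!!w. norm w < 1 ==> G w >= 0" and u: "!!w. norm w < 1 ==> u w >= 0"
   "!!z. norm z < 1 ==> ennreal (u z) <= bint (\<lambda>w. kdist z w powr (k - (?n + 1 + \<tau>)) * (rho z powr (- k) + rho w powr (- k)) * rho w powr \<tau> * G w)"
  show "bint (\<lambda>z. rho z powr \<beta> * u z powr q) <= ennreal (schur_const TYPE('n) \<beta> \<tau> k \<sigma> q q') * bint (\<lambda>w. rho w powr \<beta> * G w powr q)"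
   unfolding C
  proof (rule schur_test[where Q=Q and H=H])
   show "sigma_finite_measure ?B" using finite_measure_lball finite_measure.axioms(1) by blast
   have r: "(\<lambda>p. rho (fst p) powr x) \<in> borel_measurable (?B \<Otimes>\<^sub>M ?B)" "(\<lambda>p. rho (snd p) powr x) \<in> borel_measurable (?B \<Otimes>\<^sub>M ?B)" for x
    by (rule measurable_compose[OF measurable_fst measurable_rho_powr]) (rule measurable_compose[OF measurable_snd measurable_rho_powr])
   have kp: "(\<lambda>p. kdist (fst p) (snd p) powr (- e)) \<in> borel_measurable (?B \<Otimes>\<^sub>M ?B)"
    by (rule measurable_compose[OF measurable_kdist_pair]) simp
   show "(\<lambda>p. Q (fst p) (snd p)) \<in> borel_measurable (?B \<Otimes>\<^sub>M ?B)"
    unfolding Q_def by (intro borel_measurable_times borel_measurable_add r kp)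
   show "bmeas H" "bmeas (\<lambda>z. rho z powr \<beta>)" unfolding H_def by (rule measurable_rho_powr)+
   show "ennreal (u z) <= bint (\<lambda>w. Q z w * G w)" if "z \<in> space ?B" for z
    using u(2)[of z] that by (simp add: Q_def e_def)
   show "1 / q' + 1 / q = 1" using q(3) by simp
   show "H z > 0" if "z \<in> space ?B" for z using rho_pos[of z] that by (simp add: H_def)
   show "Q z w >= 0" for z w by (simp add: Q_def)
  qed (use q(1,2) G u(1) a1(1) a2(1) b1(1) b2(1) S1 S2 in auto)}
qed


section \<open>Nonisotropic Lipschitz estimates for Bloch functions\<close>

lemma norm_diff_sq_le_kdist:
 assumes "norm z <= 1" "norm w <= 1"
 shows "(norm (z - w))^2 <= 2 * kdist z w"
proof -
 have "1 - Re (cdot z w) <= kdist z w" unfolding kdist_def using complex_Re_le_cmod[of "1 - cdot z w"] by simp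
 moreover have "(norm z)^2 <= 1" "(norm w)^2 <= 1" using assms by (simp_all add: power_le_one)
 ultimately show ?thesis unfolding norm_diff_sq by linarith
qed

text \<open>The anisotropy exponent: \<open>|z - w|\<close> is of order \<open>kdist z w powr e\<close> with \<open>e = 1\<close> in dimension 1 and
 \<open>e = 1/2\<close> otherwise.\<close>

definition aniso :: "'n::finite itself => real" where
 "aniso _ = (if CARD('n) = 1 then 1 else 1 / 2)"

lemma aniso_bounds: "1 / 2 <= aniso TYPE('n::finite)" "aniso TYPE('n) <= 1" "0 < aniso TYPE('n)"
 by (auto simp: aniso_def)

text \<open>From |1 - z w'|^2 - |z - w|^2 = (1 - |z|^2)(1 - |w|^2), where w' is the conjugate of w;
  this identity is peculiar to dimension one.\<close>

lemma norm_diff_le_kdist1: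
 fixes z w :: "complex^'n"
 assumes "CARD('n) = 1" "norm z < 1" "norm w < 1"
 shows "norm (z - w) <= kdist z w"
proof -
 obtain j :: 'n where j: "UNIV = {j}" using assms(1) card_1_singletonE by blast
 have nj: "norm v = norm (v $ j)" for v :: "complex^'n" unfolding norm_vec_def by (simp add: j)
 have c: "cdot z w = z $ j * cnj (w $ j)" by (simp add: cdot_def j)
 have "complex_of_real ((norm (1 - z $ j * cnj (w $ j)))^2) - of_real ((norm (z $ j - w $ j))^2)
  = (1 - of_real ((norm (z $ j))^2)) * (1 - of_real ((norm (w $ j))^2))"
  by (simp only: complex_norm_square complex_cnj_diff complex_cnj_mult complex_cnj_cnj complex_cnj_one) (simp add: algebra_simps)
 hence "complex_of_real ((norm (1 - z $ j * cnj (w $ j)))^2 - (norm (z $ j - w $ j))^2) = of_real ((1 - (norm (z $ j))^2) * (1 - (norm (w $ j))^2))"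
  by simp
 hence "(norm (1 - z $ j * cnj (w $ j)))^2 - (norm (z $ j - w $ j))^2 = (1 - (norm (z $ j))^2) * (1 - (norm (w $ j))^2)"
  using of_real_eq_iff by blast
 also have "... >= 0" using assms(2,3) unfolding nj by (intro mult_nonneg_nonneg) (simp_all add: power_le_one)
 finally have "(norm (z $ j - w $ j))^2 <= (norm (1 - z $ j * cnj (w $ j)))^2" by simp
 hence "norm (z $ j - w $ j) <= norm (1 - z $ j * cnj (w $ j))" by (rule power2_le_imp_le) simp
 thus ?thesis unfolding kdist_def c nj by simp
qed

lemma norm_diff_le_kdist:
 fixes z w :: "complex^'n"
 assumes "norm z < 1" "norm w < 1"
 shows "norm (z - w) <= 2 * kdist z w powr aniso TYPE('n)"
proof (cases "CARD('n) = 1")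
 case True
 thus ?thesis
  using norm_diff_le_kdist1[OF True assms] kdist_pos[of z w] assms by (simp add: aniso_def)
next
 case False
 have k: "kdist z w > 0" using kdist_pos[of z w] assms by simp
 have "norm (z - w) <= sqrt (2 * kdist z w)"
  using norm_diff_sq_le_kdist[of z w] assms by (intro real_le_rsqrt) simp
 also have "... <= sqrt (2^2 * kdist z w)" using k by (intro real_sqrt_le_mono) simp
 also have "... = 2 * kdist z w powr (1 / 2)" using k by (simp only: real_sqrt_mult real_sqrt_abs powr_half_sqrt less_imp_le)
 finally show ?thesis using False by (simp add: aniso_def)
qed

lemma holo_ray_vector_derivative:
 assumes "holo_on S f" "of_real t *s z \<in> S"
 shows "((\<lambda>t::real. f (of_real t *s z)) has_vector_derivative dir z f (of_real t *s z)) (at t)"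
proof -
 have "((\<lambda>t. f (t *s z)) has_field_derivative dir z f (of_real t *s z)) (at (of_real t))"
  using slice_holo_DERIV[OF assms(1), of 0 "of_real t" z] assms(2) by simp
 moreover have "((of_real :: real => complex) has_vector_derivative 1) (at t)"
  unfolding has_vector_derivative_def of_real_def
  by (rule bounded_linear_imp_has_derivative, rule bounded_linear_scaleR_left)
 ultimately have "((\<lambda>t. f (t *s z)) \<circ> of_real has_vector_derivative 1 * dir z f (of_real t *s z)) (at t)"
  using field_vector_diff_chain_at by blast
 thus ?thesis by (simp add: o_def)
qed

lemma norm_ray: "norm z < 1 ==> 0 <= t ==> t <= 1 ==> norm (complex_of_real t *s z) < 1"
 using mult_right_mono[of t 1 "norm z"] by (simp add: norm_vsmult)

lemma DERIV_one_minus_powr: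
 fixes t a :: real
 assumes "t < 1"
 shows "((\<lambda>t. (1 - t) powr a) has_real_derivative - a * (1 - t) powr (a - 1)) (at t)"
proof -
 have "((\<lambda>t. (1 - t) powr a) has_real_derivative (a * (1 - t) powr (a - 1)) * (0 - 1)) (at t)"
  by (rule DERIV_chain2[where f="\<lambda>x. x powr a" and g="\<lambda>t. 1 - t"], rule has_real_derivative_powr)
   (use assms in \<open>auto intro!: derivative_eq_intros\<close>)
 thus ?thesis by simp
qed

text \<open>Along the ray the exponent - (1 + \<gamma>) of rho(t z) is split into - (\<gamma> +
  \<theta>) and \<theta> - 1. The first power is estimated through rho(t z) >= rho(z), the second
  through rho(t z) >= 1 - t, which leaves a power integrable up to t = 1.\<close>

lemma radial_estimate:
 fixes f :: "'n::finite cfun"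
 assumes f: "holo_on (ball 0 1) f"
  and B: "!!z v. norm z < 1 ==> norm (dir v f z) <= N * norm v * rho z powr (- (1 + \<gamma>))"
  and p: "N >= 0" "\<theta> > 0" "\<theta> <= 1" "\<gamma> + \<theta> >= 0" and z: "norm z < 1" and a: "0 <= a" "a <= 1"
 shows "norm (f z - f (of_real (1 - a) *s z)) <= N / \<theta> * rho z powr (- (\<gamma> + \<theta>)) * a powr \<theta>"
proof (cases "a = 0")
 case True
 thus ?thesis by simp
next
 case False
 let ?k = "\<gamma> + \<theta>"
 let ?u = "\<lambda>t::real. f (of_real t *s z)"
 have in_ball: "of_real t *s z \<in> ball 0 1" if "0 <= t" "t <= 1" for t :: real
  using norm_ray[OF z that] by simp
 have D: "(?u has_vector_derivative dir z f (of_real t *s z)) (at t)" if "0 <= t" "t <= 1" for t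
  by (rule holo_ray_vector_derivative[OF f in_ball[OF that]])
 let ?\<phi> = "\<lambda>t. - (N / \<theta> * rho z powr (- ?k)) * (1 - t) powr \<theta>"
 have "norm (?u 1 - ?u (1 - a)) <= ?\<phi> 1 - ?\<phi> (1 - a)"
 proof (rule differentiable_bound_general)
  show "1 - a < 1" using False a by simp
  show "continuous_on {1 - a..1} ?u"
   using a by (intro continuous_at_imp_continuous_on ballI has_vector_derivative_continuous[OF D]) auto
  show "continuous_on {1 - a..1} ?\<phi>"
   using p by (intro continuous_intros continuous_on_powr') auto
  fix t assume t: "1 - a < t" "t < 1"
  hence t01: "0 <= t" "t <= 1" using a by auto
  show "(?u has_vector_derivative dir z f (of_real t *s z)) (at t)" by (rule D[OF t01])
  have "(?\<phi> has_real_derivative - (N / \<theta> * rho z powr (- ?k)) * (- \<theta> * (1 - t) powr (\<theta> - 1))) (at t)"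
   by (rule DERIV_cmult[OF DERIV_one_minus_powr[OF t(2)]])
  hence "(?\<phi> has_real_derivative N * rho z powr (- ?k) * (1 - t) powr (\<theta> - 1)) (at t)"
   using p by (simp add: mult.assoc)
  thus "(?\<phi> has_vector_derivative N * rho z powr (- ?k) * (1 - t) powr (\<theta> - 1)) (at t)"
   by (simp add: has_real_derivative_iff_has_vector_derivative)
  let ?r = "rho (of_real t *s z)"
  have r1: "rho z <= ?r" by (rule rho_dilate[OF t01])
  have r2: "1 - t <= ?r"
  proof -
   have "(norm (of_real t *s z))^2 <= t"
   proof -
    have "norm (of_real t *s z) <= t * 1" using z t01 unfolding norm_vsmult by (intro mult_mono) auto
    hence "(norm (of_real t *s z))^2 <= (t * 1)^2" by (intro power_mono) auto
    also have "... <= t" using t01 by (simp add: power2_eq_square mult_left_le)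
    finally show ?thesis .
   qed
   thus ?thesis unfolding rho_def by linarith
  qed
  have rz: "rho z > 0" by (rule rho_pos[OF z])
  have "norm (dir z f (of_real t *s z)) <= N * norm z * ?r powr (- (1 + \<gamma>))"
   by (rule B) (use norm_ray[OF z t01] in simp)
  also have "... <= N * 1 * ?r powr (- (1 + \<gamma>))" using z p by (intro mult_right_mono mult_left_mono) auto
  also have "?r powr (- (1 + \<gamma>)) = ?r powr (- ?k) * ?r powr (\<theta> - 1)"
   unfolding powr_add[symmetric] by (rule arg_cong[where f="\<lambda>x. ?r powr x"]) simp
  also have "N * 1 * (?r powr (- ?k) * ?r powr (\<theta> - 1)) <= N * 1 * (rho z powr (- ?k) * (1 - t) powr (\<theta> - 1))"
   using r1 r2 rz p t by (intro mult_left_mono mult_mono powr_mono2') auto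
  finally show "norm (dir z f (of_real t *s z)) <= N * rho z powr (- ?k) * (1 - t) powr (\<theta> - 1)" by (simp add: mult.assoc)
 qed
 thus ?thesis by simp
qed

text \<open>How far the complex line through t z and t w can be followed inside the ball; here the
  anisotropy enters. In dimension one |z - w| <= d. Otherwise |z + l (w - z)|^2 has a linear term of
  size |l| d, as <z, w - z> is O(d), and a quadratic term |l|^2 |z - w|^2 = O(|l|^2 d), so that |l|
  may reach a fraction of ((1 - t) / d)^(1/2).\<close>

lemma slice_in_ball:
 fixes z w :: "complex^'n"
 assumes z: "norm z < 1" and w: "norm w < 1" and t: "0 <= t" "t < 1" and d: "kdist z w <= 1 - t"
  and l: "norm l <= (1 / 16) * ((1 - t) / kdist z w) powr aniso TYPE('n)"
 shows "rho (of_real t *s z + l *s (of_real t *s w - of_real t *s z)) >= (1 - t) / 2"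
proof -
 let ?d = "kdist z w"
 let ?\<tau> = "1 - t"
 let ?x = "of_real t *s z + l *s (of_real t *s w - of_real t *s z)"
 have dp: "?d > 0" using kdist_pos[of z w] z w by simp
 have aux: "t * (1 + ?\<tau> * c) <= 1 - ?\<tau> / 2" if "0 <= c" "c <= 1 / 2" for c
 proof -
  have "t * c <= 1 * (1 / 2)" using t that by (intro mult_mono) auto
  hence "0 <= ?\<tau> * (1 / 2 - t * c)" using t by (intro mult_nonneg_nonneg) auto
  also have "... = 1 - ?\<tau> / 2 - t * (1 + ?\<tau> * c)" by (simp add: field_simps)
  finally show ?thesis by simp
 qed
 have x: "?x = of_real t *s (z + l *s (w - z))" by (simp add: vec_eq_iff algebra_simps)
 have "(norm ?x)^2 <= 1 - ?\<tau> / 2"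
 proof (cases "CARD('n) = 1")
  case True
  have "norm l <= (1 / 16) * (?\<tau> / ?d)" using l True dp t by (simp add: aniso_def)
  hence l: "norm l * ?d <= ?\<tau> / 16" using dp by (simp add: field_simps)
  have "norm (z + l *s (w - z)) <= norm z + norm l * norm (w - z)"
   using norm_triangle_ineq[of z "l *s (w - z)"] unfolding norm_vsmult .
  also have "norm l * norm (w - z) <= norm l * ?d"
   using norm_diff_le_kdist1[OF True z w] by (intro mult_left_mono) (simp_all add: norm_minus_commute)
  finally have n: "norm (z + l *s (w - z)) <= 1 + ?\<tau> / 16" using z l by linarith
  have "norm ?x <= t * (1 + ?\<tau> / 16)" unfolding x norm_vsmult using n t by (simp add: mult_left_mono)
  also have "... <= 1 - ?\<tau> / 2"
   using aux[of "1 / 16"] by simp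
  finally have "norm ?x <= 1 - ?\<tau> / 2" .
  moreover have "0 <= 1 - ?\<tau> / 2" "1 - ?\<tau> / 2 <= 1" using t by auto
  ultimately have "norm ?x * norm ?x <= (1 - ?\<tau> / 2) * 1" by (intro mult_mono order_trans[of "norm ?x" "1 - ?\<tau> / 2" 1] norm_ge_zero)
  thus ?thesis by (simp add: power2_eq_square)
 next
  case False
  define L where "L = norm l"
  have L: "L >= 0" "L <= (1 / 16) * sqrt (?\<tau> / ?d)" using l False dp t by (simp_all add: L_def aniso_def powr_half_sqrt)
  have "L^2 <= ((1 / 16) * sqrt (?\<tau> / ?d))^2" using L by (intro power_mono) auto
  also have "... = ?\<tau> / ?d / 256" using dp t by (simp add: power_mult_distrib power_divide)
  finally have L2: "L^2 * ?d <= ?\<tau> / 256" using dp by (simp add: field_simps)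
  have "?\<tau> / ?d >= 1" using d dp by simp
  hence "(?\<tau> / ?d) * 1 <= (?\<tau> / ?d) * (?\<tau> / ?d)" by (intro mult_left_mono) auto
  hence "sqrt (?\<tau> / ?d) <= ?\<tau> / ?d" using \<open>?\<tau> / ?d >= 1\<close> by (intro real_le_lsqrt) (simp_all add: power2_eq_square)
  hence "sqrt (?\<tau> / ?d) * ?d <= (?\<tau> / ?d) * ?d" using dp by (intro mult_right_mono) auto
  hence sq: "sqrt (?\<tau> / ?d) * ?d <= ?\<tau>" using dp by simp
  have "L * ?d <= (1 / 16) * sqrt (?\<tau> / ?d) * ?d" using L dp by (intro mult_right_mono) auto
  also have "... = (1 / 16) * (sqrt (?\<tau> / ?d) * ?d)" by (rule mult.assoc)
  also have "... <= (1 / 16) * ?\<tau>" by (rule mult_left_mono[OF sq]) simp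
  finally have L1: "L * ?d <= ?\<tau> / 16" by simp
  \<comment> \<open>A difference of \<open>rho z\<close> and \<open>1 - cdot z w\<close>, hence at
    most \<open>3 * kdist z w\<close>: the first-order term costs the full power of
    \<open>kdist\<close>, not its square root.\<close>
  have "cdot z (w - z) = (1 - of_real ((norm z)^2)) - (1 - cdot z w)" by (simp add: cdot_self)
  hence "norm (cdot z (w - z)) <= norm (complex_of_real (1 - (norm z)^2)) + ?d"
   unfolding kdist_def using norm_triangle_ineq4[of "complex_of_real (1 - (norm z)^2)" "1 - cdot z w"] by simp
  also have "norm (complex_of_real (1 - (norm z)^2)) = rho z" using rho_pos[OF z] unfolding norm_of_real rho_def by simp
  finally have c: "norm (cdot z (w - z)) <= 3 * ?d" using kdist_ge_rho(2)[OF z, of w] w by simp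
  have "Re (cdot z (l *s (w - z))) <= norm (cnj l * cdot z (w - z))" using complex_Re_le_cmod[of "cdot z (l *s (w - z))"] by (simp only: cdot_simps)
  also have "... <= L * (3 * ?d)" unfolding norm_mult L_def complex_mod_cnj using c by (intro mult_left_mono) auto
  finally have re: "Re (cdot z (l *s (w - z))) <= 3 * (L * ?d)" by simp
  have "(norm (l *s (w - z)))^2 = L^2 * (norm (z - w))^2" by (simp only: norm_vsmult power_mult_distrib L_def norm_minus_commute[of w z])
  also have "... <= L^2 * (2 * ?d)" using norm_diff_sq_le_kdist[of z w] z w by (intro mult_left_mono) auto
  finally have "(norm (l *s (w - z)))^2 <= 2 * (L^2 * ?d)" by simp
  moreover have "(norm z)^2 <= 1" using z by (simp add: power_le_one)
  ultimately have n: "(norm (z + l *s (w - z)))^2 <= 1 + ?\<tau> / 2" unfolding norm_add_sq using re L1 L2 t by argo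
  have "(norm ?x)^2 = t^2 * (norm (z + l *s (w - z)))^2" unfolding x norm_vsmult by (simp add: power_mult_distrib)
  also have "... <= t * (1 + ?\<tau> / 2)" using n t by (intro mult_mono) (auto simp: power2_eq_square mult_left_le)
  also have "... <= 1 - ?\<tau> / 2"
   using aux[of "1 / 2"] by simp
  finally show ?thesis .
 qed
 thus ?thesis unfolding rho_def by argo
qed

lemma rho_pos_iff: "rho z > 0 \<longleftrightarrow> norm z < 1"
 using rho_pos[of z] rho_le_0[of z] by fastforce

text \<open>A Schwarz-type gain: on the line through t z and t w the function is bounded on a disc
  of radius \<open>\<Lambda>\<close>, so its increment between the parameters 0 and 1 is smaller
  than the bound by a factor of order 1 / \<open>\<Lambda>\<close>.\<close>

lemma slice_difference:
 fixes g :: "'n::finite cfun"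
 assumes g: "holo_on (ball 0 1) g" and B: "!!x. norm x < 1 ==> norm (g x) <= N * rho x powr (- s)" and p: "N >= 0" "s >= 0"
  and z: "norm z < 1" and w: "norm w < 1" and t: "0 <= t" "1024 * kdist z w <= 1 - t"
 shows "norm (g (of_real t *s w) - g (of_real t *s z)) <= 64 * 2 powr s * N * (1 - t) powr (- s) * (kdist z w / (1 - t)) powr aniso TYPE('n)"
proof -
 let ?d = "kdist z w"
 let ?\<tau> = "1 - t"
 let ?e = "aniso TYPE('n)"
 have dp: "?d > 0" using kdist_pos[of z w] z w by simp
 have \<tau>: "?\<tau> > 0" "t < 1" "?d <= ?\<tau>" using dp t by auto
 define \<Lambda> where "\<Lambda> = (1 / 16) * (?\<tau> / ?d) powr ?e"
 \<comment> \<open>The threshold 1024 = 32^2 makes \<open>\<Lambda>\<close> at least 32 / 16 = 2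
   even for the exponent 1/2; then discs of radius \<open>\<Lambda> / 2\<close> about points of the
   unit segment stay in the disc of radius \<open>\<Lambda>\<close>.\<close>
 have "32 = sqrt (1024::real)" by (rule real_sqrt_unique[symmetric]) auto
 also have "... = 1024 powr (1 / 2)" by (simp add: powr_half_sqrt)
 also have "... <= 1024 powr ?e" using aniso_bounds(1)[where 'n='n] by (intro powr_mono) auto
 also have "... <= (?\<tau> / ?d) powr ?e" using t dp aniso_bounds[where 'n='n] by (intro powr_mono2) (auto simp: pos_le_divide_eq)
 finally have \<Lambda>: "\<Lambda> >= 2" unfolding \<Lambda>_def by simp
 let ?x = "of_real t *s z" and ?h = "of_real t *s w - of_real t *s z"
 define M where "M = N * (?\<tau> / 2) powr (- s)"
 have M0: "M >= 0" using p by (simp add: M_def)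
 have in_b: "norm (?x + l *s ?h) < 1" "norm (g (?x + l *s ?h)) <= M" if "norm l <= \<Lambda>" for l
 proof -
  have r: "rho (?x + l *s ?h) >= ?\<tau> / 2" by (rule slice_in_ball[OF z w t(1) \<tau>(2,3)]) (use that in \<open>simp add: \<Lambda>_def\<close>)
  hence "rho (?x + l *s ?h) > 0" using order_less_le_trans[OF half_gt_zero[OF \<tau>(1)]] by blast
  thus n: "norm (?x + l *s ?h) < 1" unfolding rho_pos_iff .
  have "norm (g (?x + l *s ?h)) <= N * rho (?x + l *s ?h) powr (- s)" by (rule B[OF n])
  also have "... <= M" unfolding M_def using r \<tau> p by (intro mult_left_mono powr_mono2') auto
  finally show "norm (g (?x + l *s ?h)) <= M" .
 qed
 let ?\<phi> = "\<lambda>l. g (?x + l *s ?h)"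
 have hol: "?\<phi> holomorphic_on ball 0 \<Lambda>"
  by (rule slice_holomorphic[OF g]) (use in_b in auto)
 have sub: "ball l (\<Lambda> / 2) \<subseteq> ball 0 \<Lambda>" if "l \<in> closed_segment 0 1" for l :: complex
 proof
  fix y assume "y \<in> ball l (\<Lambda> / 2)"
  moreover have "norm l <= 1" using that segment_bound(1)[of l 0 1] by simp
  ultimately show "y \<in> ball 0 \<Lambda>" using norm_triangle_ineq2[of y l] \<Lambda> by (simp add: dist_norm norm_minus_commute)
 qed
 have "norm (?\<phi> 1 - ?\<phi> 0) <= (4 * M / \<Lambda>) * norm (1 - 0 :: complex)"
 proof (rule field_differentiable_bound[where S="closed_segment 0 1" and f'="deriv ?\<phi>"])
  fix l :: complex assume l: "l \<in> closed_segment 0 1"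
  have lb: "l \<in> ball 0 \<Lambda>" using sub[OF l] \<Lambda> by (meson centre_in_ball half_gt_zero less_le_trans subsetD zero_less_numeral)
  show "(?\<phi> has_field_derivative deriv ?\<phi> l) (at l within closed_segment 0 1)"
   using holomorphic_derivI[OF hol open_ball lb] by (rule has_field_derivative_at_within)
  have "norm (deriv ?\<phi> l) <= 2 * M / (\<Lambda> / 2)"
  proof (rule Cauchy_deriv_le)
   show "?\<phi> holomorphic_on ball l (\<Lambda> / 2)" by (rule holomorphic_on_subset[OF hol sub[OF l]])
   show "norm (?\<phi> y) <= M" if "y \<in> ball l (\<Lambda> / 2)" for y
    by (rule in_b(2)) (use subsetD[OF sub[OF l] that] in simp)
  qed (use \<Lambda> in simp)
  thus "norm (deriv ?\<phi> l) <= 4 * M / \<Lambda>" by simp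
 qed auto
 also have "(4 * M / \<Lambda>) * norm (1 - 0 :: complex) = 64 * M * (1 / (?\<tau> / ?d) powr ?e)" by (simp add: \<Lambda>_def)
 also have "1 / (?\<tau> / ?d) powr ?e = (?d / ?\<tau>) powr ?e" using dp \<tau> by (simp add: powr_divide)
 also have "64 * M = 64 * 2 powr s * N * ?\<tau> powr (- s)" unfolding M_def using \<tau> by (simp add: powr_divide powr_minus_divide)
 finally show ?thesis by simp
qed

lemma holo_radial:
 fixes f :: "'n::finite cfun"
 assumes f: "holo_on S f" "open S"
 shows "holo_on S (\<lambda>x. dir x f x)"
proof (rule holo_on_cong(1)[OF _ f(2)])
 show "holo_on S (\<lambda>x. \<Sum>j\<in>UNIV. x $ j * dir (axis j 1) f x)"
  by (intro holo_sum holo_mult(1) holo_nth holo_dir f)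
 show "(\<Sum>j\<in>UNIV. x $ j * dir (axis j 1) f x) = dir x f x" if "x \<in> S" for x
  by (subst (3) vec_sum_axis[of x]) (simp only: dir_sum[OF f(1) that] dir_cmul[OF f(1) that])
qed

text \<open>The Bloch seminorm with directional derivatives in place of the gradient;
  \<open>bloch_bound_iff\<close> is the bridge to the definitions of the statement.\<close>

definition bloch_bound :: "real => real => 'n::finite cfun => bool" where
 "bloch_bound \<gamma> N f \<longleftrightarrow> N >= 0 \<and> (\<forall>z v. norm z < 1 --> norm (dir v f z) <= N * norm v * rho z powr (- (1 + \<gamma>)))"

text \<open>One summand for each part of the path from z to w: the radial descents, the transport
  along the rays, and the region of radius at most 1/2.\<close>

definition lip_const :: "'n::finite itself => real => real => real" where
 "lip_const T \<gamma> \<theta> = 2048 powr \<theta> / \<theta> + 2 * (64 * 2 powr (1 + \<gamma>)) / (\<gamma> + aniso T) * 2 powr (\<gamma> + \<theta>) + (3 / 4) powr (- (1 + \<gamma>))"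

text \<open>Descend along the rays of z and w to a depth comparable to d, at the cost d^\<theta> of
  \<open>radial_estimate\<close>. Between the radii 1/2 and 1 - 1024 d compare f(t z) and f(t w)
  through the difference of radial derivatives, for which \<open>slice_difference\<close> gains (d /
  (1 - t))^e; as \<gamma> + e > 0, the integral in t is governed by its upper end. At radius 1/2 the
  function is Lipschitz.\<close>

proposition bloch_lipschitz:
 fixes f :: "'n::finite cfun"
 assumes p: "0 < \<theta>" "- \<gamma> < \<theta>" "\<theta> < aniso TYPE('n)" "- aniso TYPE('n) < \<gamma>"
 shows "lip_const TYPE('n) \<gamma> \<theta> > 0" and "holo_on (ball 0 1) f ==> bloch_bound \<gamma> N f ==> norm z < 1 ==> norm w < 1 ==>
   norm (f z - f w) <= lip_const TYPE('n) \<gamma> \<theta> * N * kdist z w powr \<theta> * (rho z powr (- (\<gamma> + \<theta>)) + rho w powr (- (\<gamma> + \<theta>)))"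
proof -
 define e where "e = aniso TYPE('n)"
 define k where "k = \<gamma> + \<theta>"
 have e: "1 / 2 <= e" "e <= 1" "e > 0" unfolding e_def by (rule aniso_bounds)+
 have k: "k > 0" using p by (simp add: k_def)
 have \<theta>: "\<theta> <= 1" "\<theta> < e" using p e by (auto simp: e_def)
 have \<gamma>: "\<gamma> + e > 0" "1 + \<gamma> > 0" using p e by (auto simp: e_def)
 define A where "A = 2 * (64 * 2 powr (1 + \<gamma>)) / (\<gamma> + e)"
 define C where "C = 2048 powr \<theta> / \<theta> + A * 2 powr k + (3 / 4) powr (- (1 + \<gamma>))"
 have A0: "A >= 0" using \<gamma> by (simp add: A_def)
 have CC: "lip_const TYPE('n) \<gamma> \<theta> = C" by (simp add: lip_const_def C_def A_def k_def e_def)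
 show "lip_const TYPE('n) \<gamma> \<theta> > 0" unfolding CC C_def using p A0 by (intro add_pos_pos add_pos_nonneg) auto
 {assume f: "holo_on (ball 0 1) f" and "bloch_bound \<gamma> N f" and z: "norm z < 1" and w: "norm w < 1"
  hence B: "!!z v. norm z < 1 ==> norm (dir v f z) <= N * norm v * rho z powr (- (1 + \<gamma>))" and N: "N >= 0"
   by (auto simp: bloch_bound_def)
  define d where "d = kdist z w"
  have d: "d > 0" using kdist_pos[of z w] z w by (simp add: d_def)
  define S where "S = rho z powr (- k) + rho w powr (- k)"
  have S1: "1 <= rho z powr (- k)" "rho z powr (- k) <= S" "1 <= S"
  proof -
   have *: "1 <= rho x powr (- k)" if "norm x < 1" for x :: "complex^'n"
    using powr_mono2'[of "- k" "rho x" 1] rho_pos[OF that] rho_le_1[of x] k by simp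
   show "1 <= rho z powr (- k)" by (rule *[OF z])
   show "rho z powr (- k) <= S" using *[OF w] by (simp add: S_def)
   show "1 <= S" using *[OF w] *[OF z] by (simp add: S_def)
  qed
  have R: "norm (f x - f (of_real (1 - a) *s x)) <= N / \<theta> * rho x powr (- k) * a powr \<theta>" if "norm x < 1" "0 <= a" "a <= 1" for x a
   unfolding k_def by (rule radial_estimate[OF f B]) (use p N \<theta> that in auto)
  have two: "norm (f z - f w) <= N / \<theta> * S * a powr \<theta> + norm (f (of_real (1 - a) *s z) - f (of_real (1 - a) *s w))"
   if "0 <= a" "a <= 1" for a
  proof -
   have "f z - f w = (f z - f (of_real (1 - a) *s z)) - (f w - f (of_real (1 - a) *s w)) + (f (of_real (1 - a) *s z) - f (of_real (1 - a) *s w))" by simp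
   hence "norm (f z - f w) <= norm (f z - f (of_real (1 - a) *s z)) + norm (f w - f (of_real (1 - a) *s w)) + norm (f (of_real (1 - a) *s z) - f (of_real (1 - a) *s w))"
    by (metis add_right_mono norm_triangle_ineq norm_triangle_ineq4 order_trans)
   thus ?thesis using R[OF z that] R[OF w that] by (simp add: S_def distrib_left distrib_right)
  qed
  have "norm (f z - f w) <= C * N * d powr \<theta> * S"
  proof (cases "2048 * d < 1")
   \<comment> \<open>Distant points descend to the centre: \<open>2048 * d >= 1\<close> lets the
     power of \<open>d\<close> absorb a constant.\<close>
   case False
   have "norm (f z - f w) <= N / \<theta> * S * 1" using two[of 1] by simp
   also have "... <= N / \<theta> * S * (2048 powr \<theta> * d powr \<theta>)"
   proof (intro mult_left_mono)
    have "1 <= (2048 * d) powr \<theta>" using False p by (intro ge_one_powr_ge_zero) auto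
    thus "1 <= 2048 powr \<theta> * d powr \<theta>" using d by (simp add: powr_mult)
   qed (use N p S1 in auto)
   also have "... = (2048 powr \<theta> / \<theta>) * (N * d powr \<theta> * S)" by simp
   also have "... <= C * (N * d powr \<theta> * S)" using N S1 A0 by (intro mult_right_mono) (auto simp: C_def)
   finally show ?thesis by (simp add: mult.assoc)
  next
   case True
   let ?G = "\<lambda>t::real. f (of_real t *s z) - f (of_real t *s w)"
   have in_ball: "of_real t *s x \<in> ball 0 1" if "0 <= t" "t <= 1" "norm x < 1" for t :: real and x :: "complex^'n"
    using norm_ray[OF that(3,1,2)] by simp
   have D: "(?G has_vector_derivative dir z f (of_real t *s z) - dir w f (of_real t *s w)) (at t)" if "0 <= t" "t <= 1" for t
    by (intro has_vector_derivative_diff holo_ray_vector_derivative[OF f] in_ball that z w)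
   define g where "g x = dir x f x" for x
   have g: "holo_on (ball 0 1) g" unfolding g_def by (rule holo_radial[OF f open_ball])
   have gB: "norm (g x) <= N * rho x powr (- (1 + \<gamma>))" if "norm x < 1" for x
   proof -
    have "norm (g x) <= N * norm x * rho x powr (- (1 + \<gamma>))" unfolding g_def by (rule B[OF that])
    also have "... <= N * 1 * rho x powr (- (1 + \<gamma>))" using that N by (intro mult_right_mono mult_left_mono) auto
    finally show ?thesis by simp
   qed
   let ?P = "\<lambda>t. A * N * d powr e * (1 - t) powr (- (\<gamma> + e))"
   let ?P' = "\<lambda>t. 2 * (64 * 2 powr (1 + \<gamma>)) * N * d powr e * (1 - t) powr (- (\<gamma> + e) - 1)"
   have "norm (?G (1 - 1024 * d) - ?G (1 / 2)) <= ?P (1 - 1024 * d) - ?P (1 / 2)"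
   proof (rule differentiable_bound_general)
    show "1 / 2 < 1 - 1024 * d" using True by simp
    show "continuous_on {1 / 2..1 - 1024 * d} ?G"
     using d by (intro continuous_at_imp_continuous_on ballI has_vector_derivative_continuous[OF D]) auto
    show "continuous_on {1 / 2..1 - 1024 * d} ?P"
     using d by (intro continuous_intros) auto
    fix t assume t: "1 / 2 < t" "t < 1 - 1024 * d"
    hence t01: "0 <= t" "t <= 1" "t < 1" "t > 0" using d by auto
    show "(?G has_vector_derivative dir z f (of_real t *s z) - dir w f (of_real t *s w)) (at t)" by (rule D[OF t01(1,2)])
    have "((\<lambda>t. (1 - t) powr (- (\<gamma> + e))) has_real_derivative (\<gamma> + e) * (1 - t) powr (- (\<gamma> + e) - 1)) (at t)"
     using DERIV_one_minus_powr[OF t01(3), of "- (\<gamma> + e)"] by (simp only: minus_minus)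
    from DERIV_cmult[OF this, of "A * N * d powr e"]
    have "(?P has_real_derivative (A * (\<gamma> + e)) * N * d powr e * (1 - t) powr (- (\<gamma> + e) - 1)) (at t)" by (simp only: mult_ac)
    moreover have "A * (\<gamma> + e) = 2 * (64 * 2 powr (1 + \<gamma>))" using \<gamma> by (simp add: A_def)
    ultimately show "(?P has_vector_derivative ?P' t) (at t)"
     by (simp add: has_real_derivative_iff_has_vector_derivative)
    \<comment> \<open>\<open>g\<close> is the radial derivative along the moving point rather than
      along \<open>x\<close>; the resulting division by \<open>t\<close> is harmless for
      \<open>t > 1 / 2\<close>.\<close>
    have gt: "dir x f (of_real t *s x) = g (of_real t *s x) / of_real t" if "norm x < 1" for x
     unfolding g_def using dir_cmul[OF f in_ball[OF t01(1,2) that]] t01 by simp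
    have "norm (dir z f (of_real t *s z) - dir w f (of_real t *s w)) = norm (g (of_real t *s w) - g (of_real t *s z)) / t"
     unfolding gt[OF z] gt[OF w] using t01 by (simp add: norm_divide norm_minus_commute flip: diff_divide_distrib)
    also have "... <= norm (g (of_real t *s w) - g (of_real t *s z)) / (1 / 2)"
     using t by (intro divide_left_mono) auto
    also have "... <= 2 * (64 * 2 powr (1 + \<gamma>) * N * (1 - t) powr (- (1 + \<gamma>)) * (d / (1 - t)) powr e)"
    proof -
     have "norm (g (of_real t *s w) - g (of_real t *s z)) <= 64 * 2 powr (1 + \<gamma>) * N * (1 - t) powr (- (1 + \<gamma>)) * (d / (1 - t)) powr e"
      unfolding d_def e_def by (rule slice_difference[OF g gB N _ z w t01(1)]) (use t \<gamma> in \<open>auto simp: d_def\<close>)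
     thus ?thesis by (simp only: div_by_1 divide_divide_eq_right times_divide_eq_left mult.commute[of _ 2])
    qed
    also have "(d / (1 - t)) powr e = d powr e * (1 - t) powr (- e)" using d t01 by (simp add: powr_divide powr_minus_divide)
    also have "2 * (64 * 2 powr (1 + \<gamma>) * N * (1 - t) powr (- (1 + \<gamma>)) * (d powr e * (1 - t) powr (- e))) = 2 * (64 * 2 powr (1 + \<gamma>)) * N * d powr e * ((1 - t) powr (- (1 + \<gamma>)) * (1 - t) powr (- e))"
     by (simp only: mult_ac)
    also have "(1 - t) powr (- (1 + \<gamma>)) * (1 - t) powr (- e) = (1 - t) powr (- (\<gamma> + e) - 1)"
     unfolding powr_add[symmetric] by (rule arg_cong[where f="\<lambda>x. (1 - t) powr x"]) simp
    finally show "norm (dir z f (of_real t *s z) - dir w f (of_real t *s w)) <= ?P' t" .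
   qed
   also have "... <= ?P (1 - 1024 * d)" using A0 N by simp
   also have "?P (1 - 1024 * d) <= A * N * d powr e * d powr (- (\<gamma> + e))"
    using A0 N d \<gamma> by (intro mult_left_mono powr_mono2') auto
   also have "... = A * N * (d powr \<theta> * d powr (- k))" by (simp add: k_def flip: powr_add)
   also have "... <= A * N * (d powr \<theta> * (2 powr k * S))"
   proof (intro mult_left_mono)
    \<comment> \<open>From \<open>rho z <= 2 * d\<close>: the negative power of \<open>d\<close> is
      traded for one of \<open>rho z\<close>, hence for \<open>S\<close>.\<close>
    have "d powr (- k) <= (rho z / 2) powr (- k)"
     using kdist_ge_rho(2)[OF z, of w] w rho_pos[OF z] k by (intro powr_mono2') (auto simp: d_def)
    also have "... = 2 powr k * rho z powr (- k)" using rho_pos[OF z] by (simp add: powr_divide powr_minus_divide)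
    also have "... <= 2 powr k * S" using S1 by (intro mult_left_mono) auto
    finally show "d powr (- k) <= 2 powr k * S" .
   qed (use A0 N in auto)
   finally have G1: "norm (?G (1 - 1024 * d) - ?G (1 / 2)) <= A * N * (d powr \<theta> * (2 powr k * S))" .
   have G2: "norm (?G (1 / 2)) <= (3 / 4) powr (- (1 + \<gamma>)) * N * d powr \<theta> * S"
   proof -
    let ?z = "complex_of_real (1 / 2) *s z" and ?w = "complex_of_real (1 / 2) *s w"
    have hz: "norm ?z <= 1 / 2" "norm ?w <= 1 / 2" using z w by (simp_all add: norm_vsmult)
    have A1: "norm (f ?z - f ?w) <= (N * (3 / 4) powr (- (1 + \<gamma>))) * norm (?z - ?w)"
    proof (rule differentiable_bound[where S="cball 0 (1/2)" and f'="\<lambda>x v. dir v f x"])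
     show "(f has_derivative (\<lambda>v. dir v f x)) (at x within cball 0 (1 / 2))" if "x \<in> cball 0 (1 / 2)" for x
      by (rule has_derivative_at_withinI[OF holo_has_derivative[OF f]]) (use that in auto)
     show "onorm (\<lambda>v. dir v f x) <= N * (3 / 4) powr (- (1 + \<gamma>))" if "x \<in> cball 0 (1 / 2)" for x
     proof (rule onorm_le)
      fix v
      have x: "norm x <= 1 / 2" using that by simp
      hence "(norm x)^2 <= (1 / 2)^2" by (intro power_mono) auto
      hence r: "rho x >= 3 / 4" by (simp add: rho_def power_divide)
      have "norm (dir v f x) <= N * norm v * rho x powr (- (1 + \<gamma>))" by (rule B) (use x in simp)
      also have "... <= N * norm v * (3 / 4) powr (- (1 + \<gamma>))" using r N \<gamma> by (intro mult_left_mono powr_mono2') auto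
      finally show "norm (dir v f x) <= N * (3 / 4) powr (- (1 + \<gamma>)) * norm v" by (simp add: mult_ac)
     qed
    qed (use hz in auto)
    have A2: "norm (?z - ?w) <= d powr \<theta> * S"
    proof -
     have "norm (?z - ?w) = norm (z - w) / 2" unfolding vector_ssub_ldistrib[symmetric] norm_vsmult by simp
     also have "... <= d powr e" using norm_diff_le_kdist[OF z w] by (simp add: d_def e_def)
     also have "... <= d powr \<theta>" using d True \<theta> by (intro powr_mono') auto
     also have "... <= d powr \<theta> * S" using S1 by (simp add: mult_left_le mult_le_cancel_left1)
     finally show ?thesis .
    qed
    have "norm (f ?z - f ?w) <= (N * (3 / 4) powr (- (1 + \<gamma>))) * (d powr \<theta> * S)"
     by (rule order_trans[OF A1 mult_left_mono[OF A2]]) (use N in simp)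
    thus ?thesis by (simp only: mult_ac)
   qed
   have "norm (?G (1 - 1024 * d)) <= norm (?G (1 - 1024 * d) - ?G (1 / 2)) + norm (?G (1 / 2))"
    using norm_triangle_ineq[of "?G (1 - 1024 * d) - ?G (1 / 2)" "?G (1 / 2)"] by simp
   hence G3: "norm (?G (1 - 1024 * d)) <= A * N * (d powr \<theta> * (2 powr k * S)) + (3 / 4) powr (- (1 + \<gamma>)) * N * d powr \<theta> * S"
    using G1 G2 by linarith
   have "(1024 * d) powr \<theta> <= (2048 * d) powr \<theta>" using d p by (intro powr_mono2) auto
   hence "(1024 * d) powr \<theta> <= 2048 powr \<theta> * d powr \<theta>" using d by (simp add: powr_mult)
   hence "N / \<theta> * S * (1024 * d) powr \<theta> <= N / \<theta> * S * (2048 powr \<theta> * d powr \<theta>)"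
    using N p S1 by (intro mult_left_mono) auto
   hence "norm (f z - f w) <= N / \<theta> * S * (2048 powr \<theta> * d powr \<theta>) + (A * N * (d powr \<theta> * (2 powr k * S)) + (3 / 4) powr (- (1 + \<gamma>)) * N * d powr \<theta> * S)"
    using two[of "1024 * d"] G3 True d by (intro order_trans[OF two[of "1024 * d"] add_mono]) auto
   also have "... = C * N * d powr \<theta> * S" unfolding C_def by (simp add: algebra_simps)
   finally show ?thesis .
  qed
  thus "norm (f z - f w) <= lip_const TYPE('n) \<gamma> \<theta> * N * kdist z w powr \<theta> * (rho z powr (- (\<gamma> + \<theta>)) + rho w powr (- (\<gamma> + \<theta>)))"
   by (simp add: d_def S_def k_def CC)}
qed


section \<open>Weighted spaces on the ball\<close>

text \<open>Valid for every function because a non-integrable one has integral 0.\<close>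

lemma norm_integral_le_nn_integral:
 fixes f :: "'x => 'b::{banach, second_countable_topology}"
 shows "ennreal (norm (LINT x|M. f x)) <= (\<integral>\<^sup>+x. ennreal (norm (f x)) \<partial>M)"
proof (cases "integrable M f")
 case True
 thus ?thesis by (rule integral_norm_bound_ennreal)
next
 case False
 thus ?thesis by (simp add: not_integrable_integral_eq)
qed

text \<open>The volume of the ball cancels between \<open>ball_volume\<close> and
  \<open>weight_const\<close> and the single constant \<open>bmass\<close> is left, so that later
  integrals can be taken over the unnormalised \<open>lball\<close>.\<close>

lemma ball_weighted_eq:
 assumes \<alpha>: "\<alpha> > -1"
 shows "(ball_weighted \<alpha> :: (complex^'n) measure) = density lball (\<lambda>z. ennreal (rho z powr \<alpha> / bmass TYPE('n) \<alpha>))"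
proof -
 let ?B = "lball :: (complex^'n) measure"
 let ?b = "ball (0::complex^'n) 1"
 define v where "v = measure ?B ?b"
 have V: "emeasure ?B ?b = ennreal v"
  unfolding v_def using finite_measure.emeasure_eq_measure[OF finite_measure_lball] .
 have v: "v > 0"
  using emeasure_lball_pos[where 'n='n] unfolding space_lball V by (simp add: zero_less_iff_neq_zero ennreal_eq_0_iff not_le)
 have bs: "?b \<in> sets ?B" using sets.top[of ?B] by simp
 have m: "bmeas (\<lambda>z. ennreal (rho z powr x))" for x
  by (rule measurable_compose[OF measurable_rho_powr measurable_ennreal])
 have bv: "ball_volume = density ?B (\<lambda>z. ennreal (1 / v))"
  unfolding ball_volume_def uniform_measure_def V
 proof (rule density_cong)
  show "AE x in ?B. indicator ?b x / ennreal v = ennreal (1 / v)"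
   using v by (intro AE_I2) (simp add: divide_ennreal[symmetric])
 qed (use bs in auto)
 have "(LINT z|(ball_volume :: (complex^'n) measure). (1 - (norm z)^2) powr \<alpha>) = (LINT z|?B. (1 / v) *\<^sub>R (rho z powr \<alpha>))"
  unfolding bv rho_def[symmetric] using v by (intro integral_density measurable_rho_powr) auto
 also have "... = bmass TYPE('n) \<alpha> / v" by (simp add: bmass_def)
 finally have wc: "weight_const TYPE('n) \<alpha> = v / bmass TYPE('n) \<alpha>" by (simp add: weight_const_def)
 have A: "bmass TYPE('n) \<alpha> > 0" by (rule bmass_pos[OF \<alpha>])
 have "(ball_weighted \<alpha> :: (complex^'n) measure) = density ?B (\<lambda>z. ennreal (1 / v) * ennreal (v / bmass TYPE('n) \<alpha> * rho z powr \<alpha>))"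
  unfolding ball_weighted_def bv rho_def[symmetric] wc
  by (rule density_density_eq) (use measurable_rho_powr[of \<alpha>] in measurable)
 also have "... = density ?B (\<lambda>z. ennreal (rho z powr \<alpha> / bmass TYPE('n) \<alpha>))"
  using v A by (intro arg_cong[where f="density ?B"] ext) (simp flip: ennreal_mult)
 finally show ?thesis .
qed

lemma
 fixes G :: "'n::finite cfun"
 assumes \<alpha>: "\<alpha> > -1"
 shows space_ball_weighted: "space (ball_weighted \<alpha> :: (complex^'n) measure) = ball 0 1"
  and measurable_ball_weighted: "borel_measurable (ball_weighted \<alpha>) = (borel_measurable lball :: (complex^'n => 'b::topological_space) set)"
  and AE_ball_weighted: "(AE z in (ball_weighted \<alpha> :: (complex^'n) measure). P z) \<longleftrightarrow> (AE z in lball. P z)"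
  and nn_integral_ball_weighted: "F \<in> borel_measurable lball ==>
   (\<integral>\<^sup>+z. F z \<partial>(ball_weighted \<alpha> :: (complex^'n) measure)) = ennreal (1 / bmass TYPE('n) \<alpha>) * (\<integral>\<^sup>+z. ennreal (rho z powr \<alpha>) * F z \<partial>lball)"
  and integral_ball_weighted: "G \<in> borel_measurable lball ==>
   (LINT z|(ball_weighted \<alpha> :: (complex^'n) measure). G z) = (1 / bmass TYPE('n) \<alpha>) *\<^sub>R (LINT z|lball. of_real (rho z powr \<alpha>) * G z)"
proof -
 let ?B = "lball :: (complex^'n) measure"
 note eq = ball_weighted_eq[OF \<alpha>, where 'n='n]
 have A: "bmass TYPE('n) \<alpha> > 0" by (rule bmass_pos[OF \<alpha>])
 have m0: "bmeas (\<lambda>z. rho z powr \<alpha> / bmass TYPE('n) \<alpha>)" using measurable_rho_powr[of \<alpha>] by measurable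
 note m = measurable_compose[OF m0 measurable_ennreal]
 show "space (ball_weighted \<alpha> :: (complex^'n) measure) = ball 0 1" by (simp add: eq)
 show "borel_measurable (ball_weighted \<alpha>) = (borel_measurable lball :: (complex^'n => 'b::topological_space) set)"
  by (rule measurable_cong_sets) (simp_all add: eq)
 have "(AE z in (ball_weighted \<alpha> :: (complex^'n) measure). P z) \<longleftrightarrow> (AE z in ?B. 0 < ennreal (rho z powr \<alpha> / bmass TYPE('n) \<alpha>) --> P z)"
  unfolding eq by (rule AE_density[OF m])
 also have "... \<longleftrightarrow> (AE z in lball. P z)"
 proof (rule AE_cong)
  fix z :: "complex^'n" assume "z \<in> space lball"
  hence "rho z > 0" using rho_pos[of z] by simp
  thus "(0 < ennreal (rho z powr \<alpha> / bmass TYPE('n) \<alpha>) --> P z) = P z" using A by simp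
 qed
 finally show "(AE z in (ball_weighted \<alpha> :: (complex^'n) measure). P z) \<longleftrightarrow> (AE z in lball. P z)" .
 show "(\<integral>\<^sup>+z. F z \<partial>(ball_weighted \<alpha> :: (complex^'n) measure)) = ennreal (1 / bmass TYPE('n) \<alpha>) * (\<integral>\<^sup>+z. ennreal (rho z powr \<alpha>) * F z \<partial>lball)"
  if F: "bmeas F"
 proof -
  have "(\<integral>\<^sup>+z. F z \<partial>(ball_weighted \<alpha> :: (complex^'n) measure)) = (\<integral>\<^sup>+z. ennreal (rho z powr \<alpha> / bmass TYPE('n) \<alpha>) * F z \<partial>lball)"
   unfolding eq by (rule nn_integral_density[OF m F])
  also have "... = (\<integral>\<^sup>+z. ennreal (1 / bmass TYPE('n) \<alpha>) * (ennreal (rho z powr \<alpha>) * F z) \<partial>lball)"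
   using A by (intro nn_integral_cong) (simp add: mult.assoc[symmetric] flip: ennreal_mult)
  also have "... = ennreal (1 / bmass TYPE('n) \<alpha>) * (\<integral>\<^sup>+z. ennreal (rho z powr \<alpha>) * F z \<partial>lball)"
   by (rule nn_integral_cmult, rule borel_measurable_times_ennreal[OF measurable_compose[OF measurable_rho_powr[of \<alpha>] measurable_ennreal] F])
  finally show ?thesis .
 qed
 show "(LINT z|(ball_weighted \<alpha> :: (complex^'n) measure). G z) = (1 / bmass TYPE('n) \<alpha>) *\<^sub>R (LINT z|lball. of_real (rho z powr \<alpha>) * G z)"
  if G: "bmeas G"
 proof -
  have "(LINT z|(ball_weighted \<alpha> :: (complex^'n) measure). G z) = (LINT z|lball. (rho z powr \<alpha> / bmass TYPE('n) \<alpha>) *\<^sub>R G z)"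
   unfolding eq using A by (intro integral_density G m0) auto
  also have "... = (LINT z|lball. (1 / bmass TYPE('n) \<alpha>) *\<^sub>R (of_real (rho z powr \<alpha>) * G z))"
   by (intro Bochner_Integration.integral_cong) (simp_all add: scaleR_conv_of_real)
  finally show ?thesis by simp
 qed
qed

text \<open>The p-th power of the weighted norm without normalising constant, in the extended reals
  so that it can be estimated before it is known to be finite; \<open>Lp_norm_wint\<close> relates
  it to \<open>Lp_norm\<close>.\<close>

definition wint :: "real => real => 'n::finite cfun => ennreal" where
 "wint \<alpha> p f = bint (\<lambda>z. rho z powr \<alpha> * norm (f z) powr p)"

lemma measurable_wint:
 fixes f :: "'n::finite cfun"
 assumes "bmeas f"
 shows "bmeas (\<lambda>z. rho z powr \<alpha> * norm (f z) powr p)"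
 by (rule borel_measurable_times[OF measurable_rho_powr measurable_compose[OF assms, of "\<lambda>x. norm x powr p"]]) simp

lemma wint_cmult: "c >= 0 ==> bmeas u ==> bint (\<lambda>w. c * (rho w powr a * norm (u w) powr p)) = ennreal c * wint a p u"
 unfolding wint_def by (rule bint_cmult[OF _ measurable_wint])

lemma wint_mono: "(!!z. norm z < 1 ==> norm (f z) <= norm (g z)) ==> p >= 0 ==> wint \<alpha> p f <= wint \<alpha> p g"
 unfolding wint_def by (intro nn_integral_mono ennreal_leI mult_left_mono powr_mono2) auto

lemma Lp_ball_weighted_iff:
 fixes f :: "'n::finite cfun"
 assumes \<alpha>: "\<alpha> > -1"
 shows "f \<in> Lp (ball_weighted \<alpha>) p \<longleftrightarrow> f \<in> borel_measurable lball \<and> wint \<alpha> p f < \<infinity>"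
proof -
 have A: "bmass TYPE('n) \<alpha> > 0" by (rule bmass_pos[OF \<alpha>])
 have "integrable (ball_weighted \<alpha>) (\<lambda>x. norm (f x) powr p) \<longleftrightarrow> wint \<alpha> p f < \<infinity>" if f: "bmeas f"
 proof -
  have m: "bmeas (\<lambda>x. norm (f x) powr p)"
   by (rule measurable_compose[OF f, of "\<lambda>x. norm x powr p"]) simp
  have "integrable (ball_weighted \<alpha>) (\<lambda>x. norm (f x) powr p) \<longleftrightarrow> (\<integral>\<^sup>+x. ennreal (norm (norm (f x) powr p)) \<partial>(ball_weighted \<alpha>)) < \<infinity>"
   using m by (simp add: integrable_iff_bounded measurable_ball_weighted[OF \<alpha>])
  also have "(\<integral>\<^sup>+x. ennreal (norm (norm (f x) powr p)) \<partial>(ball_weighted \<alpha>)) = ennreal (1 / bmass TYPE('n) \<alpha>) * wint \<alpha> p f"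
   unfolding wint_def using m by (subst nn_integral_ball_weighted[OF \<alpha>]) (auto simp: ennreal_mult)
  also have "... < \<infinity> \<longleftrightarrow> wint \<alpha> p f < \<infinity>"
   using A by (cases "wint \<alpha> p f") (auto simp: ennreal_mult_top ennreal_mult_less_top)
  finally show ?thesis .
 qed
 thus ?thesis unfolding Lp_def measurable_ball_weighted[OF \<alpha>] by blast
qed

lemma Lp_norm_wint:
 fixes f :: "'n::finite cfun"
 assumes \<alpha>: "\<alpha> > -1" and p: "p > 0" and f: "f \<in> Lp (ball_weighted \<alpha>) p"
 shows "wint \<alpha> p f = ennreal (bmass TYPE('n) \<alpha> * Lp_norm (ball_weighted \<alpha>) p f powr p)"
proof -
 have A: "bmass TYPE('n) \<alpha> > 0" by (rule bmass_pos[OF \<alpha>])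
 let ?I = "LINT x|ball_weighted \<alpha>. norm (f x) powr p"
 have fm: "bmeas f" using f Lp_ball_weighted_iff[OF \<alpha>] by blast
 have m: "bmeas (\<lambda>x. norm (f x) powr p)"
  by (rule measurable_compose[OF fm, of "\<lambda>x. norm x powr p"]) simp
 have I0: "?I >= 0" by (rule integral_nonneg_AE) simp
 have "ennreal ?I = (\<integral>\<^sup>+x. ennreal (norm (f x) powr p) \<partial>(ball_weighted \<alpha>))"
  by (rule nn_integral_eq_integral[symmetric]) (use f in \<open>auto simp: Lp_def\<close>)
 also have "... = ennreal (1 / bmass TYPE('n) \<alpha>) * wint \<alpha> p f"
  unfolding wint_def using m by (subst nn_integral_ball_weighted[OF \<alpha>]) (auto simp: ennreal_mult)
 finally have "ennreal (bmass TYPE('n) \<alpha>) * ennreal ?I = ennreal (bmass TYPE('n) \<alpha>) * ennreal (1 / bmass TYPE('n) \<alpha>) * wint \<alpha> p f"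
  by (simp add: mult.assoc)
 also have "ennreal (bmass TYPE('n) \<alpha>) * ennreal (1 / bmass TYPE('n) \<alpha>) = 1" using A by (simp flip: ennreal_mult)
 finally have "wint \<alpha> p f = ennreal (bmass TYPE('n) \<alpha> * ?I)" using A I0 by (simp add: ennreal_mult)
 moreover have "Lp_norm (ball_weighted \<alpha>) p f powr p = ?I" unfolding Lp_norm_def using p I0 by (simp add: powr_powr)
 ultimately show ?thesis by simp
qed

section \<open>The Bergman projection as a kernel integral\<close>

lemma bergman_proj_eq:
 fixes g :: "'n::finite cfun"
 assumes \<beta>: "\<beta> > -1" and g: "bmeas g" and z: "norm z < 1"
 shows "bergman_proj \<beta> g z = (LINT w|lball. of_real (rho w powr \<beta>) * (g w * ker (real CARD('n) + 1 + \<beta>) z w)) / of_real (bmass TYPE('n) \<beta>)"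
proof -
 have e: "g w / (1 - cdot z w) powr complex_of_real (real CARD('n) + 1 + \<beta>) = g w * ker (real CARD('n) + 1 + \<beta>) z w" for w
  unfolding ker_alt by simp
 have "ker (real CARD('n) + 1 + \<beta>) z \<in> borel_measurable lball"
  by (rule measurable_lball[OF continuous_on_subset[OF ker_cont_right[OF z]]]) auto
 hence "bmeas (\<lambda>w. g w * ker (real CARD('n) + 1 + \<beta>) z w)" using g by measurable
 thus ?thesis unfolding bergman_proj_def e by (simp add: integral_ball_weighted[OF \<beta>] scaleR_conv_of_real)
qed

lemma norm_bergman_proj_le:
 fixes g :: "'n::finite cfun"
 assumes \<beta>: "\<beta> > -1" and g: "bmeas g" and z: "norm z < 1"
 shows "ennreal (norm (bergman_proj \<beta> g z)) <= bint (\<lambda>w. 1 / bmass TYPE('n) \<beta> * (rho w powr \<beta> * norm (g w) * kdist z w powr (- (real CARD('n) + 1 + \<beta>))))"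
proof -
 have "norm (bergman_proj \<beta> g z) = norm (LINT w|lball. 1 / of_real (bmass TYPE('n) \<beta>) * (of_real (rho w powr \<beta>) * (g w * ker (real CARD('n) + 1 + \<beta>) z w)))"
  unfolding bergman_proj_eq[OF assms] by (simp add: norm_divide)
 thus ?thesis using norm_integral_le_nn_integral[of lball "\<lambda>w. 1 / of_real (bmass TYPE('n) \<beta>) * (of_real (rho w powr \<beta>) * (g w * ker (real CARD('n) + 1 + \<beta>) z w))"] bmass_pos[OF \<beta>, where 'n='n]
  by (simp add: norm_mult norm_divide norm_ker mult_ac)
qed

lemma holo_measurable: "holo_on (ball 0 1) f ==> bmeas f"
 by (rule measurable_lball[OF holo_continuous_on])

lemma wint_1_integrable:
 fixes g :: "'n::finite cfun"
 assumes "bmeas g" "wint t 1 g < \<infinity>"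
 shows "integrable lball (\<lambda>w. of_real (rho w powr t) * g w)"
proof (rule integrableI_bounded)
 show "bmeas (\<lambda>w. of_real (rho w powr t) * g w)"
  using measurable_rho_powr_complex[of t] assms(1) by measurable
 show "bint (\<lambda>w. norm (of_real (rho w powr t) * g w)) < \<infinity>"
  using assms(2) unfolding wint_def by (simp add: norm_mult)
qed

text \<open>On a ball around \<open>z\<close> of half the distance to the sphere the kernel is
  bounded uniformly in \<open>w\<close>, so \<open>holo_integral\<close> applies with a multiple of
  the weighted modulus of \<open>g\<close> as majorant.\<close>

lemma ker_integral_holo:
 fixes g :: "'n::finite cfun"
 assumes g: "bmeas g" "wint t 1 g < \<infinity>" and s: "s > 0"
 defines "F \<equiv> \<lambda>z. (LINT w|lball. of_real (rho w powr t) * g w * ker s z w)"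
 shows "holo_on (ball 0 1) F"
  and "norm z < 1 ==> dir v F z = (LINT w|lball. of_real (rho w powr t) * g w * (of_real s * cdot v w * ker (s + 1) z w))"
  and "norm z < 1 ==> integrable lball (\<lambda>w. of_real (rho w powr t) * g w * (of_real s * cdot v w * ker (s + 1) z w))"
proof -
 have main: "\<exists>r>0. holo_on (ball z r) F \<and>
  dir v F z = (LINT w|lball. of_real (rho w powr t) * g w * (of_real s * cdot v w * ker (s + 1) z w)) \<and>
  integrable lball (\<lambda>w. of_real (rho w powr t) * g w * (of_real s * cdot v w * ker (s + 1) z w))" if z: "norm z < 1" for z :: "complex^'n" and v
 proof -
  let ?G = "\<lambda>z w. of_real (rho w powr t) * g w * ker s z w"
  define r where "r = (1 - norm z) / 2"
  have r: "r > 0" using z by (simp add: r_def)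
  have le: "norm x <= 1 - r" if "x \<in> ball z r" for x
   using that norm_triangle_ineq2[of x z] by (simp add: dist_norm norm_minus_commute r_def field_simps)
  have c: "norm (cdot x w) < 1" if "x \<in> ball z r" "w \<in> space lball" for x w
   by (rule norm_cdot_lt') (use le[OF that(1)] r that in auto)
  have 1: "holo_on (ball z r) (\<lambda>z. ?G z w)" if "w \<in> space lball" for w
   by (intro holo_cmul ker_holo(1) c that)
  have 2: "norm (?G x w) <= norm (of_real (rho w powr t) * g w) * r powr (- s)" if "x \<in> ball z r" "w \<in> space lball" for x w
   unfolding norm_mult[of _ "ker s x w"] using norm_ker_le[OF le[OF that(1)], of w s] that r s by (intro mult_left_mono) auto
  have 3: "bmeas (?G x)" if "x \<in> ball z r" for x
  proof -
   have "norm x < 1" using le[OF that] r by linarith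
   hence "bmeas (ker s x)"
    by (intro measurable_lball continuous_on_subset[OF ker_cont_right]) auto
   thus ?thesis using measurable_rho_powr_complex[of t] g(1) by measurable
  qed
  have 4: "integrable lball (\<lambda>w. norm (of_real (rho w powr t) * g w) * r powr (- s))"
   by (intro integrable_mult_left integrable_norm wint_1_integrable g)
  note hi = holo_integral[OF 1 2 3 4]
  have zr: "z \<in> ball z r" using r by simp
  have d: "dir v (\<lambda>z. ?G z w) z = of_real (rho w powr t) * g w * (of_real s * cdot v w * ker (s + 1) z w)" if "w \<in> space lball" for w
  proof -
   have k: "holo_on (ball z r) (\<lambda>z. ker s z w)" by (rule ker_holo(1)) (rule c[OF _ that])
   have "dir v (\<lambda>z. ker s z w) z = of_real s * cdot v w * ker (s + 1) z w" by (rule ker_holo(2)[OF _ zr]) (rule c[OF _ that])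
   thus ?thesis unfolding dir_fun_cmul[OF k zr] by simp
  qed
  have "dir v F z = (LINT w|lball. dir v (\<lambda>z. ?G z w) z)" unfolding F_def by (rule hi(2)[OF _ _ _ _ zr]) auto
  also have "... = (LINT w|lball. of_real (rho w powr t) * g w * (of_real s * cdot v w * ker (s + 1) z w))"
   by (rule Bochner_Integration.integral_cong[OF refl d])
  finally have "dir v F z = ..." .
  moreover have "integrable lball (\<lambda>w. dir v (\<lambda>z. ?G z w) z)" by (rule hi(3)[OF _ _ _ _ zr]) auto
  hence "integrable lball (\<lambda>w. of_real (rho w powr t) * g w * (of_real s * cdot v w * ker (s + 1) z w))"
   by (rule iffD1[OF Bochner_Integration.integrable_cong, rotated 2]) (use d in auto)
  ultimately show ?thesis using hi(1) r unfolding F_def by blast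
 qed
 show "holo_on (ball 0 1) F" by (rule holo_on_locally) (use main in \<open>auto simp: mem_ball_0\<close>)
 show "norm z < 1 ==> dir v F z = (LINT w|lball. of_real (rho w powr t) * g w * (of_real s * cdot v w * ker (s + 1) z w))"
  "norm z < 1 ==> integrable lball (\<lambda>w. of_real (rho w powr t) * g w * (of_real s * cdot v w * ker (s + 1) z w))"
  using main by blast+
qed

lemma bergman_proj_holo:
 fixes g :: "'n::finite cfun"
 assumes \<beta>: "\<beta> > -1" and g: "bmeas g" "wint \<beta> 1 g < \<infinity>"
 shows "holo_on (ball 0 1) (bergman_proj \<beta> g)"
proof -
 define s where "s = real CARD('n) + 1 + \<beta>"
 have s: "s > 0" using \<beta> by (simp add: s_def add_pos_pos)
 have "holo_on (ball 0 1) (\<lambda>z. (1 / of_real (bmass TYPE('n) \<beta>)) * (LINT w|lball. of_real (rho w powr \<beta>) * g w * ker s z w))"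
  by (rule holo_cmul[OF ker_integral_holo(1)[OF g s]])
 thus ?thesis
  by (rule holo_on_cong(1)) (simp_all add: bergman_proj_eq[OF \<beta> g(1)] s_def mult.assoc)
qed

subsection \<open>Growth of functions in weighted Bergman spaces\<close>

lemma one_minus_norm_powr_le:
 assumes z: "norm z < 1" and s: "s >= 0"
 shows "(1 - norm z) powr (- s) <= 2 powr s * rho z powr (- s)"
proof -
 have "rho z = (1 - norm z) * (1 + norm z)" by (simp add: rho_def power2_eq_square algebra_simps)
 also have "... <= (1 - norm z) * 2" using z by (intro mult_left_mono) auto
 finally have "rho z / 2 <= 1 - norm z" by simp
 hence "(1 - norm z) powr (- s) <= (rho z / 2) powr (- s)" using s rho_pos[OF z] by (intro powr_mono2') auto
 also have "... = 2 powr s * rho z powr (- s)" using rho_pos[OF z] by (simp add: powr_divide powr_minus field_simps)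
 finally show ?thesis .
qed

lemma nn_integral_dilate:
 fixes g :: "'a::euclidean_space => ennreal"
 assumes g: "g \<in> borel_measurable borel" and r: "r > 0"
 shows "(\<integral>\<^sup>+x. g x \<partial>lborel) = ennreal (r ^ DIM('a)) * (\<integral>\<^sup>+w. g (r *\<^sub>R w) \<partial>lborel)"
proof -
 have "(\<integral>\<^sup>+x. g x \<partial>lborel) = (\<integral>\<^sup>+x. g x \<partial>density (distr lborel borel (\<lambda>w. 0 + r *\<^sub>R w)) (\<lambda>_. ennreal (\<bar>r\<bar> ^ DIM('a))))"
  using lborel_affine[of r "0::'a"] r by simp
 also have "... = (\<integral>\<^sup>+x. ennreal (\<bar>r\<bar> ^ DIM('a)) * g x \<partial>(distr lborel borel (\<lambda>w. 0 + r *\<^sub>R w)))"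
  by (rule nn_integral_density) (use g in auto)
 also have "... = ennreal (r ^ DIM('a)) * (\<integral>\<^sup>+x. g x \<partial>(distr lborel borel (\<lambda>w. 0 + r *\<^sub>R w)))"
  using g r by (subst nn_integral_cmult) auto
 also have "(\<integral>\<^sup>+x. g x \<partial>(distr lborel borel (\<lambda>w. 0 + r *\<^sub>R w))) = (\<integral>\<^sup>+w. g (0 + r *\<^sub>R w) \<partial>lborel)"
  by (rule nn_integral_distr) (use g in auto)
 finally show ?thesis by simp
qed

text \<open>The reproducing formula presupposes a growth bound, the very thing sought here. It is
  therefore applied to dilates, holomorphic across the sphere; a linear change of variables bounds
  their integrals by that of \<open>f\<close>, uniformly for radii at least 1/2, and the radius then
  tends to 1. The weight exponent is |t| because rho(w)^|t| <= rho(r w)^t for either sign of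
  t.\<close>

lemma crude_growth:
 fixes f :: "'n::finite cfun" and t :: real
 assumes f: "holo_on (ball 0 1) f" and fin: "wint t 1 f < \<infinity>"
 obtains C where "C >= 0" "!!z. norm z < 1 ==> norm (f z) <= C * rho z powr (- (real CARD('n) + 1 + \<bar>t\<bar>))"
proof -
 let ?D = "DIM(complex^'n)"
 define s where "s = real CARD('n) + 1 + \<bar>t\<bar>"
 have s: "s >= 0" by (simp add: s_def)
 define A where "A = bmass TYPE('n) \<bar>t\<bar>"
 have A: "A > 0" unfolding A_def by (rule bmass_pos) simp
 obtain K where K: "K >= 0" "wint t 1 f = ennreal K" using fin by (cases "wint t 1 f") auto
 let ?F = "\<lambda>x. ennreal (rho x powr t * norm (f x) powr 1)"
 have Fm: "bmeas ?F" by (rule measurable_compose[OF measurable_wint[OF holo_measurable[OF f]] measurable_ennreal])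
 have gm: "(\<lambda>x. ?F x * indicator (ball 0 1) x) \<in> borel_measurable borel"
  using Fm by (subst (asm) borel_measurable_restrict_space_iff_ennreal) auto
 have wK: "(\<integral>\<^sup>+x. ?F x * indicator (ball 0 1) x \<partial>lborel) = ennreal K"
  unfolding K(2)[symmetric] wint_def by (subst nn_integral_restrict_space) auto
 have main: "norm (f (of_real r *s z)) <= (1 - norm z) powr (- s) * (2 ^ ?D * K) / A" if z: "norm z < 1" and r: "1 / 2 <= r" "r < 1" for z r
 proof -
  let ?h = "\<lambda>w. f (of_real r *s w)"
  let ?I = "\<integral>\<^sup>+w. ?F (r *\<^sub>R w) * indicator (ball 0 1) (r *\<^sub>R w) \<partial>lborel"
  have "ennreal (A * norm (?h z)) = ennreal (norm (LINT w|lball. of_real (rho w powr \<bar>t\<bar>) * (?h w * ker s z w)))"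
   using reproducing_smooth[OF holo_dilate[OF f, of r] _ _ z, of "\<bar>t\<bar>"] r A by (simp add: norm_mult s_def A_def)
  also have "... <= bint (\<lambda>w. norm (of_real (rho w powr \<bar>t\<bar>) * (?h w * ker s z w)))" by (rule norm_integral_le_nn_integral)
  also have "... <= (\<integral>\<^sup>+w. ennreal ((1 - norm z) powr (- s)) * ?F (r *\<^sub>R w) \<partial>lball)"
  proof (rule nn_integral_mono)
   fix w :: "complex^'n" assume "w \<in> space lball"
   hence w: "norm w < 1" by simp
   have "rho w powr \<bar>t\<bar> <= rho (of_real r *s w) powr \<bar>t\<bar>" using rho_dilate[of r w] rho_pos[OF w] r by (intro powr_mono2) auto
   also have "... <= rho (of_real r *s w) powr t" using rho_dilate[of r w] rho_pos[OF w] r rho_le_1 by (intro powr_mono') auto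
   finally have "rho w powr \<bar>t\<bar> * (norm (?h w) * norm (ker s z w)) <= rho (of_real r *s w) powr t * (norm (?h w) * (1 - norm z) powr (- s))"
    using norm_ker_le[OF order_refl z, of w s] w s by (intro mult_mono mult_left_mono) auto
   thus "ennreal (norm (of_real (rho w powr \<bar>t\<bar>) * (?h w * ker s z w))) <= ennreal ((1 - norm z) powr (- s)) * ?F (r *\<^sub>R w)"
    by (simp add: norm_mult scaleR_eq_vsmult mult_ac ennreal_leI flip: ennreal_mult)
  qed
  also have "... = (\<integral>\<^sup>+w. ennreal ((1 - norm z) powr (- s)) * ?F (r *\<^sub>R w) * indicator (ball 0 1) w \<partial>lborel)"
   by (subst nn_integral_restrict_space) auto
  also have "... <= (\<integral>\<^sup>+w. ennreal ((1 - norm z) powr (- s)) * (?F (r *\<^sub>R w) * indicator (ball 0 1) (r *\<^sub>R w)) \<partial>lborel)"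
  proof (rule nn_integral_mono)
   fix w :: "complex^'n"
   have "r * norm w <= 1 * norm w" using r by (intro mult_right_mono) auto
   thus "ennreal ((1 - norm z) powr (- s)) * ?F (r *\<^sub>R w) * indicator (ball 0 1) w <= ennreal ((1 - norm z) powr (- s)) * (?F (r *\<^sub>R w) * indicator (ball 0 1) (r *\<^sub>R w))"
    using r by (auto simp: indicator_def)
  qed
  also have "... = ennreal ((1 - norm z) powr (- s)) * ?I"
   by (rule nn_integral_cmult) (rule measurable_compose[OF _ gm], measurable)
  also have "... <= ennreal ((1 - norm z) powr (- s)) * ennreal (2 ^ ?D * K)"
  proof (intro mult_left_mono)
   have "(1 / 2) ^ ?D <= r ^ ?D" using r by (intro power_mono) auto
   hence "ennreal ((1 / 2) ^ ?D) * ?I <= ennreal (r ^ ?D) * ?I" by (intro mult_right_mono ennreal_leI) auto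
   also have "... = ennreal K" using nn_integral_dilate[OF gm, of r] r wK by simp
   finally have "ennreal (2 ^ ?D) * (ennreal ((1 / 2) ^ ?D) * ?I) <= ennreal (2 ^ ?D) * ennreal K" by (rule mult_left_mono) simp
   moreover have "ennreal (2 ^ ?D) * (ennreal ((1 / 2) ^ ?D) * ?I) = ?I"
    unfolding mult.assoc[symmetric] by (simp add: power_divide flip: ennreal_mult)
   ultimately show "?I <= ennreal (2 ^ ?D * K)" using K(1) by (simp add: ennreal_mult)
  qed simp
  finally have "A * norm (?h z) <= (1 - norm z) powr (- s) * (2 ^ ?D * K)" using K(1) by (simp flip: ennreal_mult)
  thus ?thesis using A by (simp add: pos_le_divide_eq mult.commute)
 qed
 show thesis
 proof (rule that)
  show "0 <= 2 powr s * (2 ^ ?D * K) / A" using K A by simp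
  fix z :: "complex^'n" assume z: "norm z < 1"
  have le: "norm (f (of_real (1 - 1 / real (i + 2)) *s z)) <= (1 - norm z) powr (- s) * (2 ^ ?D * K) / A" for i
   by (rule main[OF z]) (auto simp: field_simps)
  have "norm (f z) <= (1 - norm z) powr (- s) * (2 ^ ?D * K) / A"
   by (rule LIMSEQ_le_const2[OF tendsto_norm[OF dilate_LIMSEQ[OF f z]]]) (use le in blast)
  also have "... <= (2 powr s * rho z powr (- s)) * (2 ^ ?D * K) / A"
   using one_minus_norm_powr_le[OF z s] K A by (intro divide_right_mono mult_right_mono) auto
  finally show "norm (f z) <= 2 powr s * (2 ^ ?D * K) / A * rho z powr (- (real CARD('n) + 1 + \<bar>t\<bar>))" unfolding s_def[symmetric] by (simp add: mult_ac)
 qed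
qed

lemma wint_1_le:
 fixes g :: "'n::finite cfun"
 assumes "\<alpha> > -1" "p >= 1" "bmeas g" "wint \<alpha> p g < \<infinity>"
 shows "wint \<alpha> 1 g < \<infinity>"
proof -
 have "wint \<alpha> 1 g <= (\<integral>\<^sup>+z. ennreal (rho z powr \<alpha>) + ennreal (rho z powr \<alpha> * norm (g z) powr p) \<partial>(lball :: (complex^'n) measure))"
  unfolding wint_def
 proof (rule nn_integral_mono)
  fix z :: "complex^'n"
  have "norm (g z) powr 1 <= 1 + norm (g z) powr p"
  proof (cases "norm (g z) <= 1")
   case True
   hence "norm (g z) powr 1 <= 1" by simp
   moreover have "0 <= norm (g z) powr p" by simp
   ultimately show ?thesis by linarith
  next
   case False
   hence "norm (g z) powr 1 <= norm (g z) powr p" using assms(2) by (intro powr_mono) auto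
   thus ?thesis by linarith
  qed
  hence "rho z powr \<alpha> * norm (g z) powr 1 <= rho z powr \<alpha> * (1 + norm (g z) powr p)" by (intro mult_left_mono) auto
  thus "ennreal (rho z powr \<alpha> * norm (g z) powr 1) <= ennreal (rho z powr \<alpha>) + ennreal (rho z powr \<alpha> * norm (g z) powr p)"
   by (simp add: distrib_left ennreal_leI flip: ennreal_plus)
 qed
 also have "... = (\<integral>\<^sup>+z. ennreal (rho z powr \<alpha>) \<partial>(lball :: (complex^'n) measure)) + wint \<alpha> p g"
  unfolding wint_def
  by (rule nn_integral_add) (intro measurable_compose[OF _ measurable_ennreal] measurable_rho_powr measurable_wint assms)+
 also have "(\<integral>\<^sup>+z. ennreal (rho z powr \<alpha>) \<partial>(lball :: (complex^'n) measure)) = ennreal (bmass TYPE('n) \<alpha>)"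
  unfolding bmass_def by (rule nn_integral_eq_integral[OF integrable_rho_powr[OF assms(1)]]) simp
 also have "ennreal (bmass TYPE('n) \<alpha>) + wint \<alpha> p g < \<infinity>" using assms(4) by simp
 finally show ?thesis .
qed

text \<open>With the crude bound in hand the reproducing formula holds for a large exponent
  \<open>b\<close>. Hoelder's inequality, with the weight split as \<alpha> / p and b - \<alpha> /
  p, and a Forelli-Rudin estimate of the kernel factor give the exponent (n + 1 + \<alpha>) / p on
  which the embedding below depends.\<close>

proposition bergman_growth:
 fixes \<alpha> p :: real
 assumes \<alpha>: "\<alpha> > -1" and p: "p > 1"
 obtains C where "C > 0" "!!(g :: 'n::finite cfun) B (z :: complex^'n). holo_on (ball 0 1) g ==> B > 0 ==> wint \<alpha> p g <= ennreal (B powr p) ==>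
  norm z < 1 ==> norm (g z) <= C * B * rho z powr (- ((real CARD('n) + 1 + \<alpha>) / p))"
proof -
 let ?n = "real CARD('n)"
 define \<kappa> where "\<kappa> = real CARD('n) + 1 + \<bar>\<alpha>\<bar>"
 define b where "b = \<kappa> + \<bar>\<alpha>\<bar>"
 define s where "s = ?n + 1 + b"
 define p' where "p' = p / (p - 1)"
 have p': "p' > 1" "1 / p + 1 / p' = 1" using p by (auto simp: p'_def field_simps)
 have p'p: "p' - 1 = p' / p" using p by (simp add: p'_def field_simps)
 have b: "b > -1" "b - \<kappa> > -1" "\<kappa> >= 0" by (auto simp: b_def \<kappa>_def)
 define t where "t = (b - \<alpha> / p) * p'"
 have "\<alpha> / p <= \<bar>\<alpha>\<bar>"
  by (rule order_trans[of _ "\<bar>\<alpha>\<bar> / p"]) (use p in \<open>auto intro!: divide_right_mono simp: divide_le_eq mult_le_cancel_left1\<close>)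
 hence "b - \<alpha> / p >= 0" by (simp add: b_def \<kappa>_def)
 hence t: "t > -1" using p' by (simp add: t_def order_less_le_trans[of "-1" 0])
 have c: "s * p' - (?n + 1 + t) = (?n + 1 + \<alpha>) * (p' / p)"
 proof -
  have "s * p' - (?n + 1 + t) = (?n + 1) * (p' - 1) + \<alpha> * (p' / p)"
   unfolding s_def t_def by (simp add: algebra_simps)
  thus ?thesis unfolding p'p by (simp add: algebra_simps)
 qed
 have "?n >= 0" by simp
 hence "?n + 1 + \<alpha> > 0" using \<alpha> by linarith
 hence "(?n + 1 + \<alpha>) * (p' / p) > 0" using p p' by simp
 define C1 where "C1 = fr_const TYPE('n) t (s * p')"
 have "s * p' > ?n + 1 + t" using c \<open>(?n + 1 + \<alpha>) * (p' / p) > 0\<close> by linarith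
 note C1 = forelli_rudin[OF t this, folded C1_def]
 have A: "bmass TYPE('n) b > 0" by (rule bmass_pos[OF b(1)])
 show thesis
 proof (rule that[of "C1 powr (1 / p') / bmass TYPE('n) b"])
  show "C1 powr (1 / p') / bmass TYPE('n) b > 0" using C1 A by simp
  fix g :: "'n cfun" and B and z :: "complex^'n"
  assume g: "holo_on (ball 0 1) g" and B: "B > 0" "wint \<alpha> p g <= ennreal (B powr p)" and z: "norm z < 1"
  have "wint \<alpha> 1 g < \<infinity>"
  proof (rule wint_1_le[OF \<alpha> _ holo_measurable[OF g]])
   show "wint \<alpha> p g < \<infinity>" unfolding infinity_ennreal_def by (rule order_le_less_trans[OF B(2) ennreal_less_top])
  qed (use p in simp)
  from crude_growth[OF g this, folded \<kappa>_def]
  obtain C where C: "!!z. norm z < 1 ==> norm (g z) <= C * rho z powr (- \<kappa>)" by blast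
  have gm: "bmeas g" by (rule holo_measurable[OF g])
  have "of_real (bmass TYPE('n) b) * g z = (LINT w|lball. of_real (rho w powr b) * (g w * ker s z w))"
   unfolding s_def by (rule reproducing_growth[OF g C b z, symmetric])
  hence "norm (of_real (bmass TYPE('n) b) * g z) = norm (LINT w|lball. of_real (rho w powr b) * (g w * ker s z w))" by simp
  hence "bmass TYPE('n) b * norm (g z) = norm (LINT w|lball. of_real (rho w powr b) * (g w * ker s z w))"
   using A by (simp add: norm_mult)
  hence "ennreal (bmass TYPE('n) b * norm (g z)) <= bint (\<lambda>w. norm (of_real (rho w powr b) * (g w * ker s z w)))"
   by (simp only: norm_integral_le_nn_integral)
  also have "... = bint (\<lambda>w. (rho w powr (\<alpha> / p) * norm (g w)) * (rho w powr (b - \<alpha> / p) * kdist z w powr (- s)))"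
  proof (intro nn_integral_cong arg_cong[where f=ennreal])
   fix w :: "complex^'n"
   have "rho w powr b = rho w powr (\<alpha> / p) * rho w powr (b - \<alpha> / p)" by (simp flip: powr_add)
   thus "norm (of_real (rho w powr b) * (g w * ker s z w)) = (rho w powr (\<alpha> / p) * norm (g w)) * (rho w powr (b - \<alpha> / p) * kdist z w powr (- s))"
    by (simp add: norm_mult norm_ker mult_ac)
  qed
  also have "... <= ennreal (B * (C1 powr (1 / p') * rho z powr (- ((?n + 1 + \<alpha>) / p))))"
  proof (rule nn_integral_Hoelder[OF p p'])
   have "bmeas (\<lambda>w. norm (g w))" using gm by measurable
   thus "bmeas (\<lambda>w. rho w powr (\<alpha> / p) * norm (g w))"
    by (intro borel_measurable_times measurable_rho_powr)
   show "bmeas (\<lambda>w. rho w powr (b - \<alpha> / p) * kdist z w powr (- s))" by (rule measurable_rho_kdist[OF z])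
   have "bint (\<lambda>w. (rho w powr (\<alpha> / p) * norm (g w)) powr p) = wint \<alpha> p g"
    unfolding wint_def using p by (intro nn_integral_cong) (simp add: powr_mult powr_powr)
   thus "bint (\<lambda>w. (rho w powr (\<alpha> / p) * norm (g w)) powr p) <= ennreal (B powr p)" using B by simp
   have "bint (\<lambda>w. (rho w powr (b - \<alpha> / p) * kdist z w powr (- s)) powr p') = bint (\<lambda>w. rho w powr t * kdist z w powr (- (s * p')))"
    unfolding t_def by (intro nn_integral_cong) (simp add: powr_mult powr_powr)
   also have "... <= ennreal (C1 * rho z powr (?n + 1 + t - s * p'))" by (rule C1(2)[OF z])
   also have "?n + 1 + t - s * p' = - ((?n + 1 + \<alpha>) / p) * p'" using c by (simp add: field_simps)
   also have "C1 * rho z powr (- ((?n + 1 + \<alpha>) / p) * p') = (C1 powr (1 / p') * rho z powr (- ((?n + 1 + \<alpha>) / p))) powr p'"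
    using C1(1) p' by (simp add: powr_mult powr_powr)
   finally show "bint (\<lambda>w. (rho w powr (b - \<alpha> / p) * kdist z w powr (- s)) powr p') <= ennreal ((C1 powr (1 / p') * rho z powr (- ((?n + 1 + \<alpha>) / p))) powr p')" .
  qed (use B C1 rho_pos[OF z] in auto)
  finally have "bmass TYPE('n) b * norm (g z) <= B * (C1 powr (1 / p') * rho z powr (- ((?n + 1 + \<alpha>) / p)))"
   using B by (subst (asm) ennreal_le_iff) auto
  thus "norm (g z) <= C1 powr (1 / p') / bmass TYPE('n) b * B * rho z powr (- ((?n + 1 + \<alpha>) / p))"
   using A by (simp add: field_simps)
 qed
qed


section \<open>The commutator of the Bergman projection with a conjugate holomorphic symbol\<close>

text \<open>A class on which projections with \<open>b\<close> large converge absolutely and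
  reproduce. The order \<open>\<kappa>\<close> enters such side conditions, while the constants of
  the operator bounds are independent of it.\<close>

definition growth :: "real => 'n::finite cfun => bool" where
 "growth \<kappa> f \<longleftrightarrow> holo_on (ball 0 1) f \<and> (\<exists>C. \<forall>z. norm z < 1 --> norm (f z) <= C * rho z powr (- \<kappa>))"

lemma growth_holo: "growth \<kappa> f ==> holo_on (ball 0 1) f"
 by (simp add: growth_def)

lemma growthE:
 fixes f :: "'n::finite cfun"
 assumes "growth \<kappa> f"
 obtains C where "C >= 0" "!!z. norm z < 1 ==> norm (f z) <= C * rho z powr (- \<kappa>)"
proof -
 obtain C where C: "!!z. norm z < 1 ==> norm (f z) <= C * rho z powr (- \<kappa>)" using assms unfolding growth_def by blast
 have "0 <= C * rho (0::complex^'n) powr (- \<kappa>)" by (rule order_trans[OF norm_ge_zero C]) simp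
 hence "C >= 0" by (simp add: rho_def)
 thus thesis using that C by blast
qed

lemma growth_diff:
 fixes f :: "'n::finite cfun"
 assumes "growth \<kappa> f" "growth \<kappa> g"
 shows "growth \<kappa> (\<lambda>z. f z - g z)"
proof -
 obtain C where C: "C >= 0" "!!z. norm z < 1 ==> norm (f z) <= C * rho z powr (- \<kappa>)" by (rule growthE[OF assms(1)]) blast
 obtain D where D: "D >= 0" "!!z. norm z < 1 ==> norm (g z) <= D * rho z powr (- \<kappa>)" by (rule growthE[OF assms(2)]) blast
 have "norm (f z - g z) <= (C + D) * rho z powr (- \<kappa>)" if "norm z < 1" for z
  using norm_triangle_ineq4[of "f z" "g z"] C(2)[OF that] D(2)[OF that] by (simp add: distrib_right)
 thus ?thesis using assms unfolding growth_def by (blast intro: holo_diff)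
qed

lemma bounded_growth:
 fixes f :: "'n::finite cfun"
 assumes "holo_on (ball 0 1) f" "!!z. norm z < 1 ==> norm (f z) <= C" "\<kappa> >= 0"
 shows "growth \<kappa> f"
proof -
 have C: "C >= 0" using order_trans[OF norm_ge_zero assms(2)[of 0]] by simp
 have "norm (f z) <= C * rho z powr (- \<kappa>)" if "norm z < 1" for z
 proof -
  have "1 <= rho z powr (- \<kappa>)" using powr_mono2'[of "- \<kappa>" "rho z" 1] rho_pos[OF that] rho_le_1[of z] assms(3) by simp
  hence "C * 1 <= C * rho z powr (- \<kappa>)" using C by (intro mult_left_mono) auto
  thus ?thesis using assms(2)[OF that] by simp
 qed
 thus ?thesis using assms(1) unfolding growth_def by blast
qed

lemma wint_growth_lt_top:
 fixes f g :: "'n::finite cfun"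
 assumes f: "growth \<kappa> f" and g: "growth \<kappa>' g" and b: "b - \<kappa> - \<kappa>' > -1"
 shows "wint b 1 (\<lambda>w. cnj (f w) * g w) < \<infinity>"
proof -
 obtain C where C: "C >= 0" "!!z. norm z < 1 ==> norm (f z) <= C * rho z powr (- \<kappa>)" by (rule growthE[OF f]) blast
 obtain D where D: "D >= 0" "!!z. norm z < 1 ==> norm (g z) <= D * rho z powr (- \<kappa>')" by (rule growthE[OF g]) blast
 have "wint b 1 (\<lambda>w. cnj (f w) * g w) <= (\<integral>\<^sup>+w. ennreal (C * D * rho w powr (b - \<kappa> - \<kappa>')) \<partial>(lball :: (complex^'n) measure))"
  unfolding wint_def
 proof (intro nn_integral_mono ennreal_leI)
  fix w :: "complex^'n" assume "w \<in> space lball"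
  hence w: "norm w < 1" by simp
  have "norm (f w) * norm (g w) <= (C * rho w powr (- \<kappa>)) * (D * rho w powr (- \<kappa>'))"
   using C D w by (intro mult_mono) auto
  hence "rho w powr b * (norm (f w) * norm (g w)) <= rho w powr b * ((C * rho w powr (- \<kappa>)) * (D * rho w powr (- \<kappa>')))"
   by (intro mult_left_mono) auto
  also have "... = C * D * (rho w powr b * rho w powr (- \<kappa>) * rho w powr (- \<kappa>'))" by (simp only: mult_ac)
  also have "rho w powr b * rho w powr (- \<kappa>) * rho w powr (- \<kappa>') = rho w powr (b - \<kappa> - \<kappa>')" by (simp flip: powr_add)
  finally show "rho w powr b * norm (cnj (f w) * g w) powr 1 <= C * D * rho w powr (b - \<kappa> - \<kappa>')" by (simp add: norm_mult)
 qed
 also have "... = ennreal (LINT w|(lball :: (complex^'n) measure). C * D * rho w powr (b - \<kappa> - \<kappa>'))"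
  by (rule nn_integral_eq_integral[OF integrable_mult_right[OF integrable_rho_powr[OF b]]]) (use C D in auto)
 finally show ?thesis unfolding infinity_ennreal_def by (rule order_le_less_trans[OF _ ennreal_less_top])
qed

lemma proj_integrable:
 fixes u :: "'n::finite cfun"
 assumes u: "bmeas u" "wint b 1 u < \<infinity>" and z: "norm z < 1" and s: "s >= 0"
 shows "integrable lball (\<lambda>w. of_real (rho w powr b) * (u w * ker s z w))"
proof (rule Bochner_Integration.integrable_bound[OF integrable_mult_left[OF integrable_norm[OF wint_1_integrable[OF u]], of "(1 - norm z) powr (- s)"]])
 have "bmeas (ker s z)"
  by (intro measurable_lball continuous_on_subset[OF ker_cont_right[OF z]]) auto
 thus "bmeas (\<lambda>w. of_real (rho w powr b) * (u w * ker s z w))"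
  using measurable_rho_powr_complex[of b] u(1) by measurable
 show "AE w in lball. norm (of_real (rho w powr b) * (u w * ker s z w)) <= norm (norm (of_real (rho w powr b) * u w) * (1 - norm z) powr (- s))"
 proof (rule AE_I2)
  fix w :: "complex^'n" assume "w \<in> space lball"
  hence "norm (ker s z w) <= (1 - norm z) powr (- s)" using z s by (intro norm_ker_le) auto
  hence "norm (of_real (rho w powr b) * u w) * norm (ker s z w) <= norm (of_real (rho w powr b) * u w) * (1 - norm z) powr (- s)"
   by (intro mult_left_mono) auto
  thus "norm (of_real (rho w powr b) * (u w * ker s z w)) <= norm (norm (of_real (rho w powr b) * u w) * (1 - norm z) powr (- s))"
   by (simp add: norm_mult mult.assoc)
 qed
qed

lemma bergman_proj_lin:
 fixes u v :: "'n::finite cfun"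
 assumes b: "b > -1" and u: "bmeas u" "wint b 1 u < \<infinity>" and v: "bmeas v" "wint b 1 v < \<infinity>"
  and z: "norm z < 1"
 shows "bergman_proj b (\<lambda>w. c * u w + d * v w) z = c * bergman_proj b u z + d * bergman_proj b v z"
proof -
 define s where "s = real CARD('n) + 1 + b"
 have s: "s >= 0" using b by (simp add: s_def add_nonneg_nonneg)
 have m: "bmeas (\<lambda>w. c * u w + d * v w)" using u(1) v(1) by measurable
 note i = proj_integrable[OF u z s] proj_integrable[OF v z s]
 have "(LINT w|lball. of_real (rho w powr b) * ((c * u w + d * v w) * ker s z w))
  = (LINT w|lball. c * (of_real (rho w powr b) * (u w * ker s z w)) + d * (of_real (rho w powr b) * (v w * ker s z w)))"
  by (intro Bochner_Integration.integral_cong refl) (simp add: algebra_simps)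
 also have "... = c * (LINT w|lball. of_real (rho w powr b) * (u w * ker s z w)) + d * (LINT w|lball. of_real (rho w powr b) * (v w * ker s z w))"
  using i by (subst Bochner_Integration.integral_add) auto
 finally show ?thesis
  unfolding bergman_proj_eq[OF b m z] bergman_proj_eq[OF b u(1) z] bergman_proj_eq[OF b v(1) z] s_def by (simp add: add_divide_distrib)
qed

lemma bergman_proj_reproducing:
 fixes f :: "'n::finite cfun"
 assumes f: "growth \<kappa> f" and b: "b > -1" "b - \<kappa> > -1" "\<kappa> >= 0" and z: "norm z < 1"
 shows "bergman_proj b f z = f z"
proof -
 obtain C where "!!z. norm z < 1 ==> norm (f z) <= C * rho z powr (- \<kappa>)" by (rule growthE[OF f]) blast
 from reproducing_growth[OF growth_holo[OF f] this b z] show ?thesis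
  unfolding bergman_proj_eq[OF b(1) holo_measurable[OF growth_holo[OF f]] z] using bmass_pos[OF b(1), where 'n='n] by simp
qed

text \<open>The formula of \<open>hankel_conj\<close> at the weight \<open>b\<close>. For
  \<open>g\<close> reproduced by the projection it is the commutator of multiplication by the
  conjugate of \<open>f\<close> with that projection, applied to \<open>g\<close>.\<close>

definition commutator :: "real => 'n::finite cfun => 'n cfun => 'n cfun" where
 "commutator b f g z = cnj (f z) * g z - bergman_proj b (\<lambda>w. cnj (f w) * g w) z"

text \<open>The source weight \<beta> - q \<gamma> balances a factor rho^(-\<gamma>) from the
  symbol. One \<open>C\<close> serves all symbols and functions, and \<open>f\<close> enters through
  the power of \<open>N\<close> only; the approximation argument lives on this homogeneity.\<close>

definition op_bound :: "real => real => real => real => real => ('n::finite cfun => 'n cfun => 'n cfun) => bool" where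
 "op_bound \<beta> \<gamma> q b C S \<longleftrightarrow> C > 0 \<and> (\<forall>f g N \<kappa> \<kappa>'. growth \<kappa> f --> growth \<kappa>' g --> \<kappa> >= 0 --> \<kappa>' >= 0 --> b - \<kappa> - \<kappa>' > -1 -->
  bloch_bound \<gamma> N f --> wint (\<beta> - q * \<gamma>) q g < \<infinity> --> wint \<beta> q (S f g) <= ennreal (C * N powr q) * wint (\<beta> - q * \<gamma>) q g)"

lemma op_boundD:
 assumes "op_bound \<beta> \<gamma> q b C S" "growth \<kappa> f" "growth \<kappa>' g" "\<kappa> >= 0" "\<kappa>' >= 0" "b - \<kappa> - \<kappa>' > -1" "bloch_bound \<gamma> N f" "wint (\<beta> - q * \<gamma>) q g < \<infinity>"
 shows "wint \<beta> q (S f g) <= ennreal (C * N powr q) * wint (\<beta> - q * \<gamma>) q g"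
 using assms unfolding op_bound_def by blast

text \<open>\<open>bloch_lipschitz\<close> against the point 0, where \<open>kdist\<close> is 1,
  with \<theta> chosen so that \<gamma> + \<theta> stays below \<beta> + 1.\<close>

lemma bloch_growth:
 fixes f :: "'n::finite cfun"
 assumes f: "holo_on (ball 0 1) f" "bloch_bound \<gamma> N f" and \<gamma>: "- aniso TYPE('n) < \<gamma>" "\<gamma> < \<beta> + 1" and \<beta>: "\<beta> > -1"
 obtains \<kappa> where "0 < \<kappa>" "\<kappa> < \<beta> + 1" "growth \<kappa> f"
proof -
 have "max 0 (- \<gamma>) < min (aniso TYPE('n)) (\<beta> + 1 - \<gamma>)" using \<gamma> \<beta> aniso_bounds[where 'n='n] by auto
 then obtain \<theta> where "max 0 (- \<gamma>) < \<theta>" "\<theta> < min (aniso TYPE('n)) (\<beta> + 1 - \<gamma>)" using dense by blast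
 hence \<theta>: "0 < \<theta>" "- \<gamma> < \<theta>" "\<theta> < aniso TYPE('n)" "\<gamma> + \<theta> < \<beta> + 1" by auto
 define L where "L = lip_const TYPE('n) \<gamma> \<theta>"
 note L = bloch_lipschitz[OF \<theta>(1-3) \<gamma>(1), folded L_def]
 have N: "N >= 0" using f(2) by (simp add: bloch_bound_def)
 have "norm (f z) <= (norm (f 0) + L * N * 2) * rho z powr (- (\<gamma> + \<theta>))" if z: "norm z < 1" for z
 proof -
  have 1: "1 <= rho z powr (- (\<gamma> + \<theta>))" using powr_mono'[of "- (\<gamma> + \<theta>)" 0 "rho z"] rho_pos[OF z] rho_le_1[of z] \<theta>(2) by simp
  have "norm (f z - f 0) <= L * N * kdist z 0 powr \<theta> * (rho z powr (- (\<gamma> + \<theta>)) + rho (0 :: complex^'n) powr (- (\<gamma> + \<theta>)))"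
   by (rule L(2)[OF f z]) simp
  also have "... = L * N * (rho z powr (- (\<gamma> + \<theta>)) + 1)" by (simp add: kdist_def rho_def)
  also have "... <= L * N * (2 * rho z powr (- (\<gamma> + \<theta>)))" using 1 L(1) N by (intro mult_left_mono) auto
  finally have "norm (f z - f 0) <= L * N * 2 * rho z powr (- (\<gamma> + \<theta>))" by simp
  moreover have "norm (f 0) * 1 <= norm (f 0) * rho z powr (- (\<gamma> + \<theta>))" by (rule mult_left_mono[OF 1]) simp
  ultimately show ?thesis using norm_triangle_sub[of "f z" "f 0"] by (simp add: distrib_right)
 qed
 hence "growth (\<gamma> + \<theta>) f" using f(1) unfolding growth_def by blast
 thus thesis by (rule that[rotated 2]) (use \<theta> in auto)
qed

lemma growth_measurable: "growth \<kappa> f ==> bmeas f"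
 by (rule holo_measurable[OF growth_holo])

lemma measurable_cnj_mult:
 fixes f g :: "'n::finite cfun"
 assumes "bmeas f" "bmeas g"
 shows "bmeas (\<lambda>w. cnj (f w) * g w)"
proof -
 have "bmeas (\<lambda>w. cnj (f w))"
  by (rule measurable_compose[OF assms(1), of cnj]) (rule borel_measurable_continuous_onI, intro continuous_intros)
 thus ?thesis using assms(2) by measurable
qed

lemma commutator_measurable:
 fixes f g :: "'n::finite cfun"
 assumes f: "growth \<kappa> f" and g: "growth \<kappa>' g" and b: "b > -1" "b - \<kappa> - \<kappa>' > -1"
 shows "bmeas (commutator b f g)"
proof -
 note m = measurable_cnj_mult[OF growth_measurable[OF f] growth_measurable[OF g]]
 have "bergman_proj b (\<lambda>w. cnj (f w) * g w) \<in> borel_measurable lball"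
  by (rule holo_measurable[OF bergman_proj_holo[OF b(1) m wint_growth_lt_top[OF f g b(2)]]])
 with m show ?thesis unfolding commutator_def[abs_def] by measurable
qed

text \<open>As \<open>g\<close> is reproduced by the projection, \<open>cnj (f z) * g z\<close> can
  be written under the same integral, and the symbol appears only through
  \<open>f z - f w\<close>.\<close>

lemma commutator_le:
 fixes f g :: "'n::finite cfun"
 assumes f: "growth \<kappa> f" and g: "growth \<kappa>' g" and b: "b > -1" "b - \<kappa> - \<kappa>' > -1" "b - \<kappa>' > -1" "\<kappa>' >= 0" and z: "norm z < 1"
 shows "ennreal (norm (commutator b f g z))
  <= bint (\<lambda>w. 1 / bmass TYPE('n) b * (rho w powr b * (norm (f z - f w) * norm (g w)) * kdist z w powr (- (real CARD('n) + 1 + b))))"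
proof -
 note mf = growth_measurable[OF f] and mg = growth_measurable[OF g]
 have c0: "growth 0 (\<lambda>_::complex^'n. 1)" by (rule bounded_growth[where C=1]) auto
 have wg: "wint b 1 g < \<infinity>" using wint_growth_lt_top[OF c0 g, of b] b by simp
 have "commutator b f g z = bergman_proj b (\<lambda>w. cnj (f z) * g w + (-1) * (cnj (f w) * g w)) z"
  unfolding bergman_proj_lin[OF b(1) mg wg measurable_cnj_mult[OF mf mg] wint_growth_lt_top[OF f g b(2)] z] bergman_proj_reproducing[OF g b(1,3,4) z] commutator_def by simp
 also have "(\<lambda>w. cnj (f z) * g w + (-1) * (cnj (f w) * g w)) = (\<lambda>w. cnj (f z - f w) * g w)" by (simp add: algebra_simps)
 finally have e: "commutator b f g z = bergman_proj b (\<lambda>w. cnj (f z - f w) * g w) z" .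
 have "bmeas (\<lambda>w. cnj (f z - f w) * g w)" by (rule measurable_cnj_mult[OF _ mg]) (use mf in measurable)
 from norm_bergman_proj_le[OF b(1) this z] show ?thesis by (simp only: e norm_mult complex_mod_cnj)
qed

text \<open>The Lipschitz factor changes the power of \<open>kdist\<close> from - (n + 1 + b) to
  \<theta> - (n + 1 + b). Once rho^(-\<gamma>) is attached to \<open>g\<close>, this is the kernel
  of \<open>bergman_schur\<close> with k = \<gamma> + \<theta> and \<tau> = b + \<gamma>.\<close>

proposition commutator_bound:
 fixes \<beta> \<gamma> q :: real
 assumes q: "q > 1" and \<beta>: "\<beta> > -1" and \<gamma>: "- aniso TYPE('n::finite) < \<gamma>" "\<gamma> < (\<beta> + 1) / q"
 shows "\<exists>b0. \<forall>b\<ge>b0. \<exists>C. op_bound \<beta> \<gamma> q b C (commutator b :: 'n cfun => _)"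
proof -
 let ?n = "real CARD('n)"
 define e where "e = aniso TYPE('n)"
 have e: "0 < e" "e <= 1" using aniso_bounds[where 'n='n] by (auto simp: e_def)
 define q' where "q' = q / (q - 1)"
 have q': "q' > 1" "1 / q + 1 / q' = 1" using q by (auto simp: q'_def field_simps)
 \<comment> \<open>\<open>k\<close> becomes \<gamma> + \<theta>: positivity of \<open>k\<close> and
   of \<theta> gives the lower end, the condition k q < \<beta> + 1 and \<theta> < e the upper
   end.\<close>
 have "max 0 \<gamma> < min ((\<beta> + 1) / q) (\<gamma> + e)" using \<beta> q \<gamma> e by (auto simp: e_def)
 then obtain k where k: "max 0 \<gamma> < k" "k < min ((\<beta> + 1) / q) (\<gamma> + e)" using dense by blast
 have k0: "k > 0" "k > \<gamma>" "k * q < \<beta> + 1" "k < \<gamma> + e" using k q by (auto simp: pos_less_divide_eq)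
 have qq: "k / q' = k - k / q" using q by (simp add: q'_def field_simps)
 \<comment> \<open>The interval for \<open>\<sigma>\<close> is nonempty precisely when
   \<open>k < (\<beta> + 1) / q\<close>.\<close>
 have "k - k / q < (\<beta> + 1 - k) / q" using k0(3) q by (simp add: field_simps)
 hence "k / q' < (\<beta> + 1 - k) / q" by (simp add: qq)
 then obtain \<sigma> where \<sigma>: "k / q' < \<sigma>" "\<sigma> < (\<beta> + 1 - k) / q" using dense by blast
 have "k / q' > 0" using k0 q' by simp
 hence \<sigma>0: "\<sigma> > 0" using \<sigma>(1) by linarith
 have \<sigma>': "k < \<sigma> * q'" "k + \<sigma> * q < \<beta> + 1" using \<sigma> q q' by (simp_all add: pos_divide_less_eq pos_less_divide_eq)
 define \<theta> where "\<theta> = k - \<gamma>"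
 have \<theta>: "0 < \<theta>" "- \<gamma> < \<theta>" "\<theta> < e" "\<gamma> + \<theta> = k" using k0 by (auto simp: \<theta>_def)
 define L where "L = lip_const TYPE('n) \<gamma> \<theta>"
 have L: "L > 0" "!!(f::'n cfun) N z w. holo_on (ball 0 1) f ==> bloch_bound \<gamma> N f ==> norm z < 1 ==> norm w < 1 ==>
   norm (f z - f w) <= L * N * kdist z w powr \<theta> * (rho z powr (- k) + rho w powr (- k))"
  unfolding L_def \<theta>(4)[symmetric] by (rule bloch_lipschitz[OF \<theta>(1,2) _ \<gamma>(1)]; use \<theta> in \<open>simp add: e_def\<close>)+
 show ?thesis
 proof (rule exI[of _ "\<bar>\<beta>\<bar> + \<bar>\<gamma>\<bar> + k + \<sigma> * q' + 1"], intro allI impI)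
  fix b assume b: "b >= \<bar>\<beta>\<bar> + \<bar>\<gamma>\<bar> + k + \<sigma> * q' + 1"
  define \<tau> where "\<tau> = b + \<gamma>"
  have sq: "\<sigma> * q' > 0" "\<sigma> * q > 0" using \<sigma>0 q q' by auto
  have b1: "b > -1" using b k0 sq by linarith
  have \<tau>: "\<tau> > k + \<sigma> * q' - 1" "\<tau> > \<beta> + k - \<sigma> * q" using b k0 sq unfolding \<tau>_def by linarith+
  define A where "A = bmass TYPE('n) b"
  have A: "A > 0" unfolding A_def by (rule bmass_pos[OF b1])
  define C where "C = schur_const TYPE('n) \<beta> \<tau> k \<sigma> q q'"
  note C = bergman_schur[where 'n='n, OF q q' less_imp_le[OF k0(1)] \<sigma>0 \<sigma>' \<tau>, folded C_def]
  have main: "wint \<beta> q (commutator b f g) <= ennreal (C * (L / A) powr q * N powr q) * wint (\<beta> - q * \<gamma>) q g"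
   if f: "growth \<kappa> f" and g: "growth \<kappa>' g" and \<kappa>: "\<kappa> >= 0" "\<kappa>' >= 0" "b - \<kappa> - \<kappa>' > -1" and B: "bloch_bound \<gamma> N f"
   for f g :: "'n cfun" and N \<kappa> \<kappa>'
  proof -
   have N: "N >= 0" using B by (simp add: bloch_bound_def)
   define G where "G w = (L * N / A) * (rho w powr (- \<gamma>) * norm (g w))" for w
   have gm: "bmeas (\<lambda>w. norm (g w))" using growth_measurable[OF g] by measurable
   have "bint (\<lambda>z. rho z powr \<beta> * norm (commutator b f g z) powr q) <= ennreal C * bint (\<lambda>w. rho w powr \<beta> * G w powr q)"
   proof (rule C(2))
    show "bmeas G" unfolding G_def[abs_def]
     by (intro borel_measurable_times borel_measurable_const measurable_rho_powr gm)
    show "G w >= 0" for w using L N A by (simp add: G_def)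
    fix z :: "complex^'n" assume z: "norm z < 1"
    have "ennreal (norm (commutator b f g z)) <= bint (\<lambda>w. 1 / A * (rho w powr b * (norm (f z - f w) * norm (g w)) * kdist z w powr (- (?n + 1 + b))))"
     unfolding A_def by (rule commutator_le[OF f g b1 \<kappa>(3) _ \<kappa>(2) z]) (use \<kappa> in auto)
    also have "... <= bint (\<lambda>w. kdist z w powr (k - (?n + 1 + \<tau>)) * (rho z powr (- k) + rho w powr (- k)) * rho w powr \<tau> * G w)"
    proof (rule bint_mono)
     fix w :: "complex^'n" assume w: "norm w < 1"
     let ?S = "rho z powr (- k) + rho w powr (- k)"
     have rb: "rho w powr b = rho w powr \<tau> * rho w powr (- \<gamma>)" by (simp add: \<tau>_def flip: powr_add)
     have "1 / A * (rho w powr b * (norm (f z - f w) * norm (g w)) * kdist z w powr (- (?n + 1 + b)))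
      <= 1 / A * (rho w powr b * ((L * N * kdist z w powr \<theta> * ?S) * norm (g w)) * kdist z w powr (- (?n + 1 + b)))"
      using A by (intro mult_left_mono mult_right_mono L(2)[OF growth_holo[OF f] B] z w) auto
     also have "... = (kdist z w powr \<theta> * kdist z w powr (- (?n + 1 + b))) * ?S * rho w powr b * (L * N / A * norm (g w))"
      using A by (simp add: field_simps)
     also have "kdist z w powr \<theta> * kdist z w powr (- (?n + 1 + b)) = kdist z w powr (k - (?n + 1 + \<tau>))"
      unfolding powr_add[symmetric] by (rule arg_cong[where f="\<lambda>x. kdist z w powr x"]) (simp add: \<theta>_def \<tau>_def)
     finally show "1 / A * (rho w powr b * (norm (f z - f w) * norm (g w)) * kdist z w powr (- (?n + 1 + b))) <= kdist z w powr (k - (?n + 1 + \<tau>)) * ?S * rho w powr \<tau> * G w"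
      unfolding G_def rb by (simp only: mult_ac)
    qed
    finally show "ennreal (norm (commutator b f g z)) <= bint (\<lambda>w. kdist z w powr (k - (?n + 1 + \<tau>)) * (rho z powr (- k) + rho w powr (- k)) * rho w powr \<tau> * G w)" .
   qed simp
   also have "bint (\<lambda>w. rho w powr \<beta> * G w powr q) = bint (\<lambda>w. (L * N / A) powr q * (rho w powr (\<beta> - q * \<gamma>) * norm (g w) powr q))"
   proof (intro nn_integral_cong arg_cong[where f=ennreal])
    fix w
    define c where "c = L * N / A"
    have "c >= 0" using L(1) N A by (simp add: c_def)
    hence "G w powr q = c powr q * (rho w powr (- (q * \<gamma>)) * norm (g w) powr q)"
     unfolding G_def c_def[symmetric] by (simp add: powr_mult powr_powr mult.commute)
    moreover have "rho w powr (\<beta> - q * \<gamma>) = rho w powr \<beta> * rho w powr (- (q * \<gamma>))" by (simp flip: powr_add)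
    ultimately show "rho w powr \<beta> * G w powr q = (L * N / A) powr q * (rho w powr (\<beta> - q * \<gamma>) * norm (g w) powr q)"
     unfolding c_def by (simp only: mult_ac)
   qed
   also have "... = ennreal ((L * N / A) powr q) * wint (\<beta> - q * \<gamma>) q g" by (rule wint_cmult) (use growth_measurable[OF g] in auto)
   also have "ennreal C * (ennreal ((L * N / A) powr q) * wint (\<beta> - q * \<gamma>) q g) = ennreal (C * (L * N / A) powr q) * wint (\<beta> - q * \<gamma>) q g"
    using C(1) by (simp add: ennreal_mult mult.assoc)
   also have "C * (L * N / A) powr q = C * (L / A) powr q * N powr q"
    using L N A powr_mult[of "L / A" N q] by simp
   finally show ?thesis unfolding wint_def .
  qed
  show "\<exists>C. op_bound \<beta> \<gamma> q b C (commutator b :: 'n cfun => _)"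
   unfolding op_bound_def by (rule exI[of _ "C * (L / A) powr q"]) (use main C(1) L(1) A in auto)
 qed
qed


text \<open>The case \<open>k = 0\<close> of the Schur bound, where the two powers of
  \<open>rho\<close> in the kernel add up to 2; \<open>\<sigma>\<close> is chosen with \<sigma> (q +
  q') = \<beta> + 1.\<close>

lemma bergman_proj_bound:
 fixes \<beta> q :: real
 assumes q: "q > 1" and \<beta>: "\<beta> > -1"
 obtains C where "C > 0" "!!u :: 'n::finite cfun. u \<in> borel_measurable lball ==>
  wint \<beta> q (bergman_proj \<beta> u) <= ennreal C * wint \<beta> q u"
proof -
 let ?n = "real CARD('n)"
 define q' where "q' = q / (q - 1)"
 have q': "q' > 1" "1 / q + 1 / q' = 1" using q by (auto simp: q'_def field_simps)
 define \<sigma> where "\<sigma> = (\<beta> + 1) / (q + q')"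
 have s: "\<sigma> > 0" using \<beta> q q' by (simp add: \<sigma>_def)
 have "\<sigma> * q + \<sigma> * q' = \<beta> + 1" unfolding distrib_left[symmetric] \<sigma>_def using q q' by simp
 moreover have "\<sigma> * q > 0" "\<sigma> * q' > 0" using s q q' by auto
 ultimately have \<sigma>: "0 < \<sigma> * q'" "0 + \<sigma> * q < \<beta> + 1" "\<beta> > 0 + \<sigma> * q' - 1" "\<beta> > \<beta> + 0 - \<sigma> * q" by linarith+
 define A where "A = bmass TYPE('n) \<beta>"
 have A: "A > 0" unfolding A_def by (rule bmass_pos[OF \<beta>])
 define C where "C = schur_const TYPE('n) \<beta> \<beta> 0 \<sigma> q q'"
 note C = bergman_schur[where 'n='n, OF q q' order_refl s \<sigma>, folded C_def]
 have main: "wint \<beta> q (bergman_proj \<beta> u) <= ennreal (C * (1 / A) powr q) * wint \<beta> q u" if u: "bmeas u" for u :: "'n cfun"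
 proof -
  have um: "bmeas (\<lambda>w. norm (u w))" using u by measurable
  have "bint (\<lambda>z. rho z powr \<beta> * norm (bergman_proj \<beta> u z) powr q) <= ennreal C * bint (\<lambda>w. rho w powr \<beta> * ((1 / A) * norm (u w)) powr q)"
  proof (rule C(2))
   show "bmeas (\<lambda>w. (1 / A) * norm (u w))" by (intro borel_measurable_times borel_measurable_const um)
   fix z :: "complex^'n" assume z: "norm z < 1"
   have "ennreal (norm (bergman_proj \<beta> u z)) <= bint (\<lambda>w. 1 / A * (rho w powr \<beta> * norm (u w) * kdist z w powr (- (?n + 1 + \<beta>))))"
    unfolding A_def by (rule norm_bergman_proj_le[OF \<beta> u z])
   also have "... <= bint (\<lambda>w. kdist z w powr (0 - (?n + 1 + \<beta>)) * (rho z powr (- 0) + rho w powr (- 0)) * rho w powr \<beta> * ((1 / A) * norm (u w)))"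
   proof (rule bint_mono)
    fix w :: "complex^'n" assume "norm w < 1"
    hence r: "rho w > 0" "rho z > 0" using rho_pos[of w] rho_pos[OF z] by auto
    have "0 <= kdist z w powr (0 - (?n + 1 + \<beta>)) * rho w powr \<beta> * ((1 / A) * norm (u w))" using A by simp
    thus "1 / A * (rho w powr \<beta> * norm (u w) * kdist z w powr (- (?n + 1 + \<beta>)))
     <= kdist z w powr (0 - (?n + 1 + \<beta>)) * (rho z powr (- 0) + rho w powr (- 0)) * rho w powr \<beta> * ((1 / A) * norm (u w))"
     using r by (simp add: mult_ac)
   qed
   finally show "ennreal (norm (bergman_proj \<beta> u z)) <= bint (\<lambda>w. kdist z w powr (0 - (?n + 1 + \<beta>)) * (rho z powr (- 0) + rho w powr (- 0)) * rho w powr \<beta> * ((1 / A) * norm (u w)))" .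
  qed (use A in auto)
  also have "bint (\<lambda>w. rho w powr \<beta> * ((1 / A) * norm (u w)) powr q) = bint (\<lambda>w. (1 / A) powr q * (rho w powr \<beta> * norm (u w) powr q))"
   using A by (simp add: powr_mult mult.left_commute powr_divide)
  also have "... = ennreal ((1 / A) powr q) * wint \<beta> q u" by (rule wint_cmult[OF _ u]) simp
  also have "ennreal C * (ennreal ((1 / A) powr q) * wint \<beta> q u) = ennreal (C * (1 / A) powr q) * wint \<beta> q u"
   using C(1) by (simp add: ennreal_mult mult.assoc)
  finally show ?thesis unfolding wint_def .
 qed
 show thesis by (rule that[OF _ main]) (use C(1) A in auto)
qed

section \<open>Growth of projections and a quasi-triangle inequality\<close>

lemma bergman_proj_cong:
 fixes u v :: "'n::finite cfun"
 assumes "\<beta> > -1" "!!w. norm w < 1 ==> u w = v w"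
 shows "bergman_proj \<beta> u z = bergman_proj \<beta> v z"
 unfolding bergman_proj_def
 by (intro Bochner_Integration.integral_cong refl) (use assms in \<open>auto simp: space_ball_weighted\<close>)

lemma bergman_proj_weighted_growth:
 fixes u :: "'n::finite cfun"
 assumes \<kappa>: "\<kappa> > 0" "b - \<kappa> > -1" and u: "bmeas u" "!!w. norm w < 1 ==> norm (u w) <= C * rho w powr (- \<kappa>)" and C: "C >= 0"
 shows "wint b 1 u < \<infinity>" "growth \<kappa> (bergman_proj b u)"
proof -
 define s where "s = real CARD('n) + 1 + b"
 have b: "b > -1" using \<kappa> by simp
 have le: "rho w powr b * norm (u w) <= C * rho w powr (b - \<kappa>)" if "norm w < 1" for w
 proof -
  have "rho w powr b * norm (u w) <= rho w powr b * (C * rho w powr (- \<kappa>))" by (intro mult_left_mono u that) simp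
  also have "... = C * (rho w powr b * rho w powr (- \<kappa>))" by simp
  finally show ?thesis unfolding powr_add[symmetric] by simp
 qed
 have "wint b 1 u <= (\<integral>\<^sup>+w. ennreal (C * rho w powr (b - \<kappa>)) \<partial>(lball :: (complex^'n) measure))"
  unfolding wint_def by (intro nn_integral_mono ennreal_leI) (use le in auto)
 also have "... = ennreal (LINT w|(lball :: (complex^'n) measure). C * rho w powr (b - \<kappa>))"
  by (rule nn_integral_eq_integral[OF integrable_mult_right[OF integrable_rho_powr[OF \<kappa>(2)]]]) (use C in auto)
 finally show w: "wint b 1 u < \<infinity>" by (rule le_less_trans) simp
 have A: "bmass TYPE('n) b > 0" by (rule bmass_pos[OF b])
 define F where "F = fr_const TYPE('n) (b - \<kappa>) s"
 have "s > real CARD('n) + 1 + (b - \<kappa>)" using \<kappa> by (simp add: s_def)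
 note F = forelli_rudin[OF \<kappa>(2) this, folded F_def]
 have "norm (bergman_proj b u z) <= C / bmass TYPE('n) b * F * rho z powr (- \<kappa>)" if z: "norm z < 1" for z
 proof -
  have "ennreal (norm (bergman_proj b u z)) <= bint (\<lambda>w. 1 / bmass TYPE('n) b * (rho w powr b * norm (u w) * kdist z w powr (- s)))"
   unfolding s_def by (rule norm_bergman_proj_le[OF b u(1) z])
  also have "... <= bint (\<lambda>w. C / bmass TYPE('n) b * (rho w powr (b - \<kappa>) * kdist z w powr (- s)))"
  proof (rule bint_mono)
   fix w :: "complex^'n" assume "norm w < 1"
   from mult_right_mono[OF mult_left_mono[OF le[OF this], of "1 / bmass TYPE('n) b"], of "kdist z w powr (- s)"] A
   show "1 / bmass TYPE('n) b * (rho w powr b * norm (u w) * kdist z w powr (- s)) <= C / bmass TYPE('n) b * (rho w powr (b - \<kappa>) * kdist z w powr (- s))"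
    by (simp add: mult_ac)
  qed
  also have "... = ennreal (C / bmass TYPE('n) b) * bint (\<lambda>w. rho w powr (b - \<kappa>) * kdist z w powr (- s))"
   by (rule bint_cmult[OF _ measurable_rho_kdist[OF z]]) (use C A in simp)
  also have "... <= ennreal (C / bmass TYPE('n) b) * ennreal (F * rho z powr (real CARD('n) + 1 + (b - \<kappa>) - s))" by (intro mult_left_mono F z) simp
  also have "... = ennreal (C / bmass TYPE('n) b * F * rho z powr (- \<kappa>))" using C F(1) A by (simp add: s_def flip: ennreal_mult)
  finally show ?thesis using C F(1) A by simp
 qed
 thus "growth \<kappa> (bergman_proj b u)" using bergman_proj_holo[OF b u(1) w] unfolding growth_def by blast
qed

lemma wint_diff_le:
 fixes u v :: "'n::finite cfun"
 assumes q: "q > 0" and m: "bmeas u" "bmeas v"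
  and w: "!!z. norm z < 1 ==> norm (w z) <= norm (u z) + norm (v z)"
 shows "wint a q w <= ennreal (2 powr q) * (wint a q u + wint a q v)"
proof -
 have "wint a q w <= bint (\<lambda>z. 2 powr q * (rho z powr a * norm (u z) powr q) + 2 powr q * (rho z powr a * norm (v z) powr q))"
  unfolding wint_def
 proof (rule bint_mono)
  fix z :: "complex^'n" assume "norm z < 1"
  hence "norm (w z) powr q <= (2 * max (norm (u z)) (norm (v z))) powr q"
   using w[of z] q by (intro powr_mono2) auto
  also have "... = 2 powr q * max (norm (u z)) (norm (v z)) powr q" by (rule powr_mult)
  also have "... <= 2 powr q * (norm (u z) powr q + norm (v z) powr q)" by (intro mult_left_mono) (auto simp: max_def)
  finally have "rho z powr a * norm (w z) powr q <= rho z powr a * (2 powr q * (norm (u z) powr q + norm (v z) powr q))"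
   by (intro mult_left_mono) auto
  thus "rho z powr a * norm (w z) powr q <= 2 powr q * (rho z powr a * norm (u z) powr q) + 2 powr q * (rho z powr a * norm (v z) powr q)"
   by (simp add: algebra_simps)
 qed
 also have "... = ennreal (2 powr q) * (wint a q u + wint a q v)"
  unfolding wint_def distrib_left by (rule bint_lincomb) (auto intro: measurable_wint m)
 finally show ?thesis .
qed


section \<open>Sufficiency\<close>

lemma rho_ge_one_minus_norm: "norm x < 1 ==> 1 - norm x <= rho x"
 unfolding rho_def power2_eq_square using mult_left_mono[of "norm x" 1 "norm x"] by simp

lemma growth_local_bound:
 fixes z :: "complex^'n"
 assumes "norm z < 1" "\<kappa> >= 0" "K >= 0"
 obtains R M where "R > 0" "ball z (2 * R) \<subseteq> ball 0 1" "!!(g :: 'n cfun) x. (!!x. norm x < 1 ==> norm (g x) <= K * rho x powr (- \<kappa>)) ==> x \<in> ball z (2 * R) ==> norm (g x) <= M"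
proof -
 define R where "R = (1 - norm z) / 4"
 have R: "R > 0" "norm z = 1 - 4 * R" using assms(1) by (simp_all add: R_def diff_divide_distrib)
 have le: "norm x <= 1 - 2 * R" if "x \<in> ball z (2 * R)" for x
  using that norm_triangle_ineq2[of x z] R(2) by (simp add: dist_norm norm_minus_commute)
 show thesis
 proof (rule that[OF R(1)])
  show "ball z (2 * R) \<subseteq> ball 0 1" using le R(1) by force
  fix g :: "'n cfun" and x
  assume g: "!!x. norm x < 1 ==> norm (g x) <= K * rho x powr (- \<kappa>)" and x: "x \<in> ball z (2 * R)"
  have x1: "norm x < 1" using le[OF x] R(1) by linarith
  have "rho x >= 2 * R" using rho_ge_one_minus_norm[OF x1] le[OF x] by linarith
  hence "rho x powr (- \<kappa>) <= (2 * R) powr (- \<kappa>)" using R assms by (intro powr_mono2') auto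
  hence "K * rho x powr (- \<kappa>) <= K * (2 * R) powr (- \<kappa>)" using assms by (intro mult_left_mono) auto
  thus "norm (g x) <= K * (2 * R) powr (- \<kappa>)" using g[OF x1] by linarith
 qed
qed

text \<open>Montel's theorem for a growth class: a diagonal subsequence converges on a countable
  dense set, and the local Lipschitz estimate carries the Cauchy property to every point.\<close>

lemma growth_convergent_subsequence:
 fixes g :: "nat => 'n::finite cfun"
 assumes g: "!!k. holo_on (ball 0 1) (g k)" and K: "!!k x. norm x < 1 ==> norm (g k x) <= K * rho x powr (- \<kappa>)" and k: "\<kappa> >= 0" "K >= 0"
 obtains r h where "strict_mono r" "holo_on (ball 0 1) h" "!!x. norm x < 1 ==> (\<lambda>k. g (r k) x) \<longlonglongrightarrow> h x"
proof -
 obtain D :: "(complex^'n) set" where D: "countable D" "!!X. open X ==> X ~= {} ==> \<exists>d\<in>D. d \<in> X"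
  using countable_dense_exists by blast
 \<comment> \<open>Multiplied by \<open>rho x powr \<kappa>\<close> the values obey one bound
   \<open>K\<close> at all points, as the diagonal selection requires; the positive factor is
   removed afterwards.\<close>
 have le: "norm (g k x * of_real (rho x powr \<kappa>)) <= K" if "x \<in> D \<inter> ball 0 1" for k x
 proof -
  have x: "norm x < 1" using that by simp
  have "norm (g k x) * rho x powr \<kappa> <= K * rho x powr (- \<kappa>) * rho x powr \<kappa>" by (intro mult_right_mono K x) simp
  also have "... = K" using rho_pos[OF x] by (simp add: mult.assoc flip: powr_add)
  finally show ?thesis by (simp add: norm_mult)
 qed
 obtain r :: "nat => nat" where r: "strict_mono r" "!!x. x \<in> D \<inter> ball 0 1 ==> \<exists>l. (\<lambda>n. g (r n) x * of_real (rho x powr \<kappa>)) \<longlonglongrightarrow> l"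
  by (rule function_convergent_subsequence[of "D \<inter> ball 0 1" "\<lambda>k x. g k x * of_real (rho x powr \<kappa>)" K, OF _ le]) (use D(1) in auto)
 have convD: "convergent (\<lambda>n. g (r n) x)" if "x \<in> D" "norm x < 1" for x
 proof -
  obtain l where "(\<lambda>n. g (r n) x * of_real (rho x powr \<kappa>)) \<longlonglongrightarrow> l" using r(2) \<open>x \<in> D\<close> \<open>norm x < 1\<close> by auto
  hence "(\<lambda>n. g (r n) x * of_real (rho x powr \<kappa>) * of_real (rho x powr (- \<kappa>))) \<longlonglongrightarrow> l * of_real (rho x powr (- \<kappa>))" by (intro tendsto_intros)
  moreover have "complex_of_real (rho x powr \<kappa>) * of_real (rho x powr (- \<kappa>)) = 1" using rho_pos[OF \<open>norm x < 1\<close>] by (simp flip: powr_add of_real_mult)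
  ultimately show ?thesis by (auto simp: mult.assoc convergent_def)
 qed
 have conv: "convergent (\<lambda>n. g (r n) z)" if z: "norm z < 1" for z
 proof -
  obtain R M where RM: "R > 0" "ball z (2 * R) \<subseteq> ball 0 1" "!!(g :: 'n cfun) x. (!!x. norm x < 1 ==> norm (g x) <= K * rho x powr (- \<kappa>)) ==> x \<in> ball z (2 * R) ==> norm (g x) <= M"
   by (rule growth_local_bound[OF z k]) blast
  have M: "norm (g k x) <= M" if "x \<in> ball z (2 * R)" for k x by (rule RM(3)[OF K that])
  have M0: "M >= 0" by (rule order_trans[OF norm_ge_zero M[of z 0]]) (use RM(1) in simp)
  have "Cauchy (\<lambda>n. g (r n) z)"
  proof (rule metric_CauchyI)
   fix e :: real assume e: "e > 0"
   define d where "d = min R (e * R / (8 * (M + 1)))"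
   have d: "d > 0" using e RM(1) M0 by (simp add: d_def)
   obtain x where x: "x \<in> D" "x \<in> ball z d" using D(2)[of "ball z d"] d by auto
   have xR: "x \<in> ball z R" "norm x < 1" using x RM by (auto simp: d_def subset_iff)
   have Lx: "norm (g k x - g k z) <= e / 4" for k
   proof -
    have "norm (g k x - g k z) <= 2 * M / R * norm (x - z)"
     by (rule holo_local_lipschitz[OF holo_on_subset[OF g RM(2)] RM(1) M xR(1)])
    also have "... <= 2 * (M + 1) / R * (e * R / (8 * (M + 1)))"
     using x(2) M0 RM(1) by (intro mult_mono divide_right_mono) (auto simp: d_def dist_norm norm_minus_commute)
    also have "... = e / 4"         proof -
     have "2 * m / R * (e * R / (8 * m)) = e / 4" if "m ~= 0" for m using RM(1) that by simp
     from this[of "M + 1"] show ?thesis using M0 by linarith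
    qed
    finally show ?thesis .
   qed
   obtain N where N: "!!m n. m >= N ==> n >= N ==> dist (g (r m) x) (g (r n) x) < e / 4"
    using metric_CauchyD[OF convergent_Cauchy[OF convD[OF x(1) xR(2)]], of "e / 4"] e by auto
   show "\<exists>N. \<forall>m\<ge>N. \<forall>n\<ge>N. dist (g (r m) z) (g (r n) z) < e"
   proof (intro exI allI impI)
    fix m n assume mn: "m >= N" "n >= N"
    have "dist (g (r m) z) (g (r n) z) <= dist (g (r m) x) (g (r m) z) + dist (g (r m) x) (g (r n) x) + dist (g (r n) x) (g (r n) z)"
     using dist_triangle[of "g (r m) z" "g (r n) z" "g (r m) x"] dist_triangle[of "g (r m) x" "g (r n) z" "g (r n) x"]
     by (simp add: dist_commute)
    thus "dist (g (r m) z) (g (r n) z) < e" using N[OF mn] Lx[of "r m"] Lx[of "r n"] e by (simp add: dist_norm)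
   qed
  qed
  thus ?thesis by (rule Cauchy_convergent)
 qed
 define h where "h x = lim (\<lambda>n. g (r n) x)" for x
 have h: "(\<lambda>k. g (r k) x) \<longlonglongrightarrow> h x" if "norm x < 1" for x
  using conv[OF that] unfolding h_def by (simp add: convergent_LIMSEQ_iff)
 have "holo_on (ball 0 1) h"
 proof (rule holo_on_locally)
  fix z :: "complex^'n" assume "z \<in> ball 0 1"
  hence z: "norm z < 1" by simp
  obtain R M where RM: "R > 0" "ball z (2 * R) \<subseteq> ball 0 1" "!!(g :: 'n cfun) x. (!!x. norm x < 1 ==> norm (g x) <= K * rho x powr (- \<kappa>)) ==> x \<in> ball z (2 * R) ==> norm (g x) <= M"
   by (rule growth_local_bound[OF z k]) blast
  have "holo_on (ball z (2 * R)) h"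
  proof (rule holo_pointwise_limit[where f="\<lambda>k. g (r k)"])
   show "holo_on (ball z (2 * R)) (g (r j))" for j by (rule holo_on_subset[OF g RM(2)])
   show "norm (g (r j) x) <= M" if "x \<in> ball z (2 * R)" for j x by (rule RM(3)[OF K that])
   show "(\<lambda>j. g (r j) x) \<longlonglongrightarrow> h x" if "x \<in> ball z (2 * R)" for x by (rule h) (use that RM(2) in auto)
  qed
  thus "\<exists>r>0. holo_on (ball z r) h" using RM(1) by (intro exI[of _ "2 * R"]) auto
 qed
 thus thesis by (rule that[OF r(1) _ h])
qed

text \<open>The gain lies in the larger exponent: where rho < \<open>\<eta>\<close> the new weight
  is at most \<eta>^(a' - a) times the old one, whose integrals are bounded by \<open>M\<close>;
  where rho >= \<open>\<eta>\<close> the functions are uniformly bounded and dominated convergence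
  applies.\<close>

lemma wint_tendsto_0:
 fixes d :: "nat => 'n::finite cfun"
 assumes d: "!!k. d k \<in> borel_measurable lball" "!!x. norm x < 1 ==> (\<lambda>k. d k x) \<longlonglongrightarrow> 0"
  and K: "!!k x. norm x < 1 ==> norm (d k x) <= K * rho x powr (- \<kappa>)" and k: "\<kappa> >= 0" "K >= 0"
  and M: "!!k. wint a q (d k) <= ennreal M" "M >= 0" and q: "q > 0" and a: "a < a'" and e: "e > 0"
 shows "\<forall>\<^sub>F k in sequentially. wint a' q (d k) <= ennreal e"
proof -
 let ?B = "lball :: (complex^'n) measure"
 define \<eta> where "\<eta> = (e / (2 * (M + 1))) powr (1 / (a' - a))"
 have c: "e / (2 * (M + 1)) > 0" "2 * M + 2 ~= 0" using e M by auto
 have \<eta>: "\<eta> > 0" using c e by (simp add: \<eta>_def powr_gt_zero)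
 have \<eta>e: "\<eta> powr (a' - a) * M <= e / 2"
 proof -
  have "\<eta> powr (a' - a) = e / (2 * (M + 1))" proof -
   have "1 / (a' - a) * (a' - a) = 1" using a by simp
   thus ?thesis unfolding \<eta>_def powr_powr using c(1) by (simp only: powr_one)
  qed
  hence "\<eta> powr (a' - a) * M = e / 2 * (M / (M + 1))" by simp
  also have "... <= e / 2 * 1" using e M by (intro mult_left_mono) auto
  finally show ?thesis by simp
 qed
 define S where "S = {x :: complex^'n. rho x >= \<eta>}"
 define C where "C = (1 + \<eta> powr a') * (K * \<eta> powr (- \<kappa>)) powr q"
 have Sm: "bmeas (indicator S :: _ => real)"
 proof -
  have "(indicator {\<eta>..} :: real => real) \<circ> rho = indicator S" by (auto simp: S_def indicator_def)
  moreover have "bmeas (\<lambda>x::complex^'n. (indicator {\<eta>..} (rho x) :: real))"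
   by (rule measurable_compose[OF measurable_lball_borel[OF measurable_rho]]) simp
  ultimately show ?thesis by (simp add: o_def)
 qed
 have fm: "bmeas (\<lambda>x. rho x powr a' * norm (d k x) powr q * indicator S x)" for k
  by (intro borel_measurable_times[OF measurable_wint[OF d(1)] Sm])
 have bd: "norm (rho x powr a' * norm (d k x) powr q * indicator S x) <= C" if x: "norm x < 1" for k x
 proof (cases "x \<in> S")
  case True
  hence r: "\<eta> <= rho x" by (simp add: S_def)
  have "rho x powr (- \<kappa>) <= \<eta> powr (- \<kappa>)" using r \<eta> k by (intro powr_mono2') auto
  hence "norm (d k x) <= K * \<eta> powr (- \<kappa>)" using K[OF x, of k] k mult_left_mono[of "rho x powr (- \<kappa>)" "\<eta> powr (- \<kappa>)" K] by linarith
  hence 1: "norm (d k x) powr q <= (K * \<eta> powr (- \<kappa>)) powr q" using q by (intro powr_mono2) auto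
  have 2: "rho x powr a' <= 1 + \<eta> powr a'"
  proof (cases "a' >= 0")
   case True
   have "rho x powr a' <= 1" using rho_pos[OF x] rho_le_1[of x] True by (intro powr_le1) auto
   thus ?thesis using powr_ge_zero[of \<eta> a'] by linarith
  next
   case False
   have "rho x powr a' <= \<eta> powr a'" using r \<eta> False by (intro powr_mono2') auto
   thus ?thesis by linarith
  qed
  have "rho x powr a' * norm (d k x) powr q <= C" unfolding C_def by (intro mult_mono 1 2) auto
  thus ?thesis using True by simp
 qed (simp add: C_def)
 have "(\<lambda>k. (LINT x|?B. rho x powr a' * norm (d k x) powr q * indicator S x)) \<longlonglongrightarrow> (LINT x|?B. 0)"
 proof (rule integral_dominated_convergence[where w="\<lambda>_. C"])
  show "AE x in ?B. (\<lambda>k. rho x powr a' * norm (d k x) powr q * indicator S x) \<longlonglongrightarrow> 0"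
  proof (rule AE_I2)
   fix x :: "complex^'n" assume "x \<in> space ?B"
   hence "(\<lambda>k. norm (d k x) powr q) \<longlonglongrightarrow> 0 powr q"
    using d(2)[of x] q by (intro tendsto_powr' tendsto_norm_zero tendsto_intros) auto
   hence "(\<lambda>k. norm (d k x) powr q) \<longlonglongrightarrow> 0" by simp
   thus "(\<lambda>k. rho x powr a' * norm (d k x) powr q * indicator S x) \<longlonglongrightarrow> 0"
    by (intro tendsto_mult_left_zero tendsto_mult_right_zero)
  qed
  show "AE x in ?B. norm (rho x powr a' * norm (d k x) powr q * indicator S x) <= C" for k
   by (rule AE_I2) (use bd in simp)
  show "integrable ?B (\<lambda>_. C)" by (rule finite_measure.integrable_const[OF finite_measure_lball])
 qed (use fm in auto)
 hence "\<forall>\<^sub>F k in sequentially. (LINT x|?B. rho x powr a' * norm (d k x) powr q * indicator S x) < e / 2"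
  using e by (intro order_tendstoD(2)) auto
 thus ?thesis
 proof eventually_elim
  case (elim k)
  have "wint a' q (d k) <= bint (\<lambda>x. 1 * (rho x powr a' * norm (d k x) powr q * indicator S x) + \<eta> powr (a' - a) * (rho x powr a * norm (d k x) powr q))"
   unfolding wint_def
  proof (rule bint_mono)
   fix x :: "complex^'n" assume "norm x < 1"
   hence x: "rho x > 0" by (rule rho_pos)
   show "rho x powr a' * norm (d k x) powr q <= 1 * (rho x powr a' * norm (d k x) powr q * indicator S x) + \<eta> powr (a' - a) * (rho x powr a * norm (d k x) powr q)"
   proof (cases "x \<in> S")
    case False
    have "rho x powr a' = rho x powr (a' - a) * rho x powr a" by (simp flip: powr_add)
    also have "... <= \<eta> powr (a' - a) * rho x powr a" using False x a by (intro mult_right_mono powr_mono2) (auto simp: S_def)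
    finally have "rho x powr a' * norm (d k x) powr q <= \<eta> powr (a' - a) * rho x powr a * norm (d k x) powr q" by (intro mult_right_mono) auto
    thus ?thesis using False by (simp add: mult.assoc)
   qed simp
  qed
  also have "... = ennreal 1 * bint (\<lambda>x. rho x powr a' * norm (d k x) powr q * indicator S x) + ennreal (\<eta> powr (a' - a)) * wint a q (d k)"
   unfolding wint_def by (rule bint_lincomb) (use fm measurable_wint[OF d(1)] in auto)
  also have "ennreal 1 * bint (\<lambda>x. rho x powr a' * norm (d k x) powr q * indicator S x) = bint (\<lambda>x. rho x powr a' * norm (d k x) powr q * indicator S x)" by simp
  also have "bint (\<lambda>x. rho x powr a' * norm (d k x) powr q * indicator S x) = ennreal (LINT x|?B. rho x powr a' * norm (d k x) powr q * indicator S x)"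
   by (rule nn_integral_eq_integral[OF integrable_lball_bounded[OF fm bd]]) auto
  also have "... + ennreal (\<eta> powr (a' - a)) * wint a q (d k) <= ennreal (e / 2) + ennreal (\<eta> powr (a' - a)) * ennreal M"
   using elim by (intro add_mono mult_left_mono M ennreal_leI) auto
  also have "... = ennreal (e / 2 + \<eta> powr (a' - a) * M)" using e M by (simp add: ennreal_plus ennreal_mult)
  also have "... <= ennreal e" using \<eta>e by (intro ennreal_leI) linarith
  finally show ?case .
 qed
qed

text \<open>Write |g|^q = |g|^p |g|^(q-p) and estimate the second factor, of nonnegative exponent,
  by the growth bound; the definition of \<gamma> makes the powers of \<open>rho\<close>
  match.\<close>

lemma bergman_embedding:
 fixes \<alpha> \<beta> \<gamma> p q :: real
 assumes \<alpha>: "\<alpha> > -1" and p: "p > 1" and q: "p <= q"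
  and \<gamma>: "\<gamma> = (real CARD('n::finite) + 1 + \<beta>) / q - (real CARD('n) + 1 + \<alpha>) / p"
 obtains C where "C > 0" "!!(g :: 'n cfun) B. holo_on (ball 0 1) g ==> B > 0 ==> wint \<alpha> p g <= ennreal (B powr p) ==>
  wint (\<beta> - q * \<gamma>) q g <= ennreal (C * B powr q)"
proof -
 define \<kappa> where "\<kappa> = (real CARD('n) + 1 + \<alpha>) / p"
 obtain D where D: "D > 0" "!!(g :: 'n cfun) B (z :: complex^'n). holo_on (ball 0 1) g ==> B > 0 ==> wint \<alpha> p g <= ennreal (B powr p) ==>
  norm z < 1 ==> norm (g z) <= D * B * rho z powr (- \<kappa>)"
  unfolding \<kappa>_def by (rule bergman_growth[where 'n='n, OF \<alpha> p]) blast
 have ex: "\<beta> - q * \<gamma> - \<kappa> * (q - p) = \<alpha>"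
  unfolding \<gamma> \<kappa>_def using p q by (simp add: field_simps)
 show thesis
 proof (rule that[of "D powr (q - p)"])
  show "D powr (q - p) > 0" using D by simp
  fix g :: "'n cfun" and B :: real
  assume g: "holo_on (ball 0 1) g" and B: "B > 0" "wint \<alpha> p g <= ennreal (B powr p)"
  have "wint (\<beta> - q * \<gamma>) q g <= bint (\<lambda>z. (D * B) powr (q - p) * (rho z powr \<alpha> * norm (g z) powr p))"
   unfolding wint_def
  proof (rule bint_mono)
   fix z :: "complex^'n" assume z: "norm z < 1"
   have "norm (g z) powr (q - p) <= (D * B * rho z powr (- \<kappa>)) powr (q - p)"
    using D(2)[OF g B z] q by (intro powr_mono2) auto
   also have "... = (D * B) powr (q - p) * rho z powr (- \<kappa> * (q - p))" using D(1) B(1) by (simp add: powr_mult powr_powr)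
   finally have 1: "norm (g z) powr (q - p) <= (D * B) powr (q - p) * rho z powr (- \<kappa> * (q - p))" .
   have "rho z powr (\<beta> - q * \<gamma>) * norm (g z) powr q = rho z powr (\<beta> - q * \<gamma>) * norm (g z) powr p * norm (g z) powr (q - p)"
    by (simp add: mult.assoc flip: powr_add)
   also have "... <= rho z powr (\<beta> - q * \<gamma>) * norm (g z) powr p * ((D * B) powr (q - p) * rho z powr (- \<kappa> * (q - p)))"
    by (intro mult_left_mono 1) simp
   also have "... = (D * B) powr (q - p) * ((rho z powr (\<beta> - q * \<gamma>) * rho z powr (- \<kappa> * (q - p))) * norm (g z) powr p)" by (simp only: mult_ac)
   also have "rho z powr (\<beta> - q * \<gamma>) * rho z powr (- \<kappa> * (q - p)) = rho z powr \<alpha>"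
    unfolding powr_add[symmetric] using ex by simp
   finally show "rho z powr (\<beta> - q * \<gamma>) * norm (g z) powr q <= (D * B) powr (q - p) * (rho z powr \<alpha> * norm (g z) powr p)" .
  qed
  also have "... = ennreal ((D * B) powr (q - p)) * wint \<alpha> p g" by (rule wint_cmult[OF _ holo_measurable[OF g]]) simp
  also have "... <= ennreal ((D * B) powr (q - p)) * ennreal (B powr p)" by (intro mult_left_mono B) simp
  also have "... = ennreal ((D * B) powr (q - p) * B powr p)" by (simp add: ennreal_mult)
  also have "(D * B) powr (q - p) * B powr p = D powr (q - p) * B powr q"
   using D(1) B(1) by (simp add: powr_mult mult.assoc flip: powr_add)
  finally show "wint (\<beta> - q * \<gamma>) q g <= ennreal (D powr (q - p) * B powr q)" .
 qed
qed


text \<open>The extension of the Hankel operator from bounded functions to the whole Bergman space: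
 for \<open>b > \<beta>\<close> the operator \<open>(I - P\<^sub>\<beta>)(I - P\<^sub>b)\<close> agrees with \<open>I - P\<^sub>\<beta>\<close>, and
 \<open>(I - P\<^sub>b)(cnj f * g)\<close> makes sense even when \<open>P\<^sub>\<beta> (cnj f * g)\<close> does not.\<close>

definition hankel_ext :: "real => real => 'n::finite cfun => 'n cfun => 'n cfun" where
 "hankel_ext \<beta> b f g z = commutator b f g z - bergman_proj \<beta> (commutator b f g) z"

lemma coproj_lin:
 fixes U U1 U2 :: "'n::finite cfun"
 assumes b: "b > -1" and U1: "bmeas U1" "wint b 1 U1 < \<infinity>" and U2: "bmeas U2" "wint b 1 U2 < \<infinity>"
  and U: "!!w. norm w < 1 ==> U w = c * U1 w + d * U2 w" and z: "norm z < 1"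
 shows "U z - bergman_proj b U z = c * (U1 z - bergman_proj b U1 z) + d * (U2 z - bergman_proj b U2 z)"
proof -
 have "bergman_proj b U z = bergman_proj b (\<lambda>w. c * U1 w + d * U2 w) z" by (rule bergman_proj_cong[OF b U])
 thus ?thesis unfolding bergman_proj_lin[OF b U1 U2 z] U[OF z] by (simp add: algebra_simps)
qed

text \<open>Phrased for the product \<open>cnj (f w) * g w\<close>, so that one statement yields
  both linearity in \<open>g\<close> and the splitting of the symbol.\<close>

lemma hankel_ext_lin:
 fixes f f1 f2 g g1 g2 :: "'n::finite cfun"
 assumes b: "b > -1" "b - \<kappa> - \<kappa>' > -1" and \<beta>: "\<beta> > -1"
  and gr: "growth \<kappa> f1" "growth \<kappa> f2" "growth \<kappa>' g1" "growth \<kappa>' g2"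
  and fin: "wint \<beta> 1 (commutator b f1 g1) < \<infinity>" "wint \<beta> 1 (commutator b f2 g2) < \<infinity>"
  and e: "!!w. norm w < 1 ==> cnj (f w) * g w = c * (cnj (f1 w) * g1 w) + d * (cnj (f2 w) * g2 w)" and z: "norm z < 1"
 shows "hankel_ext \<beta> b f g z = c * hankel_ext \<beta> b f1 g1 z + d * hankel_ext \<beta> b f2 g2 z"
proof -
 note m = measurable_cnj_mult[OF growth_measurable growth_measurable]
 have 1: "commutator b f g w = c * commutator b f1 g1 w + d * commutator b f2 g2 w" if "norm w < 1" for w
  unfolding commutator_def
  by (rule coproj_lin[OF b(1) m[OF gr(1,3)] wint_growth_lt_top[OF gr(1,3) b(2)] m[OF gr(2,4)] wint_growth_lt_top[OF gr(2,4) b(2)] e that])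
 show ?thesis unfolding hankel_ext_def
  by (rule coproj_lin[OF \<beta> commutator_measurable[OF gr(1,3) b] fin(1) commutator_measurable[OF gr(2,4) b] fin(2) 1 z])
qed

lemma growth_wint_1:
 fixes h :: "'n::finite cfun"
 assumes h: "growth \<kappa> h" and b: "b - \<kappa> > -1"
 shows "wint b 1 h < \<infinity>"
proof -
 have "growth 0 (\<lambda>_::complex^'n. 1)" by (rule bounded_growth[where C=1]) auto
 from wint_growth_lt_top[OF this h, of b] b show ?thesis by simp
qed

text \<open>The projection of the product at weight \<open>b\<close> is holomorphic of growth order
  \<open>\<kappa>\<close> below \<beta> + 1. The projection at \<beta> therefore reproduces it, and
  its two occurrences cancel.\<close>

lemma hankel_ext_eq_hankel_conj:
 fixes f g :: "'n::finite cfun"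
 assumes b: "\<beta> > -1" "b > \<beta>" and f: "growth \<kappa> f" "\<kappa> > 0" "\<kappa> < \<beta> + 1"
  and g: "bmeas g" "!!z. norm z < 1 ==> norm (g z) <= M" and z: "norm z < 1"
 shows "hankel_ext \<beta> b f g z = hankel_conj \<beta> f g z"
proof -
 define u where "u w = cnj (f w) * g w" for w
 have um: "bmeas u" unfolding u_def[abs_def] by (rule measurable_cnj_mult[OF growth_measurable[OF f(1)] g(1)])
 obtain C where C: "C >= 0" "!!z. norm z < 1 ==> norm (f z) <= C * rho z powr (- \<kappa>)" by (rule growthE[OF f(1)]) blast
 have M: "M >= 0" using order_trans[OF norm_ge_zero g(2)[of 0]] by simp
 have ub: "norm (u w) <= C * M * rho w powr (- \<kappa>)" if "norm w < 1" for w
  using mult_mono[OF C(2)[OF that] g(2)[OF that]] C(1) by (simp add: u_def norm_mult mult_ac)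
 have CM: "C * M >= 0" using C(1) M by simp
 have k: "\<beta> - \<kappa> > -1" "b - \<kappa> > -1" using f(3) b by auto
 note uf = bergman_proj_weighted_growth(1)[OF f(2) k(1) um ub CM]
 have pg: "growth \<kappa> (bergman_proj b u)" by (rule bergman_proj_weighted_growth(2)[OF f(2) k(2) um ub CM])
 have c: "commutator b f g w = 1 * u w + (-1) * bergman_proj b u w" for w by (simp add: commutator_def u_def[abs_def])
 have "hankel_ext \<beta> b f g z = 1 * (u z - bergman_proj \<beta> u z) + (-1) * (bergman_proj b u z - bergman_proj \<beta> (bergman_proj b u) z)"
  unfolding hankel_ext_def by (rule coproj_lin[OF b(1) um uf growth_measurable[OF pg] growth_wint_1[OF pg k(1)] c z])
 thus ?thesis unfolding bergman_proj_reproducing[OF pg b(1) k(1) less_imp_le[OF f(2)] z] by (simp add: hankel_conj_def u_def[abs_def])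
qed

definition ext_bound :: "'n::finite itself => real => real => real => real => real => bool" where
 "ext_bound (_ :: 'n itself) \<beta> \<gamma> q b C \<longleftrightarrow> C > 0 \<and> (\<forall>(f :: 'n cfun) g N \<kappa> \<kappa>'. growth \<kappa> f --> growth \<kappa>' g --> \<kappa> >= 0 --> \<kappa>' >= 0 --> b - \<kappa> - \<kappa>' > -1 -->
  bloch_bound \<gamma> N f --> wint (\<beta> - q * \<gamma>) q g < \<infinity> --> wint \<beta> 1 (commutator b f g) < \<infinity> \<and> hankel_ext \<beta> b f g \<in> borel_measurable lball \<and>
  wint \<beta> q (hankel_ext \<beta> b f g) <= ennreal (C * N powr q) * wint (\<beta> - q * \<gamma>) q g)"

lemma ext_boundD:
 fixes f g :: "'n::finite cfun"
 assumes "ext_bound TYPE('n) \<beta> \<gamma> q b C" "growth \<kappa> f" "growth \<kappa>' g" "\<kappa> >= 0" "\<kappa>' >= 0" "b - \<kappa> - \<kappa>' > -1" "bloch_bound \<gamma> N f" "wint (\<beta> - q * \<gamma>) q g < \<infinity>"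
 shows "wint \<beta> 1 (commutator b f g) < \<infinity> \<and> hankel_ext \<beta> b f g \<in> borel_measurable lball \<and>
  wint \<beta> q (hankel_ext \<beta> b f g) <= ennreal (C * N powr q) * wint (\<beta> - q * \<gamma>) q g"
 using assms unfolding ext_bound_def by blast

lemma hankel_ext_bound:
 fixes \<beta> \<gamma> q :: real
 assumes q: "q > 1" and \<beta>: "\<beta> > -1" and \<gamma>: "- aniso TYPE('n::finite) < \<gamma>" "\<gamma> < (\<beta> + 1) / q"
 shows "\<exists>b0. \<forall>b\<ge>b0. b > -1 --> (\<exists>C. ext_bound TYPE('n) \<beta> \<gamma> q b C)"
proof -
 obtain b0 where b0: "!!b. b >= b0 ==> \<exists>C. op_bound \<beta> \<gamma> q b C (commutator b :: 'n cfun => _)"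
  using commutator_bound[OF q \<beta> \<gamma>] by blast
 obtain P where P: "P > 0" "!!u :: 'n cfun. u \<in> borel_measurable lball ==> wint \<beta> q (bergman_proj \<beta> u) <= ennreal P * wint \<beta> q u"
  by (rule bergman_proj_bound[OF q \<beta>]) blast
 show ?thesis
 proof (rule exI[of _ b0], intro allI impI)
  fix b assume b: "b >= b0" "b > -1"
  obtain C where C: "op_bound \<beta> \<gamma> q b C (commutator b :: 'n cfun => _)" using b0[OF b(1)] by blast
  hence C0: "C > 0" by (simp add: op_bound_def)
  define D where "D = 2 powr q * (1 + P) * C"
  have D: "D > 0" using P C0 by (simp add: D_def)
  have "wint \<beta> 1 (commutator b f g) < \<infinity> \<and> hankel_ext \<beta> b f g \<in> borel_measurable lball \<and>
   wint \<beta> q (hankel_ext \<beta> b f g) <= ennreal (D * N powr q) * wint (\<beta> - q * \<gamma>) q g"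
   if h: "growth \<kappa> f" "growth \<kappa>' g" "\<kappa> >= 0" "\<kappa>' >= 0" "b - \<kappa> - \<kappa>' > -1" "bloch_bound \<gamma> N f" "wint (\<beta> - q * \<gamma>) q g < \<infinity>"
   for f g :: "'n cfun" and N \<kappa> \<kappa>'
  proof -
   let ?w = "wint (\<beta> - q * \<gamma>) q g" and ?c = "commutator b f g"
   have N: "N >= 0" using h(6) by (simp add: bloch_bound_def)
   have cm: "bmeas ?c" by (rule commutator_measurable[OF h(1,2) b(2) h(5)])
   note c = op_boundD[OF C h]
   have "wint \<beta> q ?c < \<infinity>" by (rule le_less_trans[OF c]) (use h(7) in \<open>simp add: ennreal_mult_less_top\<close>)
   hence f1: "wint \<beta> 1 ?c < \<infinity>" by (intro wint_1_le[OF \<beta> _ cm, of q]) (use q in auto)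
   have pm: "bergman_proj \<beta> ?c \<in> borel_measurable lball" by (rule holo_measurable[OF bergman_proj_holo[OF \<beta> cm f1]])
   have hm: "hankel_ext \<beta> b f g \<in> borel_measurable lball"
    unfolding hankel_ext_def[abs_def] using cm pm by measurable
   have "wint \<beta> q (hankel_ext \<beta> b f g) <= ennreal (2 powr q) * (wint \<beta> q ?c + wint \<beta> q (bergman_proj \<beta> ?c))"
    by (rule wint_diff_le[OF _ cm pm]) (use q in \<open>auto simp: hankel_ext_def norm_triangle_ineq4\<close>)
   also have "... <= ennreal (2 powr q) * (wint \<beta> q ?c + ennreal P * wint \<beta> q ?c)"
    by (intro mult_left_mono add_mono order_refl P(2) cm) simp
   also have "... = ennreal (2 powr q * (1 + P)) * wint \<beta> q ?c"
    using P(1) by (simp add: ennreal_mult distrib_left distrib_right mult.assoc)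
   also have "... <= ennreal (2 powr q * (1 + P)) * (ennreal (C * N powr q) * ?w)"
    by (rule mult_left_mono[OF c]) simp
   also have "... = ennreal (D * N powr q) * ?w"
    using P(1) C0 unfolding D_def by (simp add: ennreal_mult mult.assoc)
   finally show ?thesis using f1 hm by blast
  qed
  thus "\<exists>C. ext_bound TYPE('n) \<beta> \<gamma> q b C"
   unfolding ext_bound_def using D by blast
 qed
qed

text \<open>The summand 1 next to |L| makes the bound strictly positive, as the growth and embedding
  lemmas ask of their \<open>B\<close>.\<close>

lemma Lp_norm_le_wint:
 fixes g :: "'n::finite cfun"
 assumes \<alpha>: "\<alpha> > -1" and p: "p > 0" and L: "Lp_norm (ball_weighted \<alpha>) p g <= L" and g: "g \<in> Lp (ball_weighted \<alpha>) p"
 shows "bmass TYPE('n) \<alpha> powr (1 / p) * (\<bar>L\<bar> + 1) > 0" "wint \<alpha> p g <= ennreal ((bmass TYPE('n) \<alpha> powr (1 / p) * (\<bar>L\<bar> + 1)) powr p)"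
proof -
 have A: "bmass TYPE('n) \<alpha> > 0" by (rule bmass_pos[OF \<alpha>])
 thus "bmass TYPE('n) \<alpha> powr (1 / p) * (\<bar>L\<bar> + 1) > 0" by simp
 have "Lp_norm (ball_weighted \<alpha>) p g powr p <= (\<bar>L\<bar> + 1) powr p" using L p by (intro powr_mono2) (auto simp: Lp_norm_def)
 hence "bmass TYPE('n) \<alpha> * Lp_norm (ball_weighted \<alpha>) p g powr p <= bmass TYPE('n) \<alpha> * (\<bar>L\<bar> + 1) powr p"
  using A by (intro mult_left_mono) auto
 thus "wint \<alpha> p g <= ennreal ((bmass TYPE('n) \<alpha> powr (1 / p) * (\<bar>L\<bar> + 1)) powr p)"
  unfolding Lp_norm_wint[OF \<alpha> p g] using A p by (simp add: powr_mult powr_powr ennreal_leI)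
qed

lemma Lp_norm_LIMSEQ_0:
 fixes u :: "nat => 'n::finite cfun"
 assumes \<beta>: "\<beta> > -1" and q: "q > 0" and u: "!!k. u k \<in> Lp (ball_weighted \<beta>) q"
  and lim: "!!e. e > 0 ==> \<forall>\<^sub>F k in sequentially. wint \<beta> q (u k) <= ennreal e"
 shows "(\<lambda>k. Lp_norm (ball_weighted \<beta>) q (u k)) \<longlonglongrightarrow> 0"
proof (rule order_tendstoI)
 have A: "bmass TYPE('n) \<beta> > 0" by (rule bmass_pos[OF \<beta>])
 fix a :: real
 show "\<forall>\<^sub>F k in sequentially. a < Lp_norm (ball_weighted \<beta>) q (u k)" if "a < 0"
  by (rule always_eventually) (use that in \<open>auto simp: Lp_norm_def intro: less_le_trans\<close>)
 assume a: "0 < a"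
 hence "bmass TYPE('n) \<beta> * (a / 2) powr q > 0" using A by simp
 from lim[OF this] show "\<forall>\<^sub>F k in sequentially. Lp_norm (ball_weighted \<beta>) q (u k) < a"
 proof eventually_elim
  case (elim k)
  hence "Lp_norm (ball_weighted \<beta>) q (u k) powr q <= (a / 2) powr q"
   unfolding Lp_norm_wint[OF \<beta> q u] using A a by (simp add: ennreal_le_iff)
  hence "Lp_norm (ball_weighted \<beta>) q (u k) <= a / 2"
   using powr_less_mono2[of q "a / 2" "Lp_norm (ball_weighted \<beta>) q (u k)"] q a by linarith
  thus ?case using a by linarith
 qed
qed

text \<open>The approximants are abstract: bounded holomorphic functions of smaller Bloch order
  \<open>\<gamma>'\<close>. A bounded sequence has a pointwise convergent subsequence; on the
  differences \<open>d k\<close> the operator splits into that of \<open>f - Q\<close>, small by the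
  operator bound, and that of \<open>Q\<close>, whose source weight \<beta> - q \<gamma>' is the
  larger exponent for which \<open>wint_tendsto_0\<close> gives convergence to 0.\<close>

proposition compact_sufficient:
 fixes f :: "'n::finite cfun" and p q \<alpha> \<beta> \<gamma> :: real
 assumes f: "f \<in> bergman_space 1 \<beta>" and p: "1 < p" "p <= q" and \<alpha>: "\<alpha> > -1" and \<beta>: "\<beta> > -1"
  and \<gamma>: "\<gamma> = (real CARD('n) + 1 + \<beta>) / q - (real CARD('n) + 1 + \<alpha>) / p"
  and \<gamma>': "- aniso TYPE('n) < \<gamma>'" "\<gamma>' < \<gamma>"
  and approx: "!!\<epsilon>. \<epsilon> > 0 ==> \<exists>Q N. bloch_bound \<gamma> \<epsilon> (\<lambda>z. f z - Q z) \<and> growth 0 Q \<and> bloch_bound \<gamma>' N Q"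
 shows "hankel_conj_compact \<beta> f p \<alpha> q"
proof -
 let ?n = "real CARD('n)"
 have q: "q > 1" "q > 0" using p by auto
 \<comment> \<open>From \<open>p <= q\<close> and \<open>\<alpha> > -1\<close> it follows that
   \<gamma> < (\<beta> + 1) / q, the upper limit in the operator bounds.\<close>
 have "?n / q <= ?n / p" using p by (intro divide_left_mono) auto
 moreover have "?n / p < (?n + 1 + \<alpha>) / p" using p \<alpha> by (intro divide_strict_right_mono) auto
 ultimately have \<gamma>q: "\<gamma> < (\<beta> + 1) / q" unfolding \<gamma> by (simp add: add_divide_distrib)
 have g: "- aniso TYPE('n) < \<gamma>" "\<gamma>' < (\<beta> + 1) / q" using \<gamma>' \<gamma>q by auto
 have fh: "holo_on (ball 0 1) f" using f by (simp add: bergman_space_def holomorphic_ball_eq)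
 obtain N1 where N1: "bloch_bound \<gamma> N1 f"
 proof -
  obtain Q N where Q: "bloch_bound \<gamma> 1 (\<lambda>z. f z - Q z)" "growth 0 Q" "bloch_bound \<gamma>' N Q" using approx[of 1] by auto
  have "norm (dir v f z) <= (1 + N) * norm v * rho z powr (- (1 + \<gamma>))" if z: "norm z < 1" for z v
  proof -
   have "dir v (\<lambda>z. f z - Q z) z = dir v f z - dir v Q z" by (rule dir_fun_diff[OF fh growth_holo[OF Q(2)]]) (use z in simp)
   hence "norm (dir v f z) <= norm (dir v (\<lambda>z. f z - Q z) z) + norm (dir v Q z)"
    using norm_triangle_ineq[of "dir v (\<lambda>z. f z - Q z) z" "dir v Q z"] by simp
   also have "... <= 1 * norm v * rho z powr (- (1 + \<gamma>)) + N * norm v * rho z powr (- (1 + \<gamma>'))"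
    using Q z unfolding bloch_bound_def by (intro add_mono) auto
   also have "... <= 1 * norm v * rho z powr (- (1 + \<gamma>)) + N * norm v * rho z powr (- (1 + \<gamma>))"
    using Q(3) \<gamma>'(2) rho_pos[OF z] rho_le_1[of z] unfolding bloch_bound_def by (intro add_mono mult_left_mono powr_mono') auto
   finally show ?thesis by (simp add: algebra_simps)
  qed
  moreover have "1 + N >= 0" using Q(3) by (simp add: bloch_bound_def)
  ultimately show thesis using that unfolding bloch_bound_def by blast
 qed
 have "\<gamma> < \<beta> + 1"
 proof -
  have "(\<beta> + 1) / q <= \<beta> + 1" using \<beta> q by (simp add: divide_le_eq mult_le_cancel_left1)
  thus ?thesis using \<gamma>q by linarith
 qed
 then obtain \<kappa>f where \<kappa>f: "0 < \<kappa>f" "\<kappa>f < \<beta> + 1" and fg: "growth \<kappa>f f"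
  by (rule bloch_growth[OF fh N1 g(1) _ \<beta>]) blast
 define \<kappa>g where "\<kappa>g = (?n + 1 + \<alpha>) / p"
 have \<kappa>: "\<kappa>f >= 0" "\<kappa>g >= 0" using \<kappa>f \<alpha> p by (auto simp: \<kappa>g_def)
 have gr0: "growth \<kappa>f Q" if Q: "growth 0 Q" for Q :: "'n cfun"
 proof -
  obtain C where C: "C >= 0" "!!z. norm z < 1 ==> norm (Q z) <= C * rho z powr (- 0)" by (rule growthE[OF Q]) blast
  have "norm (Q z) <= C" if "norm z < 1" for z using C(2)[OF that] rho_pos[OF that] by simp
  thus ?thesis by (rule bounded_growth[OF growth_holo[OF Q] _ \<kappa>(1)])
 qed
 note eb = hankel_ext_bound[where 'n='n, OF q(1) \<beta>]
 obtain b1 where b1: "!!b. b >= b1 ==> b > -1 ==> \<exists>C. ext_bound TYPE('n) \<beta> \<gamma> q b C" using eb[OF g(1) \<gamma>q] by blast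
 obtain b2 where b2: "!!b. b >= b2 ==> b > -1 ==> \<exists>C. ext_bound TYPE('n) \<beta> \<gamma>' q b C" using eb[OF \<gamma>'(1) g(2)] by blast
 \<comment> \<open>One \<open>b\<close> for both Bloch orders, above \<beta> as the identification
   with the Hankel operator demands, and large enough for the products of symbols and functions to
   be projected.\<close>
 define b where "b = max (max b1 b2) (max (\<beta> + 1) (\<kappa>f + \<kappa>g))"
 have b: "b >= b1" "b >= b2" "b > \<beta>" "b > -1" "b - \<kappa>f - \<kappa>g > -1" using \<beta> by (auto simp: b_def)
 obtain C1 where x1: "ext_bound TYPE('n) \<beta> \<gamma> q b C1" using b1[OF b(1,4)] by blast
 obtain C2 where x2: "ext_bound TYPE('n) \<beta> \<gamma>' q b C2" using b2[OF b(2,4)] by blast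
 have C1: "C1 > 0" and C2: "C2 > 0" using x1 x2 by (simp_all add: ext_bound_def)
 obtain G where G: "G > 0" "!!(g :: 'n cfun) B (z :: complex^'n). holo_on (ball 0 1) g ==> B > 0 ==> wint \<alpha> p g <= ennreal (B powr p) ==>
  norm z < 1 ==> norm (g z) <= G * B * rho z powr (- \<kappa>g)" unfolding \<kappa>g_def by (rule bergman_growth[OF \<alpha> p(1)]) blast
 obtain E where E: "E > 0" "!!(g :: 'n cfun) B. holo_on (ball 0 1) g ==> B > 0 ==> wint \<alpha> p g <= ennreal (B powr p) ==>
  wint (\<beta> - q * \<gamma>) q g <= ennreal (E * B powr q)" by (rule bergman_embedding[OF \<alpha> p \<gamma>]) blast
 let ?V = "bergman_space p \<alpha> :: 'n cfun set" and ?T = "hankel_ext \<beta> b f"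
 have V: "holo_on (ball 0 1) g" "growth \<kappa>g g" "wint (\<beta> - q * \<gamma>) q g < \<infinity>" "g \<in> Lp (ball_weighted \<alpha>) p" if "g \<in> ?V" for g
 proof -
  show h: "holo_on (ball 0 1) g" and L: "g \<in> Lp (ball_weighted \<alpha>) p" using that by (auto simp: bergman_space_def holomorphic_ball_eq)
  note B = Lp_norm_le_wint[OF \<alpha> _ order_refl L]
  have p0: "p > 0" using p by simp
  show "growth \<kappa>g g" unfolding growth_def using h G(2)[OF h B(1)[OF p0] B(2)[OF p0]] by blast
  show "wint (\<beta> - q * \<gamma>) q g < \<infinity>" by (rule le_less_trans[OF E(2)[OF h B(1)[OF p0] B(2)[OF p0]]]) simp
 qed
 have TV: "wint \<beta> 1 (commutator b f g) < \<infinity>" "?T g \<in> Lp (ball_weighted \<beta>) q" if "g \<in> ?V" for g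
 proof -
  note v = V[OF that]
  note c = ext_boundD[OF x1 fg v(2) \<kappa> b(5) N1 v(3)]
  show "wint \<beta> 1 (commutator b f g) < \<infinity>" using c by blast
  have "wint \<beta> q (?T g) < \<infinity>" by (rule le_less_trans[OF conjunct2[OF conjunct2[OF c]]]) (use v(3) in \<open>simp add: ennreal_mult_less_top\<close>)
  thus "?T g \<in> Lp (ball_weighted \<beta>) q" using c Lp_ball_weighted_iff[OF \<beta>] by blast
 qed
 have lin: "?T (\<lambda>y. c * g y + d * h y) z = c * ?T g z + d * ?T h z" if "g \<in> ?V" "h \<in> ?V" "norm z < 1" for g h c d z
  by (rule hankel_ext_lin[OF b(4,5) \<beta> fg fg V(2)[OF that(1)] V(2)[OF that(2)] TV(1)[OF that(1)] TV(1)[OF that(2)] _ that(3)])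
   (simp add: algebra_simps)
 have AEI: "AE x in (ball_weighted \<beta> :: (complex^'n) measure). P x" if "!!x. norm x < 1 ==> P x" for P
  by (rule AE_I2) (use that in \<open>auto simp: space_ball_weighted[OF \<beta>]\<close>)
 have "compact_operator ?V (ball_weighted \<alpha>) p (ball_weighted \<beta>) q ?T"
  unfolding compact_operator_def
 proof (intro conjI ballI allI impI AEI)
  fix g assume g: "g \<in> ?V" show "?T g \<in> Lp (ball_weighted \<beta>) q" by (rule TV(2)[OF g])
  fix x :: "complex^'n" assume x: "norm x < 1"
  show "?T (\<lambda>y. g y + h y) x = ?T g x + ?T h x" if "h \<in> ?V" for h using lin[OF g that x, of 1 1] by simp
  show "?T (\<lambda>y. c * g y) x = c * ?T g x" for c using lin[OF g g x, of c 0] by simp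
 next
  fix g :: "nat => 'n cfun"
  assume "range g \<subseteq> ?V \<and> bounded (range (\<lambda>k. Lp_norm (ball_weighted \<alpha>) p (g k)))"
  then obtain L where gV: "!!k. g k \<in> ?V" and L: "!!k. Lp_norm (ball_weighted \<alpha>) p (g k) <= L"
   unfolding bounded_iff by (auto simp: abs_le_iff image_subset_iff)
  have p0: "p > 0" using p by simp
  define B where "B = bmass TYPE('n) \<alpha> powr (1 / p) * (\<bar>L\<bar> + 1)"
  have B: "B > 0" "wint \<alpha> p (g k) <= ennreal (B powr p)" for k
   unfolding B_def by (rule Lp_norm_le_wint[OF \<alpha> p0 L V(4)[OF gV]])+
  obtain r h where r: "strict_mono r" and hh: "holo_on (ball 0 1) h" and lim: "!!x. norm x < 1 ==> (\<lambda>k. g (r k) x) \<longlonglongrightarrow> h x"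
   by (rule growth_convergent_subsequence[where g=g, OF V(1)[OF gV] G(2)[OF V(1)[OF gV] B] \<kappa>(2)]) (use G(1) B(1) in auto)
  \<comment> \<open>Fatou's lemma: the limit inherits the bound of the sequence, so it lies in the
    Bergman space.\<close>
  have hB: "wint \<alpha> p h <= ennreal (B powr p)" unfolding wint_def
  proof (rule nn_integral_limit_le[where f="\<lambda>k x. ennreal (rho x powr \<alpha> * norm (g (r k) x) powr p)"])
   show "bmeas (\<lambda>x. ennreal (rho x powr \<alpha> * norm (g (r k) x) powr p))" for k
    by (rule measurable_compose[OF measurable_wint[OF holo_measurable[OF V(1)[OF gV]]] measurable_ennreal])
   show "(\<lambda>k. ennreal (rho x powr \<alpha> * norm (g (r k) x) powr p)) \<longlonglongrightarrow> ennreal (rho x powr \<alpha> * norm (h x) powr p)"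
    if "x \<in> space lball" for x :: "complex^'n"
    by (rule tendsto_ennrealI, rule tendsto_mult[OF tendsto_const], rule tendsto_powr') (use lim[of x] that p0 in \<open>auto intro!: tendsto_intros\<close>)
   show "bint (\<lambda>x. rho x powr \<alpha> * norm (g (r k) x) powr p) <= ennreal (B powr p)" for k
    using B(2)[of "r k"] unfolding wint_def .
  qed
  have "h \<in> ?V" using hh le_less_trans[OF hB] holo_measurable[OF hh]
   by (auto simp: bergman_space_def holomorphic_ball_eq Lp_ball_weighted_iff[OF \<alpha>])
  note hV = this
  define d where "d k x = g (r k) x - h x" for k x
  have dh: "holo_on (ball 0 1) (d k)" for k unfolding d_def[abs_def] by (rule holo_diff[OF V(1)[OF gV] hh])
  define B' where "B' = 2 * 2 powr (1 / p) * B"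
  have B'0: "B' > 0" using B(1) by (simp add: B'_def)
  have B': "wint \<alpha> p (d k) <= ennreal (B' powr p)" for k
  proof -
   have "wint \<alpha> p (d k) <= ennreal (2 powr p) * (wint \<alpha> p (g (r k)) + wint \<alpha> p h)"
    by (rule wint_diff_le[OF p0 holo_measurable[OF V(1)[OF gV]] holo_measurable[OF hh]]) (simp add: d_def norm_triangle_ineq4)
   also have "... <= ennreal (2 powr p) * (ennreal (B powr p) + ennreal (B powr p))" by (intro mult_left_mono add_mono B(2) hB) simp
   also have "... = ennreal (2 powr p * (2 * B powr p))" by (simp add: ennreal_mult flip: ennreal_plus)
   also have "2 powr p * (2 * B powr p) = B' powr p" using p0 B(1) by (simp add: B'_def powr_mult powr_powr)
   finally show ?thesis .
  qed
  have dV: "d k \<in> ?V" for k using dh le_less_trans[OF B'] holo_measurable[OF dh]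
   by (auto simp: bergman_space_def holomorphic_ball_eq Lp_ball_weighted_iff[OF \<alpha>])
  define M where "M = E * B' powr q"
  have M: "M >= 0" "wint (\<beta> - q * \<gamma>) q (d k) <= ennreal M" for k
   using E(1) E(2)[OF dh B'0 B'] by (auto simp: M_def)
  have Td: "?T (d k) x = ?T (g (r k)) x - ?T h x" if "norm x < 1" for k x
   using lin[OF gV hV that, of 1 "r k" "-1"] by (simp add: d_def[abs_def])
  have small: "\<forall>\<^sub>F k in sequentially. wint \<beta> q (?T (d k)) <= ennreal e" if e: "e > 0" for e
  proof -
   define c where "c = 2 powr q"
   have c: "c > 0" by (simp add: c_def)
   \<comment> \<open>\<open>\<epsilon>\<close> and, further down, \<open>e'\<close> each claim half
     of \<open>e\<close>; the 1 added in the denominators covers the case that \<open>M\<close> or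
     \<open>N\<close> vanishes.\<close>
   define \<epsilon> where "\<epsilon> = (e / (2 * c * C1 * (M + 1))) powr (1 / q)"
   have X: "e / (2 * c * C1 * (M + 1)) > 0" using e c C1 M(1) by (intro divide_pos_pos mult_pos_pos) auto
   hence \<epsilon>: "\<epsilon> > 0" unfolding \<epsilon>_def using powr_gt_zero by (metis less_irrefl)
   have "1 / q * q = 1" using q by simp
   hence "\<epsilon> powr q = e / (2 * c * C1 * (M + 1))" unfolding \<epsilon>_def powr_powr using X by (simp only: powr_one)
   hence "c * (C1 * \<epsilon> powr q * M) = e / 2 * (M / (M + 1))" using c C1 by simp
   also have "... <= e / 2 * 1" using e M(1) by (intro mult_left_mono) auto
   finally have e1: "c * (C1 * \<epsilon> powr q * M) <= e / 2" by simp
   obtain Q N where Q: "bloch_bound \<gamma> \<epsilon> (\<lambda>z. f z - Q z)" "growth 0 Q" "bloch_bound \<gamma>' N Q" using approx[OF \<epsilon>] by blast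
   define e' where "e' = e / (2 * c * (C2 * N powr q + 1))"
   have e': "e' > 0" using e c C2 by (auto simp: e'_def add_nonneg_pos)
   have "c * (C2 * N powr q * e') = e / 2 * ((C2 * N powr q) / (C2 * N powr q + 1))" using c by (simp add: e'_def)
   also have "... <= e / 2 * 1" using e C2 by (intro mult_left_mono) (auto simp: divide_le_eq add_nonneg_pos)
   finally have e2: "c * (C2 * N powr q * e') <= e / 2" by simp
   have "\<forall>\<^sub>F k in sequentially. wint (\<beta> - q * \<gamma>') q (d k) <= ennreal e'"
   proof (rule wint_tendsto_0[where \<kappa>=\<kappa>g and K="G * B'" and a="\<beta> - q * \<gamma>" and M=M])
    show "bmeas (d k)" for k by (rule holo_measurable[OF dh])
    show "(\<lambda>k. d k x) \<longlonglongrightarrow> 0" if "norm x < 1" for x using LIM_zero[OF lim[OF that]] by (simp add: d_def[abs_def])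
    show "norm (d k x) <= G * B' * rho x powr (- \<kappa>g)" if "norm x < 1" for k x by (rule G(2)[OF dh B'0 B' that])
    show "\<beta> - q * \<gamma> < \<beta> - q * \<gamma>'" using \<gamma>'(2) q by simp
   qed (use \<kappa> G(1) B'0 M q e' in auto)
   thus ?thesis
   proof eventually_elim
    case (elim k)
    note fQ = growth_diff[OF fg gr0[OF Q(2)]]
    note dk = V[OF dV[of k]]
    have fin': "wint (\<beta> - q * \<gamma>') q (d k) < \<infinity>" by (rule le_less_trans[OF elim]) simp
    note t1 = ext_boundD[OF x1 fQ dk(2) \<kappa> b(5) Q(1) dk(3)] and t2 = ext_boundD[OF x2 gr0[OF Q(2)] dk(2) \<kappa> b(5) Q(3) fin']
    have "?T (d k) x = 1 * hankel_ext \<beta> b (\<lambda>z. f z - Q z) (d k) x + 1 * hankel_ext \<beta> b Q (d k) x" if "norm x < 1" for x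
     by (rule hankel_ext_lin[OF b(4,5) \<beta> fQ gr0[OF Q(2)] dk(2) dk(2) conjunct1[OF t1] conjunct1[OF t2] _ that]) (simp add: algebra_simps)
    hence le: "norm (?T (d k) x) <= norm (hankel_ext \<beta> b (\<lambda>z. f z - Q z) (d k) x) + norm (hankel_ext \<beta> b Q (d k) x)" if "norm x < 1" for x
     using that norm_triangle_ineq by simp
    have "wint \<beta> q (?T (d k)) <= ennreal c * (wint \<beta> q (hankel_ext \<beta> b (\<lambda>z. f z - Q z) (d k)) + wint \<beta> q (hankel_ext \<beta> b Q (d k)))"
     unfolding c_def by (rule wint_diff_le[OF q(2) _ _ le]) (use t1 t2 in auto)
    also have "... <= ennreal c * (ennreal (C1 * \<epsilon> powr q) * ennreal M + ennreal (C2 * N powr q) * ennreal e')"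
     by (intro mult_left_mono add_mono order_trans[OF conjunct2[OF conjunct2[OF t1]]] order_trans[OF conjunct2[OF conjunct2[OF t2]]] M elim) auto
    also have "... = ennreal (c * (C1 * \<epsilon> powr q * M) + c * (C2 * N powr q * e'))"
     using c C1 C2 M(1) e' by (simp add: ennreal_mult ennreal_plus distrib_left)
    also have "... <= ennreal e" using e1 e2 by (intro ennreal_leI) linarith
    finally show ?case .
   qed
  qed
  have eq: "wint \<beta> q (\<lambda>x. ?T (g (r k)) x - ?T h x) <= wint \<beta> q (?T (d k))" for k
   by (rule wint_mono) (use Td q in auto)
  show "\<exists>h\<in>Lp (ball_weighted \<beta>) q. \<exists>r. strict_mono r \<and> (\<lambda>k. Lp_norm (ball_weighted \<beta>) q (\<lambda>x. ?T (g (r k)) x - h x)) \<longlonglongrightarrow> 0"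
  proof (intro bexI exI conjI)
   show "(\<lambda>k. Lp_norm (ball_weighted \<beta>) q (\<lambda>x. ?T (g (r k)) x - ?T h x)) \<longlonglongrightarrow> 0"
   proof (rule Lp_norm_LIMSEQ_0[OF \<beta> q(2)])
    show "(\<lambda>x. ?T (g (r k)) x - ?T h x) \<in> Lp (ball_weighted \<beta>) q" for k
     using TV(2)[OF gV[of "r k"]] TV(2)[OF hV] le_less_trans[OF eq[of k]] TV(2)[OF dV[of k]]
     by (auto simp: Lp_ball_weighted_iff[OF \<beta>])
    show "\<forall>\<^sub>F k in sequentially. wint \<beta> q (\<lambda>x. ?T (g (r k)) x - ?T h x) <= ennreal e" if "e > 0" for e
     using small[OF that] by eventually_elim (rule order_trans[OF eq])
   qed
  qed (rule r, rule TV(2)[OF hV])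
 qed
 moreover have "AE z in ball_weighted \<beta>. ?T g z = hankel_conj \<beta> f g z" if g: "g \<in> H_infinity" for g
 proof -
  have gh: "holo_on (ball 0 1) g" and "\<exists>M. \<forall>x\<in>ball 0 1. norm (g x) <= M"
   using g unfolding H_infinity_def bounded_iff holomorphic_ball_eq by auto
  then obtain M where "\<forall>x\<in>ball 0 1. norm (g x) <= M" by blast
  hence M: "norm (g z) <= M" if "norm z < 1" for z using that by simp
  show ?thesis by (rule AEI) (rule hankel_ext_eq_hankel_conj[OF \<beta> b(3) fg \<kappa>f holo_measurable[OF gh] M])
 qed
 ultimately show ?thesis unfolding hankel_conj_compact_def by blast
qed


section \<open>Necessity\<close>

lemma norm_ker_le_right: "norm z < 1 ==> norm w <= 1 ==> s >= 0 ==> norm (ker s w z) <= (1 - norm z) powr (- s)"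
 unfolding norm_ker kdist_commute[of w] using kdist_ge_rho(1)[of z w] by (intro powr_mono2') auto

lemma ker_holo_left: "norm z < 1 ==> holo_on (ball 0 1) (\<lambda>w. ker s w z)"
 by (rule ker_holo(1)) (simp add: norm_cdot_lt')

lemma growth_mult_bounded:
 fixes f g :: "'n::finite cfun"
 assumes f: "growth \<kappa> f" and g: "holo_on (ball 0 1) g" "!!w. norm w < 1 ==> norm (g w) <= M"
 shows "growth \<kappa> (\<lambda>w. f w * g w)"
proof -
 obtain C where C: "C >= 0" "!!z. norm z < 1 ==> norm (f z) <= C * rho z powr (- \<kappa>)" by (rule growthE[OF f]) blast
 have "norm (f w * g w) <= C * M * rho w powr (- \<kappa>)" if "norm w < 1" for w
  using mult_mono[OF C(2)[OF that] g(2)[OF that]] C(1) by (simp add: norm_mult mult_ac)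
 thus ?thesis unfolding growth_def using holo_mult(1)[OF growth_holo[OF f] g(1)] by blast
qed

lemma wint_mult_bounded:
 fixes f g :: "'n::finite cfun"
 assumes f: "bmeas f" "wint \<beta> 1 f < \<infinity>" and g: "!!z. norm z < 1 ==> norm (g z) <= M"
 shows "wint \<beta> 1 (\<lambda>w. cnj (f w) * g w) < \<infinity>"
proof -
 have M: "M >= 0" using order_trans[OF norm_ge_zero g[of 0]] by simp
 have "wint \<beta> 1 (\<lambda>w. cnj (f w) * g w) <= bint (\<lambda>w. M * (rho w powr \<beta> * norm (f w) powr 1))"
  unfolding wint_def
 proof (rule bint_mono)
  fix w :: "complex^'n" assume "norm w < 1"
  hence "norm (f w) * norm (g w) <= norm (f w) * M" by (intro mult_left_mono g) auto
  hence "rho w powr \<beta> * (norm (f w) * norm (g w)) <= rho w powr \<beta> * (norm (f w) * M)" by (rule mult_left_mono) simp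
  thus "rho w powr \<beta> * norm (cnj (f w) * g w) powr 1 <= M * (rho w powr \<beta> * norm (f w) powr 1)"
   by (simp add: norm_mult mult_ac)
 qed
 also have "... = ennreal M * wint \<beta> 1 f" by (rule wint_cmult[OF M f(1)])
 also have "... < \<infinity>" using f(2) by (simp add: ennreal_mult_less_top)
 finally show ?thesis .
qed

text \<open>Differentiating the reproducing formula along v puts a factor s <v,w> and the exponent s
  + 1 into the kernel. The factor <a, w - z> is assembled from the directions a and z, because ker s
  is (1 - <z,w>) times ker (s + 1).\<close>

lemma deriv_reproducing:
 fixes h :: "'n::finite cfun"
 assumes h: "growth \<kappa> h" and b: "b > -1" "b - \<kappa> > -1" "\<kappa> >= 0" and z: "norm z < 1"
 defines "s \<equiv> real CARD('n) + 1 + b"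
 shows "(LINT w|lball. of_real (rho w powr b) * h w * (cdot a (w - z) * ker (s + 1) z w))
   = of_real (bmass TYPE('n) b / s) * (dir a h z - cdot a z * (of_real s * h z + dir z h z))"
  and "integrable lball (\<lambda>w. of_real (rho w powr b) * h w * (cdot a (w - z) * ker (s + 1) z w))"
proof -
 let ?A = "bmass TYPE('n) b"
 have s: "s > 0" using b by (simp add: s_def add_pos_pos)
 obtain C where C: "C >= 0" "!!z. norm z < 1 ==> norm (h z) <= C * rho z powr (- \<kappa>)" by (rule growthE[OF h]) blast
 have m: "bmeas h" and f: "wint b 1 h < \<infinity>" by (rule growth_measurable[OF h], rule growth_wint_1[OF h b(2)])
 have rep: "(LINT w|lball. of_real (rho w powr b) * h w * ker s x w) = of_real ?A * h x" if "norm x < 1" for x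
  using reproducing_growth[OF growth_holo[OF h] C(2) b that] by (simp add: s_def mult.assoc)
 have D: "(LINT w|lball. of_real (rho w powr b) * h w * (of_real s * cdot v w * ker (s + 1) z w)) = of_real ?A * dir v h z" for v
 proof -
  have "dir v (\<lambda>x. of_real ?A * h x) z = dir v (\<lambda>x. (LINT w|lball. of_real (rho w powr b) * h w * ker s x w)) z"
   by (rule holo_on_cong(2)[OF ker_integral_holo(1)[OF m f s] open_ball]) (use rep z in auto)
  also have "dir v (\<lambda>x. of_real ?A * h x) z = of_real ?A * dir v h z" by (rule dir_fun_cmul[OF growth_holo[OF h]]) (use z in simp)
  finally show ?thesis unfolding ker_integral_holo(2)[OF m f s z] by simp
 qed
 note DI = ker_integral_holo(3)[OF m f s z]
 have KI: "integrable lball (\<lambda>w. of_real (rho w powr b) * h w * ker s z w)"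
  using proj_integrable[OF m f z less_imp_le[OF s]] by (simp add: mult.assoc)
 let ?I = "\<lambda>v w. of_real (rho w powr b) * h w * (of_real s * cdot v w * ker (s + 1) z w)"
 have eq: "of_real (rho w powr b) * h w * (cdot a (w - z) * ker (s + 1) z w)
  = ?I a w / of_real s - cdot a z * (of_real (rho w powr b) * h w * ker s z w + ?I z w / of_real s)"
  if "w \<in> space lball" for w
 proof -
  have 1: "ker s z w + cdot z w * ker (s + 1) z w = ker (s + 1) z w"
   using that ker_add1[OF norm_cdot_lt[OF z], of w s, symmetric] by (simp add: algebra_simps)
  have 2: "?I v w / of_real s = of_real (rho w powr b) * h w * (cdot v w * ker (s + 1) z w)" for v using s by simp
  show ?thesis unfolding 2 distrib_left[symmetric] 1 by (simp add: algebra_simps)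
 qed
 note i = integrable_divide[OF DI[of a]] integrable_mult_right[OF Bochner_Integration.integrable_add[OF KI integrable_divide[OF DI[of z]]]]
 show "integrable lball (\<lambda>w. of_real (rho w powr b) * h w * (cdot a (w - z) * ker (s + 1) z w))"
  by (rule iffD1[OF Bochner_Integration.integrable_cong, rotated 2], rule Bochner_Integration.integrable_diff[OF i], rule refl, rule eq[symmetric])
 have "(LINT w|lball. of_real (rho w powr b) * h w * (cdot a (w - z) * ker (s + 1) z w))
  = (LINT w|lball. ?I a w / of_real s - cdot a z * (of_real (rho w powr b) * h w * ker s z w + ?I z w / of_real s))"
  by (rule Bochner_Integration.integral_cong[OF refl eq])
 also have "... = of_real ?A * dir a h z / of_real s - cdot a z * (of_real ?A * h z + of_real ?A * dir z h z / of_real s)"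
  unfolding Bochner_Integration.integral_diff[OF i] integral_mult_right_zero Bochner_Integration.integral_add[OF KI integrable_divide[OF DI[of z]]] integral_divide_zero D rep[OF z] ..
 also have "... = of_real (?A / s) * (dir a h z - cdot a z * (of_real s * h z + dir z h z))"
  using s by (simp add: field_simps)
 finally show "(LINT w|lball. of_real (rho w powr b) * h w * (cdot a (w - z) * ker (s + 1) z w))
   = of_real (?A / s) * (dir a h z - cdot a z * (of_real s * h z + dir z h z))" .
qed

text \<open>\<open>deriv_reproducing\<close> for the function \<open>f w * ker s w z\<close>: the
  contributions of \<open>f z\<close> cancel because \<open>1 - cdot z z\<close> is
  \<open>rho z\<close>, and the derivative in the direction a - <a,z> z is left.\<close>

lemma bergman_identity:
 fixes f :: "'n::finite cfun"
 assumes f: "growth \<kappa> f" and b: "b > -1" "b - \<kappa> > -1" "\<kappa> >= 0" and z: "norm z < 1"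
 defines "s \<equiv> real CARD('n) + 1 + b"
 shows "(LINT w|lball. of_real (rho w powr b) * (f w * ker s w z) * (cdot a (w - z) * ker (s + 1) z w))
   = of_real (bmass TYPE('n) b / s * rho z powr (- s)) * (dir a f z - cdot a z * dir z f z)"
  and "integrable lball (\<lambda>w. of_real (rho w powr b) * (f w * ker s w z) * (cdot a (w - z) * ker (s + 1) z w))"
proof -
 have s: "s >= 0" using b by (simp add: s_def add_nonneg_nonneg)
 have h: "growth \<kappa> (\<lambda>w. f w * ker s w z)"
  by (rule growth_mult_bounded[OF f ker_holo_left[OF z] norm_ker_le_right[OF z less_imp_le s]])
 note r = deriv_reproducing[OF h b z, of a, folded s_def]
 show "integrable lball (\<lambda>w. of_real (rho w powr b) * (f w * ker s w z) * (cdot a (w - z) * ker (s + 1) z w))" by (rule r(2))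
 have zb: "z \<in> ball 0 1" using z by simp
 have k: "dir v (\<lambda>w. ker s w z) z = of_real s * cdot v z * of_real (rho z powr (- s - 1))" for v
 proof -
  have "dir v (\<lambda>w. ker s w z) z = of_real s * cdot v z * ker (s + 1) z z"
   by (rule ker_holo(2)[OF _ zb]) (simp add: norm_cdot_lt'[OF _ z])
  thus ?thesis unfolding ker_self[OF z] by simp
 qed
 have d: "dir v (\<lambda>w. f w * ker s w z) z = f z * (of_real s * cdot v z * of_real (rho z powr (- s - 1))) + dir v f z * of_real (rho z powr (- s))" for v
  using holo_mult(2)[OF growth_holo[OF f] ker_holo_left[OF z] zb, of v] by (simp add: k ker_self[OF z])
 have "rho z * rho z powr (- s - 1) = rho z powr (- s)"
  using powr_add[of "rho z" 1 "- s - 1"] rho_pos[OF z] by simp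
 hence "complex_of_real (1 - (norm z)^2) * of_real (rho z powr (- s - 1)) = of_real (rho z powr (- s))"
  unfolding of_real_mult[symmetric] by (simp only: rho_def[of z, symmetric])
 hence "complex_of_real (rho z powr (- s)) + cdot z z * of_real (rho z powr (- s - 1)) = of_real (rho z powr (- s - 1))"
  unfolding cdot_self by (simp add: algebra_simps)
 hence "of_real s * cdot a z * f z * (complex_of_real (rho z powr (- s)) + cdot z z * of_real (rho z powr (- s - 1))) = of_real s * cdot a z * f z * of_real (rho z powr (- s - 1))" by simp
 hence "dir a (\<lambda>w. f w * ker s w z) z - cdot a z * (of_real s * (f z * ker s z z) + dir z (\<lambda>w. f w * ker s w z) z)
  = of_real (rho z powr (- s)) * (dir a f z - cdot a z * dir z f z)"
  unfolding d ker_self[OF z] by (simp add: algebra_simps)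
 thus "(LINT w|lball. of_real (rho w powr b) * (f w * ker s w z) * (cdot a (w - z) * ker (s + 1) z w))
   = of_real (bmass TYPE('n) b / s * rho z powr (- s)) * (dir a f z - cdot a z * dir z f z)"
  unfolding r(1) by (simp only: of_real_mult mult.assoc)
qed

section \<open>Normalised kernels as test functions\<close>

definition test_fun :: "real => real => complex^'n => complex^'n => complex" where
 "test_fun s \<kappa> z w = of_real (rho z powr (s - \<kappa>)) * ker s w z"

lemma test_fun_holo: "norm z < 1 ==> holo_on (ball 0 1) (test_fun s \<kappa> z)"
 unfolding test_fun_def[abs_def] by (intro holo_cmul ker_holo_left)

lemma test_fun_le:
 assumes z: "norm z < 1" "norm w <= 1" "s >= 0"
 shows "norm (test_fun s \<kappa> z w) <= rho z powr (s - \<kappa>) * (1 - norm z) powr (- s)"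
  and "norm w < 1 ==> norm (test_fun s \<kappa> z w) <= rho z powr (s - \<kappa>) * (1 - norm w) powr (- s)"
proof -
 have n: "norm (test_fun s \<kappa> z w) = rho z powr (s - \<kappa>) * norm (ker s w z)" by (simp add: test_fun_def norm_mult)
 show "norm (test_fun s \<kappa> z w) <= rho z powr (s - \<kappa>) * (1 - norm z) powr (- s)"
  unfolding n by (intro mult_left_mono norm_ker_le_right z) auto
 show "norm (test_fun s \<kappa> z w) <= rho z powr (s - \<kappa>) * (1 - norm w) powr (- s)" if "norm w < 1"
  unfolding n by (intro mult_left_mono norm_ker_le that z order_refl less_imp_le[OF z(1)]) auto
qed

lemma test_fun_H_infinity: "norm z < 1 ==> s >= 0 ==> test_fun s \<kappa> z \<in> H_infinity"
proof -
 assume *: "norm z < 1" "s >= 0"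
 have "norm (test_fun s \<kappa> z w) <= rho z powr (s - \<kappa>) * (1 - norm z) powr (- s)" if "w \<in> ball 0 1" for w
  by (rule test_fun_le(1)) (use * that in auto)
 hence "bounded (test_fun s \<kappa> z ` ball 0 1)" unfolding bounded_iff by blast
 thus ?thesis unfolding H_infinity_def holomorphic_ball_eq using test_fun_holo[OF *(1)] by simp
qed

text \<open>The Forelli-Rudin power n + 1 + \<alpha> - p s of \<open>rho z\<close> is compensated
  exactly by the p-th power of the prefactor, which explains the choice (n + 1 + \<alpha>) /
  p.\<close>

lemma test_fun_wint:
 assumes \<alpha>: "\<alpha> > -1" and p: "p * s > real CARD('n::finite) + 1 + \<alpha>" "p > 0"
 obtains C where "C > 0" "!!z::complex^'n. norm z < 1 ==> wint \<alpha> p (test_fun s ((real CARD('n) + 1 + \<alpha>) / p) z) <= ennreal C"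
proof -
 let ?m = "real CARD('n) + 1 + \<alpha>"
 define C where "C = fr_const TYPE('n) \<alpha> (p * s)"
 note C = forelli_rudin[OF \<alpha> p(1), folded C_def]
 show thesis
 proof (rule that[OF C(1)])
  fix z :: "complex^'n" assume z: "norm z < 1"
  have "wint \<alpha> p (test_fun s (?m / p) z) = bint (\<lambda>w. rho z powr (p * s - ?m) * (rho w powr \<alpha> * kdist z w powr (- (p * s))))"
   unfolding wint_def
  proof (intro nn_integral_cong arg_cong[where f=ennreal])
   fix w :: "complex^'n"
   have "(s - ?m / p) * p = p * s - ?m" unfolding left_diff_distrib using p(2) by (simp add: mult.commute[of s])
   hence "norm (test_fun s (?m / p) z w) powr p = rho z powr (p * s - ?m) * kdist z w powr (- (p * s))"
    by (simp add: test_fun_def norm_mult norm_ker kdist_commute[of w] powr_mult powr_powr mult.commute)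
   thus "rho w powr \<alpha> * norm (test_fun s (?m / p) z w) powr p = rho z powr (p * s - ?m) * (rho w powr \<alpha> * kdist z w powr (- (p * s)))"
    by (simp add: mult_ac)
  qed
  also have "... = ennreal (rho z powr (p * s - ?m)) * bint (\<lambda>w. rho w powr \<alpha> * kdist z w powr (- (p * s)))"
   by (rule bint_cmult[OF _ measurable_rho_kdist[OF z]]) simp
  also have "... <= ennreal (rho z powr (p * s - ?m)) * ennreal (C * rho z powr (?m - p * s))" by (intro mult_left_mono C(2) z) simp
  also have "... = ennreal (C * (rho z powr (p * s - ?m) * rho z powr (?m - p * s)))" using C(1) by (simp add: mult_ac flip: ennreal_mult)
  also have "rho z powr (p * s - ?m) * rho z powr (?m - p * s) = 1" unfolding powr_add[symmetric] using rho_pos[OF z] by simp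
  finally show "wint \<alpha> p (test_fun s (?m / p) z) <= ennreal C" by simp
 qed
qed

lemma bergman_proj_le:
 fixes u :: "'n::finite cfun"
 assumes \<beta>: "\<beta> > -1" and u: "bmeas u" "wint \<beta> 1 u <= ennreal c" "c >= 0" and z: "norm z < 1"
 shows "norm (bergman_proj \<beta> u z) <= (1 - norm z) powr (- (real CARD('n) + 1 + \<beta>)) * c / bmass TYPE('n) \<beta>"
proof -
 define s where "s = real CARD('n) + 1 + \<beta>"
 have s: "s >= 0" using \<beta> by (simp add: s_def add_nonneg_nonneg)
 have A: "bmass TYPE('n) \<beta> > 0" by (rule bmass_pos[OF \<beta>])
 let ?c = "(1 - norm z) powr (- s) / bmass TYPE('n) \<beta>"
 have "ennreal (norm (bergman_proj \<beta> u z)) <= bint (\<lambda>w. 1 / bmass TYPE('n) \<beta> * (rho w powr \<beta> * norm (u w) * kdist z w powr (- s)))"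
  unfolding s_def by (rule norm_bergman_proj_le[OF \<beta> u(1) z])
 also have "... <= bint (\<lambda>w. ?c * (rho w powr \<beta> * norm (u w) powr 1))"
 proof (rule bint_mono)
  fix w :: "complex^'n" assume "norm w < 1"
  hence "kdist z w powr (- s) <= (1 - norm z) powr (- s)" unfolding norm_ker[symmetric] by (intro norm_ker_le order_refl z s) auto
  hence "1 / bmass TYPE('n) \<beta> * (rho w powr \<beta> * norm (u w) * kdist z w powr (- s)) <= 1 / bmass TYPE('n) \<beta> * (rho w powr \<beta> * norm (u w) * (1 - norm z) powr (- s))"
   using A by (intro mult_left_mono) auto
  thus "1 / bmass TYPE('n) \<beta> * (rho w powr \<beta> * norm (u w) * kdist z w powr (- s)) <= ?c * (rho w powr \<beta> * norm (u w) powr 1)" by (simp add: mult_ac)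
 qed
 also have "... = ennreal ?c * wint \<beta> 1 u" by (rule wint_cmult[OF _ u(1)]) (use A in simp)
 also have "... <= ennreal ?c * ennreal c" by (intro mult_left_mono u) simp
 also have "... = ennreal (?c * c)" by (rule ennreal_mult'[symmetric]) (use A in simp)
 finally show ?thesis using u(3) A by (simp add: s_def)
qed

lemma bergman_proj_growth:
 fixes u :: "'n::finite cfun"
 assumes \<beta>: "\<beta> > -1" and u: "bmeas u" "wint \<beta> 1 u < \<infinity>"
 shows "growth (real CARD('n) + 1 + \<beta>) (bergman_proj \<beta> u)"
proof -
 define s where "s = real CARD('n) + 1 + \<beta>"
 have s: "s >= 0" using \<beta> by (simp add: s_def add_nonneg_nonneg)
 have A: "bmass TYPE('n) \<beta> > 0" by (rule bmass_pos[OF \<beta>])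
 obtain c where c: "c >= 0" "wint \<beta> 1 u = ennreal c" using u(2) by (cases "wint \<beta> 1 u") auto
 have "norm (bergman_proj \<beta> u z) <= 2 powr s * c / bmass TYPE('n) \<beta> * rho z powr (- s)" if z: "norm z < 1" for z :: "complex^'n"
 proof -
  have "(1 - norm z) powr (- s) * c / bmass TYPE('n) \<beta> <= 2 powr s * rho z powr (- s) * c / bmass TYPE('n) \<beta>"
   using c A by (intro divide_right_mono mult_right_mono one_minus_norm_powr_le[OF z s]) auto
  thus ?thesis using bergman_proj_le[OF \<beta> u(1) _ c(1) z] c(2) by (simp add: s_def mult_ac)
 qed
 thus ?thesis using bergman_proj_holo[OF \<beta> u] unfolding growth_def s_def by blast
qed


text \<open>Away from complex dimension one, the tangential derivatives of a Bloch-type function are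
 smaller by the factor \<open>rho powr (1/2)\<close> than the radial ones.\<close>

definition tang_bound :: "real => real => 'n::finite cfun => complex^'n => bool" where
 "tang_bound \<gamma> E f z \<longleftrightarrow> (\<forall>a. norm (dir a f z - cdot a z * dir z f z) <= E * norm a * rho z powr (aniso TYPE('n) - 1 - \<gamma>)) \<and>
  norm (dir z f z) <= E * rho z powr (- 1 - \<gamma>)"

section \<open>The Hankel operator on the test functions\<close>

context
 fixes f :: "'n::finite cfun" and p q \<alpha> \<beta> \<gamma> b s \<kappa>f \<kappa>g :: real
 assumes f: "f \<in> bergman_space 1 \<beta>" and p: "1 < p" "p <= q" and \<alpha>: "\<alpha> > -1" and \<beta>: "\<beta> > -1"
  and \<gamma>: "\<gamma> = (real CARD('n) + 1 + \<beta>) / q - (real CARD('n) + 1 + \<alpha>) / p"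
  and \<kappa>f: "\<kappa>f = real CARD('n) + 1 + \<bar>\<beta>\<bar>" and \<kappa>g: "\<kappa>g = (real CARD('n) + 1 + \<alpha>) / p"
  and b: "b = real CARD('n) + 1 + \<bar>\<beta>\<bar> + \<kappa>f + \<kappa>g" and s: "s = real CARD('n) + 1 + b"
begin

abbreviation "H z \<equiv> hankel_conj \<beta> f (test_fun s \<kappa>g z)"

text \<open>What the generous choice of \<open>b\<close> buys: reproduction with exponent
  \<open>b\<close> applies to \<open>f\<close> and to projections of integrable functions, which
  grow with order n + 1 + \<beta>, and positivity of \<open>s - \<kappa>g - \<kappa>f\<close> lets
  the decay of the test functions at a fixed point beat the crude growth of the symbol.\<close>

lemma exponents: "q > 1" "\<kappa>f >= 0" "\<kappa>g >= 0" "b > -1" "b - \<kappa>f > -1" "b - (real CARD('n) + 1 + \<beta>) > -1" "b >= 1 + \<bar>\<beta>\<bar>"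
  "s > 0" "s - \<kappa>g - \<kappa>f > 0" "p * s > real CARD('n) + 1 + \<alpha>"
proof -
 show q: "q > 1" and k: "\<kappa>f >= 0" "\<kappa>g >= 0" using p \<alpha> by (auto simp: \<kappa>f \<kappa>g)
 thus "b > -1" "b - \<kappa>f > -1" "b - (real CARD('n) + 1 + \<beta>) > -1" "b >= 1 + \<bar>\<beta>\<bar>" "s > 0" and 1: "s - \<kappa>g - \<kappa>f > 0"
  by (auto simp: b s)
 have "p * \<kappa>g < p * s" using p(1) 1 k by (intro mult_strict_left_mono) auto
 thus "p * s > real CARD('n) + 1 + \<alpha>" using p(1) by (simp add: \<kappa>g)
qed

lemma symbol: "holo_on (ball 0 1) f" "bmeas f" "wint \<beta> 1 f < \<infinity>" "growth \<kappa>f f"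
proof -
 show h: "holo_on (ball 0 1) f" and "bmeas f" and w: "wint \<beta> 1 f < \<infinity>"
  using f Lp_ball_weighted_iff[OF \<beta>, of f 1] by (auto simp: bergman_space_def holomorphic_ball_eq)
 obtain C where "C >= 0" "!!z. norm z < 1 ==> norm (f z) <= C * rho z powr (- \<kappa>f)"
  unfolding \<kappa>f by (rule crude_growth[OF h w]) blast
 thus "growth \<kappa>f f" using h unfolding growth_def by blast
qed

lemma hankel_test_fun:
 assumes z: "norm z < 1"
 defines "G \<equiv> test_fun s \<kappa>g z"
 shows "bmeas G" "bmeas (\<lambda>w. cnj (f w) * G w)" "wint \<beta> 1 (\<lambda>w. cnj (f w) * G w) < \<infinity>"
  "growth (real CARD('n) + 1 + \<beta>) (bergman_proj \<beta> (\<lambda>w. cnj (f w) * G w))" "hankel_conj \<beta> f G \<in> borel_measurable lball"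
proof -
 show g: "bmeas G" unfolding G_def by (rule holo_measurable[OF test_fun_holo[OF z]])
 show m: "bmeas (\<lambda>w. cnj (f w) * G w)" by (rule measurable_cnj_mult[OF symbol(2) g])
 show w: "wint \<beta> 1 (\<lambda>w. cnj (f w) * G w) < \<infinity>"
  unfolding G_def by (rule wint_mult_bounded[OF symbol(2,3) test_fun_le(1)[OF z _ less_imp_le[OF exponents(8)]]]) simp
 show gr: "growth (real CARD('n) + 1 + \<beta>) (bergman_proj \<beta> (\<lambda>w. cnj (f w) * G w))" by (rule bergman_proj_growth[OF \<beta> m w])
 show "hankel_conj \<beta> f G \<in> borel_measurable lball"
  unfolding hankel_conj_def[abs_def] using m growth_measurable[OF gr] by measurable
qed

text \<open>Conjugating \<open>bergman_identity\<close> yields the conjugate symbol, and the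
  conjugated \<open>ker (s + 1)\<close> splits into \<open>ker s\<close>, which belongs to the test
  function, and the holomorphic \<open>ker 1\<close>, which stays with the factor vanishing at
  \<open>z\<close>. The projection is thus paired with exactly the reproducing kernel.\<close>

lemma test_functional:
 fixes z a :: "complex^'n"
 assumes z: "norm z < 1"
 shows "norm (LINT w|lball. of_real (rho w powr b) * (H z w * (cdot (w - z) a * ker 1 w z) * ker s z w))
  = bmass TYPE('n) b / s * rho z powr (- \<kappa>g) * norm (dir a f z - cdot a z * dir z f z)"
proof -
 let ?G = "test_fun s \<kappa>g z" and ?c = "rho z powr (s - \<kappa>g)" and ?k = "\<lambda>w. cdot (w - z) a * ker 1 w z"
 let ?v = "bergman_proj \<beta> (\<lambda>w. cnj (f w) * ?G w)"
 let ?J = "\<lambda>w. of_real (rho w powr b) * (f w * ker s w z) * (cdot a (w - z) * ker (s + 1) z w)"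
 note e = exponents
 have A: "bmass TYPE('n) b > 0" by (rule bmass_pos[OF e(4)])
 have kh: "holo_on (ball 0 1) ?k" by (intro holo_mult(1) ker_holo_left z) (simp add: holo_diff)
 have kb: "norm (?k w) <= 2 * norm a * (1 - norm z) powr (- 1)" if "norm w < 1" for w
 proof -
  have "norm (w - z) <= 2" using norm_triangle_ineq4[of w z] that z by linarith
  hence "norm (cdot (w - z) a) <= 2 * norm a" by (intro order_trans[OF norm_cdot_le] mult_right_mono) auto
  moreover have "norm (ker 1 w z) <= (1 - norm z) powr (- 1)" by (rule norm_ker_le_right) (use that z in auto)
  ultimately show ?thesis unfolding norm_mult by (intro mult_mono) auto
 qed
 have vg: "growth (real CARD('n) + 1 + \<beta>) (\<lambda>w. ?v w * ?k w)" by (rule growth_mult_bounded[OF hankel_test_fun(4)[OF z] kh kb])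
 have S0: "real CARD('n) + 1 + \<beta> >= 0" using \<beta> by (simp add: add_nonneg_nonneg)
 obtain C where C: "C >= 0" "!!w. norm w < 1 ==> norm (?v w * ?k w) <= C * rho w powr (- (real CARD('n) + 1 + \<beta>))"
  by (rule growthE[OF vg]) blast
 have v0: "(LINT w|lball. of_real (rho w powr b) * (?v w * ?k w * ker s z w)) = 0"
  using reproducing_growth[OF growth_holo[OF vg] C(2) e(4,6) S0 z, folded s] by simp
 have vi: "integrable lball (\<lambda>w. of_real (rho w powr b) * (?v w * ?k w * ker s z w))"
  by (rule proj_integrable[OF growth_measurable[OF vg] growth_wint_1[OF vg e(6)] z less_imp_le[OF e(8)]])
 note bi = bergman_identity[OF symbol(4) e(4,5,2) z, of a, folded s]
 have Ji: "integrable lball (\<lambda>w. of_real ?c * cnj (?J w))"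
  by (intro integrable_mult_right integrable_cnj bi(2))
 have eq: "of_real (rho w powr b) * (hankel_conj \<beta> f ?G w * ?k w * ker s z w) = of_real ?c * cnj (?J w) - of_real (rho w powr b) * (?v w * ?k w * ker s z w)"
  if "w \<in> space lball" for w
 proof -
  have c: "norm (cdot w z) < 1" "norm (cdot z w) < 1" using that z norm_cdot_lt[of z w] norm_cdot_lt'[of w z] by auto
  have "cnj (?J w) = of_real (rho w powr b) * (cnj (f w) * ker s z w) * (cdot (w - z) a * (ker s w z * ker 1 w z))"
   unfolding ker_mult[OF c(1)] by (simp add: cnj_ker c)
  thus ?thesis unfolding hankel_conj_def test_fun_def by (simp only: left_diff_distrib right_diff_distrib mult_ac)
 qed
 have "(LINT w|lball. of_real (rho w powr b) * (hankel_conj \<beta> f ?G w * ?k w * ker s z w)) = of_real ?c * cnj (LINT w|lball. ?J w) - 0"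
  unfolding v0[symmetric] Bochner_Integration.integral_cnj[symmetric] integral_mult_right_zero[symmetric] Bochner_Integration.integral_diff[OF Ji vi, symmetric]
  by (rule Bochner_Integration.integral_cong[OF refl eq])
 also have "norm ... = ?c * (bmass TYPE('n) b / s * rho z powr (- s) * norm (dir a f z - cdot a z * dir z f z))"
  unfolding bi(1) diff_0_right norm_mult complex_mod_cnj norm_of_real using A e(8) by (simp add: abs_mult)
 also have "... = bmass TYPE('n) b / s * (?c * rho z powr (- s)) * norm (dir a f z - cdot a z * dir z f z)" by simp
 also have "?c * rho z powr (- s) = rho z powr (- \<kappa>g)" unfolding powr_add[symmetric] by simp
 finally show ?thesis .
qed

text \<open>Hoelder's inequality separates the Hankel function, with weight \<beta>, from the
  kernel, whose q'-norm is a Forelli-Rudin integral. The exponent is left free: the anisotropy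
  exponent serves all directions, 1 the radial one.\<close>

lemma hankel_lower_bound:
 assumes e: "e <= 1"
 obtains C where "C > 0" "!!(z::complex^'n) a E K. norm z < 1 ==> E > 0 ==> K > 0 ==> (!!w. norm w < 1 ==> norm (cdot (w - z) a) <= K * kdist z w powr e) ==>
  wint \<beta> q (H z) <= ennreal (E powr q) ==> norm (dir a f z - cdot a z * dir z f z) <= C * E * K * rho z powr (e - 1 - \<gamma>)"
proof -
 let ?n = "real CARD('n)"
 note ex = exponents
 define q' where "q' = q / (q - 1)"
 have q': "q' > 1" "1 / q + 1 / q' = 1" using ex(1) by (auto simp: q'_def field_simps)
 define t where "t = (b - \<beta> / q) * q'"
 define e' where "e' = q' * (s + 1 - e)"
 have "\<beta> / q <= \<bar>\<beta>\<bar>" using ex(1) by (simp add: divide_le_eq abs_le_iff mult_le_cancel_left1) (metis abs_ge_self abs_ge_zero less_eq_real_def mult_left_mono mult.right_neutral order_trans)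
 hence "t >= 0" unfolding t_def using ex(7) q'(1) by (intro mult_nonneg_nonneg) auto
 hence t: "t > -1" by simp
 have q1: "1 / q' = 1 - 1 / q" using q' by simp
 have xq: "(?n + 1 + t - e') / q' = (?n + 1) * (1 / q') + (b - \<beta> / q) - (s + 1 - e)" using q'(1) by (simp add: t_def e'_def add_divide_distrib diff_divide_distrib)
 \<comment> \<open>Together with rho^(\<kappa>g) from the normalisation this becomes the exponent e
   - 1 - \<gamma>.\<close>
 have xe: "(?n + 1 + t - e') / q' = - ((?n + 1 + \<beta>) / q) - 1 + e" unfolding xq q1 s using ex(1) by (simp add: field_simps)
 have "?n + 1 + \<beta> > 0" using \<beta> of_nat_0_le_iff[of "CARD('n)"] by linarith
 hence "(?n + 1 + \<beta>) / q > 0" using ex(1) by simp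
 hence "(?n + 1 + t - e') / q' < 0" unfolding xe using e by linarith
 hence e': "e' > ?n + 1 + t" using q'(1) by (simp add: divide_less_0_iff)
 define C where "C = fr_const TYPE('n) t e'"
 note C = forelli_rudin[OF t e', folded C_def]
 have A: "bmass TYPE('n) b > 0" by (rule bmass_pos[OF ex(4)])
 define D where "D = C powr (1 / q') * s / bmass TYPE('n) b"
 have D0: "D > 0" unfolding D_def using C(1) A ex(8) by simp
 show thesis
 proof (rule that[OF D0])
  fix z a :: "complex^'n" and E K :: real
  assume z: "norm z < 1" and E: "E > 0" and K: "K > 0" and a: "!!w. norm w < 1 ==> norm (cdot (w - z) a) <= K * kdist z w powr e"
   and Eb: "wint \<beta> q (H z) <= ennreal (E powr q)"
  let ?u = "H z" and ?N = "norm (dir a f z - cdot a z * dir z f z)"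
  define U where "U w = rho w powr (\<beta> / q) * norm (?u w)" for w
  define W where "W w = K * (rho w powr (b - \<beta> / q) * kdist z w powr (e - 1 - s))" for w
  define x where "x = (?n + 1 + t - e') / q'"
  define Y where "Y = K * (C powr (1 / q') * rho z powr x)"
  have Y: "Y > 0" unfolding Y_def using K C(1) rho_pos[OF z] by simp
  have um: "bmeas (\<lambda>w. norm (?u w))" using hankel_test_fun(5)[OF z] by measurable
  have Um: "bmeas U" unfolding U_def[abs_def] by (intro borel_measurable_times measurable_rho_powr um)
  have Wm: "bmeas W" unfolding W_def[abs_def] by (intro borel_measurable_times borel_measurable_const measurable_rho_kdist z)
  have UE: "bint (\<lambda>w. U w powr q) <= ennreal (E powr q)"
   using Eb ex(1) unfolding wint_def U_def by (simp add: powr_mult powr_powr)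
  have "bint (\<lambda>w. W w powr q') = bint (\<lambda>w. K powr q' * (rho w powr t * kdist z w powr (- e')))"
   using K by (simp add: W_def t_def e'_def powr_mult powr_powr algebra_simps)
  also have "... = ennreal (K powr q') * bint (\<lambda>w. rho w powr t * kdist z w powr (- e'))"
   by (rule bint_cmult[OF _ measurable_rho_kdist[OF z]]) simp
  also have "... <= ennreal (K powr q') * ennreal (C * rho z powr (?n + 1 + t - e'))" by (intro mult_left_mono C z) simp
  also have "... = ennreal (Y powr q')"
  proof -
   have "x * q' = ?n + 1 + t - e'" using q'(1) by (simp add: x_def)
   thus ?thesis using K C(1) q'(1) by (simp add: Y_def powr_mult powr_powr flip: ennreal_mult)
  qed
  finally have WY: "bint (\<lambda>w. W w powr q') <= ennreal (Y powr q')" .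
  have "ennreal (bmass TYPE('n) b / s * rho z powr (- \<kappa>g) * ?N)
   <= bint (\<lambda>w. norm (of_real (rho w powr b) * (?u w * (cdot (w - z) a * ker 1 w z) * ker s z w)))"
   unfolding test_functional[OF z, symmetric] by (rule norm_integral_le_nn_integral)
  also have "... <= bint (\<lambda>w. U w * W w)"
  proof (rule bint_mono)
   fix w :: "complex^'n" assume w: "norm w < 1"
   have "norm (of_real (rho w powr b) * (?u w * (cdot (w - z) a * ker 1 w z) * ker s z w))
    = rho w powr b * norm (?u w) * (kdist z w powr (-1) * kdist z w powr (- s)) * norm (cdot (w - z) a)"
    by (simp add: norm_mult norm_ker kdist_commute[of w] mult_ac)
   also have "... <= rho w powr b * norm (?u w) * (kdist z w powr (-1) * kdist z w powr (- s)) * (K * kdist z w powr e)"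
    by (intro mult_left_mono a w) simp
   also have "... = K * (rho w powr b * norm (?u w)) * (kdist z w powr (-1) * kdist z w powr (- s) * kdist z w powr e)" by (simp only: mult_ac)
   also have "kdist z w powr (-1) * kdist z w powr (- s) * kdist z w powr e = kdist z w powr (e - 1 - s)"
    unfolding powr_add[symmetric] by (rule arg_cong[where f="\<lambda>x. kdist z w powr x"]) simp
   also have "K * (rho w powr b * norm (?u w)) * kdist z w powr (e - 1 - s) = U w * W w"
    using powr_add[of "rho w" "\<beta> / q" "b - \<beta> / q"] unfolding U_def W_def by simp
   finally show "norm (of_real (rho w powr b) * (?u w * (cdot (w - z) a * ker 1 w z) * ker s z w)) <= U w * W w" .
  qed
  also have "... <= ennreal (E * Y)"
   by (rule nn_integral_Hoelder[OF ex(1) q' Um Wm _ _ E Y UE WY]) (use K in \<open>auto simp: U_def W_def\<close>)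
  finally have "bmass TYPE('n) b / s * rho z powr (- \<kappa>g) * ?N <= E * Y" using E Y by simp
  hence "(s / bmass TYPE('n) b * rho z powr \<kappa>g) * (bmass TYPE('n) b / s * rho z powr (- \<kappa>g) * ?N) <= (s / bmass TYPE('n) b * rho z powr \<kappa>g) * (E * Y)"
   by (rule mult_left_mono) (use A ex(8) in simp)
  also have "(s / bmass TYPE('n) b * rho z powr \<kappa>g) * (bmass TYPE('n) b / s * rho z powr (- \<kappa>g) * ?N) = (rho z powr \<kappa>g * rho z powr (- \<kappa>g)) * ?N"
   using A ex(8) by simp
  also have "rho z powr \<kappa>g * rho z powr (- \<kappa>g) = 1" unfolding powr_add[symmetric] using rho_pos[OF z] by simp
  also have "(s / bmass TYPE('n) b * rho z powr \<kappa>g) * (E * Y) = D * E * K * (rho z powr \<kappa>g * rho z powr x)"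
   unfolding D_def Y_def by (simp add: mult_ac)
  also have "rho z powr \<kappa>g * rho z powr x = rho z powr (e - 1 - \<gamma>)"
   unfolding powr_add[symmetric] x_def xe \<gamma> \<kappa>g by (rule arg_cong[where f="\<lambda>x. rho z powr x"]) simp
  finally show "?N <= D * E * K * rho z powr (e - 1 - \<gamma>)" by simp
 qed
qed

lemma hankel_tang_bound:
 obtains C where "C > 0" "!!(z::complex^'n) E. norm z < 1 ==> E > 0 ==>
  wint \<beta> q (H z) <= ennreal (E powr q) ==> tang_bound \<gamma> (C * E) f z"
proof -
 let ?e = "aniso TYPE('n)"
 obtain C1 where C1: "C1 > 0" "!!(z::complex^'n) a E K. norm z < 1 ==> E > 0 ==> K > 0 ==> (!!w. norm w < 1 ==> norm (cdot (w - z) a) <= K * kdist z w powr ?e) ==>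
  wint \<beta> q (H z) <= ennreal (E powr q) ==> norm (dir a f z - cdot a z * dir z f z) <= C1 * E * K * rho z powr (?e - 1 - \<gamma>)"
  by (rule hankel_lower_bound[OF aniso_bounds(2)]) blast
 obtain C2 where C2: "C2 > 0" "!!(z::complex^'n) a E K. norm z < 1 ==> E > 0 ==> K > 0 ==> (!!w. norm w < 1 ==> norm (cdot (w - z) a) <= K * kdist z w powr 1) ==>
  wint \<beta> q (H z) <= ennreal (E powr q) ==> norm (dir a f z - cdot a z * dir z f z) <= C2 * E * K * rho z powr (1 - 1 - \<gamma>)"
  by (rule hankel_lower_bound[OF order_refl]) blast
 define C where "C = 2 * C1 + 3 * C2"
 have C: "C > 0" "2 * C1 <= C" "3 * C2 <= C" using C1(1) C2(1) by (auto simp: C_def)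
 show thesis
 proof (rule that[OF C(1)])
  fix z :: "complex^'n" and E :: real
  assume z: "norm z < 1" and E: "E > 0" and w: "wint \<beta> q (H z) <= ennreal (E powr q)"
  have 1: "norm (dir a f z - cdot a z * dir z f z) <= C * E * norm a * rho z powr (?e - 1 - \<gamma>)" for a
  proof (cases "a = 0")
   case True
   thus ?thesis using dir_0[OF symbol(1), of z] z by simp
  next
   case False
   have "norm (cdot (x - z) a) <= 2 * norm a * kdist z x powr ?e" if "norm x < 1" for x
    using order_trans[OF norm_cdot_le mult_right_mono[OF norm_diff_le_kdist[OF z that, unfolded norm_minus_commute[of z]] norm_ge_zero[of a]]] by (simp add: mult_ac)
   hence "norm (dir a f z - cdot a z * dir z f z) <= C1 * E * (2 * norm a) * rho z powr (?e - 1 - \<gamma>)"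
    by (intro C1(2) z E w) (use False in auto)
   also have "... = (2 * C1) * (E * norm a * rho z powr (?e - 1 - \<gamma>))" by simp
   also have "... <= C * (E * norm a * rho z powr (?e - 1 - \<gamma>))" using E by (intro mult_right_mono C) auto
   finally show ?thesis by (simp add: mult.assoc)
  qed
  have "norm (cdot (x - z) z) <= 3 * kdist z x powr 1" if x: "norm x < 1" for x
  proof -
   \<comment> \<open>A difference of \<open>rho z\<close> and \<open>1 - cdot x z\<close>, both at
     most a multiple of \<open>kdist\<close>: in the radial direction the full power 1 is
     available.\<close>
   have eq: "cdot (x - z) z = of_real (rho z) - (1 - cdot x z)" by (simp add: cdot_self rho_def)
   have "norm (cdot (x - z) z) <= rho z + kdist x z"
    unfolding eq using norm_triangle_ineq4[of "of_real (rho z)" "1 - cdot x z"] rho_pos[OF z] by (simp add: kdist_def)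
   thus ?thesis using kdist_ge_rho(2)[OF z less_imp_le[OF x]] kdist_pos[OF z less_imp_le[OF x]] by (simp add: kdist_commute[of x])
  qed
  hence "norm (dir z f z - cdot z z * dir z f z) <= C2 * E * 3 * rho z powr (1 - 1 - \<gamma>)"
   by (intro C2(2) z E w) auto
  \<comment> \<open>For \<open>a = z\<close> the direction a - <a,z> z is \<open>rho z\<close> times
    \<open>z\<close>; dividing by \<open>rho z\<close> turns the exponent - \<gamma> into - 1 -
    \<gamma>.\<close>
  moreover have "dir z f z - cdot z z * dir z f z = of_real (rho z) * dir z f z" by (simp add: cdot_self rho_def algebra_simps)
  ultimately have "rho z * norm (dir z f z) <= 3 * C2 * (E * rho z powr (- \<gamma>))" using rho_pos[OF z] by (simp add: norm_mult)
  also have "... <= C * (E * rho z powr (- \<gamma>))" using E by (intro mult_right_mono C) auto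
  finally have "rho z powr (-1) * (rho z * norm (dir z f z)) <= rho z powr (-1) * (C * (E * rho z powr (- \<gamma>)))" by (rule mult_left_mono) simp
  also have "... = C * E * (rho z powr (-1) * rho z powr (- \<gamma>))" by (simp only: mult_ac)
  also have "rho z powr (-1) * rho z powr (- \<gamma>) = rho z powr (- 1 - \<gamma>)" unfolding powr_add[symmetric] by simp
  also have "rho z powr (-1) * (rho z * norm (dir z f z)) = norm (dir z f z)" using rho_pos[OF z] by (simp add: powr_minus_divide)
  finally show "tang_bound \<gamma> (C * E) f z" unfolding tang_bound_def using 1 by blast
 qed
qed

text \<open>Transfers sequential compactness of the abstract extension to concrete Hankel functions:
  the test functions are bounded holomorphic, so the extension is given on them by the formula
  almost everywhere, and their norms are uniformly bounded.\<close>

lemma hankel_test_subseq: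
 assumes T: "hankel_conj_compact \<beta> f p \<alpha> q" and Z: "!!k :: nat. norm (Z k :: complex^'n) < 1"
 obtains r h where "strict_mono r" "bmeas h" "wint \<beta> q h < \<infinity>"
  "!!e. e > 0 ==> \<forall>\<^sub>F k in sequentially. wint \<beta> q (\<lambda>x. hankel_conj \<beta> f (test_fun s \<kappa>g (Z (r k))) x - h x) <= ennreal e"
proof -
 define G where "G k = test_fun s \<kappa>g (Z k)" for k
 obtain T where T: "compact_operator (bergman_space p \<alpha>) (ball_weighted \<alpha>) p (ball_weighted \<beta>) q T"
  and TH: "!!g. g \<in> H_infinity ==> AE z in ball_weighted \<beta>. T g z = hankel_conj \<beta> f g z"
  using T unfolding hankel_conj_compact_def by blast
 have p0: "p > 0" and q0: "q > 0" using p by auto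
 have A: "bmass TYPE('n) \<alpha> > 0" "bmass TYPE('n) \<beta> > 0" using bmass_pos \<alpha> \<beta> by auto
 obtain C where C: "C > 0" "!!z::complex^'n. norm z < 1 ==> wint \<alpha> p (test_fun s \<kappa>g z) <= ennreal C"
  unfolding \<kappa>g by (rule test_fun_wint[OF \<alpha> exponents(10) p0]) blast
 have GL: "G k \<in> Lp (ball_weighted \<alpha>) p" for k
  unfolding Lp_ball_weighted_iff[OF \<alpha>] G_def using le_less_trans[OF C(2)[OF Z[of k]]] hankel_test_fun(1)[OF Z] by auto
 have GV: "G k \<in> bergman_space p \<alpha>" for k
  using GL test_fun_holo[OF Z] unfolding bergman_space_def holomorphic_ball_eq G_def by auto
 have "norm (Lp_norm (ball_weighted \<alpha>) p (G k)) <= (C / bmass TYPE('n) \<alpha>) powr (1 / p)" for k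
 proof -
  let ?L = "Lp_norm (ball_weighted \<alpha>) p (G k)"
  have L: "?L >= 0" by (simp add: Lp_norm_def)
  have "ennreal (bmass TYPE('n) \<alpha> * ?L powr p) <= ennreal C"
   using C(2)[OF Z[of k]] Lp_norm_wint[OF \<alpha> p0 GL[of k]] by (simp add: G_def)
  hence "?L powr p <= C / bmass TYPE('n) \<alpha>" using A C(1) by (simp add: ennreal_le_iff pos_le_divide_eq mult.commute)
  hence "(?L powr p) powr (1 / p) <= (C / bmass TYPE('n) \<alpha>) powr (1 / p)" using p0 by (intro powr_mono2) auto
  thus ?thesis using L p0 by (simp add: powr_powr)
 qed
 hence "range G \<subseteq> bergman_space p \<alpha> \<and> bounded (range (\<lambda>k. Lp_norm (ball_weighted \<alpha>) p (G k)))" using GV unfolding bounded_iff by blast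
 then obtain h r where h: "h \<in> Lp (ball_weighted \<beta>) q" and r: "strict_mono r"
  and lim: "(\<lambda>k. Lp_norm (ball_weighted \<beta>) q (\<lambda>x. T (G (r k)) x - h x)) \<longlonglongrightarrow> 0"
  using T unfolding compact_operator_def by blast
 have TL: "T (G k) \<in> Lp (ball_weighted \<beta>) q" for k using T GV unfolding compact_operator_def by blast
 note L = Lp_ball_weighted_iff[OF \<beta>]
 have dL: "(\<lambda>x. T (G k) x - h x) \<in> Lp (ball_weighted \<beta>) q" for k
 proof -
  have "wint \<beta> q (\<lambda>x. T (G k) x - h x) <= ennreal (2 powr q) * (wint \<beta> q (T (G k)) + wint \<beta> q h)"
   by (rule wint_diff_le[OF q0]) (use TL h in \<open>auto simp: L norm_triangle_ineq4\<close>)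
  also have "... < \<infinity>" using TL[of k] h by (simp add: L ennreal_mult_less_top)
  finally show ?thesis using TL[of k] h by (simp add: L borel_measurable_diff)
 qed
 show thesis
 proof (rule that[OF r])
  show "bmeas h" "wint \<beta> q h < \<infinity>" using h by (auto simp: L)
  fix e :: real assume e: "e > 0"
  have "(\<lambda>k. bmass TYPE('n) \<beta> * Lp_norm (ball_weighted \<beta>) q (\<lambda>x. T (G (r k)) x - h x) powr q) \<longlonglongrightarrow> bmass TYPE('n) \<beta> * 0 powr q"
   using q0 by (intro tendsto_mult tendsto_const tendsto_powr' lim) (auto simp: Lp_norm_def)
  hence "\<forall>\<^sub>F k in sequentially. bmass TYPE('n) \<beta> * Lp_norm (ball_weighted \<beta>) q (\<lambda>x. T (G (r k)) x - h x) powr q < e"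
   using e by (intro order_tendstoD(2)) auto
  thus "\<forall>\<^sub>F k in sequentially. wint \<beta> q (\<lambda>x. hankel_conj \<beta> f (test_fun s \<kappa>g (Z (r k))) x - h x) <= ennreal e"
  proof eventually_elim
   case (elim k)
   have "G (r k) \<in> H_infinity" unfolding G_def by (rule test_fun_H_infinity[OF Z]) (use exponents in simp)
   hence "AE x in lball. T (G (r k)) x = hankel_conj \<beta> f (G (r k)) x" using TH AE_ball_weighted[OF \<beta>] by blast
   hence "wint \<beta> q (\<lambda>x. hankel_conj \<beta> f (G (r k)) x - h x) = wint \<beta> q (\<lambda>x. T (G (r k)) x - h x)"
    unfolding wint_def by (intro nn_integral_cong_AE) auto
   also have "... <= ennreal e" unfolding Lp_norm_wint[OF \<beta> q0 dL] using elim by (intro ennreal_leI) simp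
   finally show ?case unfolding G_def .
  qed
 qed
qed

text \<open>Boundedness is extracted from sequential compactness: if no bound held, some sequence of
  images with norms above every \<open>Suc k\<close> would have a subsequence close to a fixed
  \<open>h\<close> of finite norm.\<close>

lemma hankel_test_bounded:
 assumes T: "hankel_conj_compact \<beta> f p \<alpha> q"
 obtains M where "M > 0" "!!z::complex^'n. norm z < 1 ==> wint \<beta> q (H z) <= ennreal (M powr q)"
proof (rule ccontr)
 let ?u = "\<lambda>z. H z"
 have q0: "q > 0" using p by simp
 assume "\<not> thesis"
 hence "\<exists>z::complex^'n. norm z < 1 \<and> \<not> wint \<beta> q (?u z) <= ennreal (real (Suc k) powr q)" for k
  using that[of "real (Suc k)"] by (metis of_nat_0_less_iff zero_less_Suc)
 then obtain Z :: "nat => complex^'n" where Z: "!!k. norm (Z k) < 1" "!!k. \<not> wint \<beta> q (?u (Z k)) <= ennreal (real (Suc k) powr q)" by metis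
 obtain r h where r: "strict_mono r" and h: "bmeas h" "wint \<beta> q h < \<infinity>"
  and lim: "!!e. e > 0 ==> \<forall>\<^sub>F k in sequentially. wint \<beta> q (\<lambda>x. ?u (Z (r k)) x - h x) <= ennreal e"
  by (rule hankel_test_subseq[where Z=Z, OF T Z(1)]) blast
 obtain H where H: "H >= 0" "wint \<beta> q h = ennreal H" using h(2) by (cases "wint \<beta> q h") auto
 \<comment> \<open>An index beyond which the bound for the convergent subsequence contradicts the
   choice of \<open>Z\<close>, as \<open>r k >= k\<close>.\<close>
 define N where "N = nat \<lceil>(2 powr q * (1 + H)) powr (1 / q)\<rceil>"
 obtain k where k: "k >= N" "wint \<beta> q (\<lambda>x. ?u (Z (r k)) x - h x) <= ennreal 1"
  using eventually_happens'[OF sequentially_bot eventually_conj[OF eventually_ge_at_top[of N] lim[of 1]]] by auto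
 have um: "bmeas (\<lambda>x. ?u (Z (r k)) x - h x)" using hankel_test_fun(5)[OF Z(1)[of "r k"]] h(1) by measurable
 have "wint \<beta> q (?u (Z (r k))) <= ennreal (2 powr q) * (wint \<beta> q (\<lambda>x. ?u (Z (r k)) x - h x) + wint \<beta> q h)"
  by (rule wint_diff_le[OF q0 um h(1)]) (metis diff_add_cancel norm_triangle_ineq)
 also have "... <= ennreal (2 powr q) * (ennreal 1 + ennreal H)" using k H by (intro mult_left_mono add_mono) auto
 also have "... = ennreal (2 powr q * (1 + H))" using H by (simp add: ennreal_mult ennreal_plus)
 also have "... <= ennreal (real (Suc (r k)) powr q)"
 proof (rule ennreal_leI)
  have "(2 powr q * (1 + H)) powr (1 / q) <= real N" unfolding N_def by linarith
  also have "... <= real (Suc (r k))" using k(1) seq_suble[OF r, of k] by linarith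
  finally have "((2 powr q * (1 + H)) powr (1 / q)) powr q <= real (Suc (r k)) powr q" using q0 by (intro powr_mono2) auto
  thus "2 powr q * (1 + H) <= real (Suc (r k)) powr q" using q0 H by (simp add: powr_powr)
 qed
 finally show False using Z(2) by blast
qed

text \<open>Compactness provides an L^q limit \<open>h\<close> along points approaching the sphere.
  Pointwise decay, with constants that may depend on the point, and Fatou's lemma make
  \<open>h\<close> as small as desired, so the norms themselves become small.\<close>

lemma hankel_test_vanishes:
 assumes T: "hankel_conj_compact \<beta> f p \<alpha> q" and \<epsilon>: "\<epsilon> > 0"
  and pt: "!!x::complex^'n. norm x < 1 ==> \<exists>C \<delta>. \<delta> > 0 \<and> (\<forall>z. norm z < 1 --> norm (H z x) <= C * rho z powr \<delta>)"
 obtains d where "d > 0" "!!z::complex^'n. norm z < 1 ==> rho z < d ==> wint \<beta> q (H z) <= ennreal (\<epsilon> powr q)"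
proof (rule ccontr)
 let ?u = "\<lambda>z. H z"
 have q0: "q > 0" using p by simp
 assume "\<not> thesis"
 hence "\<exists>z::complex^'n. norm z < 1 \<and> rho z < inverse (real (Suc k)) \<and> \<not> wint \<beta> q (?u z) <= ennreal (\<epsilon> powr q)" for k
  using that[of "inverse (real (Suc k))"] by (metis inverse_positive_iff_positive of_nat_0_less_iff zero_less_Suc)
 then obtain Z :: "nat => complex^'n" where Z: "!!k. norm (Z k) < 1" "!!k. rho (Z k) < inverse (real (Suc k))" "!!k. \<not> wint \<beta> q (?u (Z k)) <= ennreal (\<epsilon> powr q)" by metis
 obtain r h where r: "strict_mono r" and h: "bmeas h" "wint \<beta> q h < \<infinity>"
  and lim: "!!e. e > 0 ==> \<forall>\<^sub>F k in sequentially. wint \<beta> q (\<lambda>x. ?u (Z (r k)) x - h x) <= ennreal e"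
  by (rule hankel_test_subseq[where Z=Z, OF T Z(1)]) blast
 have um: "bmeas (\<lambda>x. ?u (Z k) x - h x)" for k using hankel_test_fun(5)[OF Z(1)[of k]] h(1) by measurable
 have "(\<lambda>k. rho (Z k)) \<longlonglongrightarrow> 0"
  by (rule real_tendsto_sandwich[OF _ _ tendsto_const LIMSEQ_inverse_real_of_nat]) (use Z rho_pos in \<open>auto intro!: always_eventually less_imp_le\<close>)
 hence rl: "(\<lambda>k. rho (Z (r k))) \<longlonglongrightarrow> 0" using LIMSEQ_subseq_LIMSEQ[OF _ r] by (simp add: o_def)
 have u0: "(\<lambda>k. ?u (Z (r k)) x) \<longlonglongrightarrow> 0" if x: "norm x < 1" for x
 proof -
  obtain C \<delta> where C: "\<delta> > 0" "!!z::complex^'n. norm z < 1 ==> norm (?u z x) <= C * rho z powr \<delta>" using pt[OF x] by blast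
  have "(\<lambda>k. C * rho (Z (r k)) powr \<delta>) \<longlonglongrightarrow> C * 0 powr \<delta>"
   by (intro tendsto_mult tendsto_const tendsto_powr' rl) (use C(1) less_imp_le[OF rho_pos[OF Z(1)]] in auto)
  hence l: "(\<lambda>k. C * rho (Z (r k)) powr \<delta>) \<longlonglongrightarrow> 0" by simp
  show ?thesis by (rule Lim_null_comparison[OF _ l]) (use C(2) Z(1) in \<open>auto intro!: always_eventually\<close>)
 qed
 \<comment> \<open>Equal shares for \<open>h\<close> and for the distance to \<open>h\<close>, after
   division by the factor 2^q of \<open>wint_diff_le\<close>.\<close>
 define e where "e = \<epsilon> powr q / (2 powr q * 2)"
 have e: "e > 0" using \<epsilon> by (simp add: e_def)
 obtain N where N: "!!k. k >= N ==> wint \<beta> q (\<lambda>x. ?u (Z (r k)) x - h x) <= ennreal e" using lim[OF e] unfolding eventually_sequentially by blast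
 have "wint \<beta> q h <= ennreal e" unfolding wint_def
 proof (rule nn_integral_limit_le[where f="\<lambda>k x. ennreal (rho x powr \<beta> * norm (?u (Z (r (k + N))) x - h x) powr q)"])
  show "bmeas (\<lambda>x. ennreal (rho x powr \<beta> * norm (?u (Z (r (k + N))) x - h x) powr q))" for k
   by (rule measurable_compose[OF measurable_wint[OF um] measurable_ennreal])
  show "(\<lambda>k. ennreal (rho x powr \<beta> * norm (?u (Z (r (k + N))) x - h x) powr q)) \<longlonglongrightarrow> ennreal (rho x powr \<beta> * norm (h x) powr q)"
   if "x \<in> space lball" for x
  proof -
   have "(\<lambda>k. ?u (Z (r (k + N))) x - h x) \<longlonglongrightarrow> 0 - h x" using that by (intro tendsto_diff tendsto_const LIMSEQ_ignore_initial_segment u0) simp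
   from tendsto_norm[OF this] have "(\<lambda>k. norm (?u (Z (r (k + N))) x - h x)) \<longlonglongrightarrow> norm (h x)" by simp
   thus ?thesis using q0 by (intro tendsto_ennrealI tendsto_mult tendsto_const tendsto_powr') auto
  qed
  show "bint (\<lambda>x. rho x powr \<beta> * norm (?u (Z (r (k + N))) x - h x) powr q) <= ennreal e" for k
   using N[of "k + N"] by (simp add: wint_def)
 qed
 moreover have "wint \<beta> q (?u (Z (r N))) <= ennreal (2 powr q) * (wint \<beta> q (\<lambda>x. ?u (Z (r N)) x - h x) + wint \<beta> q h)"
  by (rule wint_diff_le[OF q0 um h(1)]) (metis diff_add_cancel norm_triangle_ineq)
 ultimately have "wint \<beta> q (?u (Z (r N))) <= ennreal (2 powr q) * (ennreal e + ennreal e)"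
  using N[of N] by (auto elim!: order_trans intro!: mult_left_mono add_mono)
 also have "... = ennreal (\<epsilon> powr q)" using e by (simp add: e_def flip: ennreal_mult ennreal_plus)
 finally show False using Z(3) by blast
qed

text \<open>Subtracting the constant \<open>f z\<close> from the symbol changes nothing, as the test
  function is reproduced. The term at \<open>x\<close> then has order s - \<kappa>g - \<kappa>f in
  \<open>rho z\<close>. The projected term is controlled by the L^1 norm of the difference times the
  test function, for which the Lipschitz and Forelli-Rudin estimates give the order n + 1 + \<beta>
  - \<kappa>g - \<gamma>'; the last condition on \<open>\<gamma>'\<close> makes it positive.\<close>

lemma hankel_test_pointwise:
 fixes x :: "complex^'n"
 assumes fb: "bloch_bound \<gamma>' N f" and \<gamma>': "- aniso TYPE('n) < \<gamma>'" "\<gamma>' < \<beta> + 1" "\<gamma>' - \<gamma> < (real CARD('n) + 1 + \<beta>) * (1 - 1 / q)"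
  and x: "norm x < 1"
 shows "\<exists>C \<delta>. \<delta> > 0 \<and> (\<forall>z. norm z < 1 --> norm (H z x) <= C * rho z powr \<delta>)"
proof -
 let ?S = "real CARD('n) + 1 + \<beta>"
 note ex = exponents
 have N: "N >= 0" using fb by (simp add: bloch_bound_def)
 have A: "bmass TYPE('n) \<beta> > 0" by (rule bmass_pos[OF \<beta>])
 have "max 0 (- \<gamma>') < min (aniso TYPE('n)) (\<beta> + 1 - \<gamma>')" using \<gamma>' \<beta> aniso_bounds[where 'n='n] by auto
 then obtain \<theta> where "max 0 (- \<gamma>') < \<theta>" "\<theta> < min (aniso TYPE('n)) (\<beta> + 1 - \<gamma>')" using dense by blast
 hence \<theta>: "0 < \<theta>" "- \<gamma>' < \<theta>" "\<theta> < aniso TYPE('n)" "\<theta> < \<beta> + 1 - \<gamma>'" by auto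
 define k where "k = \<gamma>' + \<theta>"
 have k: "k > 0" "\<beta> - k > -1" using \<theta> by (auto simp: k_def)
 define L where "L = lip_const TYPE('n) \<gamma>' \<theta>"
 note lip = bloch_lipschitz[OF \<theta>(1-3) \<gamma>'(1), folded L_def k_def]
 note L = lip(1) and lip = lip(2)[OF symbol(1) fb]
 have ee: "s - \<theta> > ?S" "s - \<theta> > real CARD('n) + 1 + (\<beta> - k)" using ex(7) \<theta>(3) k(1) aniso_bounds(2)[where 'n='n] by (auto simp: s)
 define F1 F2 where F: "F1 = fr_const TYPE('n) \<beta> (s - \<theta>)" "F2 = fr_const TYPE('n) (\<beta> - k) (s - \<theta>)"
 note F1 = forelli_rudin[OF \<beta> ee(1), folded F] and F2 = forelli_rudin[OF k(2) ee(2), folded F]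
 define \<delta>1 where "\<delta>1 = s - \<kappa>g - \<kappa>f"
 define \<delta>2 where "\<delta>2 = ?S - \<kappa>g - \<gamma>'"
 have "?S * (1 - 1 / q) + \<gamma> = ?S - \<kappa>g" unfolding \<gamma> \<kappa>g right_diff_distrib by simp
 hence \<delta>: "\<delta>1 > 0" "\<delta>2 > 0" using ex(9) \<gamma>'(3) unfolding \<delta>1_def \<delta>2_def by linarith+
 obtain Cf where Cf: "Cf >= 0" "!!z. norm z < 1 ==> norm (f z) <= Cf * rho z powr (- \<kappa>f)" by (rule growthE[OF symbol(4)]) blast
 define D1 where "D1 = (norm (f x) + Cf) * (1 - norm x) powr (- s)"
 define D2 where "D2 = (1 - norm x) powr (- ?S) * (L * N * (F1 + F2)) / bmass TYPE('n) \<beta>"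
 have D: "D1 >= 0" "D2 >= 0" using Cf(1) L N F1(1) F2(1) A by (auto simp: D1_def D2_def intro!: mult_nonneg_nonneg divide_nonneg_nonneg)
 have main: "norm (H z x) <= (D1 + D2) * rho z powr (min \<delta>1 \<delta>2)" if z: "norm z < 1" for z
 proof -
  let ?G = "test_fun s \<kappa>g z"
  have rz: "0 < rho z" "rho z <= 1" using rho_pos[OF z] rho_le_1 by auto
  define y where "y w = cnj (f w) * ?G w - cnj (f z) * ?G w" for w
  note ht = hankel_test_fun[OF z]
  have G0: "growth 0 ?G" by (rule bounded_growth[OF test_fun_holo[OF z] test_fun_le(1)[OF z _ less_imp_le[OF ex(8)]]]) auto
  have Gw: "wint \<beta> 1 ?G < \<infinity>" by (rule growth_wint_1[OF G0]) (use \<beta> in simp)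
  have ym: "bmeas y" unfolding y_def[abs_def] using ht(1,2) by measurable
  let ?c = "L * N * rho z powr (s - \<kappa>g)"
  have "wint \<beta> 1 y <= bint (\<lambda>w. (?c * rho z powr (- k)) * (rho w powr \<beta> * kdist z w powr (- (s - \<theta>))) + ?c * (rho w powr (\<beta> - k) * kdist z w powr (- (s - \<theta>))))"
   unfolding wint_def
  proof (rule bint_mono)
   fix w :: "complex^'n" assume w: "norm w < 1"
   have "norm (y w) = norm (cnj (f w - f z)) * norm (?G w)" unfolding y_def norm_mult[symmetric] by (simp add: algebra_simps)
   also have "... = norm (f z - f w) * (rho z powr (s - \<kappa>g) * kdist z w powr (- s))"
    unfolding complex_mod_cnj by (simp add: test_fun_def norm_mult norm_ker kdist_commute[of w] norm_minus_commute)
   also have "... <= (L * N * kdist z w powr \<theta> * (rho z powr (- k) + rho w powr (- k))) * (rho z powr (s - \<kappa>g) * kdist z w powr (- s))"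
    by (intro mult_right_mono lip z w) simp
   also have "... = L * N * rho z powr (s - \<kappa>g) * (rho z powr (- k) + rho w powr (- k)) * (kdist z w powr \<theta> * kdist z w powr (- s))" by (simp only: mult_ac)
   also have "kdist z w powr \<theta> * kdist z w powr (- s) = kdist z w powr (- (s - \<theta>))" unfolding powr_add[symmetric] by simp
   finally have "rho w powr \<beta> * norm (y w) <= rho w powr \<beta> * (L * N * rho z powr (s - \<kappa>g) * (rho z powr (- k) + rho w powr (- k)) * kdist z w powr (- (s - \<theta>)))"
    by (rule mult_left_mono) simp
   also have "... = L * N * rho z powr (s - \<kappa>g) * rho z powr (- k) * (rho w powr \<beta> * kdist z w powr (- (s - \<theta>)))
    + L * N * rho z powr (s - \<kappa>g) * ((rho w powr \<beta> * rho w powr (- k)) * kdist z w powr (- (s - \<theta>)))" by (simp add: algebra_simps)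
   also have "rho w powr \<beta> * rho w powr (- k) = rho w powr (\<beta> - k)" unfolding powr_add[symmetric] by simp
   finally show "rho w powr \<beta> * norm (y w) powr 1 <= (?c * rho z powr (- k)) * (rho w powr \<beta> * kdist z w powr (- (s - \<theta>))) + ?c * (rho w powr (\<beta> - k) * kdist z w powr (- (s - \<theta>)))" by simp
  qed
  also have "... = ennreal (?c * rho z powr (- k)) * bint (\<lambda>w. rho w powr \<beta> * kdist z w powr (- (s - \<theta>)))
   + ennreal ?c * bint (\<lambda>w. rho w powr (\<beta> - k) * kdist z w powr (- (s - \<theta>)))"
   by (rule bint_lincomb) (use L N measurable_rho_kdist[OF z] in auto)
  also have "... <= ennreal (?c * rho z powr (- k)) * ennreal (F1 * rho z powr (?S - (s - \<theta>)))
   + ennreal ?c * ennreal (F2 * rho z powr (real CARD('n) + 1 + (\<beta> - k) - (s - \<theta>)))"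
   by (intro add_mono mult_left_mono F1 F2 z) auto
  also have "... = ennreal (L * N * (F1 * (rho z powr (s - \<kappa>g) * rho z powr (- k) * rho z powr (?S - (s - \<theta>)))
   + F2 * (rho z powr (s - \<kappa>g) * rho z powr (real CARD('n) + 1 + (\<beta> - k) - (s - \<theta>)))))"
   using L N F1(1) F2(1) by (simp add: algebra_simps flip: ennreal_mult ennreal_plus)
  also have "rho z powr (s - \<kappa>g) * rho z powr (- k) * rho z powr (?S - (s - \<theta>)) = rho z powr \<delta>2"
   unfolding powr_add[symmetric] by (rule arg_cong[where f="\<lambda>x. rho z powr x"]) (simp add: \<delta>2_def k_def)
  also have "rho z powr (s - \<kappa>g) * rho z powr (real CARD('n) + 1 + (\<beta> - k) - (s - \<theta>)) = rho z powr \<delta>2"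
   unfolding powr_add[symmetric] by (rule arg_cong[where f="\<lambda>x. rho z powr x"]) (simp add: \<delta>2_def k_def)
  finally have yw: "wint \<beta> 1 y <= ennreal (L * N * (F1 + F2) * rho z powr \<delta>2)" by (simp add: algebra_simps)
  have P: "norm (bergman_proj \<beta> y x) <= D2 * rho z powr \<delta>2"
   using bergman_proj_le[OF \<beta> ym yw _ x] L N F1(1) F2(1) unfolding D2_def by (simp add: mult_ac)
  have "bergman_proj \<beta> y x = bergman_proj \<beta> (\<lambda>w. 1 * (cnj (f w) * ?G w) + (- cnj (f z)) * ?G w) x"
   by (rule bergman_proj_cong[OF \<beta>]) (simp add: y_def)
  also have "... = bergman_proj \<beta> (\<lambda>w. cnj (f w) * ?G w) x - cnj (f z) * ?G x"
   unfolding bergman_proj_lin[OF \<beta> ht(2,3,1) Gw x] bergman_proj_reproducing[OF G0 \<beta> _ order_refl x, unfolded diff_0_right, OF \<beta>] by simp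
  finally have "hankel_conj \<beta> f ?G x = (cnj (f x) - cnj (f z)) * ?G x - bergman_proj \<beta> y x" unfolding hankel_conj_def by (simp add: algebra_simps)
  hence "norm (hankel_conj \<beta> f ?G x) <= norm (cnj (f x) - cnj (f z)) * norm (?G x) + norm (bergman_proj \<beta> y x)"
   using norm_triangle_ineq4 by (simp add: norm_mult[symmetric])
  also have "... <= ((norm (f x) + Cf) * rho z powr (- \<kappa>f)) * (rho z powr (s - \<kappa>g) * (1 - norm x) powr (- s)) + D2 * rho z powr \<delta>2"
  proof (intro add_mono P mult_mono test_fun_le(2) z less_imp_le[OF x] x)
   have "1 <= rho z powr (- \<kappa>f)" using powr_mono'[of "- \<kappa>f" 0 "rho z"] rz ex(2) by simp
   hence "norm (f x) <= norm (f x) * rho z powr (- \<kappa>f)" by (simp add: mult_le_cancel_left1)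
   thus "norm (cnj (f x) - cnj (f z)) <= (norm (f x) + Cf) * rho z powr (- \<kappa>f)"
    using norm_triangle_ineq4[of "cnj (f x)" "cnj (f z)"] Cf(2)[OF z] by (simp add: distrib_right)
  qed (use ex(8) Cf(1) in auto)
  also have "... = D1 * (rho z powr (- \<kappa>f) * rho z powr (s - \<kappa>g)) + D2 * rho z powr \<delta>2" unfolding D1_def by (simp only: mult_ac)
  also have "rho z powr (- \<kappa>f) * rho z powr (s - \<kappa>g) = rho z powr \<delta>1" unfolding powr_add[symmetric] \<delta>1_def by simp
  also have "D1 * rho z powr \<delta>1 + D2 * rho z powr \<delta>2 <= D1 * rho z powr (min \<delta>1 \<delta>2) + D2 * rho z powr (min \<delta>1 \<delta>2)"
   using D rz by (intro add_mono mult_left_mono powr_mono') auto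
  finally show ?thesis by (simp add: distrib_right)
 qed
 show ?thesis by (rule exI[of _ "D1 + D2"], rule exI[of _ "min \<delta>1 \<delta>2"]) (use \<delta> main in auto)
qed

end


section \<open>Consequences of compactness for the symbol\<close>

lemma tang_bound_imp_bloch:
 fixes z :: "complex^'n"
 assumes t: "tang_bound \<gamma> E f z" and E: "E >= 0" and z: "norm z < 1"
 shows "norm (dir v f z) <= 2 * E * norm v * rho z powr (- (1 + \<gamma>))"
proof -
 have r: "rho z powr (- 1 - \<gamma>) = rho z powr (- (1 + \<gamma>))" by simp
 have "norm (cdot v z) <= norm v" using norm_cdot_le[of v z] mult_left_mono[of "norm z" 1 "norm v"] z by simp
 hence "norm (cdot v z * dir z f z) <= norm v * (E * rho z powr (- (1 + \<gamma>)))"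
  using t unfolding norm_mult tang_bound_def r by (intro mult_mono) auto
 moreover have "norm (dir v f z - cdot v z * dir z f z) <= E * norm v * rho z powr (- (1 + \<gamma>))"
 proof -
  have "rho z powr (aniso TYPE('n) - 1 - \<gamma>) <= rho z powr (- (1 + \<gamma>))"
   using rho_pos[OF z] rho_le_1[of z] aniso_bounds(3)[where 'n='n] by (intro powr_mono') auto
  hence "E * norm v * rho z powr (aniso TYPE('n) - 1 - \<gamma>) <= E * norm v * rho z powr (- (1 + \<gamma>))" using E by (intro mult_left_mono) auto
  thus ?thesis using t unfolding tang_bound_def by (meson order_trans)
 qed
 ultimately show ?thesis using norm_triangle_ineq[of "dir v f z - cdot v z * dir z f z" "cdot v z * dir z f z"] by (simp add: mult_ac)
qed

lemma compact_necessary: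
 fixes f :: "'n::finite cfun" and p q \<alpha> \<beta> \<gamma> :: real
 assumes f: "f \<in> bergman_space 1 \<beta>" and p: "1 < p" "p <= q" and \<alpha>: "\<alpha> > -1" and \<beta>: "\<beta> > -1"
  and \<gamma>: "\<gamma> = (real CARD('n) + 1 + \<beta>) / q - (real CARD('n) + 1 + \<alpha>) / p"
  and T: "hankel_conj_compact \<beta> f p \<alpha> q"
 shows "\<exists>C>0. \<forall>z. norm z < 1 --> tang_bound \<gamma> C f z"
  and "- aniso TYPE('n) <= \<gamma> ==> \<epsilon> > 0 ==> \<exists>d>0. \<forall>z. norm z < 1 --> rho z < d --> tang_bound \<gamma> \<epsilon> f z"
proof -
 let ?n = "real CARD('n)" and ?e = "aniso TYPE('n)"
 define \<kappa>f where "\<kappa>f = real CARD('n) + 1 + \<bar>\<beta>\<bar>"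
 define \<kappa>g where "\<kappa>g = (?n + 1 + \<alpha>) / p"
 define b where "b = ?n + 1 + \<bar>\<beta>\<bar> + \<kappa>f + \<kappa>g"
 define s where "s = ?n + 1 + b"
 note A = f p \<alpha> \<beta> \<gamma> \<kappa>f_def \<kappa>g_def b_def s_def
 obtain C where C: "C > 0" "!!(z::complex^'n) E. norm z < 1 ==> E > 0 ==>
  wint \<beta> q (hankel_conj \<beta> f (test_fun s \<kappa>g z)) <= ennreal (E powr q) ==> tang_bound \<gamma> (C * E) f z"
  by (rule hankel_tang_bound[OF A]) blast
 obtain M where M: "M > 0" "!!z::complex^'n. norm z < 1 ==> wint \<beta> q (hankel_conj \<beta> f (test_fun s \<kappa>g z)) <= ennreal (M powr q)"
  by (rule hankel_test_bounded[OF A T]) blast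
 have tb: "tang_bound \<gamma> (C * M) f z" if "norm z < 1" for z by (rule C(2)[OF that M(1) M(2)[OF that]])
 thus "\<exists>C>0. \<forall>z. norm z < 1 --> tang_bound \<gamma> C f z" using C(1) M(1) by (intro exI[of _ "C * M"]) auto
 assume \<gamma>e: "- ?e <= \<gamma>" and \<epsilon>: "\<epsilon> > 0"
 have q: "q > 1" using p by simp
 have X: "(?n + 1 + \<beta>) * (1 - 1 / q) > 0" using q \<beta> of_nat_0_le_iff[of "CARD('n)"] by (intro mult_pos_pos) auto
 have "?n / q <= ?n / p" using p by (intro divide_left_mono) auto
 moreover have "?n / p < (?n + 1 + \<alpha>) / p" using p \<alpha> by (intro divide_strict_right_mono) auto
 ultimately have "\<gamma> < (\<beta> + 1) / q" unfolding \<gamma> by (simp add: add_divide_distrib)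
 moreover have "(\<beta> + 1) / q <= \<beta> + 1" using \<beta> q by (simp add: divide_le_eq mult_le_cancel_left1)
 ultimately have "\<gamma> < \<beta> + 1" by linarith
 hence "\<gamma> < min (\<beta> + 1) (\<gamma> + (?n + 1 + \<beta>) * (1 - 1 / q))" using X by simp
 \<comment> \<open>The pointwise estimate asks for a Bloch order strictly above -e, while \<gamma>
   may equal -e. The first claim implies the Bloch bound for every larger order, so \<gamma> can be
   raised slightly.\<close>
 then obtain \<gamma>' where "\<gamma> < \<gamma>'" "\<gamma>' < min (\<beta> + 1) (\<gamma> + (?n + 1 + \<beta>) * (1 - 1 / q))" using dense by blast
 hence \<gamma>': "\<gamma> < \<gamma>'" "- ?e < \<gamma>'" "\<gamma>' < \<beta> + 1" "\<gamma>' - \<gamma> < (?n + 1 + \<beta>) * (1 - 1 / q)" using \<gamma>e by auto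
 have "norm (dir v f z) <= 2 * (C * M) * norm v * rho z powr (- (1 + \<gamma>'))" if z: "norm z < 1" for z v
 proof -
  have "rho z powr (- (1 + \<gamma>)) <= rho z powr (- (1 + \<gamma>'))" using \<gamma>'(1) rho_pos[OF z] rho_le_1[of z] by (intro powr_mono') auto
  hence "2 * (C * M) * norm v * rho z powr (- (1 + \<gamma>)) <= 2 * (C * M) * norm v * rho z powr (- (1 + \<gamma>'))"
   using C(1) M(1) by (intro mult_left_mono) auto
  moreover have "0 <= C * M" using C(1) M(1) by simp
  ultimately show ?thesis using tang_bound_imp_bloch[OF tb[OF z] _ z, of v] by linarith
 qed
 hence fb: "bloch_bound \<gamma>' (2 * (C * M)) f" using C(1) M(1) by (simp add: bloch_bound_def)
 note pt = hankel_test_pointwise[OF A fb \<gamma>'(2-4)]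
 have \<epsilon>C: "\<epsilon> / C > 0" using \<epsilon> C(1) by simp
 obtain d where d: "d > 0" "!!z::complex^'n. norm z < 1 ==> rho z < d ==> wint \<beta> q (hankel_conj \<beta> f (test_fun s \<kappa>g z)) <= ennreal ((\<epsilon> / C) powr q)"
  by (rule hankel_test_vanishes[OF A T \<epsilon>C pt]) blast+
 have "tang_bound \<gamma> \<epsilon> f z" if "norm z < 1" "rho z < d" for z
  using C(2)[OF that(1) \<epsilon>C d(2)[OF that]] C(1) by simp
 thus "\<exists>d>0. \<forall>z. norm z < 1 --> rho z < d --> tang_bound \<gamma> \<epsilon> f z" using d(1) by blast
qed

section \<open>The degenerate case\<close>

text \<open>The maximum principle on a disc whose bounding circle lies in the zone where the modulus
  is at most \<open>\<epsilon>\<close>, for every \<open>\<epsilon>\<close>.\<close>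

lemma holomorphic_boundary_0:
 fixes \<phi> :: "complex => complex"
 assumes h: "\<phi> holomorphic_on ball 0 R" and lim: "!!\<epsilon>. \<epsilon> > 0 ==> \<exists>r<R. \<forall>t. r < norm t \<and> norm t < R --> norm (\<phi> t) <= \<epsilon>"
  and t: "norm t < R"
 shows "\<phi> t = 0"
proof -
 have "norm (\<phi> t) <= 0 + \<epsilon>" if "\<epsilon> > 0" for \<epsilon>
 proof -
  obtain r where r: "r < R" "!!t. r < norm t ==> norm t < R ==> norm (\<phi> t) <= \<epsilon>" using lim[OF \<open>\<epsilon> > 0\<close>] by blast
  have "max r (norm t) < R" using r(1) t by simp
  then obtain m where "max r (norm t) < m" "m < R" using dense by blast
  hence m: "r < m" "norm t < m" "m < R" by auto
  hence m0: "0 < m" using norm_ge_zero[of t] by linarith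
  show ?thesis
  proof (subst add_0, rule maximum_modulus_frontier[of \<phi> "ball 0 m"])
   show "\<phi> holomorphic_on interior (ball 0 m)" using h m by (auto intro: holomorphic_on_subset)
   show "continuous_on (closure (ball 0 m)) \<phi>"
    using m m0 by (intro continuous_on_subset[OF holomorphic_on_imp_continuous_on[OF h]]) auto
   show "norm (\<phi> x) <= \<epsilon>" if "x \<in> frontier (ball 0 m)" for x
    using that m m0 by (intro r(2)) (auto simp: frontier_ball)
  qed (use m in auto)
 qed
 hence "norm (\<phi> t) <= 0" by (rule field_le_epsilon)
 thus ?thesis by simp
qed

lemma slice_boundary_0:
 fixes F :: "'n::finite cfun"
 assumes F: "holo_on (ball 0 1) F" and z: "z ~= 0" "norm z < 1"
  and lim: "!!\<epsilon>. \<epsilon> > 0 ==> \<exists>d>0. \<forall>t. norm (t *s z) < 1 --> rho (t *s z) < d --> norm (F (t *s z)) <= \<epsilon>"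
 shows "F z = 0"
proof -
 have "(\<lambda>t. F (0 + t *s z)) holomorphic_on ball 0 (1 / norm z)" by (rule holo_slice_ball(1)[OF F]) (use z in auto)
 hence h: "(\<lambda>t. F (t *s z)) holomorphic_on ball 0 (1 / norm z)" by simp
 have "F (1 *s z) = 0"
 proof (rule holomorphic_boundary_0[OF h])
  fix \<epsilon> :: real assume "\<epsilon> > 0"
  then obtain d where d: "d > 0" "!!t. norm (t *s z) < 1 ==> rho (t *s z) < d ==> norm (F (t *s z)) <= \<epsilon>" using lim by blast
  \<comment> \<open>Truncated at 0 since \<open>d\<close> may exceed 1; \<open>rho\<close> is below
    \<open>d\<close> beyond the radius \<open>sqrt m\<close>.\<close>
  define m where "m = max 0 (1 - d)"
  have m: "0 <= m" "m < 1" "1 - d <= m" using d by (auto simp: m_def)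
  have "norm (F (t *s z)) <= \<epsilon>" if t: "sqrt m / norm z < norm t" "norm t < 1 / norm z" for t
  proof (rule d(2))
   show "norm (t *s z) < 1" using t z by (simp add: norm_vsmult pos_less_divide_eq)
   have "sqrt m < norm (t *s z)" using t z by (simp add: norm_vsmult pos_divide_less_eq)
   hence "m < (norm (t *s z))^2" using m real_less_lsqrt real_sqrt_less_iff by (metis norm_ge_zero real_sqrt_abs abs_of_nonneg real_sqrt_less_iff)
   thus "rho (t *s z) < d" using m by (simp add: rho_def)
  qed
  moreover have "sqrt m / norm z < 1 / norm z" using m z by (intro divide_strict_right_mono) auto
  ultimately show "\<exists>r<1 / norm z. \<forall>t. r < norm t \<and> norm t < 1 / norm z --> norm (F (t *s z)) <= \<epsilon>" by blast
 qed (use z in simp)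
 thus ?thesis by simp
qed

text \<open>On a complex line through 0 the slice has derivative
  \<open>dir (t *s z) f (t *s z) / t\<close>, which vanishes away from \<open>t = 0\<close>;
  continuity at 0 makes \<open>f\<close> equal to \<open>f 0\<close> on the line.\<close>

lemma radial_derivative_0_imp_constant:
 fixes f :: "'n::finite cfun"
 assumes f: "holo_on (ball 0 1) f" and d: "!!z. z ~= 0 ==> norm z < 1 ==> dir z f z = 0"
 shows "f constant_on ball 0 1"
proof -
 have *: "f z = f 0" if z: "norm z < 1" for z
 proof (cases "z = 0")
  case False
  have in1: "t *s z \<in> ball 0 1" if "t \<in> ball 0 (1 / norm z)" for t using that False by (simp add: norm_vsmult pos_less_divide_eq)
  have D: "((\<lambda>t. f (0 + t *s z)) has_field_derivative dir z f (0 + t *s z)) (at t)" if "t \<in> ball 0 (1 / norm z)" for t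
   by (rule slice_holo_DERIV[OF f]) (use in1[OF that] in simp)
  have "dir z f (0 + t *s z) = 0" if t: "t \<in> ball 0 (1 / norm z) - {0}" for t
  proof -
   have "t * dir z f (t *s z) = dir (t *s z) f (t *s z)" by (rule dir_cmul[OF f, symmetric]) (use in1 t in simp)
   also have "... = 0" using in1[of t] t False by (intro d) auto
   finally show ?thesis using t by simp
  qed
  hence D0: "((\<lambda>t. f (0 + t *s z)) has_field_derivative 0) (at t)" if "t \<in> ball 0 (1 / norm z) - {0}" for t
   using D[of t] that by simp
  have ct: "continuous_on (ball 0 (1 / norm z)) (\<lambda>t. f (0 + t *s z))"
   by (rule DERIV_continuous_on[OF has_field_derivative_at_within[OF D]])
  obtain c where c: "!!t. t \<in> ball 0 (1 / norm z) ==> f (0 + t *s z) = c"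
   by (rule DERIV_zero_connected_constant[OF connected_ball open_ball _ ct, of "{0}"]) (use D0 in auto)
  show ?thesis using c[of 0] c[of 1] z False by simp
 qed simp
 show ?thesis unfolding constant_on_def by (intro exI[of _ "f 0"] ballI *) simp
qed

lemma tangential_derivative_0_imp_radial_0:
 fixes f :: "'n::finite cfun"
 assumes f: "holo_on (ball 0 1) f" and n: "CARD('n) > 1" and z: "z ~= 0" "norm z < 1"
  and d: "!!z a. z ~= 0 ==> norm z < 1 ==> cdot a z = 0 ==> dir a f z = 0"
 shows "dir z f z = 0"
proof -
 obtain j where j: "z $ j ~= 0" using z(1) by (auto simp: vec_eq_iff)
 have "(UNIV :: 'n set) ~= {j}"
 proof
  assume "(UNIV :: 'n set) = {j}"
  hence "CARD('n) = card {j}" by simp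
  thus False using n by simp
 qed
 then obtain k where k: "k ~= j" by blast
 \<comment> \<open>A nonzero vector orthogonal to \<open>z\<close>, built from two coordinates; this
   is where the dimension exceeds one.\<close>
 define y where "y = cnj (z $ k) *s axis j 1 - cnj (z $ j) *s axis k (1::complex)"
 have "cdot (axis l 1) z = cnj (z $ l)" for l unfolding cdot_axis[of z l, symmetric] by simp
 hence yz: "cdot y z = 0" by (simp add: y_def)
 hence zy: "cdot z y = 0" using cnj_cdot[of y z] by simp
 have "y $ k ~= 0" using j k by (simp add: y_def axis_def)
 hence y0: "y ~= 0" by auto
 define c where "c = complex_of_real ((norm y)^2 / (norm z)^2)"
 have c0: "c ~= 0" using y0 z(1) by (simp add: c_def)
 define \<eta> where "\<eta> = (1 - norm z) / (2 * norm y)"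
 have \<eta>: "\<eta> > 0" using z y0 by (simp add: \<eta>_def)
 have zb: "z \<in> ball 0 1" using z by simp
 note hz = holo_dir[OF f open_ball, of z] and hy = holo_dir[OF f open_ball, of y]
 have F: "dir y f (z + l *s y) = c * cnj l * dir z f (z + l *s y)" and lb: "z + l *s y \<in> ball 0 1" if l: "norm l <= \<eta>" for l
 proof -
  have "norm (l *s y) <= (1 - norm z) / 2" using l y0 by (simp add: norm_vsmult \<eta>_def pos_le_divide_eq mult_ac)
  thus b: "z + l *s y \<in> ball 0 1" using norm_triangle_ineq[of z "l *s y"] z(2) by (simp add: field_simps)
  \<comment> \<open>A combination of \<open>y\<close> and \<open>z\<close> orthogonal to
    \<open>z + l *s y\<close>; the conjugate of \<open>l\<close> comes from the second slot of
    \<open>cdot\<close>.\<close>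
  let ?a = "of_real ((norm z)^2) *s y - (cnj l * of_real ((norm y)^2)) *s z"
  have "cdot ?a (z + l *s y) = 0" using yz zy by (simp add: cdot_self algebra_simps)
  moreover have "z + l *s y ~= 0"
  proof
   assume "z + l *s y = 0"
   hence "cdot (z + l *s y) z = 0" by simp
   thus False using yz z(1) by (simp add: cdot_self)
  qed
  ultimately have "dir ?a f (z + l *s y) = 0" using b by (intro d) auto
  hence "of_real ((norm z)^2) * dir y f (z + l *s y) = cnj l * of_real ((norm y)^2) * dir z f (z + l *s y)"
   unfolding dir_diff[OF f b] dir_cmul[OF f b] by simp
  thus "dir y f (z + l *s y) = c * cnj l * dir z f (z + l *s y)" using z(1) by (simp add: c_def field_simps)
 qed
 have Fz: "dir y f z = 0" using F[of 0] \<eta> by simp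
 \<comment> \<open>Along \<open>z + l *s y\<close> the holomorphic function \<open>dir y f\<close> has the form \<open>cnj l * K l\<close>; comparing its
  derivatives in the directions \<open>y\<close> and \<open>\<i> *s y\<close> forces \<open>K 0 = 0\<close>.\<close>
 have der: "dir (u *s y) (dir y f) z = c * cnj u * dir z f z" if u: "norm u = 1" for u
 proof -
  let ?t = "\<lambda>i. complex_of_real (\<eta> / real (Suc i))"
  have l: "norm (?t i * u) <= \<eta>" for i
   unfolding norm_mult norm_of_real u using \<eta> by (simp add: divide_le_eq mult_le_cancel_left1)
  have 1: "(\<lambda>i. (dir y f (z + ?t i *s (u *s y)) - dir y f z) / ?t i) \<longlonglongrightarrow> dir (u *s y) (dir y f) z"
   by (rule dir_LIMSEQ[OF hy zb]) (use \<eta> in simp)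
  have eq: "(dir y f (z + ?t i *s (u *s y)) - dir y f z) / ?t i = c * cnj u * dir z f (z + (?t i * u) *s y)" for i
  proof -
   have "?t i ~= 0" unfolding of_real_eq_0_iff using \<eta> by simp
   moreover have "(c * (t * u') * K - 0) / t = c * u' * K" if "t ~= 0" for t u' K :: complex using that by simp
   ultimately show ?thesis unfolding vector_smult_assoc Fz F[OF l[of i]] complex_cnj_mult complex_cnj_complex_of_real by blast
  qed
  have "(\<lambda>i. \<eta> * inverse (real (Suc i))) \<longlonglongrightarrow> \<eta> * 0" by (intro tendsto_intros LIMSEQ_inverse_real_of_nat)
  hence "?t \<longlonglongrightarrow> of_real 0" by (intro tendsto_of_real) (simp add: divide_inverse)
  hence "(\<lambda>i. z + (?t i * u) *s y) \<longlonglongrightarrow> z + (of_real 0 * u) *s y"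
   by (intro tendsto_add tendsto_const bounded_linear.tendsto[OF bounded_linear_vsmult] tendsto_mult)
  hence "(\<lambda>i. dir z f (z + (?t i * u) *s y)) \<longlonglongrightarrow> dir z f z"
   using isCont_tendsto_compose[OF has_derivative_continuous[OF holo_has_derivative[OF hz zb]]] by simp
  hence "(\<lambda>i. c * cnj u * dir z f (z + (?t i * u) *s y)) \<longlonglongrightarrow> c * cnj u * dir z f z" by (rule tendsto_mult_left)
  from LIMSEQ_unique[OF 1[unfolded eq] this] show ?thesis .
 qed
 have "dir (\<i> *s y) (dir y f) z = \<i> * dir (1 *s y) (dir y f) z" unfolding dir_cmul[OF hy zb] by simp
 hence "- (\<i> * (c * dir z f z)) = \<i> * (c * dir z f z)" using der[of \<i>] der[of 1] by (simp add: mult_ac)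
 hence "2 * (\<i> * (c * dir z f z)) = 0" unfolding mult_2 by (metis add.left_inverse)
 thus ?thesis using c0 by simp
qed

text \<open>For \<gamma> strictly below -e a spare power of \<open>rho\<close> turns the bounded
  estimate into decay; at \<gamma> = -e the decay is the second claim of
  \<open>compact_necessary\<close>. At order -e the exponent of \<open>rho\<close> is 0 in the
  radial bound for n = 1 and in the tangential bound for n > 1, so exactly these derivatives tend to
  0 at the sphere.\<close>

lemma compact_degenerate:
 fixes f :: "'n::finite cfun" and p q \<alpha> \<beta> \<gamma> :: real
 assumes f: "f \<in> bergman_space 1 \<beta>" and p: "1 < p" "p <= q" and \<alpha>: "\<alpha> > -1" and \<beta>: "\<beta> > -1"
  and \<gamma>: "\<gamma> = (real CARD('n) + 1 + \<beta>) / q - (real CARD('n) + 1 + \<alpha>) / p"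
  and T: "hankel_conj_compact \<beta> f p \<alpha> q" and \<gamma>e: "\<gamma> <= - aniso TYPE('n)"
 shows "f constant_on ball 0 1"
proof -
 let ?e = "aniso TYPE('n)"
 have fh: "holo_on (ball 0 1) f" using f by (simp add: bergman_space_def holomorphic_ball_eq)
 note nec = compact_necessary[OF f p \<alpha> \<beta> \<gamma> T]
 have main: "\<exists>d>0. \<forall>z. norm z < 1 --> rho z < d --> tang_bound (- ?e) \<epsilon> f z" if \<epsilon>: "\<epsilon> > 0" for \<epsilon>
 proof (cases "\<gamma> = - ?e")
  case True
  thus ?thesis using nec(2)[OF _ \<epsilon>] by simp
 next
  case False
  define \<delta> where "\<delta> = - ?e - \<gamma>"
  have \<delta>: "\<delta> > 0" using \<gamma>e False by (simp add: \<delta>_def)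
  obtain C where C: "C > 0" "!!z. norm z < 1 ==> tang_bound \<gamma> C f z" using nec(1) by blast
  have "tang_bound (- ?e) \<epsilon> f z" if z: "norm z < 1" and d: "rho z < (\<epsilon> / C) powr (1 / \<delta>)" for z
  proof -
   have "rho z powr \<delta> <= ((\<epsilon> / C) powr (1 / \<delta>)) powr \<delta>" using d rho_pos[OF z] \<delta> by (intro powr_mono2) auto
   also have "... = \<epsilon> / C" unfolding powr_powr using \<delta> \<epsilon> C(1) by simp
   finally have r: "C * rho z powr \<delta> <= \<epsilon>" using C(1) by (simp add: pos_le_divide_eq mult.commute)
   have 1: "C * rho z powr (x - \<gamma>) <= \<epsilon> * rho z powr (x + ?e)" for x
   proof -
    have "rho z powr (x - \<gamma>) = rho z powr \<delta> * rho z powr (x + ?e)" unfolding powr_add[symmetric] \<delta>_def by (rule arg_cong[where f="\<lambda>x. rho z powr x"]) simp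
    thus ?thesis using mult_right_mono[OF r, of "rho z powr (x + ?e)"] by simp
   qed
   have 2: "C * norm a * rho z powr (?e - 1 - \<gamma>) <= \<epsilon> * norm a * rho z powr (?e - 1 + ?e)" for a :: "complex^'n"
    using mult_left_mono[OF 1[of "?e - 1"] norm_ge_zero[of a]] by (simp add: mult_ac)
   show ?thesis unfolding tang_bound_def using C(2)[OF z] 1[of "-1"] 2 unfolding tang_bound_def
    by (auto intro: order_trans simp: diff_minus_eq_add)
  qed
  thus ?thesis using \<epsilon> C(1) by (intro exI[of _ "(\<epsilon> / C) powr (1 / \<delta>)"]) auto
 qed
 show ?thesis
 proof (rule radial_derivative_0_imp_constant[OF fh])
  fix z :: "complex^'n" assume z: "z ~= 0" "norm z < 1"
  show "dir z f z = 0"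
  proof (cases "CARD('n) = 1")
   case True
   hence e: "?e = 1" by (simp add: aniso_def)
   have "(\<lambda>x. dir x f x) z = 0"
   proof (rule slice_boundary_0[OF holo_radial[OF fh open_ball] z])
    fix \<epsilon> :: real assume "\<epsilon> > 0"
    from main[OF this] obtain d where d: "d > 0" "!!z. norm z < 1 ==> rho z < d ==> tang_bound (- ?e) \<epsilon> f z" by blast
    have "norm (dir (t *s z) f (t *s z)) <= \<epsilon>" if "norm (t *s z) < 1" "rho (t *s z) < d" for t
     using d(2)[OF that] rho_pos[OF that(1)] unfolding tang_bound_def e by simp
    thus "\<exists>d>0. \<forall>t. norm (t *s z) < 1 --> rho (t *s z) < d --> norm (dir (t *s z) f (t *s z)) <= \<epsilon>" using d(1) by blast
   qed
   thus ?thesis .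
  next
   case False
   hence e: "?e = 1 / 2" by (simp add: aniso_def)
   have n: "CARD('n) > 1" using False zero_less_card_finite[where 'a='n] by linarith
   have "dir a f w = 0" if w: "w ~= 0" "norm w < 1" and a: "cdot a w = 0" for a w :: "complex^'n"
   proof (rule slice_boundary_0[OF holo_dir[OF fh open_ball] w])
    fix \<epsilon> :: real assume \<epsilon>: "\<epsilon> > 0"
    hence "\<epsilon> / (norm a + 1) > 0" by (simp add: add_nonneg_pos)
    from main[OF this] obtain d where d: "d > 0" "!!z. norm z < 1 ==> rho z < d ==> tang_bound (- ?e) (\<epsilon> / (norm a + 1)) f z" by blast
    have "norm (dir a f (t *s w)) <= \<epsilon>" if "norm (t *s w) < 1" "rho (t *s w) < d" for t
    proof -
     have "norm (dir a f (t *s w) - cdot a (t *s w) * dir (t *s w) f (t *s w)) <= \<epsilon> / (norm a + 1) * norm a * rho (t *s w) powr (?e - 1 - (- ?e))"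
      using d(2)[OF that] unfolding tang_bound_def by blast
     hence "norm (dir a f (t *s w)) <= \<epsilon> * (norm a / (norm a + 1))" using a rho_pos[OF that(1)] unfolding e by simp
     also have "... <= \<epsilon> * 1" using \<epsilon> by (intro mult_left_mono) (auto simp: divide_le_eq add_nonneg_pos)
     finally show ?thesis by simp
    qed
    thus "\<exists>d>0. \<forall>t. norm (t *s w) < 1 --> rho (t *s w) < d --> norm (dir a f (t *s w)) <= \<epsilon>" using d(1) by blast
   qed
   thus ?thesis by (rule tangential_derivative_0_imp_radial_0[OF fh n z])
  qed
 qed
qed

lemma constant_imp_compact:
 fixes f :: "'n::finite cfun"
 assumes f: "f constant_on ball 0 1" and p: "1 < p" "p <= q" and \<beta>: "\<beta> > -1"
 shows "hankel_conj_compact \<beta> f p \<alpha> q"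
proof -
 obtain c where c: "!!z. norm z < 1 ==> f z = c" using f unfolding constant_on_def by auto
 have 0: "hankel_conj \<beta> f g z = 0" if g: "g \<in> H_infinity" and z: "norm z < 1" for g z
 proof -
  have gh: "holo_on (ball 0 1) g" and "\<exists>M. \<forall>x\<in>ball 0 1. norm (g x) <= M"
   using g unfolding H_infinity_def bounded_iff holomorphic_ball_eq by auto
  then obtain M where M: "!!x. x \<in> ball 0 1 ==> norm (g x) <= M" by blast
  have "norm (cnj c * g x) <= norm c * M" if "norm x < 1" for x unfolding norm_mult complex_mod_cnj using M that by (intro mult_left_mono) auto
  hence "growth 0 (\<lambda>x. cnj c * g x)" by (rule bounded_growth[OF holo_cmul[OF gh] _ order_refl])
  from bergman_proj_reproducing[OF this \<beta> _ order_refl z] have "bergman_proj \<beta> (\<lambda>w. cnj c * g w) z = cnj c * g z" using \<beta> by simp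
  moreover have "bergman_proj \<beta> (\<lambda>w. cnj (f w) * g w) z = bergman_proj \<beta> (\<lambda>w. cnj c * g w) z" by (rule bergman_proj_cong[OF \<beta>]) (simp add: c)
  ultimately show ?thesis unfolding hankel_conj_def c[OF z] by simp
 qed
 have L0: "(\<lambda>_. 0) \<in> Lp (ball_weighted \<beta> :: (complex^'n) measure) q" using p by (simp add: Lp_def)
 have "compact_operator (bergman_space p \<alpha>) (ball_weighted \<alpha>) p (ball_weighted \<beta>) q (\<lambda>(_ :: 'n cfun) (_ :: complex^'n). 0)"
  unfolding compact_operator_def using L0
  by (intro conjI ballI allI impI bexI[of _ "\<lambda>_. 0"] exI[of _ id]) (auto simp: strict_mono_def Lp_norm_def)
 moreover have "AE z in ball_weighted \<beta>. 0 = hankel_conj \<beta> f g z" if "g \<in> H_infinity" for g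
  by (rule AE_I2) (use 0[OF that] in \<open>simp add: space_ball_weighted[OF \<beta>]\<close>)
 ultimately show ?thesis unfolding hankel_conj_compact_def by blast
qed


section \<open>The little Bloch space\<close>

lemma cgrad_nth: "cgrad f z $ k = dir (axis k 1) f z"
proof -
 have "axis k t = t *s axis k (1::complex)" for t by (simp add: vec_eq_iff axis_def)
 hence "(\<lambda>t. f (z + axis k t)) = (\<lambda>t. f (z + t *s axis k 1))" by (intro ext arg_cong[where f="\<lambda>x. f (z + x)"])
 thus ?thesis by (simp only: cgrad_def dir_def vec_lambda_beta)
qed

lemma norm_cgrad_le_iff:
 fixes f :: "'n::finite cfun"
 assumes f: "holo_on (ball 0 1) f" and z: "norm z < 1"
 shows "norm (cgrad f z) <= B \<longleftrightarrow> (\<forall>v. norm (dir v f z) <= B * norm v)"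
proof -
 \<comment> \<open>The conjugated gradient, for which \<open>dir v f z = cdot v g\<close>: any row
   of the conjugate of a matrix all of whose rows are the gradient.\<close>
 define g where "g = map_matrix cnj (vec (cgrad f z)) $ (undefined :: 'n)"
 have g: "g $ k = cnj (cgrad f z $ k)" for k by (simp add: g_def map_matrix_def vec_def)
 have ng: "norm g = norm (cgrad f z)" by (simp add: norm_vec_def g)
 have d: "dir v f z = cdot v g" for v
 proof -
  have "dir v f z = dir (\<Sum>k\<in>UNIV. (v $ k) *s axis k 1) f z" using vec_sum_axis[of v] by simp
  also have "... = cdot v g" using z by (simp add: dir_sum[OF f] dir_cmul[OF f] cdot_def g cgrad_nth)
  finally show ?thesis .
 qed
 show ?thesis
 proof
  assume "norm (cgrad f z) <= B"
  hence "norm (dir v f z) <= B * norm v" for v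
   unfolding d using norm_cdot_le[of v g] mult_left_mono[of "norm g" B "norm v"] by (simp add: ng mult.commute)
  thus "\<forall>v. norm (dir v f z) <= B * norm v" by blast
 next
  assume *: "\<forall>v. norm (dir v f z) <= B * norm v"
  show "norm (cgrad f z) <= B"
  proof (cases "g = 0")
   case False
   have "norm g * norm g <= B * norm g" using *[rule_format, of g] by (simp add: d cdot_self power2_eq_square norm_mult)
   thus ?thesis using False by (simp flip: ng)
  next
   case True
   \<comment> \<open>When the gradient is 0, any nonzero direction shows that \<open>B\<close> is
     nonnegative.\<close>
   have "0 <= B * norm (axis undefined (1::complex) :: complex^'n)" by (rule order_trans[OF norm_ge_zero *[rule_format]])
   moreover have "axis undefined (1::complex) ~= (0 :: complex^'n)" by (simp add: axis_eq_0_iff)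
   ultimately show ?thesis using True by (simp add: zero_le_mult_iff flip: ng)
  qed
 qed
qed

lemma bloch_bound_iff:
 fixes f :: "'n::finite cfun"
 assumes f: "holo_on (ball 0 1) f"
 shows "bloch_bound \<gamma> N f \<longleftrightarrow> N >= 0 \<and> (\<forall>z\<in>ball 0 1. (1 - (norm z)^2) powr (1 + \<gamma>) * norm (cgrad f z) <= N)"
proof -
 have *: "(1 - (norm z)^2) powr (1 + \<gamma>) * norm (cgrad f z) <= N \<longleftrightarrow> (\<forall>v. norm (dir v f z) <= N * norm v * rho z powr (- (1 + \<gamma>)))"
  if z: "norm z < 1" for z
 proof -
  have "(1 - (norm z)^2) powr (1 + \<gamma>) * norm (cgrad f z) <= N \<longleftrightarrow> norm (cgrad f z) <= N * rho z powr (- (1 + \<gamma>))"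
   unfolding rho_def[symmetric] powr_minus using rho_pos[OF z] by (simp add: field_simps)
  also have "... \<longleftrightarrow> (\<forall>v. norm (dir v f z) <= N * rho z powr (- (1 + \<gamma>)) * norm v)" by (rule norm_cgrad_le_iff[OF f z])
  finally show ?thesis by (simp only: mult_ac)
 qed
 show ?thesis unfolding bloch_bound_def Ball_def mem_ball_0 using * by blast
qed

lemma bloch_bound_diff:
 fixes f g :: "'n::finite cfun"
 assumes f: "holo_on (ball 0 1) f" "bloch_bound \<gamma> M f" and g: "holo_on (ball 0 1) g" "bloch_bound \<gamma> N g"
 shows "bloch_bound \<gamma> (M + N) (\<lambda>z. f z - g z)"
proof -
 have "norm (dir v (\<lambda>z. f z - g z) z) <= (M + N) * norm v * rho z powr (- (1 + \<gamma>))" if z: "norm z < 1" for z v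
 proof -
  have "dir v (\<lambda>z. f z - g z) z = dir v f z - dir v g z" by (rule dir_fun_diff[OF f(1) g(1)]) (use z in simp)
  hence "norm (dir v (\<lambda>z. f z - g z) z) <= norm (dir v f z) + norm (dir v g z)" by (simp add: norm_triangle_ineq4)
  also have "... <= M * norm v * rho z powr (- (1 + \<gamma>)) + N * norm v * rho z powr (- (1 + \<gamma>))"
   using f(2) g(2) z unfolding bloch_bound_def by (intro add_mono) auto
  finally show ?thesis by (simp add: algebra_simps)
 qed
 thus ?thesis using f(2) g(2) by (simp add: bloch_bound_def)
qed

text \<open>Cauchy's estimate on balls of radius \<open>R - 1\<close> bounds the gradient, and
  \<open>rho z powr (- (1 + \<gamma>))\<close> is at least 1 because \<open>1 + \<gamma>\<close> is
  positive.\<close>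

lemma sup_bound_imp_bloch_bound:
 fixes F :: "'n::finite cfun"
 assumes F: "holo_on (ball 0 R) F" and R: "R > 1" and M: "!!z. norm z < R ==> norm (F z) <= M" and \<gamma>: "\<gamma> > -1"
 shows "bloch_bound \<gamma> (2 * M / (R - 1)) F"
proof -
 have M0: "M >= 0" using order_trans[OF norm_ge_zero M[of 0]] R by simp
 have "norm (dir v F z) <= 2 * M / (R - 1) * norm v * rho z powr (- (1 + \<gamma>))" if z: "norm z < 1" for z v
 proof -
  have sub: "ball z (R - 1) \<subseteq> ball 0 R"
  proof
   fix y assume "y \<in> ball z (R - 1)"
   thus "y \<in> ball 0 R" using z norm_triangle_sub[of y z] by (simp add: dist_norm norm_minus_commute)
  qed
  have "norm (dir v F z) <= 2 * M * norm v / (R - 1)"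
   by (rule holo_dir_le[OF holo_on_subset[OF F sub]]) (use R M sub in \<open>auto simp: subset_iff\<close>)
  also have "... = 2 * M / (R - 1) * norm v * 1" by simp
  also have "... <= 2 * M / (R - 1) * norm v * rho z powr (- (1 + \<gamma>))"
   using powr_mono'[of "- (1 + \<gamma>)" 0 "rho z"] rho_pos[OF z] rho_le_1[of z] \<gamma> M0 R by (intro mult_left_mono) auto
  finally show ?thesis .
 qed
 thus ?thesis using M0 R by (simp add: bloch_bound_def)
qed

section \<open>Polynomials and polynomial approximation\<close>

lemma polynomials_monomial: "(\<lambda>z. c * (\<Prod>k\<in>UNIV. (z $ k) ^ m k)) \<in> polynomials"
 unfolding polynomials_def by (rule CollectI, rule exI[of _ "{m}"], rule exI[of _ "\<lambda>_. c"]) simp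

lemma polynomials_add:
 fixes P Q :: "'n::finite cfun"
 assumes "P \<in> polynomials" "Q \<in> polynomials"
 shows "(\<lambda>z. P z + Q z) \<in> polynomials"
proof -
 obtain A a where A: "finite (A :: ('n => nat) set)" "P = (\<lambda>z. \<Sum>m\<in>A. a m * (\<Prod>k\<in>UNIV. (z $ k) ^ m k))"
  using assms(1) unfolding polynomials_def by blast
 obtain B b where B: "finite (B :: ('n => nat) set)" "Q = (\<lambda>z. \<Sum>m\<in>B. b m * (\<Prod>k\<in>UNIV. (z $ k) ^ m k))"
  using assms(2) unfolding polynomials_def by blast
 \<comment> \<open>Coefficients are extended by 0, so that both sums run over the same
   multi-indices.\<close>
 define a' b' where "a' m = (if m \<in> A then a m else 0)" and "b' m = (if m \<in> B then b m else 0)" for m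
 have "P z = (\<Sum>m\<in>A \<union> B. a' m * (\<Prod>k\<in>UNIV. (z $ k) ^ m k))" for z
  unfolding A(2) by (rule sum.mono_neutral_cong_left) (use A(1) B(1) in \<open>auto simp: a'_def\<close>)
 moreover have "Q z = (\<Sum>m\<in>A \<union> B. b' m * (\<Prod>k\<in>UNIV. (z $ k) ^ m k))" for z
  unfolding B(2) by (rule sum.mono_neutral_cong_left) (use A(1) B(1) in \<open>auto simp: b'_def\<close>)
 ultimately have "(\<lambda>z. P z + Q z) = (\<lambda>z. \<Sum>m\<in>A \<union> B. (a' m + b' m) * (\<Prod>k\<in>UNIV. (z $ k) ^ m k))"
  by (simp add: sum.distrib distrib_right fun_eq_iff)
 thus ?thesis unfolding polynomials_def
  by (intro CollectI exI[of _ "A \<union> B"] exI[of _ "\<lambda>m. a' m + b' m"] conjI finite_UnI A(1) B(1))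
qed

lemma polynomials_sum: "(!!i. i \<in> I ==> P i \<in> polynomials) ==> (\<lambda>z. \<Sum>i\<in>I. P i z) \<in> polynomials"
proof (induction I rule: infinite_finite_induct)
 case (insert i I)
 thus ?case by (simp add: polynomials_add)
qed (use polynomials_monomial[of 0] in simp_all)

lemma polynomials_cmul_dilate:
 fixes P :: "'n::finite cfun"
 assumes "P \<in> polynomials"
 shows "(\<lambda>z. d * P (t *s z)) \<in> polynomials"
proof -
 obtain A a where A: "P = (\<lambda>z. \<Sum>m\<in>A. a m * (\<Prod>k\<in>UNIV. (z $ k) ^ m k))" using assms unfolding polynomials_def by blast
 show ?thesis unfolding A sum_distrib_left
  by (rule polynomials_sum, simp only: vector_smult_component power_mult_distrib prod.distrib mult.assoc[symmetric]) (rule polynomials_monomial)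
qed

lemma polynomials_nth_mult:
 fixes P :: "'n::finite cfun"
 assumes "P \<in> polynomials"
 shows "(\<lambda>z. z $ j * P z) \<in> polynomials"
proof -
 obtain A a where A: "P = (\<lambda>z. \<Sum>m\<in>A. a m * (\<Prod>k\<in>UNIV. (z $ k) ^ m k))" using assms unfolding polynomials_def by blast
 have "z $ j * (a m * (\<Prod>k\<in>UNIV. (z $ k) ^ m k)) = a m * (\<Prod>k\<in>UNIV. (z $ k) ^ (m(j := Suc (m j))) k)" for m and z :: "complex^'n"
  by (simp add: prod.remove[of UNIV j])
 thus ?thesis unfolding A sum_distrib_left by (simp only:) (rule polynomials_sum, rule polynomials_monomial)
qed

text \<open>Induction on \<open>k\<close> with \<open>g\<close> arbitrary: one factor
  \<open>cdot z w\<close> is expanded, its \<open>cnj (w $ j)\<close> is absorbed into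
  \<open>g\<close>, and its \<open>z $ j\<close> leaves the integral.\<close>

lemma polynomials_integral:
 fixes g :: "'n::finite cfun"
 assumes "continuous_on (cball 0 1) g"
 shows "(\<lambda>z. (LINT w|lball. g w * cdot z w ^ k)) \<in> polynomials"
 using assms
proof (induction k arbitrary: g)
 case 0
 thus ?case using polynomials_monomial[of "LINT w|lball. g w" "\<lambda>_. 0"] by simp
next
 case (Suc k)
 have c: "continuous_on (cball 0 1) (\<lambda>w. g w * cnj (w $ j))" for j by (intro continuous_intros Suc.prems)
 have "(LINT w|lball. g w * cdot z w ^ Suc k) = (\<Sum>j\<in>UNIV. z $ j * (LINT w|lball. (g w * cnj (w $ j)) * cdot z w ^ k))" for z
 proof -
  have "(LINT w|lball. g w * cdot z w ^ Suc k) = (LINT w|lball. (\<Sum>j\<in>UNIV. z $ j * ((g w * cnj (w $ j)) * cdot z w ^ k)))"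
   by (rule arg_cong[where f="lebesgue_integral lball"]) (simp add: fun_eq_iff cdot_def sum_distrib_left sum_distrib_right mult_ac)
  also have "... = (\<Sum>j\<in>UNIV. (LINT w|lball. z $ j * ((g w * cnj (w $ j)) * cdot z w ^ k)))"
   by (rule Bochner_Integration.integral_sum) (intro integrable_mult_right integrable_lball_cont continuous_intros c)
  finally show ?thesis by simp
 qed
 thus ?case by (simp only:) (intro polynomials_sum polynomials_nth_mult Suc.IH c)
qed

lemma polynomials_holo:
 fixes P :: "'n::finite cfun"
 assumes "P \<in> polynomials"
 shows "holo_on S P"
proof -
 have pow: "holo_on S (\<lambda>z::complex^'n. (z $ k) ^ m)" for k m
  by (induction m) (auto intro!: holo_mult(1) holo_nth)
 have "holo_on S (\<lambda>z::complex^'n. \<Prod>k\<in>K. (z $ k) ^ m k)" for K m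
  by (induction K rule: infinite_finite_induct) (auto intro!: holo_mult(1) pow)
 moreover obtain A c where "P = (\<lambda>z. \<Sum>m\<in>A. c m * (\<Prod>k\<in>UNIV. (z $ k) ^ m k))" using assms unfolding polynomials_def by blast
 ultimately show ?thesis by (simp add: holo_sum holo_cmul)
qed

text \<open>Absolute convergence at the point \<open>\<theta>\<close> dominates the tail on the
  whole disc of that radius.\<close>

lemma powser_uniform_tail:
 fixes \<phi> :: "complex => complex"
 assumes h: "\<phi> holomorphic_on ball 0 1" and \<theta>: "0 <= \<theta>" "\<theta> < 1" and \<eta>: "\<eta> > 0"
 obtains a :: "nat => complex" and K :: nat where "!!u. norm u <= \<theta> ==> norm (\<phi> u - (\<Sum>k<K. a k * u ^ k)) <= \<eta>"
proof -
 define a where "a k = (deriv ^^ k) \<phi> 0 / fact k" for k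
 have sums: "(\<lambda>k. a k * u ^ k) sums \<phi> u" if "norm u < 1" for u
  using holomorphic_power_series[OF h, of u] that by (simp add: a_def)
 have "norm (complex_of_real ((1 + \<theta>) / 2)) < 1" using \<theta> by (simp only: norm_of_real) simp
 note sm = sums_summable[OF sums[OF this]]
 have s: "summable (\<lambda>k. norm (a k * of_real \<theta> ^ k))" by (rule powser_insidea[OF sm]) (use \<theta> in \<open>simp only: norm_of_real, simp\<close>)
 obtain K where K: "norm (\<Sum>i. norm (a (i + K) * of_real \<theta> ^ (i + K))) < \<eta>" using suminf_exist_split[OF \<eta> s] by blast
 have sK: "summable (\<lambda>i. norm (a (i + K) * of_real \<theta> ^ (i + K)))" using summable_ignore_initial_segment[OF s] .
 show thesis
 proof (rule that)
  fix u :: complex assume u: "norm u <= \<theta>"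
  have "(\<lambda>i. a (i + K) * u ^ (i + K)) sums (\<phi> u - (\<Sum>k<K. a k * u ^ k))"
   using sums u \<theta> by (intro sums_split_initial_segment) auto
  hence "norm (\<phi> u - (\<Sum>k<K. a k * u ^ k)) = norm (\<Sum>i. a (i + K) * u ^ (i + K))" by (simp add: sums_iff)
  also have le: "norm (a (i + K) * u ^ (i + K)) <= norm (a (i + K) * of_real \<theta> ^ (i + K))" for i
   using power_mono[OF u, of "i + K"] \<theta> by (simp add: norm_mult norm_power mult_left_mono)
  hence sn: "summable (\<lambda>i. norm (a (i + K) * u ^ (i + K)))" by (intro summable_comparison_test'[OF sK]) auto
  have "norm (\<Sum>i. a (i + K) * u ^ (i + K)) <= (\<Sum>i. norm (a (i + K) * of_real \<theta> ^ (i + K)))"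
   by (rule order_trans[OF summable_norm[OF sn] suminf_le[OF le sn sK]])
  also have "... <= \<eta>" using K by simp
  finally show "norm (\<phi> u - (\<Sum>k<K. a k * u ^ k)) <= \<eta>" .
 qed
qed

text \<open>Expanding the kernel of the reproducing formula into a power series of \<open>cdot z w\<close>
 produces approximating polynomials.\<close>

lemma polynomial_approximation:
 fixes F :: "'n::finite cfun"
 assumes F: "holo_on (ball 0 R) F" and R: "R > 1" and \<theta>: "0 <= \<theta>" "\<theta> < 1" and \<eta>: "\<eta> > 0"
 obtains P where "P \<in> polynomials" "!!z. norm z <= \<theta> ==> norm (F z - P z) <= \<eta>"
proof -
 let ?B = "lball :: (complex^'n) measure"
 define s where "s = real CARD('n) + 1"
 define A where "A = bmass TYPE('n) 0"
 have A: "A > 0" unfolding A_def by (rule bmass_pos) simp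
 have Fc: "continuous_on (cball 0 1) F" by (rule continuous_on_subset[OF holo_continuous_on[OF F]]) (use R in auto)
 obtain M where M: "M > 0" "!!w. norm w <= 1 ==> norm (F w) <= M" using cont_cball_bound[OF Fc] by blast
 define V where "V = (LINT w|?B. 1) + (1::real)"
 have V: "V > 0" unfolding V_def by (intro add_nonneg_pos integral_nonneg_AE) auto
 define \<eta>' where "\<eta>' = \<eta> * A / (M * V)"
 have \<eta>': "\<eta>' > 0" using \<eta> A M(1) V by (simp add: \<eta>'_def)
 have "(\<lambda>u. (1 - u) powr (- complex_of_real s)) holomorphic_on ball 0 1"
  by (intro holomorphic_intros) (use one_minus_notin in auto)
 then obtain a K where aK: "!!u. norm u <= \<theta> ==> norm ((1 - u) powr (- complex_of_real s) - (\<Sum>k<K. a k * u ^ k)) <= \<eta>'"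
  by (rule powser_uniform_tail[OF _ \<theta> \<eta>']) blast
 define P where "P z = (\<Sum>k<K. a k / of_real A * (LINT w|?B. F w * cdot z w ^ k))" for z
 have ic: "integrable ?B (\<lambda>w. F w * cdot z w ^ k)" for z k by (intro integrable_lball_cont continuous_intros Fc)
 have "(\<lambda>z. a k / of_real A * (LINT w|?B. F w * cdot z w ^ k)) \<in> polynomials" for k
  using polynomials_cmul_dilate[OF polynomials_integral[OF Fc, of k], of "a k / of_real A" 1] by simp
 hence Pi: "P \<in> polynomials" unfolding P_def[abs_def] by (intro polynomials_sum)
 have "norm (F z - P z) <= \<eta>" if z: "norm z <= \<theta>" for z
 proof -
  have z1: "norm z < 1" using z \<theta> by simp
  have ik: "integrable ?B (\<lambda>w. F w * ker s z w)" by (intro integrable_lball_cont continuous_intros Fc ker_cont_right[OF z1])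
  have is': "integrable ?B (\<lambda>w. F w * (\<Sum>k<K. a k * cdot z w ^ k))" by (intro integrable_lball_cont continuous_intros Fc)
  have "of_real A * F z = (LINT w|?B. of_real (rho w powr 0) * (F w * ker s z w))"
   using reproducing_smooth[OF F R _ z1, of 0] by (simp add: A_def s_def)
  also have "... = (LINT w|?B. F w * ker s z w)"
   by (rule Bochner_Integration.integral_cong[OF refl]) (use rho_pos in \<open>fastforce simp: less_le\<close>)
  finally have 1: "of_real A * F z = (LINT w|?B. F w * ker s z w)" .
  have "(LINT w|?B. F w * (\<Sum>k<K. a k * cdot z w ^ k)) = (LINT w|?B. (\<Sum>k<K. a k * (F w * cdot z w ^ k)))"
   by (simp add: sum_distrib_left mult_ac)
  also have "... = (\<Sum>k<K. a k * (LINT w|?B. F w * cdot z w ^ k))"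
   by (simp add: Bochner_Integration.integral_sum ic)
  also have "... = of_real A * P z" using A by (simp add: P_def sum_distrib_left)
  finally have 2: "of_real A * P z = (LINT w|?B. F w * (\<Sum>k<K. a k * cdot z w ^ k))" ..
  have "of_real A * (F z - P z) = (LINT w|?B. F w * ker s z w - F w * (\<Sum>k<K. a k * cdot z w ^ k))"
   unfolding right_diff_distrib 1 2 by (rule Bochner_Integration.integral_diff[OF ik is', symmetric])
  also have "norm ... <= (LINT w|?B. M * \<eta>' * 1)"
  proof (rule norm_integral_le)
   fix w :: "complex^'n" assume "w \<in> space ?B"
   hence w: "norm w < 1" by simp
   have "norm (cdot z w) <= \<theta> * 1" by (rule order_trans[OF norm_cdot_le mult_mono]) (use z w \<theta> in auto)
   hence "norm (ker s z w - (\<Sum>k<K. a k * cdot z w ^ k)) <= \<eta>'" unfolding ker_def by (intro aK) simp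
   thus "norm (F w * ker s z w - F w * (\<Sum>k<K. a k * cdot z w ^ k)) <= M * \<eta>' * 1"
    unfolding right_diff_distrib[symmetric] norm_mult using M w by (simp add: mult_mono)
  qed (use Bochner_Integration.integrable_diff[OF ik is'] finite_measure.integrable_const[OF finite_measure_lball] in auto)
  also have "... = M * \<eta>' * (V - 1)" unfolding V_def by simp
  also have "... <= M * \<eta>' * V" using M(1) \<eta>' by (intro mult_left_mono) auto
  also have "... = \<eta> * A" using M(1) V by (simp add: \<eta>'_def)
  finally show ?thesis using A by (simp add: norm_mult mult.commute)
 qed
 thus thesis using that Pi by blast
qed

text \<open>Near the sphere both gradients are small separately, since \<open>rho\<close> at the
  dilated point is still below \<open>d\<close>. On the remaining compact ball \<open>f\<close> is
  uniformly continuous, and Cauchy's estimate on balls of radius \<open>h\<close> turns closeness of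
  values into closeness of gradients.\<close>

lemma dilation_approximation:
 fixes f :: "'n::finite cfun"
 assumes f: "holo_on (ball 0 1) f" and \<gamma>: "\<gamma> > -1" and \<epsilon>: "\<epsilon> > 0"
  and van: "!!\<epsilon>. \<epsilon> > 0 ==> \<exists>d>0. \<forall>z v. norm z < 1 --> rho z < d --> norm (dir v f z) <= \<epsilon> * norm v * rho z powr (- (1 + \<gamma>))"
 obtains r where "0 < r" "r < 1" "bloch_bound \<gamma> \<epsilon> (\<lambda>z. f z - f (of_real r *s z))"
proof -
 obtain d' where d': "d' > 0" "!!z v. norm z < 1 ==> rho z < d' ==> norm (dir v f z) <= \<epsilon> / 2 * norm v * rho z powr (- (1 + \<gamma>))"
  using van[of "\<epsilon> / 2"] \<epsilon> by auto
 define d where "d = min d' 1"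
 have d: "0 < d" "d <= 1" "!!z v. norm z < 1 ==> rho z < d ==> norm (dir v f z) <= \<epsilon> / 2 * norm v * rho z powr (- (1 + \<gamma>))"
  using d' by (auto simp: d_def)
 define R0 where "R0 = sqrt (1 - d / 2)"
 define h where "h = (1 - R0) / 2"
 have R0: "0 <= R0" "R0 < 1" using d by (auto simp: R0_def)
 hence h: "h > 0" "R0 + h < 1" by (auto simp: h_def field_simps)
 have "uniformly_continuous_on (cball 0 (R0 + h)) f"
  by (rule compact_uniformly_continuous[OF continuous_on_subset[OF holo_continuous_on[OF f]]]) (use h in auto)
 then obtain \<delta> where \<delta>: "\<delta> > 0" "!!x y. x \<in> cball 0 (R0 + h) ==> y \<in> cball 0 (R0 + h) ==> dist y x < \<delta> ==> dist (f y) (f x) < \<epsilon> * h / 2"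
  by (rule uniformly_continuous_onE[of _ _ "\<epsilon> * h / 2"]) (use \<epsilon> h(1) in auto)
 \<comment> \<open>\<open>1 - r <= d / 4\<close> raises \<open>rho\<close> by at most
   \<open>d / 2\<close> under the dilation, and \<open>1 - r < \<delta>\<close> moves points by less
   than the modulus of continuity.\<close>
 define r where "r = 1 - min (d / 4) (\<delta> / 2)"
 have r: "0 < r" "r < 1" "1 - r < \<delta>" "1 - r <= d / 4" using d \<delta>(1) by (auto simp: r_def min_def)
 let ?F = "\<lambda>z. f z - f (of_real r *s z)"
 have rz: "of_real r *s z \<in> ball 0 1" if "norm z < 1" for z :: "complex^'n"
 proof -
  have "r * norm z <= 1 * norm z" using r by (intro mult_right_mono) auto
  thus ?thesis using that r by (simp add: norm_vsmult)
 qed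
 have fr: "holo_on (ball 0 1) (\<lambda>z. f (of_real r *s z))" and dr: "norm z < 1 ==> dir v (\<lambda>z. f (of_real r *s z)) z = of_real r * dir v f (of_real r *s z)" for z v
  using holo_affine(1)[OF f, of "ball 0 1" 0 "of_real r"] holo_affine(2)[OF f, of "ball 0 1" 0 "of_real r" z v] rz by auto
 have "norm (dir v ?F z) <= \<epsilon> * norm v * rho z powr (- (1 + \<gamma>))" if z: "norm z < 1" for z v
 proof (cases "rho z < d / 2")
  case True
  have r1: "norm (of_real r *s z) < 1" using rz[OF z] by simp
  have "rho (of_real r *s z) = rho z + (1 - r) * (1 + r) * (norm z)^2" using r by (simp add: rho_def norm_vsmult power_mult_distrib power2_eq_square algebra_simps)
  also have "(1 - r) * (1 + r) * (norm z)^2 <= (d / 4 * 2) * 1" using r z d by (intro mult_mono power_le_one) auto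
  finally have rd: "rho (of_real r *s z) < d" using True by simp
  have "norm (dir v (\<lambda>z. f (of_real r *s z)) z) <= norm (dir v f (of_real r *s z))" unfolding dr[OF z] norm_mult using r by (simp add: mult_left_le_one_le)
  also have "... <= \<epsilon> / 2 * norm v * rho (of_real r *s z) powr (- (1 + \<gamma>))" by (rule d(3)[OF r1 rd])
  also have "... <= \<epsilon> / 2 * norm v * rho z powr (- (1 + \<gamma>))"
   using rho_dilate[of r z] rho_pos[OF z] r \<gamma> \<epsilon> by (intro mult_left_mono powr_mono2') auto
  finally have "norm (dir v (\<lambda>z. f (of_real r *s z)) z) <= \<epsilon> / 2 * norm v * rho z powr (- (1 + \<gamma>))" .
  moreover have "norm (dir v f z) <= \<epsilon> / 2 * norm v * rho z powr (- (1 + \<gamma>))" by (rule d(3)[OF z]) (use True d in simp)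
  moreover have "dir v ?F z = dir v f z - dir v (\<lambda>z. f (of_real r *s z)) z" by (rule dir_fun_diff[OF f fr]) (use z in simp)
  ultimately show ?thesis using norm_triangle_ineq4[of "dir v f z" "dir v (\<lambda>z. f (of_real r *s z)) z"] by simp
 next
  case False
  hence "(norm z)^2 <= 1 - d / 2" by (simp add: rho_def)
  hence zR: "norm z <= R0" unfolding R0_def by (rule real_le_rsqrt)
  have sub: "norm x < R0 + h" if "x \<in> ball z h" for x using that zR norm_triangle_sub[of x z] by (simp add: dist_norm norm_minus_commute)
  have "norm (?F x) <= \<epsilon> * h / 2" if x: "x \<in> ball z h" for x
  proof -
   have x1: "norm x < R0 + h" "norm x < 1" using sub[OF x] h by auto
   have rx: "norm (of_real r *s x) <= norm x" using r by (simp add: norm_vsmult mult_left_le_one_le)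
   have "x - of_real r *s x = of_real (1 - r) *s x" by (simp add: vec_eq_iff algebra_simps)
   hence "dist x (of_real r *s x) <= (1 - r) * 1" unfolding dist_norm using r x1 by (simp only: norm_vsmult norm_of_real) (intro mult_mono, auto)
   hence "dist (f x) (f (of_real r *s x)) < \<epsilon> * h / 2" using x1 rx r by (intro \<delta>(2)) auto
   thus ?thesis by (simp add: dist_norm)
  qed
  hence "norm (dir v ?F z) <= 2 * (\<epsilon> * h / 2) * norm v / h"
   using sub h by (intro holo_dir_le[OF holo_on_subset[OF holo_diff[OF f fr]]]) (auto dest: sub)
  also have "... = \<epsilon> * norm v * 1" using h by simp
  also have "... <= \<epsilon> * norm v * rho z powr (- (1 + \<gamma>))"
   using powr_mono'[of "- (1 + \<gamma>)" 0 "rho z"] rho_pos[OF z] rho_le_1[of z] \<gamma> \<epsilon> by (intro mult_left_mono) auto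
  finally show ?thesis .
 qed
 hence "bloch_bound \<gamma> \<epsilon> ?F" using \<epsilon> by (simp add: bloch_bound_def)
 thus thesis by (rule that[OF r(1,2)])
qed

text \<open>A dilate is close to \<open>f\<close> in the Bloch seminorm and holomorphic across the
  sphere; a polynomial uniformly close to it on a ball of radius \<open>R > 1\<close> is close in
  the Bloch norm by \<open>sup_bound_imp_bloch_bound\<close>.\<close>

lemma little_bloch_sufficient:
 fixes f :: "'n::finite cfun"
 assumes f: "holo_on (ball 0 1) f" and \<gamma>: "\<gamma> > -1" and N: "bloch_bound \<gamma> N f"
  and van: "!!\<epsilon>. \<epsilon> > 0 ==> \<exists>d>0. \<forall>z v. norm z < 1 --> rho z < d --> norm (dir v f z) <= \<epsilon> * norm v * rho z powr (- (1 + \<gamma>))"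
 shows "f \<in> little_bloch_space (1 + \<gamma>)"
 unfolding little_bloch_space_def
proof (intro CollectI conjI allI impI)
 show "f \<in> bloch_space (1 + \<gamma>)"
  using N f unfolding bloch_bound_iff[OF f] bloch_space_def holomorphic_ball_eq bdd_above_def by auto
 fix \<epsilon> :: real assume \<epsilon>: "\<epsilon> > 0"
 obtain r where r: "0 < r" "r < 1" and fr: "bloch_bound \<gamma> (\<epsilon> / 2) (\<lambda>z. f z - f (of_real r *s z))"
  by (rule dilation_approximation[OF f \<gamma> half_gt_zero[OF \<epsilon>] van]) blast+
 define R where "R = (1 + 1 / r) / 2"
 have R: "1 < R" "r * R = (1 + r) / 2" using r by (auto simp: R_def field_simps)
 \<comment> \<open>\<open>polynomial_approximation\<close> works on balls of radius below 1. Applied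
   to the dilate by \<open>t\<close>, with r R < t < 1, on the ball of radius r R / t, and rescaled
   by r / t, it covers the ball of radius \<open>R\<close>.\<close>
 define t where "t = (3 + r) / 4"
 have t: "0 < t" "t < 1" "r * R < t" using r unfolding R(2) by (auto simp: t_def)
 \<comment> \<open>Shares of \<open>\<epsilon>\<close>: one half for the dilation, at most a quarter
   for the gradient of the polynomial error, at most an eighth for its value at 0.\<close>
 define \<eta> where "\<eta> = \<epsilon> / 8 * min 1 (R - 1)"
 have \<eta>: "\<eta> > 0" "\<eta> <= \<epsilon> / 8" "2 * \<eta> / (R - 1) <= \<epsilon> / 4" using \<epsilon> R(1) by (auto simp: \<eta>_def min_def field_simps)
 have th: "0 <= r * R / t" "r * R / t < 1" using r R(1) t by auto
 obtain P where P: "P \<in> polynomials" "!!z. norm z <= r * R / t ==> norm (f (of_real t *s z) - P z) <= \<eta>"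
  by (rule polynomial_approximation[OF holo_dilate[OF f t(1,2)] _ th \<eta>(1)]) (use t in auto)
 define Q where "Q z = 1 * P (of_real (r / t) *s z)" for z
 have Q: "Q \<in> polynomials" unfolding Q_def[abs_def] by (rule polynomials_cmul_dilate[OF P(1)])
 have le: "norm (f (of_real r *s z) - Q z) <= \<eta>" if z: "norm z < R" for z
 proof -
  have "norm (of_real (r / t) *s z) <= r / t * R" unfolding norm_vsmult norm_of_real using r t z by (intro mult_mono) auto
  hence "norm (f (of_real t *s (of_real (r / t) *s z)) - P (of_real (r / t) *s z)) <= \<eta>" by (intro P(2)) simp
  thus ?thesis using t by (simp add: Q_def vector_smult_assoc)
 qed
 have RR: "ball 0 R \<subseteq> (ball 0 (1 / r) :: (complex^'n) set)" using r by (intro subset_ball) (simp add: R_def field_simps)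
 have frh: "holo_on (ball 0 R) (\<lambda>z. f (of_real r *s z))" by (rule holo_on_subset[OF holo_dilate[OF f r] RR])
 have sub: "ball 0 1 \<subseteq> (ball 0 R :: (complex^'n) set)" using R by (intro subset_ball) simp
 have Qh: "holo_on (ball 0 R) Q" by (rule polynomials_holo[OF Q])
 note d1 = sup_bound_imp_bloch_bound[OF holo_diff[OF Qh frh] R(1) _ \<gamma>, of \<eta>]
 have b1: "bloch_bound \<gamma> (2 * \<eta> / (R - 1)) (\<lambda>z. Q z - f (of_real r *s z))"
  by (rule d1) (use le in \<open>simp add: norm_minus_commute\<close>)
 have "bloch_bound \<gamma> (\<epsilon> / 2 + 2 * \<eta> / (R - 1)) (\<lambda>z. (f z - f (of_real r *s z)) - (Q z - f (of_real r *s z)))"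
  by (rule bloch_bound_diff[OF _ fr _ b1]) (intro holo_diff f holo_on_subset[OF frh sub] holo_on_subset[OF Qh sub])+
 hence fQ: "bloch_bound \<gamma> (\<epsilon> / 2 + 2 * \<eta> / (R - 1)) (\<lambda>z. f z - Q z)" by simp
 have "(SUP z\<in>ball 0 1. (1 - (norm z)^2) powr (1 + \<gamma>) * norm (cgrad (\<lambda>z. f z - Q z) z)) <= \<epsilon> / 2 + 2 * \<eta> / (R - 1)"
  using fQ unfolding bloch_bound_iff[OF holo_diff[OF f holo_on_subset[OF Qh sub]]] by (intro cSUP_least) auto
 moreover have "norm (f 0 - Q 0) <= \<eta>" using le[of 0] R by simp
 ultimately have "bloch_norm (1 + \<gamma>) (\<lambda>z. f z - Q z) < \<epsilon>" unfolding bloch_norm_def using \<eta> \<epsilon> by linarith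
 thus "\<exists>Q\<in>polynomials. bloch_norm (1 + \<gamma>) (\<lambda>z. f z - Q z) < \<epsilon>" using Q by blast
qed

lemma little_bloch_necessary:
 fixes f :: "'n::finite cfun"
 assumes f: "f \<in> little_bloch_space (1 + \<gamma>)" and \<gamma>: "\<gamma> > -1" "\<gamma>' > -1" and \<epsilon>: "\<epsilon> > 0"
 shows "\<exists>Q N. bloch_bound \<gamma> \<epsilon> (\<lambda>z. f z - Q z) \<and> growth 0 Q \<and> bloch_bound \<gamma>' N Q"
proof -
 have fh: "holo_on (ball 0 1) f" and "bdd_above ((\<lambda>z. (1 - (norm z)^2) powr (1 + \<gamma>) * norm (cgrad f z)) ` ball 0 1)"
  using f by (auto simp: little_bloch_space_def bloch_space_def holomorphic_ball_eq)
 then obtain M where M: "!!z. z \<in> ball 0 1 ==> (1 - (norm z)^2) powr (1 + \<gamma>) * norm (cgrad f z) <= M"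
  unfolding bdd_above_def ball_simps by blast
 have "M >= 0" using order_trans[OF _ M[of 0]] by simp
 hence fM: "bloch_bound \<gamma> M f" using M by (simp add: bloch_bound_iff[OF fh])
 obtain Q where Q: "Q \<in> polynomials" "bloch_norm (1 + \<gamma>) (\<lambda>z. f z - Q z) < \<epsilon>" using f \<epsilon> unfolding little_bloch_space_def by blast
 have Qh: "holo_on S Q" for S by (rule polynomials_holo[OF Q(1)])
 obtain C where C: "!!z. z \<in> cball 0 2 ==> norm (Q z) <= C"
  using compact_imp_bounded[OF compact_continuous_image[OF holo_continuous_on[OF Qh] compact_cball[of 0 2]]] unfolding bounded_iff ball_simps by blast
 have QN: "bloch_bound x (2 * C / (2 - 1)) Q" if "x > -1" for x by (rule sup_bound_imp_bloch_bound[OF Qh _ C that]) auto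
 note h = holo_diff[OF fh Qh]
 let ?g = "\<lambda>z. (1 - (norm z)^2) powr (1 + \<gamma>) * norm (cgrad (\<lambda>z. f z - Q z) z)"
 \<comment> \<open>Boundedness comes first: the supremum of an unbounded set carries no
   information.\<close>
 have "bloch_bound \<gamma> (M + 2 * C / (2 - 1)) (\<lambda>z. f z - Q z)" by (rule bloch_bound_diff[OF fh fM Qh QN[OF \<gamma>(1)]])
 hence "bdd_above (?g ` ball 0 1)" unfolding bloch_bound_iff[OF h] bdd_above_def by auto
 hence up: "?g z <= (SUP z\<in>ball 0 1. ?g z)" if "z \<in> ball 0 1" for z by (rule cSUP_upper[OF that])
 have "?g z <= \<epsilon>" if "z \<in> ball 0 1" for z using up[OF that] Q(2) norm_ge_zero[of "f 0 - Q 0"] unfolding bloch_norm_def by linarith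
 hence "bloch_bound \<gamma> \<epsilon> (\<lambda>z. f z - Q z)" unfolding bloch_bound_iff[OF h] using \<epsilon> by simp
 moreover have "growth 0 Q" by (rule bounded_growth[OF Qh C]) auto
 ultimately show ?thesis using QN[OF \<gamma>(2)] by blast
qed

theorem corollary6p5:
  fixes f :: "complex ^ 'n \<Rightarrow> complex" and p q \<alpha> \<beta> \<gamma> :: real
  assumes "f \<in> bergman_space 1 \<beta>"
    and "1 < p" and "p \<le> q" and "\<alpha> > -1" and "\<beta> > -1"
    and "\<gamma> = (real CARD('n) + 1 + \<beta>) / q - (real CARD('n) + 1 + \<alpha>) / p"
  shows "((CARD('n) = 1 \<and> \<gamma> > -1 \<or> CARD('n) > 1 \<and> \<gamma> > -1/2) \<longrightarrow>
            (hankel_conj_compact \<beta> f p \<alpha> q \<longleftrightarrow> f \<in> little_bloch_space (1 + \<gamma>))) \<and>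
         (\<not> (CARD('n) = 1 \<and> \<gamma> > -1 \<or> CARD('n) > 1 \<and> \<gamma> > -1/2) \<longrightarrow>
            (hankel_conj_compact \<beta> f p \<alpha> q \<longleftrightarrow> f constant_on ball 0 1))"
proof -
 let ?e = "aniso TYPE('n)"
 have "CARD('n) = 1 \<or> CARD('n) > 1" using zero_less_card_finite[where 'a='n] by linarith
 hence cond: "(CARD('n) = 1 \<and> \<gamma> > -1 \<or> CARD('n) > 1 \<and> \<gamma> > -1/2) \<longleftrightarrow> - ?e < \<gamma>" by (auto simp: aniso_def)
 have fh: "holo_on (ball 0 1) f" using assms(1) by (simp add: bergman_space_def holomorphic_ball_eq)
 have "hankel_conj_compact \<beta> f p \<alpha> q \<longleftrightarrow> f \<in> little_bloch_space (1 + \<gamma>)" if \<gamma>: "- ?e < \<gamma>"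
 proof
  have g1: "\<gamma> > -1" using \<gamma> aniso_bounds(2)[where 'n='n] by linarith
  assume T: "hankel_conj_compact \<beta> f p \<alpha> q"
  note nec = compact_necessary[OF assms T]
  obtain C where C: "C > 0" "!!z. norm z < 1 ==> tang_bound \<gamma> C f z" using nec(1) by blast
  show "f \<in> little_bloch_space (1 + \<gamma>)"
  proof (rule little_bloch_sufficient[OF fh g1])
   show "bloch_bound \<gamma> (2 * C) f" unfolding bloch_bound_def using C tang_bound_imp_bloch[OF C(2) less_imp_le[OF C(1)]] by auto
   fix \<epsilon> :: real assume \<epsilon>: "\<epsilon> > 0"
   obtain d where d: "d > 0" "!!z. norm z < 1 ==> rho z < d ==> tang_bound \<gamma> (\<epsilon> / 2) f z" using nec(2)[of "\<epsilon> / 2"] \<gamma> \<epsilon> by auto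
   have "norm (dir v f z) <= \<epsilon> * norm v * rho z powr (- (1 + \<gamma>))" if "norm z < 1" "rho z < d" for z v
    using tang_bound_imp_bloch[OF d(2)[OF that] _ that(1)] \<epsilon> by simp
   thus "\<exists>d>0. \<forall>z v. norm z < 1 --> rho z < d --> norm (dir v f z) <= \<epsilon> * norm v * rho z powr (- (1 + \<gamma>))" using d(1) by blast
  qed
 next
  assume f: "f \<in> little_bloch_space (1 + \<gamma>)"
  \<comment> \<open>An order strictly between -e and \<gamma>; polynomials belong to every Bloch
    class of order above -1 in this scale, so the midpoint serves.\<close>
  define \<gamma>' where "\<gamma>' = (\<gamma> - ?e) / 2"
  have \<gamma>': "- ?e < \<gamma>'" "\<gamma>' < \<gamma>" using \<gamma> by (auto simp: \<gamma>'_def)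
  have g1: "\<gamma> > -1" "\<gamma>' > -1" using \<gamma> \<gamma>' aniso_bounds(2)[where 'n='n] by auto
  show "hankel_conj_compact \<beta> f p \<alpha> q" by (rule compact_sufficient[OF assms \<gamma>' little_bloch_necessary[OF f g1]])
 qed
 moreover have "hankel_conj_compact \<beta> f p \<alpha> q \<longleftrightarrow> f constant_on ball 0 1" if "\<not> - ?e < \<gamma>"
  using compact_degenerate[OF assms] constant_imp_compact[OF _ assms(2,3,5)] that by (auto simp: not_less)
 ultimately show ?thesis unfolding cond by blast
qed

end
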